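(* Let $A$ be a $C^*$-algebra and let $I\subseteq A$ be a closed, two-sided ideal. Then $$\max\{\operatorname{gr}(I),\operatorname{gr}(A/I)\}\le \operatorname{gr}(A)\le \operatorname{gr}(I)+\operatorname{gr}(A/I)+1.$$ Further, if $A=\varinjlim_\lambda A_\lambda$ is an inductive limit of $C^*$-algebras, then $$\operatorname{gr}(A)\le\liminf_\lambda \operatorname{gr}(A_\lambda).$$
   Context: Notation: for a $C^*$-algebra $A$, $A_{\mathrm{sa}}$ is the set of self-adjoint elements; $C^*(b_0,\dots,b_n)$ is the (not necessarily unital) sub-$C^*$-algebra generated by $b_0,\dots,b_n$; $\widetilde{A}$ is the minimal unitization ($\widetilde A=A$ if $A$ is unital). For $G\subseteq A$, $c\in_\varepsilon G$ means that there is $g\in G$ with $\|c-g\|<\varepsilon$. $\operatorname{gr}_0(A)$ is the smallest integer $n\ge 0$ such that for all $a_0,\dots,a_n\in A_{\mathrm{sa}}$, $\varepsilon>0$ and $c\in A$ there exist $b_0,\dots,b_n\in A_{\mathrm{sa}}$ with $\|b_j-a_j\|<\varepsilon$ for $j=0,\dots,n$ and $c\in_\varepsilon C^*(b_0,\dots,b_n)$; $\operatorname{gr}_0(A)=\infty$ if no such $n$ exists. The generator rank of $A$ is $\operatorname{gr}(A):=\operatorname{gr}_0(\widetilde A)$. Inductive limits are over arbitrary directed index sets, with connecting $*$-homomorphisms that need not be injective or unital. *)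

theory Defs
  imports "HOL-Analysis.Analysis" "HOL-Algebra.QuotRing" "HOL-Algebra.Module"
begin

section \<open>C*-algebras\<close>

text \<open>
  C*-algebras are modelled with explicit carriers, extending the \<open>module\<close> records of HOL-Algebra
  by an involution and a norm. They need not have a unit: the field \<^const>\<open>one\<close> inherited from the
  record is not part of the structure, and nothing below depends on its value.
\<close>

record 'a cstar = "(complex, 'a) module" +
  star :: "'a \<Rightarrow> 'a"
  cnorm :: "'a \<Rightarrow> real"

definition complex_ring :: "complex ring" where
  "complex_ring = \<lparr>carrier = UNIV, mult = (*), one = 1, zero = 0, add = (+)\<rparr>"

text \<open>
  The distance is set to 0 off the carrier, since \<^locale>\<open>Metric_space\<close> demands non-negativity and
  symmetry on the whole type.
\<close>

definition cdist :: "'a cstar \<Rightarrow> 'a \<Rightarrow> 'a \<Rightarrow> real" where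
  "cdist A x y = (if x \<in> carrier A \<and> y \<in> carrier A then cnorm A (x \<ominus>\<^bsub>A\<^esub> y) else 0)"

definition ctopology :: "'a cstar \<Rightarrow> 'a topology" where
  "ctopology A = Metric_space.mtopology (carrier A) (cdist A)"

locale cstar_algebra = module complex_ring A for A :: "'a cstar" (structure) +
  assumes mult_closed: "\<lbrakk>x \<in> carrier A; y \<in> carrier A\<rbrakk> \<Longrightarrow> x \<otimes> y \<in> carrier A"
    and mult_assoc: "\<lbrakk>x \<in> carrier A; y \<in> carrier A; z \<in> carrier A\<rbrakk>
      \<Longrightarrow> (x \<otimes> y) \<otimes> z = x \<otimes> (y \<otimes> z)"
    and mult_l_distr: "\<lbrakk>x \<in> carrier A; y \<in> carrier A; z \<in> carrier A\<rbrakk>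
      \<Longrightarrow> (x \<oplus> y) \<otimes> z = x \<otimes> z \<oplus> y \<otimes> z"
    and mult_r_distr: "\<lbrakk>x \<in> carrier A; y \<in> carrier A; z \<in> carrier A\<rbrakk>
      \<Longrightarrow> z \<otimes> (x \<oplus> y) = z \<otimes> x \<oplus> z \<otimes> y"
    and smult_mult_l: "\<lbrakk>x \<in> carrier A; y \<in> carrier A\<rbrakk> \<Longrightarrow> (c \<odot> x) \<otimes> y = c \<odot> (x \<otimes> y)"
    and smult_mult_r: "\<lbrakk>x \<in> carrier A; y \<in> carrier A\<rbrakk> \<Longrightarrow> x \<otimes> (c \<odot> y) = c \<odot> (x \<otimes> y)"
    and star_closed: "x \<in> carrier A \<Longrightarrow> star A x \<in> carrier A"
    and star_star: "x \<in> carrier A \<Longrightarrow> star A (star A x) = x"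
    and star_add: "\<lbrakk>x \<in> carrier A; y \<in> carrier A\<rbrakk> \<Longrightarrow> star A (x \<oplus> y) = star A x \<oplus> star A y"
    and star_smult: "x \<in> carrier A \<Longrightarrow> star A (c \<odot> x) = cnj c \<odot> star A x"
    and star_mult: "\<lbrakk>x \<in> carrier A; y \<in> carrier A\<rbrakk> \<Longrightarrow> star A (x \<otimes> y) = star A y \<otimes> star A x"
    and cnorm_nonneg: "x \<in> carrier A \<Longrightarrow> 0 \<le> cnorm A x"
    and cnorm_eq_0_iff: "x \<in> carrier A \<Longrightarrow> cnorm A x = 0 \<longleftrightarrow> x = \<zero>"
    and cnorm_triangle: "\<lbrakk>x \<in> carrier A; y \<in> carrier A\<rbrakk>
      \<Longrightarrow> cnorm A (x \<oplus> y) \<le> cnorm A x + cnorm A y"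
    and cnorm_smult: "x \<in> carrier A \<Longrightarrow> cnorm A (c \<odot> x) = cmod c * cnorm A x"
    and cnorm_mult: "\<lbrakk>x \<in> carrier A; y \<in> carrier A\<rbrakk>
      \<Longrightarrow> cnorm A (x \<otimes> y) \<le> cnorm A x * cnorm A y"
    and cnorm_star_mult: "x \<in> carrier A \<Longrightarrow> cnorm A (star A x \<otimes> x) = (cnorm A x)\<^sup>2"
    and complete: "Metric_space.mcomplete (carrier A) (cdist A)"

definition unital :: "'a cstar \<Rightarrow> bool" where
  "unital A \<longleftrightarrow> (\<exists>e\<in>carrier A. \<forall>x\<in>carrier A. e \<otimes>\<^bsub>A\<^esub> x = x \<and> x \<otimes>\<^bsub>A\<^esub> e = x)"

definition selfadjoint :: "'a cstar \<Rightarrow> 'a set" where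
  "selfadjoint A = {a \<in> carrier A. star A a = a}"

definition star_hom :: "'a cstar \<Rightarrow> 'b cstar \<Rightarrow> ('a \<Rightarrow> 'b) set" where
  "star_hom A B = {f \<in> carrier A \<rightarrow> carrier B.
     (\<forall>x\<in>carrier A. \<forall>y\<in>carrier A. f (x \<oplus>\<^bsub>A\<^esub> y) = f x \<oplus>\<^bsub>B\<^esub> f y) \<and>
     (\<forall>x\<in>carrier A. \<forall>y\<in>carrier A. f (x \<otimes>\<^bsub>A\<^esub> y) = f x \<otimes>\<^bsub>B\<^esub> f y) \<and>
     (\<forall>c. \<forall>x\<in>carrier A. f (c \<odot>\<^bsub>A\<^esub> x) = c \<odot>\<^bsub>B\<^esub> f x) \<and>
     (\<forall>x\<in>carrier A. f (star A x) = star B (f x))}"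

definition star_isomorphic :: "'a cstar \<Rightarrow> 'b cstar \<Rightarrow> bool" where
  "star_isomorphic A B \<longleftrightarrow> (\<exists>f\<in>star_hom A B. bij_betw f (carrier A) (carrier B))"

section \<open>Generated subalgebras, unitization, ideals and quotients\<close>

definition sub_cstar_algebra :: "'a set \<Rightarrow> 'a cstar \<Rightarrow> bool" where
  "sub_cstar_algebra B A \<longleftrightarrow> additive_subgroup B A \<and>
     (\<forall>x\<in>B. \<forall>y\<in>B. x \<otimes>\<^bsub>A\<^esub> y \<in> B) \<and> (\<forall>c. \<forall>x\<in>B. c \<odot>\<^bsub>A\<^esub> x \<in> B) \<and>
     (\<forall>x\<in>B. star A x \<in> B) \<and> closedin (ctopology A) B"

definition cstar_generated :: "'a cstar \<Rightarrow> 'a set \<Rightarrow> 'a set" where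
  "cstar_generated A S = \<Inter>{B. sub_cstar_algebra B A \<and> S \<subseteq> B}"

definition closed_ideal :: "'a set \<Rightarrow> 'a cstar \<Rightarrow> bool" where
  "closed_ideal I A \<longleftrightarrow> additive_subgroup I A \<and> (\<forall>c. \<forall>x\<in>I. c \<odot>\<^bsub>A\<^esub> x \<in> I) \<and>
     (\<forall>a\<in>carrier A. \<forall>x\<in>I. a \<otimes>\<^bsub>A\<^esub> x \<in> I \<and> x \<otimes>\<^bsub>A\<^esub> a \<in> I) \<and> closedin (ctopology A) I"

text \<open>
  The operations on cosets are set-valued in the style of \<^const>\<open>rcoset_mult\<close>: the union runs over
  all representatives, which all yield the same coset.
\<close>

definition cstar_quotient :: "'a cstar \<Rightarrow> 'a set \<Rightarrow> 'a set cstar" where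
  "cstar_quotient A I =
    \<lparr>carrier = a_rcosets\<^bsub>A\<^esub> I, mult = rcoset_mult A I, one = I +>\<^bsub>A\<^esub> \<one>\<^bsub>A\<^esub>, zero = I, add = set_add A,
     smult = (\<lambda>c X. \<Union>x\<in>X. I +>\<^bsub>A\<^esub> (c \<odot>\<^bsub>A\<^esub> x)),
     star = (\<lambda>X. \<Union>x\<in>X. I +>\<^bsub>A\<^esub> star A x),
     cnorm = (\<lambda>X. INF x\<in>X. cnorm A x)\<rparr>"

text \<open>
  Adjoining a unit to a non-unital algebra. The pair \<open>(a, s)\<close> stands for \<open>a + s 1\<close>; its norm is that
  of the operator of left multiplication by it on \<open>A\<close>. This is a norm only if \<open>A\<close> is not unital.
\<close>

definition adjoin_unit :: "'a cstar \<Rightarrow> ('a \<times> complex) cstar" where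
  "adjoin_unit A =
    \<lparr>carrier = carrier A \<times> UNIV,
     mult = (\<lambda>(a, s) (b, t). (a \<otimes>\<^bsub>A\<^esub> b \<oplus>\<^bsub>A\<^esub> s \<odot>\<^bsub>A\<^esub> b \<oplus>\<^bsub>A\<^esub> t \<odot>\<^bsub>A\<^esub> a, s * t)),
     one = (\<zero>\<^bsub>A\<^esub>, 1),
     zero = (\<zero>\<^bsub>A\<^esub>, 0),
     add = (\<lambda>(a, s) (b, t). (a \<oplus>\<^bsub>A\<^esub> b, s + t)),
     smult = (\<lambda>c (a, s). (c \<odot>\<^bsub>A\<^esub> a, c * s)),
     star = (\<lambda>(a, s). (star A a, cnj s)),
     cnorm = (\<lambda>(a, s). SUP b\<in>{b \<in> carrier A. cnorm A b \<le> 1}. cnorm A (a \<otimes>\<^bsub>A\<^esub> b \<oplus>\<^bsub>A\<^esub> s \<odot>\<^bsub>A\<^esub> b))\<rparr>"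

section \<open>Generator rank\<close>

text \<open>Tuples \<open>(a\<^sub>0, \<dots>, a\<^sub>n)\<close> are given by functions on the index set \<open>{..n}\<close>.\<close>

definition dense_generation :: "'a cstar \<Rightarrow> nat \<Rightarrow> bool" where
  "dense_generation A n \<longleftrightarrow>
    (\<forall>a \<in> {..n} \<rightarrow> selfadjoint A. \<forall>\<epsilon>>0. \<forall>c\<in>carrier A.
      \<exists>b \<in> {..n} \<rightarrow> selfadjoint A. (\<forall>j\<le>n. cnorm A (b j \<ominus>\<^bsub>A\<^esub> a j) < \<epsilon>) \<and>
        (\<exists>g \<in> cstar_generated A (b ` {..n}). cnorm A (c \<ominus>\<^bsub>A\<^esub> g) < \<epsilon>))"

definition gr0 :: "'a cstar \<Rightarrow> enat" where
  "gr0 A = (if \<exists>n. dense_generation A n then enat (LEAST n. dense_generation A n) else \<infinity>)"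

definition gr :: "'a cstar \<Rightarrow> enat" where
  "gr A = (if unital A then gr0 A else gr0 (adjoin_unit A))"

section \<open>Inductive limits\<close>

text \<open>\<open>(\<lambda>, \<mu>) \<in> r\<close> means that \<open>\<lambda> \<le> \<mu>\<close>.\<close>

definition directed_on :: "'i set \<Rightarrow> 'i rel \<Rightarrow> bool" where
  "directed_on \<Lambda> r \<longleftrightarrow> \<Lambda> \<noteq> {} \<and> preorder_on \<Lambda> r \<and>
     (\<forall>i\<in>\<Lambda>. \<forall>j\<in>\<Lambda>. \<exists>k\<in>\<Lambda>. (i, k) \<in> r \<and> (j, k) \<in> r)"

text \<open>The filter of tails of a directed set, governing limits and limes inferior of nets.\<close>

definition tails :: "'i set \<Rightarrow> 'i rel \<Rightarrow> 'i filter" where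
  "tails \<Lambda> r = (INF i\<in>\<Lambda>. principal {j \<in> \<Lambda>. (i, j) \<in> r})"

definition inductive_system ::
    "'i set \<Rightarrow> 'i rel \<Rightarrow> ('i \<Rightarrow> 'a cstar) \<Rightarrow> ('i \<Rightarrow> 'i \<Rightarrow> 'a \<Rightarrow> 'a) \<Rightarrow> bool" where
  "inductive_system \<Lambda> r A \<phi> \<longleftrightarrow> directed_on \<Lambda> r \<and> (\<forall>i\<in>\<Lambda>. cstar_algebra (A i)) \<and>
     (\<forall>(i, j)\<in>r. \<phi> i j \<in> star_hom (A i) (A j)) \<and>
     (\<forall>i\<in>\<Lambda>. \<forall>x\<in>carrier (A i). \<phi> i i x = x) \<and>
     (\<forall>i j k. (i, j) \<in> r \<longrightarrow> (j, k) \<in> r \<longrightarrow>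
       (\<forall>x\<in>carrier (A i). \<phi> j k (\<phi> i j x) = \<phi> i k x))"

text \<open>The algebra of all bounded families, with the supremum norm.\<close>

definition cstar_product :: "'i set \<Rightarrow> ('i \<Rightarrow> 'a cstar) \<Rightarrow> ('i \<Rightarrow> 'a) cstar" where
  "cstar_product \<Lambda> A =
    \<lparr>carrier = {x \<in> (\<Pi>\<^sub>E i\<in>\<Lambda>. carrier (A i)). bdd_above ((\<lambda>i. cnorm (A i) (x i)) ` \<Lambda>)},
     mult = (\<lambda>x y. \<lambda>i\<in>\<Lambda>. x i \<otimes>\<^bsub>A i\<^esub> y i),
     one = (\<lambda>i\<in>\<Lambda>. \<one>\<^bsub>A i\<^esub>),
     zero = (\<lambda>i\<in>\<Lambda>. \<zero>\<^bsub>A i\<^esub>),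
     add = (\<lambda>x y. \<lambda>i\<in>\<Lambda>. x i \<oplus>\<^bsub>A i\<^esub> y i),
     smult = (\<lambda>c x. \<lambda>i\<in>\<Lambda>. c \<odot>\<^bsub>A i\<^esub> x i),
     star = (\<lambda>x. \<lambda>i\<in>\<Lambda>. star (A i) (x i)),
     cnorm = (\<lambda>x. SUP i\<in>\<Lambda>. cnorm (A i) (x i))\<rparr>"

definition null_families :: "'i set \<Rightarrow> 'i rel \<Rightarrow> ('i \<Rightarrow> 'a cstar) \<Rightarrow> ('i \<Rightarrow> 'a) set" where
  "null_families \<Lambda> r A =
    {x \<in> carrier (cstar_product \<Lambda> A). ((\<lambda>i. cnorm (A i) (x i)) \<longlongrightarrow> 0) (tails \<Lambda> r)}"

definition asymptotic_algebra ::
    "'i set \<Rightarrow> 'i rel \<Rightarrow> ('i \<Rightarrow> 'a cstar) \<Rightarrow> ('i \<Rightarrow> 'a) set cstar" where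
  "asymptotic_algebra \<Lambda> r A = cstar_quotient (cstar_product \<Lambda> A) (null_families \<Lambda> r A)"

text \<open>
  The canonical map out of \<open>A\<^sub>i\<close> sends \<open>a\<close> to the class of the family \<open>(\<phi>\<^sub>i\<^sub>j(a))\<^sub>j\<close>, which is
  extended by 0 to those \<open>j\<close> that do not lie above \<open>i\<close>.
\<close>

definition limit_map ::
    "'i set \<Rightarrow> 'i rel \<Rightarrow> ('i \<Rightarrow> 'a cstar) \<Rightarrow> ('i \<Rightarrow> 'i \<Rightarrow> 'a \<Rightarrow> 'a) \<Rightarrow> 'i \<Rightarrow> 'a \<Rightarrow> ('i \<Rightarrow> 'a) set" where
  "limit_map \<Lambda> r A \<phi> i a = null_families \<Lambda> r A +>\<^bsub>cstar_product \<Lambda> A\<^esub>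
     (\<lambda>j\<in>\<Lambda>. if (i, j) \<in> r then \<phi> i j a else \<zero>\<^bsub>A j\<^esub>)"

text \<open>
  The quotient norm of the class of a family is the limes superior of its norms. Hence the union of
  the images of the canonical maps is the algebraic direct limit, modulo the elements of seminorm 0
  for the seminorm sending the class of \<open>a\<close> in \<open>A\<^sub>i\<close> to the limit of the norms of \<open>\<phi>\<^sub>i\<^sub>j(a)\<close>, and its
  closure is the completion.
\<close>

definition inductive_limit ::
    "'i set \<Rightarrow> 'i rel \<Rightarrow> ('i \<Rightarrow> 'a cstar) \<Rightarrow> ('i \<Rightarrow> 'i \<Rightarrow> 'a \<Rightarrow> 'a) \<Rightarrow> ('i \<Rightarrow> 'a) set cstar" where
  "inductive_limit \<Lambda> r A \<phi> = (asymptotic_algebra \<Lambda> r A)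
     \<lparr>carrier := ctopology (asymptotic_algebra \<Lambda> r A) closure_of
        (\<Union>i\<in>\<Lambda>. limit_map \<Lambda> r A \<phi> i ` carrier (A i))\<rparr>"

end

theory Submission
  imports Defs
begin

text \<open>
  All C*-algebras with elements in a given type embed into a single unital one, and the generator rank
  of \<open>A\<close> becomes density of the generating self-adjoint tuples of \<open>A + \<complex>1\<close>, where generation
  means approximation by noncommutative polynomials.

  Let \<open>J\<close> be an ideal of \<open>X\<close>. Self-adjoint elements \<open>h = 1 - u\<close> of \<open>J\<close> serve as approximate
  units. A tuple \<open>b\<close> that generates in \<open>X\<close> and is close to \<open>a + s\<close>, with \<open>a\<close> in \<open>J\<close> and \<open>s\<close> scalar, is
  replaced by \<open>h(b - s)h + s\<close>; for \<open>v\<close> in \<open>J\<close> this hardly changes the products of \<open>v\<close> with polynomials in \<open>b\<close>.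
  Multiplying by resolvents, whose norms are at most 1, makes up for the lack of a unit in \<open>J\<close> without
  reference to the uncontrolled norms of polynomials in the compressed tuple.

  For the upper bound, the first \<open>n + 1\<close> entries of a tuple are moved so that they generate the quotient.
  They then approximate the target and the remaining \<open>m + 1\<close> entries up to errors in \<open>J\<close>, and these
  errors are perturbed so that they generate the error of the target.

  *-Homomorphisms are contractive and preserve dense generation, so every finite set of elements of an
  inductive limit is close to the image of some \<open>A\<^sub>i\<close> of small rank, and this suffices.
\<close>

section \<open>Unital C*-algebras as a type class\<close>

text \<open>The obstacle in an ideal is the order of choices. A compression controls
  \<open>v * eval n b p\<close> only for an element v of the ideal fixed beforehand, while the
  polynomial arrives together with the tuple, so no bound for its value at the compressed tuple can
  be planned for. The truncation t -> t T(t) with T(t) = (1 + i t/K)^-1 breaks this circle. Its norm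
  is at most 2K for every self-adjoint t, and t T(t) - t' T(t') = T(t') (t - t') T(t), so it is
  enough that y T(t') (t - t') is small for one suitable y in the ideal. Hence K and every tolerance
  depending on it are fixed before the polynomial is known. Spectral theory is replaced by Banach's
  fixed point theorem: it yields square roots, hence unitaries, whose norm is read off the
  C*-identity; the bound for resolvents and the contractivity of *-homomorphisms follow. The rank is
  always computed in A + C1 with a new unit, even if A has a unit e; for unital A this changes
  nothing, since the extra summand C(1 - e) can be generated after a small perturbation of the
  scalar part.\<close>

text \<open>Scalars act through the central square root \<open>imag\<close> of -1, so that the real type classes of
  the library apply.\<close>

class unital_cstar = real_normed_algebra_1 + complete_space +
  fixes adj :: "'a \<Rightarrow> 'a" and imag :: 'a
  assumes imag_sq: "imag * imag = - 1"
    and imag_comm: "x * imag = imag * x"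
    and adj_adj [simp]: "adj (adj x) = x"
    and adj_add: "adj (x + y) = adj x + adj y"
    and adj_mult: "adj (x * y) = adj y * adj x"
    and adj_scaleR: "adj (scaleR r x) = scaleR r (adj x)"
    and adj_imag: "adj imag = - imag"
    and norm_adj_mult: "norm (adj x * x) = (norm x)\<^sup>2"

instance unital_cstar \<subseteq> banach ..

definition scaleC :: "complex \<Rightarrow> 'a::unital_cstar \<Rightarrow> 'a" where
  "scaleC z x = Re z *\<^sub>R x + Im z *\<^sub>R (imag * x)"

lemma adj_zero [simp]: "adj (0::'a::unital_cstar) = 0"
  using adj_scaleR[of 0 0] by simp

lemma adj_minus: "adj (- x) = - adj (x::'a::unital_cstar)"
  using adj_scaleR[of "-1" x] by simp

lemma adj_diff: "adj (x - y) = adj x - adj (y::'a::unital_cstar)"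
  using adj_add[of x "- y"] by (simp add: adj_minus)

lemma adj_one [simp]: "adj (1::'a::unital_cstar) = 1"
  using adj_mult[of "adj 1" "1::'a"] by simp

lemma imag_left_comm: "x * (imag * y) = imag * (x * (y::'a::unital_cstar))"
  by (metis imag_comm mult.assoc)

lemma imag_imag_mult: "imag * (imag * x) = - (x::'a::unital_cstar)"
  by (metis imag_sq mult.assoc mult_minus1)

text \<open>Normal form has \<open>imag\<close> on the left. The guard \<open>NO_MATCH\<close> keeps
  the commutation rule from looping on \<open>imag * imag\<close>.\<close>

lemma imag_normalize:
  "NO_MATCH imag x \<Longrightarrow> x * imag = imag * (x::'a::unital_cstar)"
  "NO_MATCH imag x \<Longrightarrow> x * (imag * y) = imag * (x * (y::'a::unital_cstar))"
  by (rule imag_comm, rule imag_left_comm)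

lemmas imag_simps = imag_normalize imag_imag_mult imag_sq

lemma norm_adj [simp]: "norm (adj x) = norm (x::'a::unital_cstar)"
proof -
  have le: "norm (z::'a) \<le> norm (adj z)" for z
  proof (cases "z = 0")
    case False
    have "(norm z)\<^sup>2 \<le> norm (adj z) * norm z"
      using norm_mult_ineq[of "adj z" z] by (simp add: norm_adj_mult)
    thus ?thesis using False by (simp add: power2_eq_square)
  qed simp
  show ?thesis using le[of x] le[of "adj x"] by simp
qed

lemma norm_imag_mult [simp]: "norm (imag * x) = norm (x::'a::unital_cstar)"
proof -
  have "adj (imag * x) * (imag * x) = adj x * x"
    by (simp add: adj_mult adj_imag mult.assoc imag_simps)
  hence "(norm (imag * x))\<^sup>2 = (norm x)\<^sup>2" by (metis norm_adj_mult)
  thus ?thesis by simp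
qed

lemma scaleC_of_real: "scaleC (of_real r) x = r *\<^sub>R (x::'a::unital_cstar)"
  by (simp add: scaleC_def)

lemma scaleC_one [simp]: "scaleC 1 x = (x::'a::unital_cstar)"
  by (simp add: scaleC_def)

lemma scaleC_zero [simp]: "scaleC 0 x = (0::'a::unital_cstar)" "scaleC z (0::'a::unital_cstar) = 0"
  by (simp_all add: scaleC_def)

lemma scaleC_ii: "scaleC \<i> x = imag * (x::'a::unital_cstar)"
  by (simp add: scaleC_def)

lemma scaleC_add_right: "scaleC z (x + y) = scaleC z x + scaleC z (y::'a::unital_cstar)"
  by (simp add: scaleC_def algebra_simps)

lemma scaleC_add_left: "scaleC (z + w) x = scaleC z x + scaleC w (x::'a::unital_cstar)"
  by (simp add: scaleC_def algebra_simps)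

lemma scaleC_minus_left: "scaleC (- z) x = - scaleC z (x::'a::unital_cstar)"
  by (simp add: scaleC_def)

lemma scaleC_diff_right: "scaleC z (x - y) = scaleC z x - scaleC z (y::'a::unital_cstar)"
  by (simp add: scaleC_def algebra_simps)

lemma scaleC_scaleC: "scaleC z (scaleC w x) = scaleC (z * w) (x::'a::unital_cstar)"
  by (simp add: scaleC_def algebra_simps imag_imag_mult)

lemma scaleC_mult_left: "scaleC z x * y = scaleC z (x * (y::'a::unital_cstar))"
  by (simp add: scaleC_def algebra_simps)

lemma scaleC_mult_right: "x * scaleC z y = scaleC z (x * (y::'a::unital_cstar))"
  by (simp add: scaleC_def algebra_simps imag_simps)

lemma adj_scaleC: "adj (scaleC z x) = scaleC (cnj z) (adj (x::'a::unital_cstar))"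
  by (simp add: scaleC_def adj_add adj_scaleR adj_mult adj_imag imag_simps)

text \<open>Multiplying z x by its adjoint gives the real multiple |z|^2 of
  \<open>adj x * x\<close>, so the C*-identity reduces the claim to real scalars.\<close>

lemma norm_scaleC: "norm (scaleC z (x::'a::unital_cstar)) = cmod z * norm x"
proof -
  have "adj (scaleC z x) * scaleC z x = scaleC (cnj z * z) (adj x * x)"
    by (simp add: adj_scaleC scaleC_mult_left scaleC_mult_right scaleC_scaleC mult.commute)
  also have "cnj z * z = of_real ((cmod z)\<^sup>2)"
    by (metis complex_norm_square mult.commute)
  finally have "(norm (scaleC z x))\<^sup>2 = (cmod z * norm x)\<^sup>2"
    by (metis scaleC_of_real norm_adj_mult norm_scaleR abs_power2 power_mult_distrib)
  thus ?thesis by simp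
qed

section \<open>Subalgebras, self-adjoint elements and closures\<close>

definition subalg :: "'a::unital_cstar set \<Rightarrow> bool" where
  "subalg S \<longleftrightarrow> 0 \<in> S \<and> (\<forall>x\<in>S. \<forall>y\<in>S. x + y \<in> S \<and> x * y \<in> S) \<and> (\<forall>x\<in>S. \<forall>z. scaleC z x \<in> S)"

definition star_closed :: "'a::unital_cstar set \<Rightarrow> bool" where
  "star_closed S \<longleftrightarrow> (\<forall>x\<in>S. adj x \<in> S)"

definition self_adj :: "'a::unital_cstar \<Rightarrow> bool" where
  "self_adj x \<longleftrightarrow> adj x = x"

lemma subalgD:
  assumes "subalg S"
  shows "0 \<in> S" "x \<in> S \<Longrightarrow> y \<in> S \<Longrightarrow> x + y \<in> S" "x \<in> S \<Longrightarrow> y \<in> S \<Longrightarrow> x * y \<in> S"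
    "x \<in> S \<Longrightarrow> scaleC z x \<in> S" "x \<in> S \<Longrightarrow> r *\<^sub>R x \<in> S" "x \<in> S \<Longrightarrow> imag * x \<in> S"
    "x \<in> S \<Longrightarrow> - x \<in> S" "x \<in> S \<Longrightarrow> y \<in> S \<Longrightarrow> x - y \<in> S"
proof -
  show *: "0 \<in> S" "x \<in> S \<Longrightarrow> y \<in> S \<Longrightarrow> x + y \<in> S" "x \<in> S \<Longrightarrow> y \<in> S \<Longrightarrow> x * y \<in> S"
    "x \<in> S \<Longrightarrow> scaleC z x \<in> S" for x y z
    using assms by (auto simp: subalg_def)
  show "x \<in> S \<Longrightarrow> r *\<^sub>R x \<in> S" using *(4)[of x "of_real r"] by (simp add: scaleC_of_real)
  show "x \<in> S \<Longrightarrow> imag * x \<in> S" using *(4)[of x \<i>] by (simp add: scaleC_ii)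
  show m: "x \<in> S \<Longrightarrow> - x \<in> S" for x using *(4)[of x "- 1"] by (simp add: scaleC_minus_left)
  show "x \<in> S \<Longrightarrow> y \<in> S \<Longrightarrow> x - y \<in> S" using *(2)[of x "- y"] m[of y] by simp
qed

lemma subalg_power: "subalg S \<Longrightarrow> 1 \<in> S \<Longrightarrow> x \<in> S \<Longrightarrow> x ^ n \<in> S"
  by (induction n) (auto intro: subalgD)

lemma self_adjD: "self_adj x \<Longrightarrow> adj x = x"
  by (simp add: self_adj_def)

lemma self_adj_add: "self_adj x \<Longrightarrow> self_adj y \<Longrightarrow> self_adj (x + y)"
  and self_adj_diff: "self_adj x \<Longrightarrow> self_adj y \<Longrightarrow> self_adj (x - y)"
  and self_adj_scaleR: "self_adj x \<Longrightarrow> self_adj (r *\<^sub>R x)"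
  and self_adj_one: "self_adj 1"
  and self_adj_zero: "self_adj 0"
  and self_adj_conj: "self_adj x \<Longrightarrow> self_adj y \<Longrightarrow> self_adj (x * y * x)"
  and self_adj_adj_mult: "self_adj (adj z * z)"
  and self_adj_mult_adj: "self_adj (z * adj z)"
  and self_adj_square: "self_adj x \<Longrightarrow> self_adj (x * x)"
  by (simp_all add: self_adj_def adj_add adj_diff adj_scaleR adj_mult mult.assoc)

lemma continuous_adj: "continuous_on UNIV (adj :: 'a::unital_cstar \<Rightarrow> 'a)"
proof -
  have "dist (adj x) (adj y) = dist x (y::'a)" for x y
    by (simp add: dist_norm flip: adj_diff)
  thus ?thesis by (auto simp: continuous_on_iff)
qed

lemma tendsto_adj: "(f \<longlongrightarrow> l) F \<Longrightarrow> ((\<lambda>x. adj (f x)) \<longlongrightarrow> adj (l::'a::unital_cstar)) F"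
  by (rule continuous_on_tendsto_compose[OF continuous_adj]) auto

lemma tendsto_scaleC: "(f \<longlongrightarrow> l) F \<Longrightarrow> ((\<lambda>x. scaleC z (f x)) \<longlongrightarrow> scaleC z (l::'a::unital_cstar)) F"
  unfolding scaleC_def by (intro tendsto_intros)

lemma closed_self_adj: "closed (Collect (self_adj :: 'a::unital_cstar \<Rightarrow> bool))"
proof -
  have "Collect (self_adj :: 'a \<Rightarrow> bool) = {x. adj x = x}" by (auto simp: self_adj_def)
  thus ?thesis using closed_Collect_eq[of "adj :: 'a \<Rightarrow> 'a" "\<lambda>x. x"] continuous_adj by simp
qed

lemma subalg_closure:
  assumes "subalg S" shows "subalg (closure S)"
proof -
  have seq: "\<exists>f. (\<forall>n. f n \<in> S) \<and> f \<longlonglongrightarrow> x" if "x \<in> closure S" for x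
    using that closure_sequential by blast
  have 0: "0 \<in> closure S" using assms closure_subset by (auto simp: subalg_def)
  have 1: "x + y \<in> closure S \<and> x * y \<in> closure S" if xy: "x \<in> closure S" "y \<in> closure S" for x y
  proof -
    obtain f g where f: "\<forall>n. f n \<in> S" "f \<longlonglongrightarrow> x" and g: "\<forall>n. g n \<in> S" "g \<longlonglongrightarrow> y"
      using seq xy by meson
    have "(\<lambda>n. f n + g n) \<longlonglongrightarrow> x + y" "(\<lambda>n. f n * g n) \<longlonglongrightarrow> x * y"
      using f g by (auto intro: tendsto_intros)
    moreover have "\<forall>n. f n + g n \<in> S" "\<forall>n. f n * g n \<in> S" using f g assms by (auto simp: subalg_def)
    ultimately show ?thesis unfolding closure_sequential by (intro conjI) (rule exI, rule conjI, assumption, assumption)+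
  qed
  have 2: "scaleC z x \<in> closure S" if x: "x \<in> closure S" for x z
  proof -
    obtain f where f: "\<forall>n. f n \<in> S" "f \<longlonglongrightarrow> x" using seq x by meson
    have "(\<lambda>n. scaleC z (f n)) \<longlonglongrightarrow> scaleC z x" using f(2) by (rule tendsto_scaleC)
    moreover have "\<forall>n. scaleC z (f n) \<in> S" using f assms by (auto simp: subalg_def)
    ultimately show ?thesis unfolding closure_sequential by (intro exI conjI)
  qed
  show ?thesis using 0 1 2 by (auto simp: subalg_def)
qed

lemma star_closed_closure:
  assumes "star_closed S" shows "star_closed (closure S)"
  unfolding star_closed_def
proof
  fix x assume "x \<in> closure S"
  then obtain f where f: "\<forall>n. f n \<in> S" "f \<longlonglongrightarrow> x" using closure_sequential by blast
  have "(\<lambda>n. adj (f n)) \<longlonglongrightarrow> adj x" using f(2) by (rule tendsto_adj)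
  moreover have "\<forall>n. adj (f n) \<in> S" using f assms by (auto simp: star_closed_def)
  ultimately show "adj x \<in> closure S" unfolding closure_sequential by (intro exI conjI)
qed

text \<open>The idealizer lets unital arguments produce elements of a subalgebra that may lack a unit.\<close>

definition idealizer :: "'a::unital_cstar set \<Rightarrow> 'a set" where
  "idealizer S = {t. \<forall>x\<in>S. t * x \<in> S \<and> x * t \<in> S}"

lemma idealizer_props:
  assumes "subalg S"
  shows "subalg (idealizer S)" "1 \<in> idealizer S" "S \<subseteq> idealizer S"
  using assms
  by (auto simp: idealizer_def subalg_def ring_distribs scaleC_mult_left scaleC_mult_right mult.assoc)
    (metis mult.assoc)

lemma closed_idealizer:
  assumes "closed S" shows "closed (idealizer S)"
proof -
  have "idealizer S = (\<Inter>x\<in>S. (\<lambda>t. t * x) -` S \<inter> (\<lambda>t. x * t) -` S)"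
    by (auto simp: idealizer_def)
  moreover have "closed ((\<lambda>t. t * x) -` S)" "closed ((\<lambda>t. x * t) -` S)" for x
    by (rule closed_vimage[OF assms]; intro continuous_intros)+
  hence "closed (\<Inter>x\<in>S. (\<lambda>t. t * x) -` S \<inter> (\<lambda>t. x * t) -` S)"
    by (intro closed_INT ballI closed_Int)
  ultimately show ?thesis by simp
qed

lemma unitary_norm_le:
  assumes "adj w * w = (1::'a::unital_cstar)" shows "norm w \<le> 1"
  using norm_adj_mult[of w] assms by (simp add: power2_eq_square) (metis abs_ge_self abs_square_eq_1 power2_eq_square)

section \<open>Square roots and resolvents\<close>

text \<open>The fixed point is y = 1 - sqrt(1 - a^2), an expression in a without constant term;
  unlike the root itself it can therefore be found in a closed subalgebra that lacks 1.\<close>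

lemma half_square_fixpoint:
  fixes a :: "'a::unital_cstar"
  assumes a: "self_adj a" "norm a < 1" and S: "closed S" "subalg S" "a \<in> S"
  obtains y where "y \<in> S" "self_adj y" "a * y = y * a" "y = (1/2) *\<^sub>R (a * a + y * y)"
proof -
  define t where "t = (norm a)\<^sup>2"
  have t: "0 \<le> t" "t < 1" using a(2) by (auto simp: t_def power2_eq_square intro: mult_nonneg_nonneg)
    (metis mult_strict_mono' norm_ge_zero mult_1)
  \<comment> \<open>\<rho> is the smaller root of the same equation for norms, \<rho> = (t +
    \<rho>^2)/2. It is the radius of an invariant ball and at the same time the contraction
    constant.\<close>
  define \<rho> where "\<rho> = 1 - sqrt (1 - t)"
  have \<rho>: "0 \<le> \<rho>" "\<rho> < 1" "(t + \<rho>\<^sup>2) / 2 = \<rho>"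
    using t by (auto simp: \<rho>_def power2_diff)
  define f where "f = (\<lambda>y. (1/2) *\<^sub>R (a * a + y * y))"
  \<comment> \<open>Every property wanted of y is a closed condition preserved by \<open>f\<close>,
    so it is built into the domain of the contraction.\<close>
  define B where "B = S \<inter> Collect self_adj \<inter> {y. a * y = y * a} \<inter> cball 0 \<rho>"
  have "closed {y. a * y = y * a}" by (intro closed_Collect_eq continuous_intros)
  hence "closed B" unfolding B_def using S closed_self_adj by auto
  hence "complete B" by (simp add: complete_eq_closed) 
  moreover have "0 \<in> B" using S \<rho> by (auto simp: B_def subalgD self_adj_zero)
  moreover have "f ` B \<subseteq> B"
  proof
    fix z assume "z \<in> f ` B"
    then obtain y where y: "y \<in> B" and z: "z = (1/2) *\<^sub>R (a * a + y * y)" by (auto simp: f_def)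
    have yy: "y \<in> S" "self_adj y" "a * y = y * a" "norm y \<le> \<rho>" using y by (auto simp: B_def)
    have "z \<in> S" unfolding z using S yy by (intro subalgD) auto
    moreover have "self_adj z" unfolding z using a yy
      by (intro self_adj_scaleR self_adj_add self_adj_square)
    moreover have "a * z = z * a" unfolding z
      by (simp add: ring_distribs mult.assoc yy(3)) (metis mult.assoc yy(3))
    moreover have "norm z \<le> \<rho>"
    proof -
      have "norm (a * a + y * y) \<le> norm a * norm a + norm y * norm y"
        by (meson norm_triangle_ineq norm_mult_ineq add_mono order_trans)
      also have "\<dots> \<le> t + \<rho>\<^sup>2" using mult_mono[OF yy(4) yy(4)] \<rho>
        by (simp add: t_def power2_eq_square)
      finally show ?thesis using \<rho> by (simp add: z)
    qed
    ultimately show "z \<in> B" by (auto simp: B_def)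
  qed
  moreover have "dist (f x) (f y) \<le> \<rho> * dist x y" if "x \<in> B" "y \<in> B" for x y
  proof -
    have "f x - f y = (1/2) *\<^sub>R (x * (x - y) + (x - y) * y)"
      by (simp add: f_def ring_distribs flip: scaleR_diff_right)
    hence "norm (f x - f y) \<le> (1/2) * (norm x * norm (x - y) + norm (x - y) * norm y)"
      using norm_triangle_ineq[of "x * (x - y)" "(x - y) * y"]
        norm_mult_ineq[of x "x - y"] norm_mult_ineq[of "x - y" y] by simp
    also have "\<dots> \<le> (1/2) * (\<rho> * norm (x - y) + norm (x - y) * \<rho>)"
      using that by (intro mult_left_mono add_mono mult_right_mono) (auto simp: B_def)
    finally show ?thesis by (simp add: dist_norm)
  qed
  ultimately have "\<exists>!x. x \<in> B \<and> f x = x"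
    using \<rho> by (intro Banach_fix[of B \<rho>]) auto
  then obtain y where "y \<in> B" "f y = y" by blast
  thus ?thesis using that[of y] by (auto simp: B_def f_def)
qed

text \<open>Here \<open>1 - y\<close> is a square root of \<open>1 - a\<^sup>2\<close>, so that \<open>a + i(1 - y)\<close> is unitary.\<close>

lemma half_square_unitary:
  fixes a :: "'a::unital_cstar"
  assumes "self_adj a" "self_adj y" "a * y = y * a" "y = (1/2) *\<^sub>R (a * a + y * y)"
  shows "norm a \<le> 1" "norm (1 - y) \<le> 1" "1 - a * a = (1 - y) * (1 - y)"
proof -
  define w where "w = a + imag * (1 - y)"
  have ad: "adj w = a - imag * (1 - y)"
    using assms by (simp add: w_def adj_add adj_diff adj_mult adj_imag self_adjD imag_simps ring_distribs)
  have 2: "a * a + y * y = 2 *\<^sub>R y"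
    by (subst assms(4)) simp
  have yy: "y * y = 2 *\<^sub>R y - a * a" using 2 by (simp add: algebra_simps)
  have "adj w * w = 1" "w * adj w = 1"
    unfolding ad unfolding w_def by (simp_all add: ring_distribs imag_simps mult.assoc assms(3) yy scaleR_2)
  hence "norm w \<le> 1" using unitary_norm_le by blast
  hence n: "norm w \<le> 1" "norm (adj w) \<le> 1" by auto
  have "a = (1/2) *\<^sub>R (w + adj w)" by (simp add: ad) (simp add: w_def scaleR_2[symmetric])
  hence "norm a = (1/2) * norm (w + adj w)" by (metis norm_scaleR abs_of_pos zero_less_divide_1_iff zero_less_numeral)
  thus "norm a \<le> 1" using norm_triangle_ineq[of w "adj w"] n by simp
  have "imag * (1 - y) = (1/2) *\<^sub>R (w - adj w)" by (simp add: ad) (simp add: w_def scaleR_2[symmetric])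
  hence "norm (1 - y) = (1/2) * norm (w - adj w)"
    by (metis norm_imag_mult norm_scaleR abs_of_pos zero_less_divide_1_iff zero_less_numeral)
  thus "norm (1 - y) \<le> 1" using norm_triangle_ineq4[of w "adj w"] n by simp
  show "1 - a * a = (1 - y) * (1 - y)"
    by (simp add: ring_distribs yy scaleR_2)
qed

text \<open>Factor 1 - a^2 as the square of 1 - y, which is contractive as the imaginary part of a
  unitary. This takes the place of the spectral estimate 0 \<le> 1 - a^2 \<le> 1.\<close>

lemma norm_one_minus_square:
  fixes a :: "'a::unital_cstar"
  assumes "self_adj a" "norm a < 1"
  shows "norm (1 - a * a) \<le> 1"
proof -
  obtain y where "self_adj y" "a * y = y * a" "y = (1/2) *\<^sub>R (a * a + y * y)"
    using half_square_fixpoint[OF assms, of UNIV] by (auto simp: subalg_def)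
  from half_square_unitary[OF assms(1) this] show ?thesis
    by (metis mult_le_one norm_ge_zero norm_mult_ineq order_trans)
qed

text \<open>The fixed point of x -> 1 + u x is the Neumann series of u; the fixed point theorem
  places it in \<open>S\<close> at once.\<close>

lemma neumann_inverse:
  fixes u :: "'a::unital_cstar"
  assumes u: "norm u < 1" and S: "closed S" "subalg S" "1 \<in> S" "u \<in> S"
  obtains t where "t \<in> S" "(1 - u) * t = 1"
proof -
  have "\<exists>!x. x \<in> S \<and> 1 + u * x = x"
  proof (rule Banach_fix)
    show "complete S" using S by (simp add: complete_eq_closed)
    show "S \<noteq> {}" "(\<lambda>x. 1 + u * x) ` S \<subseteq> S" using S by (auto intro!: subalgD)
    show "dist (1 + u * x) (1 + u * y) \<le> norm u * dist x y" for x y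
      by (simp add: dist_norm norm_mult_ineq flip: right_diff_distrib)
  qed (use u in auto)
  then obtain x where "x \<in> S" "1 + u * x = x" by blast
  thus ?thesis using that[of x] by (simp add: algebra_simps)
qed

text \<open>The inverse of \<open>1 + iz\<close> is contractive because its Cayley transform is unitary.\<close>

lemma resolvent_exists:
  fixes z :: "'a::unital_cstar"
  assumes z: "self_adj z" and S: "closed S" "subalg S" "1 \<in> S" "z \<in> S"
  obtains R where "R \<in> S" "adj R \<in> S" "R * (1 + imag * z) = 1" "(1 + imag * z) * R = 1" "norm R \<le> 1"
proof -
  define m where "m = norm z + 1"
  have m: "m > 0" "norm z < m" by (auto simp: m_def add_nonneg_pos)
  define a where "a = (1/m) *\<^sub>R z"
  have a: "self_adj a" "norm a < 1" using z m by (auto simp: a_def self_adj_scaleR)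
  \<comment> \<open>With this value (1 + z^2)/K = 1 - u, where \<open>u\<close> has norm at most
    m^2/K < 1. So 1 + z^2 is inverted by a Neumann series although z may be large.\<close>
  define K where "K = 1 + m\<^sup>2"
  have K: "K > 0" by (simp add: K_def add_pos_nonneg)
  define u where "u = (m\<^sup>2 / K) *\<^sub>R (1 - a * a)"
  have "norm u \<le> m\<^sup>2 / K" using norm_one_minus_square[OF a] K
    by (auto simp: u_def mult_le_cancel_left2 divide_simps)
  also have "\<dots> < 1" using K by (simp add: K_def)
  finally have u1: "norm u < 1" .
  have uS: "u \<in> S" using S by (auto simp: u_def a_def intro!: subalgD)
  obtain t where t: "t \<in> S" "(1 - u) * t = 1" using neumann_inverse[OF u1 S(1-3) uS] by blast
  have "(m\<^sup>2 / K) *\<^sub>R (a * a) = (1/K) *\<^sub>R (z * z)" using m by (simp add: a_def power2_eq_square)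
  hence "1 - u = (1 - m\<^sup>2 / K) *\<^sub>R 1 + (1/K) *\<^sub>R (z * z)" by (simp add: u_def algebra_simps)
  also have "1 - m\<^sup>2 / K = 1 / K" using K by (simp add: K_def field_simps)
  finally have u2: "1 - u = (1/K) *\<^sub>R (1 + z * z)" by (simp add: algebra_simps)
  define T where "T = (1/K) *\<^sub>R t"
  have T: "T \<in> S" "(1 + z * z) * T = 1" using t S by (auto simp: T_def u2 intro: subalgD)
  have saq: "adj (1 + z * z) = 1 + z * z" using z by (simp add: adj_add adj_mult self_adjD)
  \<comment> \<open>The adjoint of a right inverse of a self-adjoint element is a left inverse, so
    the two coincide.\<close>
  have T': "adj T * (1 + z * z) = 1" using arg_cong[OF T(2), of adj] by (simp add: adj_mult saq)
  have TT: "adj T = T" using T T' by (metis mult.assoc mult.left_neutral mult.right_neutral)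
  have Tl: "T * (1 + z * z) = 1" using T' TT by simp
  have comm: "z * (1 + z * z) = (1 + z * z) * z" by (simp add: algebra_simps)
  have zT: "z * T = T * z"
  proof -
    have "z * T = (T * (1 + z * z)) * (z * T)" using Tl by simp
    also have "\<dots> = T * (z * ((1 + z * z) * T))" by (metis comm mult.assoc)
    also have "\<dots> = T * z" using T by simp
    finally show ?thesis .
  qed
  define R where "R = (1 - imag * z) * T"
  have pr: "(1 + imag * z) * (1 - imag * z) = 1 + z * z" "(1 - imag * z) * (1 + imag * z) = 1 + z * z"
    by (simp_all add: algebra_simps imag_simps)
  have cT: "(1 + imag * z) * T = T * (1 + imag * z)" "(1 - imag * z) * T = T * (1 - imag * z)"
    using zT by (simp_all add: ring_distribs mult.assoc imag_simps)
  have R1: "(1 + imag * z) * R = 1" unfolding R_def by (metis pr(1) T(2) mult.assoc)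
  have R2: "R * (1 + imag * z) = 1" unfolding R_def cT(2) by (metis pr(2) Tl mult.assoc)
  have RS: "R \<in> S" unfolding R_def using S T by (auto intro!: subalgD)
  have adR: "adj R = (1 + imag * z) * T"
    using z by (simp add: R_def adj_mult adj_diff adj_imag self_adjD TT cT imag_simps)
  have aRS: "adj R \<in> S" unfolding adR using S T by (auto intro!: subalgD)
  have "adj R * R = T * ((1 + imag * z) * (1 - imag * z)) * T"
    unfolding adR unfolding R_def by (simp only: cT(1) mult.assoc)
  hence RR: "adj R * R = T" by (simp only: pr T mult.assoc mult_1_right)
  have sum: "R + adj R = 2 *\<^sub>R T" unfolding adR unfolding R_def by (simp add: ring_distribs scaleR_2)
  \<comment> \<open>\<open>w\<close> is the Cayley transform (1 - i z)(1 + i z)^-1, and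
    \<open>R\<close> is the mean of \<open>w\<close> and 1.\<close>
  define w where "w = 2 *\<^sub>R R - 1"
  have "adj w * w = 4 *\<^sub>R (adj R * R) - 2 *\<^sub>R (R + adj R) + 1"
    by (simp add: w_def adj_diff adj_scaleR ring_distribs scaleR_add_right scaleR_diff_right)
  also have "\<dots> = 1" by (simp add: RR sum)
  finally have "norm w \<le> 1" by (rule unitary_norm_le)
  moreover have "2 *\<^sub>R R = w + 1" by (simp add: w_def)
  hence "2 * norm R = norm (w + 1)" by (metis norm_scaleR abs_numeral)
  ultimately have "norm R \<le> 1" using norm_triangle_ineq[of w 1] by simp
  thus ?thesis using that[of R] R1 R2 RS aRS by blast
qed

section \<open>Noncommutative polynomials and dense generation\<close>

text \<open>There are no constant terms, since the generated algebras need not contain 1.\<close>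

datatype expr = Var nat | Add expr expr | Mul expr expr | Scale complex expr

text \<open>Variables beyond \<open>n\<close> take the value 0, which keeps every value inside each
  subalgebra that contains the entries 0 to n.\<close>

primrec eval :: "nat \<Rightarrow> (nat \<Rightarrow> 'a::unital_cstar) \<Rightarrow> expr \<Rightarrow> 'a" where
  "eval n b (Var j) = (if j \<le> n then b j else 0)"
| "eval n b (Add p q) = eval n b p + eval n b q"
| "eval n b (Mul p q) = eval n b p * eval n b q"
| "eval n b (Scale z p) = scaleC z (eval n b p)"

text \<open>Variables are fixed because only tuples of self-adjoint elements are inserted.\<close>

primrec star_expr :: "expr \<Rightarrow> expr" where
  "star_expr (Var j) = Var j"
| "star_expr (Add p q) = Add (star_expr p) (star_expr q)"
| "star_expr (Mul p q) = Mul (star_expr q) (star_expr p)"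
| "star_expr (Scale z p) = Scale (cnj z) (star_expr p)"

definition re_expr :: "expr \<Rightarrow> expr" where
  "re_expr p = Scale (1/2) (Add p (star_expr p))"

definition self_adj_tuple :: "'a::unital_cstar set \<Rightarrow> nat \<Rightarrow> (nat \<Rightarrow> 'a) \<Rightarrow> bool" where
  "self_adj_tuple X n b \<longleftrightarrow> (\<forall>j\<le>n. b j \<in> X \<and> self_adj (b j))"

text \<open>No closure is taken; for self-adjoint entries the closure of this set is the generated
  C*-algebra.\<close>

definition gen :: "nat \<Rightarrow> (nat \<Rightarrow> 'a::unital_cstar) \<Rightarrow> 'a set" where
  "gen n b = range (eval n b)"

lemma eval_star:
  assumes "\<forall>j\<le>n. self_adj (b j)"
  shows "eval n b (star_expr p) = adj (eval n b p)"
  by (induction p) (use assms in \<open>auto simp: self_adj_def adj_add adj_mult adj_scaleC\<close>)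

lemma eval_re:
  assumes "\<forall>j\<le>n. self_adj (b j)"
  shows "eval n b (re_expr p) = (1/2) *\<^sub>R (eval n b p + adj (eval n b p))"
  using scaleC_of_real[of "1/2" "eval n b p + adj (eval n b p)"]
  by (simp add: re_expr_def eval_star[OF assms])

lemma self_adj_eval_re: "\<forall>j\<le>n. self_adj (b j) \<Longrightarrow> self_adj (eval n b (re_expr p))"
  by (simp add: eval_re self_adj_def adj_scaleR adj_add add.commute)

text \<open>Averaging with the adjoint is contractive and fixes \<open>c\<close>, so approximants of
  self-adjoint targets may be taken self-adjoint.\<close>

lemma norm_diff_re:
  fixes c :: "'a::unital_cstar"
  assumes "self_adj c" "\<forall>j\<le>n. self_adj (b j)"
  shows "norm (c - eval n b (re_expr p)) \<le> norm (c - eval n b p)"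
proof -
  have "c - eval n b (re_expr p) = (1/2) *\<^sub>R ((c - eval n b p) + adj (c - eval n b p))"
    by (simp add: eval_re[OF assms(2)] adj_diff self_adjD[OF assms(1)] algebra_simps flip: scaleR_add_left)
  thus ?thesis using norm_triangle_ineq[of "c - eval n b p" "adj (c - eval n b p)"] by simp
qed

lemma eval_in_subalg: "subalg S \<Longrightarrow> \<forall>j\<le>n. b j \<in> S \<Longrightarrow> eval n b p \<in> S"
  by (induction p) (auto intro: subalgD)

lemma eval_in_gen: "eval n b p \<in> gen n b"
  by (simp add: gen_def)

lemma gen_mem: "j \<le> n \<Longrightarrow> b j \<in> gen n b"
  using eval_in_gen[of n b "Var j"] by simp

lemma subalg_gen: "subalg (gen n b)"
  unfolding subalg_def gen_def
proof (safe)
  show "0 \<in> range (eval n b)" using rangeI[of "eval n b" "Scale 0 (Var 0)"] by (simp add: scaleC_def)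
  fix p q z
  show "eval n b p + eval n b q \<in> range (eval n b)" using rangeI[of "eval n b" "Add p q"] by simp
  show "eval n b p * eval n b q \<in> range (eval n b)" using rangeI[of "eval n b" "Mul p q"] by simp
  show "scaleC z (eval n b p) \<in> range (eval n b)" using rangeI[of "eval n b" "Scale z p"] by simp
qed

lemma star_closed_gen: "\<forall>j\<le>n. self_adj (b j) \<Longrightarrow> star_closed (gen n b)"
  unfolding star_closed_def gen_def by (auto simp flip: eval_star)

lemma closure_gen_approx:
  assumes "c \<in> closure (gen n b)" "\<epsilon> > 0"
  obtains p where "norm (c - eval n b p) < \<epsilon>"
proof -
  obtain y where "y \<in> gen n b" "dist y c < \<epsilon>"
    using assms closure_approachable[of c "gen n b"] by blast
  then obtain p where "norm (c - eval n b p) < \<epsilon>"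
    by (metis dist_norm gen_def imageE norm_minus_commute)
  thus ?thesis by (rule that)
qed

lemma tendsto_eval:
  assumes "\<forall>j\<le>n. ((\<lambda>x. f x j) \<longlongrightarrow> b j) F"
  shows "((\<lambda>x. eval n (f x) p) \<longlongrightarrow> eval n b p) F"
  by (induction p) (use assms in \<open>auto intro!: tendsto_intros tendsto_scaleC\<close>)

text \<open>Compressed tuples stay in a ball but need not converge in norm; a bound uniform over the
  ball is what can be said about the values there.\<close>

lemma eval_bounded:
  fixes M :: real
  shows "\<exists>K. \<forall>b :: nat \<Rightarrow> 'a::unital_cstar. (\<forall>j\<le>n. norm (b j) \<le> M) \<longrightarrow> norm (eval n b p) \<le> K"
proof (induction p)
  case (Var j)
  show ?case by (rule exI[of _ "max M 0"]) auto
next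
  case (Add p q)
  then obtain K L where "\<forall>b :: nat \<Rightarrow> 'a. (\<forall>j\<le>n. norm (b j) \<le> M) \<longrightarrow> norm (eval n b p) \<le> K"
    "\<forall>b :: nat \<Rightarrow> 'a. (\<forall>j\<le>n. norm (b j) \<le> M) \<longrightarrow> norm (eval n b q) \<le> L" by blast
  thus ?case by (intro exI[of _ "K + L"]) (auto intro: order_trans[OF norm_triangle_ineq] add_mono)
next
  case (Mul p q)
  then obtain K L where "\<forall>b :: nat \<Rightarrow> 'a. (\<forall>j\<le>n. norm (b j) \<le> M) \<longrightarrow> norm (eval n b p) \<le> K"
    "\<forall>b :: nat \<Rightarrow> 'a. (\<forall>j\<le>n. norm (b j) \<le> M) \<longrightarrow> norm (eval n b q) \<le> L" by blast
  thus ?case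
    by (intro exI[of _ "K * L"])
      (auto intro!: order_trans[OF norm_mult_ineq] mult_mono intro: order_trans[OF norm_ge_zero])
next
  case (Scale z p)
  then obtain K where "\<forall>b :: nat \<Rightarrow> 'a. (\<forall>j\<le>n. norm (b j) \<le> M) \<longrightarrow> norm (eval n b p) \<le> K" by blast
  thus ?case by (intro exI[of _ "cmod z * K"]) (auto simp: norm_scaleC mult_left_mono)
qed

text \<open>A failure for every radius 1/(k+1) would give tuples converging to \<open>b\<close>
  whose values stay away, against \<open>tendsto_eval\<close>.\<close>

lemma eval_open:
  fixes b :: "nat \<Rightarrow> 'a::unital_cstar"
  assumes "\<epsilon> > 0"
  obtains \<delta> where "\<delta> > 0"
    "\<And>b'. \<forall>j\<le>n. norm (b' j - b j) < \<delta> \<Longrightarrow> norm (eval n b' p - eval n b p) < \<epsilon>"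
proof -
  have "\<exists>\<delta>>0. \<forall>b'. (\<forall>j\<le>n. norm (b' j - b j) < \<delta>) \<longrightarrow> norm (eval n b' p - eval n b p) < \<epsilon>"
  proof (rule ccontr)
    assume neg: "\<not> ?thesis"
    have "\<exists>b'. (\<forall>j\<le>n. norm (b' j - b j) < inverse (real (Suc k))) \<and> norm (eval n b' p - eval n b p) \<ge> \<epsilon>" for k
      using neg by (metis inverse_positive_iff_positive not_le of_nat_0_less_iff zero_less_Suc)
    then obtain f where f: "\<And>k j. j \<le> n \<Longrightarrow> norm (f k j - b j) < inverse (real (Suc k))"
      "\<And>k. norm (eval n (f k) p - eval n b p) \<ge> \<epsilon>" by metis
    have "(\<lambda>k. f k j) \<longlonglongrightarrow> b j" if "j \<le> n" for j
    proof -
      have "(\<lambda>k. f k j - b j) \<longlonglongrightarrow> 0"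
        by (rule Lim_null_comparison[OF _ LIMSEQ_inverse_real_of_nat])
          (use f(1)[OF that] in \<open>auto intro!: always_eventually less_imp_le\<close>)
      thus ?thesis by (simp add: LIM_zero_iff)
    qed
    hence "(\<lambda>k. eval n (f k) p) \<longlonglongrightarrow> eval n b p" by (intro tendsto_eval) auto
    hence "eventually (\<lambda>k. norm (eval n (f k) p - eval n b p) < \<epsilon>) sequentially"
      using assms by (auto simp: tendsto_iff dist_norm)
    then obtain k where "norm (eval n (f k) p - eval n b p) < \<epsilon>"
      by (auto simp: eventually_sequentially)
    thus False using f(2)[of k] by simp
  qed
  thus ?thesis using that by blast
qed

lemma eval_open_dist:
  fixes b :: "nat \<Rightarrow> 'a::unital_cstar"
  assumes "norm (c - eval n b p) < \<epsilon>"
  obtains \<delta> where "\<delta> > 0"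
    "\<And>b'. \<forall>j\<le>n. norm (b' j - b j) < \<delta> \<Longrightarrow> norm (c - eval n b' p) < \<epsilon>"
proof -
  obtain \<delta> where "\<delta> > 0" and \<delta>:
    "\<And>b'. \<forall>j\<le>n. norm (b' j - b j) < \<delta> \<Longrightarrow> norm (eval n b' p - eval n b p) < \<epsilon> - norm (c - eval n b p)"
    using eval_open[of "\<epsilon> - norm (c - eval n b p)" n b p] assms by auto
  have "norm (c - eval n b' p) < \<epsilon>" if "\<forall>j\<le>n. norm (b' j - b j) < \<delta>" for b'
  proof -
    have "c - eval n b' p = (c - eval n b p) - (eval n b' p - eval n b p)" by simp
    hence "norm (c - eval n b' p) \<le> norm (c - eval n b p) + norm (eval n b' p - eval n b p)"
      by (metis norm_triangle_ineq4)
    thus ?thesis using \<delta>[OF that] by simp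
  qed
  thus ?thesis using that \<open>\<delta> > 0\<close> by blast
qed

text \<open>The condition of \<open>dense_generation\<close> with polynomials in place of the
  generated C*-algebra; a dense subset suffices since targets are only approximated.\<close>

definition dense_gen :: "'a::unital_cstar set \<Rightarrow> nat \<Rightarrow> bool" where
  "dense_gen X n \<longleftrightarrow> (\<forall>a \<epsilon>. \<forall>c\<in>X. self_adj_tuple X n a \<longrightarrow> \<epsilon> > 0 \<longrightarrow>
     (\<exists>b p. self_adj_tuple X n b \<and> (\<forall>j\<le>n. norm (b j - a j) < \<epsilon>) \<and> norm (c - eval n b p) < \<epsilon>))"

lemma dense_genE:
  assumes "dense_gen X n" "self_adj_tuple X n a" "\<epsilon> > 0" "c \<in> X"
  obtains b p where "self_adj_tuple X n b" "\<And>j. j \<le> n \<Longrightarrow> norm (b j - a j) < \<epsilon>"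
    "norm (c - eval n b p) < \<epsilon>"
  using assms unfolding dense_gen_def by blast

lemma dense_genE2:
  assumes "dense_gen X n" "self_adj_tuple X n a" "\<epsilon> > 0" "\<delta> > 0" "c \<in> X"
  obtains b p where "self_adj_tuple X n b" "\<And>j. j \<le> n \<Longrightarrow> norm (b j - a j) < \<epsilon>"
    "norm (c - eval n b p) < \<delta>"
  using dense_genE[OF assms(1,2), of "min \<epsilon> \<delta>" c] assms(3-5) by (metis min_less_iff_conj)

text \<open>Each strict approximation is an open condition on the tuple, and finitely many open
  conditions share a radius.\<close>

lemma finite_targets_open:
  fixes b :: "nat \<Rightarrow> 'a::unital_cstar"
  assumes "finite C" "\<forall>c\<in>C. \<exists>p. norm (c - eval n b p) < \<epsilon>"
  shows "\<exists>\<delta>>0. \<forall>b'. (\<forall>j\<le>n. norm (b' j - b j) < \<delta>) \<longrightarrow> (\<forall>c\<in>C. \<exists>p. norm (c - eval n b' p) < \<epsilon>)"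
  using assms
proof (induction C)
  case empty
  show ?case by (auto intro: exI[of _ 1])
next
  case (insert c C)
  then obtain \<delta>1 where 1: "\<delta>1 > 0"
    "\<And>b'. \<forall>j\<le>n. norm (b' j - b j) < \<delta>1 \<Longrightarrow> \<forall>c\<in>C. \<exists>p. norm (c - eval n b' p) < \<epsilon>" by auto
  obtain p where p: "norm (c - eval n b p) < \<epsilon>" using insert by auto
  obtain \<delta>2 where 2: "\<delta>2 > 0"
    "\<And>b'. \<forall>j\<le>n. norm (b' j - b j) < \<delta>2 \<Longrightarrow> norm (c - eval n b' p) < \<epsilon>"
    using eval_open_dist[OF p] by blast
  show ?case
  proof (intro exI[of _ "min \<delta>1 \<delta>2"] conjI allI impI)
    fix b' assume "\<forall>j\<le>n. norm (b' j - b j) < min \<delta>1 \<delta>2"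
    thus "\<forall>c\<in>insert c C. \<exists>p. norm (c - eval n b' p) < \<epsilon>" using 1(2)[of b'] 2(2)[of b'] by auto
  qed (use 1 2 in auto)
qed

text \<open>Targets are added one at a time, and the perturbation for a new target stays within the
  radius in which the old ones remain approximable. Quantifying over \<eta> in the induction leaves
  room to halve it.\<close>

lemma dense_gen_finite:
  fixes X :: "'a::unital_cstar set"
  assumes X: "dense_gen X n" and "finite C" "C \<subseteq> X" and a: "self_adj_tuple X n a" and e: "\<epsilon> > 0" "\<eta> > 0"
  obtains b where "self_adj_tuple X n b" "\<And>j. j \<le> n \<Longrightarrow> norm (b j - a j) < \<eta>"
    "\<forall>c\<in>C. \<exists>p. norm (c - eval n b p) < \<epsilon>"
proof -
  have "\<forall>\<eta>>0. \<exists>b. self_adj_tuple X n b \<and> (\<forall>j\<le>n. norm (b j - a j) < \<eta>) \<and> (\<forall>c\<in>C. \<exists>p. norm (c - eval n b p) < \<epsilon>)"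
    using assms(2,3)
  proof (induction C)
    case empty
    thus ?case using a e by (auto intro!: exI[of _ a])
  next
    case (insert c C)
    show ?case
    proof (intro allI impI)
      fix \<eta> :: real assume \<eta>: "\<eta> > 0"
      obtain b where b: "self_adj_tuple X n b" "\<forall>j\<le>n. norm (b j - a j) < \<eta>/2"
        "\<forall>c\<in>C. \<exists>p. norm (c - eval n b p) < \<epsilon>"
        using insert \<eta> by (meson half_gt_zero insert_subset)
      obtain \<delta> where d: "\<delta> > 0" "\<And>b'. \<forall>j\<le>n. norm (b' j - b j) < \<delta> \<Longrightarrow> \<forall>c\<in>C. \<exists>p. norm (c - eval n b' p) < \<epsilon>"
        using finite_targets_open[OF insert(1) b(3)] by blast
      obtain b' p where b': "self_adj_tuple X n b'" "\<And>j. j \<le> n \<Longrightarrow> norm (b' j - b j) < min \<delta> (\<eta>/2)"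
        "norm (c - eval n b' p) < \<epsilon>"
        using dense_genE2[OF X b(1), of "min \<delta> (\<eta>/2)" \<epsilon> c] d \<eta> e insert by auto
      have "norm (b' j - a j) < \<eta>" if "j \<le> n" for j
        using b'(2)[OF that] b(2) that norm_triangle_ineq[of "b' j - b j" "b j - a j"] by fastforce
      thus "\<exists>b. self_adj_tuple X n b \<and> (\<forall>j\<le>n. norm (b j - a j) < \<eta>) \<and> (\<forall>c\<in>insert c C. \<exists>p. norm (c - eval n b p) < \<epsilon>)"
        using b' d(2)[of b'] by (intro exI[of _ b']) auto
    qed
  qed
  thus ?thesis using that e by blast
qed

text \<open>Split the target as c1 + i c2. The tuple is perturbed for c1 first and then for c2, the
  second time so little that the polynomial for c1 keeps its quality.\<close>

lemma dense_gen_self_adj_targets: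
  fixes X :: "'a::unital_cstar set"
  assumes X: "subalg X" "star_closed X"
    and sa: "\<And>a \<epsilon> c. c \<in> X \<Longrightarrow> self_adj c \<Longrightarrow> self_adj_tuple X n a \<Longrightarrow> \<epsilon> > 0 \<Longrightarrow>
     (\<exists>b p. self_adj_tuple X n b \<and> (\<forall>j\<le>n. norm (b j - a j) < \<epsilon>) \<and> norm (c - eval n b p) < \<epsilon>)"
  shows "dense_gen X n"
  unfolding dense_gen_def
proof (intro allI ballI impI)
  fix a c and \<epsilon> :: real assume c: "c \<in> X" and a: "self_adj_tuple X n a" and e: "\<epsilon> > 0"
  define c1 where "c1 = (1/2) *\<^sub>R (c + adj c)"
  define c2 where "c2 = (1/2) *\<^sub>R (imag * (adj c - c))"
  have ac: "adj c \<in> X" using c X by (auto simp: star_closed_def)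
  have mem: "c1 \<in> X" "c2 \<in> X" using X c ac by (auto simp: c1_def c2_def intro!: subalgD)
  have sa12: "self_adj c1" "self_adj c2"
    by (simp_all add: self_adj_def c1_def c2_def adj_scaleR adj_add adj_diff adj_mult adj_imag imag_simps algebra_simps)
  have c12: "c = c1 + scaleC \<i> c2"
    by (simp add: c1_def c2_def scaleC_ii imag_simps algebra_simps flip: scaleR_add_left)
  obtain b1 p1 where b1: "self_adj_tuple X n b1" "\<forall>j\<le>n. norm (b1 j - a j) < \<epsilon>/2" "norm (c1 - eval n b1 p1) < \<epsilon>/2"
    using sa[OF mem(1) sa12(1) a, of "\<epsilon>/2"] e by auto
  obtain \<delta> where d: "\<delta> > 0" "\<And>b'. \<forall>j\<le>n. norm (b' j - b1 j) < \<delta> \<Longrightarrow> norm (c1 - eval n b' p1) < \<epsilon>/2"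
    using eval_open_dist[OF b1(3)] by blast
  obtain b2 p2 where b2: "self_adj_tuple X n b2" "\<forall>j\<le>n. norm (b2 j - b1 j) < min \<delta> (\<epsilon>/2)"
    "norm (c2 - eval n b2 p2) < min \<delta> (\<epsilon>/2)"
    using sa[OF mem(2) sa12(2) b1(1), of "min \<delta> (\<epsilon>/2)"] e d by auto
  have "norm (b2 j - a j) < \<epsilon>" if "j \<le> n" for j
    using b2(2) b1(2) that norm_triangle_ineq[of "b2 j - b1 j" "b1 j - a j"] by fastforce
  moreover have "norm (c - eval n b2 (Add p1 (Scale \<i> p2))) < \<epsilon>"
  proof -
    have "c - eval n b2 (Add p1 (Scale \<i> p2)) = (c1 - eval n b2 p1) + scaleC \<i> (c2 - eval n b2 p2)"
      by (simp add: c12 scaleC_diff_right)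
    hence "norm (c - eval n b2 (Add p1 (Scale \<i> p2))) \<le> norm (c1 - eval n b2 p1) + norm (c2 - eval n b2 p2)"
      by (metis norm_scaleC norm_triangle_ineq norm_ii mult_1)
    thus ?thesis using d(2)[of b2] b2 by auto
  qed
  ultimately show "\<exists>b p. self_adj_tuple X n b \<and> (\<forall>j\<le>n. norm (b j - a j) < \<epsilon>) \<and> norm (c - eval n b p) < \<epsilon>"
    using b2(1) by blast
qed

text \<open>A variable strictly above \<open>n\<close> denotes 0 on the left but may denote an entry
  on the right, so it is replaced by an expression with value 0.\<close>

lemma eval_extend: "n \<le> m \<Longrightarrow> \<exists>q. \<forall>b :: nat \<Rightarrow> 'a::unital_cstar. eval n b p = eval m b q"
proof (induction p)
  case (Var j)
  show ?case
  proof (cases "j \<le> n")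
    case True thus ?thesis using Var by (intro exI[of _ "Var j"]) auto
  next
    case False thus ?thesis by (intro exI[of _ "Scale 0 (Var 0)"]) auto
  qed
next
  case (Add p q) thus ?case by (metis eval.simps(2))
next
  case (Mul p q) thus ?case by (metis eval.simps(3))
next
  case (Scale z p) thus ?case by (metis eval.simps(4))
qed

text \<open>The entries beyond \<open>n\<close> are left as they are. Since \<open>gr\<close> yields
  only the least admissible number, this is how a bound gr \<le> m becomes dense generation for
  m.\<close>

lemma dense_gen_mono:
  fixes X :: "'a::unital_cstar set"
  assumes X: "dense_gen X n" and nm: "n \<le> m"
  shows "dense_gen X m"
  unfolding dense_gen_def
proof (intro allI ballI impI)
  fix a c and \<epsilon> :: real assume c: "c \<in> X" and a: "self_adj_tuple X m a" and e: "\<epsilon> > 0"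
  have "self_adj_tuple X n a" using a nm by (auto simp: self_adj_tuple_def)
  then obtain b p where b: "self_adj_tuple X n b" "\<And>j. j \<le> n \<Longrightarrow> norm (b j - a j) < \<epsilon>" "norm (c - eval n b p) < \<epsilon>"
    using dense_genE[OF X _ e c] by blast
  define b' where "b' = (\<lambda>j. if j \<le> n then b j else a j)"
  have "eval n b p = eval n b' p" by (induction p) (auto simp: b'_def)
  then obtain q where "eval n b p = eval m b' q" using eval_extend[OF nm, of p] by metis
  thus "\<exists>b p. self_adj_tuple X m b \<and> (\<forall>j\<le>m. norm (b j - a j) < \<epsilon>) \<and> norm (c - eval m b p) < \<epsilon>"
    using a b e by (intro exI[of _ b'] exI[of _ q]) (auto simp: self_adj_tuple_def b'_def)
qed

section \<open>Resolvents and approximate units\<close>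

definition res :: "'a::unital_cstar \<Rightarrow> 'a" where
  "res z = (SOME R. R * (1 + imag * z) = 1 \<and> (1 + imag * z) * R = 1 \<and> norm R \<le> 1)"

lemma res:
  assumes "self_adj z"
  shows "res z * (1 + imag * z) = 1" "(1 + imag * z) * res z = 1" "norm (res z) \<le> 1"
proof -
  obtain R where "R * (1 + imag * z) = 1" "(1 + imag * z) * R = 1" "norm R \<le> 1"
    using resolvent_exists[OF assms, of UNIV] by (auto simp: subalg_def)
  hence "\<exists>R. R * (1 + imag * z) = 1 \<and> (1 + imag * z) * R = 1 \<and> norm R \<le> 1" by blast
  from someI_ex[OF this] show "res z * (1 + imag * z) = 1" "(1 + imag * z) * res z = 1" "norm (res z) \<le> 1"
    by (auto simp: res_def)
qed

text \<open>Inverses are unique, so the resolvent chosen in the whole algebra agrees with the one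
  constructed inside \<open>S\<close>.\<close>

lemma res_mem:
  assumes z: "self_adj z" and S: "closed S" "subalg S" "1 \<in> S" "z \<in> S"
  shows "res z \<in> S" "adj (res z) \<in> S"
proof -
  obtain R where R: "R \<in> S" "adj R \<in> S" "R * (1 + imag * z) = 1"
    using resolvent_exists[OF assms] by blast
  have "R = R * ((1 + imag * z) * res z)" using res[OF z] by simp
  also have "\<dots> = res z" by (metis R(3) mult.assoc mult_1)
  finally show "res z \<in> S" "adj (res z) \<in> S" using R by auto
qed

lemma res_mem_idealizer:
  assumes "self_adj z" "closed S" "subalg S" "z \<in> idealizer S"
  shows "res z \<in> idealizer S"
  using res_mem(1)[OF assms(1), of "idealizer S"] assms idealizer_props[OF assms(3)] closed_idealizer by blast

lemma one_minus_res:
  assumes "self_adj z"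
  shows "1 - res z = imag * (z * res z)" "1 - res z = imag * (res z * z)"
  using res(1,2)[OF assms] by (simp_all add: ring_distribs mult.assoc imag_simps) (simp_all add: algebra_simps)

lemma norm_one_minus_res: "self_adj z \<Longrightarrow> norm (1 - res z) \<le> 2"
  using norm_triangle_ineq4[of 1 "res z"] res(3)[of z] by simp

text \<open>Up to the factor i the product is 1 - \<open>res z\<close>, a difference of two
  contractions. The bound is the same for all z, so z -> z \<open>res z\<close> truncates
  arbitrarily large elements.\<close>

lemma norm_mult_res: "self_adj z \<Longrightarrow> norm (z * res z) \<le> 2"
  using norm_one_minus_res[of z] by (simp add: one_minus_res(1))

text \<open>The resolvent identity: the difference of the arguments appears between two
  contractions.\<close>

lemma res_diff:
  assumes "self_adj z" "self_adj w"
  shows "res z - res w = imag * (res z * (w - z) * res w)"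
proof -
  have "res z - res w = res z * ((1 + imag * w) * res w) - (res z * (1 + imag * z)) * res w"
    using res[OF assms(1)] res[OF assms(2)] by simp
  also have "\<dots> = res z * (imag * w - imag * z) * res w"
    by (simp add: ring_distribs mult.assoc)
  also have "\<dots> = imag * (res z * (w - z) * res w)"
    by (simp add: ring_distribs mult.assoc imag_simps)
  finally show ?thesis .
qed

text \<open>A factor that nearly annihilates \<open>F\<close> on the right is enlarged to one for \<open>insert v F\<close>
  by multiplying it with a resolvent of \<open>(vu)\<^sup>*vu\<close>.\<close>

lemma right_annihilator:
  fixes J :: "'a::unital_cstar set"
  assumes J: "closed J" "subalg J" "star_closed J" and F: "finite F" "F \<subseteq> J" and e: "\<epsilon> > 0"
  shows "\<exists>u. norm u \<le> 1 \<and> 1 - u \<in> J \<and> (\<forall>v\<in>F. norm (v * u) < \<epsilon>)"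
  using F
proof (induction F)
  case empty
  show ?case using J by (intro exI[of _ 1]) (auto intro: subalgD)
next
  case (insert v F)
  then obtain u where u: "norm u \<le> 1" "1 - u \<in> J" "\<forall>v\<in>F. norm (v * u) < \<epsilon>" by auto
  have v: "v \<in> J" using insert by simp
  define y where "y = v * u"
  have "y = v - v * (1 - u)" by (simp add: y_def algebra_simps)
  hence yJ: "y \<in> J" using J u v by (auto intro!: subalgD)
  \<comment> \<open>The square of the norm of y R, with R the resolvent of \<tau>
    \<open>adj y * y\<close>, is at most 2/\<tau>; this value makes it \<epsilon>^2/2.\<close>
  define \<tau> where "\<tau> = 4 / \<epsilon>\<^sup>2"
  have \<tau>: "\<tau> > 0" using e by (simp add: \<tau>_def)
  define w where "w = \<tau> *\<^sub>R (adj y * y)"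
  have w: "self_adj w" by (simp add: w_def self_adj_scaleR self_adj_adj_mult)
  have wJ: "w \<in> J" using J yJ unfolding w_def by (intro subalgD) (auto simp: star_closed_def)
  \<comment> \<open>The resolvent is formed with the help of 1, which J may lack; as an element of
    the idealizer it still multiplies J into J.\<close>
  have rI: "res w \<in> idealizer J" using res_mem_idealizer[OF w J(1,2)] wJ idealizer_props[OF J(2)] by blast
  have "w * res w \<in> J" using rI wJ by (auto simp: idealizer_def)
  hence rJ: "1 - res w \<in> J" using one_minus_res(1)[OF w] J by (auto intro: subalgD)
  have small: "norm (y * res w) < \<epsilon>"
  proof -
    have "adj (y * res w) * (y * res w) = (1/\<tau>) *\<^sub>R (adj (res w) * (w * res w))"
      using \<tau> by (simp add: adj_mult w_def mult.assoc)
    hence "(norm (y * res w))\<^sup>2 = (1/\<tau>) * norm (adj (res w) * (w * res w))"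
      using \<tau> by (metis norm_adj_mult norm_scaleR abs_of_pos zero_less_divide_1_iff)
    also have "\<dots> \<le> (1/\<tau>) * (norm (adj (res w)) * norm (w * res w))"
      using \<tau> by (intro mult_left_mono norm_mult_ineq) auto
    also have "\<dots> \<le> (1/\<tau>) * (1 * 2)"
      using \<tau> res(3)[OF w] norm_mult_res[OF w] by (intro mult_left_mono mult_mono) auto
    also have "\<dots> < \<epsilon>\<^sup>2" using e by (simp add: \<tau>_def)
    finally show ?thesis using e by (simp add: power2_less_imp_less)
  qed
  have "1 - u * res w = (1 - u) + (1 - res w) - (1 - u) * (1 - res w)" by (simp add: algebra_simps)
  moreover have "(1 - u) + (1 - res w) - (1 - u) * (1 - res w) \<in> J"
    by (intro subalgD(8)[OF J(2)] subalgD(2,3)[OF J(2)] u(2) rJ)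
  ultimately have "1 - u * res w \<in> J" by (simp only:)
  moreover have "norm (u * res w) \<le> 1"
    using norm_mult_ineq[of u "res w"] u res(3)[OF w] by (meson mult_le_one norm_ge_zero order_trans)
  moreover have "norm (x * (u * res w)) < \<epsilon>" if "x \<in> F" for x
    using norm_mult_ineq[of "x * u" "res w"] u that res(3)[OF w]
      mult_left_mono[OF res(3)[OF w], of "norm (x * u)"] by (fastforce simp: mult.assoc)
  ultimately show ?case using small by (intro exI[of _ "u * res w"]) (auto simp: y_def mult.assoc)
qed

text \<open>Apply the one-sided result to \<open>F\<close> together with its adjoints and take u =
  \<open>w * adj w\<close>. Then u is self-adjoint, and \<open>u * v\<close> has the norm of
  \<open>adj v * u\<close>, which turns right smallness into left smallness.\<close>

lemma two_sided_annihilator: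
  fixes J :: "'a::unital_cstar set"
  assumes J: "closed J" "subalg J" "star_closed J" and F: "finite F" "F \<subseteq> J" and e: "\<epsilon> > 0"
  shows "\<exists>u. self_adj u \<and> norm u \<le> 1 \<and> 1 - u \<in> J \<and> (\<forall>v\<in>F. norm (v * u) < \<epsilon> \<and> norm (u * v) < \<epsilon>)"
proof -
  have "finite (F \<union> adj ` F)" "F \<union> adj ` F \<subseteq> J" using F J by (auto simp: star_closed_def)
  from right_annihilator[OF J this e]
  obtain w where w: "norm w \<le> 1" "1 - w \<in> J" "\<forall>v\<in>F \<union> adj ` F. norm (v * w) < \<epsilon>"
    by (elim exE conjE)
  define u where "u = w * adj w"
  have "adj (1 - w) \<in> J" using w(2) J(3) unfolding star_closed_def by (rule bspec[rotated])
  hence aw: "1 - adj w \<in> J" by (simp add: adj_diff)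
  have "1 - u = (1 - w) + (1 - adj w) - (1 - w) * (1 - adj w)" by (simp add: u_def algebra_simps)
  moreover have "(1 - w) + (1 - adj w) - (1 - w) * (1 - adj w) \<in> J"
    by (intro subalgD(8)[OF J(2)] subalgD(2,3)[OF J(2)] w(2) aw)
  ultimately have 1: "1 - u \<in> J" by (simp only:)
  have 2: "self_adj u" by (simp add: u_def self_adj_mult_adj)
  have "norm u \<le> norm w * norm (adj w)" unfolding u_def by (rule norm_mult_ineq)
  hence 3: "norm u \<le> 1" using w(1) mult_mono[OF w(1) w(1)] by simp
  have 4: "norm (v * u) < \<epsilon>" if v: "norm (v * w) < \<epsilon>" for v
  proof -
    have "norm (v * u) \<le> norm (v * w) * norm (adj w)" unfolding u_def by (metis mult.assoc norm_mult_ineq)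
    also have "\<dots> \<le> norm (v * w)" using w(1) mult_left_mono[OF w(1), of "norm (v * w)"] by simp
    finally show ?thesis using v by simp
  qed
  have 5: "norm (u * v) = norm (adj v * u)" for v
    by (metis 2 adj_mult self_adjD norm_adj adj_adj)
  show ?thesis using 1 2 3 4 5 w by (intro exI[of _ u]) auto
qed

text \<open>A filter rather than a net, so that finitely many smallness requirements on u, arising
  from different limits, are combined as a conjunction of eventual properties.\<close>

definition approx_units :: "'a::unital_cstar set \<Rightarrow> 'a filter" where
  "approx_units J = (INF (F, \<epsilon>) \<in> {F. finite F \<and> F \<subseteq> J} \<times> {0<..}.
     principal {u. self_adj u \<and> norm u \<le> 1 \<and> 1 - u \<in> J \<and> (\<forall>v\<in>F. norm (v * u) < \<epsilon> \<and> norm (u * v) < \<epsilon>)})"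

lemma approx_units_nontrivial:
  fixes J :: "'a::unital_cstar set"
  assumes J: "closed J" "subalg J" "star_closed J"
  shows "approx_units J \<noteq> bot"
proof -
  let ?P = "\<lambda>F \<epsilon>. {u. self_adj u \<and> norm u \<le> 1 \<and> 1 - u \<in> J \<and> (\<forall>v\<in>F. norm (v * u) < \<epsilon> \<and> norm (u * v) < \<epsilon>)}"
  have base: "approx_units J = bot \<longleftrightarrow> (\<exists>i\<in>{F. finite F \<and> F \<subseteq> J} \<times> {0<..}. (case i of (F, \<epsilon>) \<Rightarrow> principal (?P F \<epsilon>)) = bot)"
    unfolding approx_units_def
  proof (rule INF_filter_bot_base)
    fix i j :: "'a set \<times> real"
    assume i: "i \<in> {F. finite F \<and> F \<subseteq> J} \<times> {0<..}" and j: "j \<in> {F. finite F \<and> F \<subseteq> J} \<times> {0<..}"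
    obtain F a G b where [simp]: "i = (F, a)" "j = (G, b)" by (cases i, cases j) auto
    show "\<exists>k\<in>{F. finite F \<and> F \<subseteq> J} \<times> {0<..}. (case k of (F, \<epsilon>) \<Rightarrow> principal (?P F \<epsilon>))
        \<le> inf (case i of (F, \<epsilon>) \<Rightarrow> principal (?P F \<epsilon>)) (case j of (F, \<epsilon>) \<Rightarrow> principal (?P F \<epsilon>))"
      using i j by (intro bexI[of _ "(F \<union> G, min a b)"]) auto
  qed
  have ne: "principal (?P F \<epsilon>) \<noteq> bot" if "finite F" "F \<subseteq> J" "\<epsilon> > 0" for F \<epsilon>
    using two_sided_annihilator[OF J that] unfolding principal_eq_bot_iff by blast
  show ?thesis
  proof
    assume "approx_units J = bot"
    then obtain i where i: "i \<in> {F. finite F \<and> F \<subseteq> J} \<times> {0<..}"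
      "(case i of (F, \<epsilon>) \<Rightarrow> principal (?P F \<epsilon>)) = bot"
      unfolding base by (rule bexE)
    obtain F \<epsilon> where "i = (F, \<epsilon>)" by (cases i)
    with i ne[of F \<epsilon>] show False by simp
  qed
qed

lemma eventually_approx_units:
  "\<forall>\<^sub>F u in approx_units J. self_adj u \<and> norm u \<le> 1 \<and> 1 - u \<in> J"
  unfolding approx_units_def
  by (rule eventually_INF1[of "({}, 1)"]) (auto simp: eventually_principal)

lemma approx_units_tendsto:
  assumes "v \<in> J"
  shows "((\<lambda>u. v * u) \<longlongrightarrow> 0) (approx_units J)" "((\<lambda>u. u * v) \<longlongrightarrow> 0) (approx_units J)"
proof -
  have "\<forall>\<^sub>F u in approx_units J. norm (v * u) < \<epsilon> \<and> norm (u * v) < \<epsilon>" if "\<epsilon> > 0" for \<epsilon>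
    unfolding approx_units_def
    by (rule eventually_INF1[of "({v}, \<epsilon>)"]) (use that assms in \<open>auto simp: eventually_principal\<close>)
  thus "((\<lambda>u. v * u) \<longlongrightarrow> 0) (approx_units J)" "((\<lambda>u. u * v) \<longlongrightarrow> 0) (approx_units J)"
    by (simp_all add: tendsto_iff eventually_conj_iff)
qed

section \<open>Passing to ideals\<close>

text \<open>For a product p q, the difference v p(b') - v p(b) tends to 0 and q(b') is bounded,
  while v p(b) is again an element of \<open>J\<close>, to which the induction hypothesis for q
  applies. Hence v has to vary in the induction.\<close>

lemma tendsto_left_mult_eval:
  fixes b :: "nat \<Rightarrow> 'a::unital_cstar" and b' :: "'x \<Rightarrow> nat \<Rightarrow> 'a"
  assumes J: "\<And>v j. v \<in> J \<Longrightarrow> j \<le> n \<Longrightarrow> v * b j \<in> J" "subalg J"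
    and lim: "\<And>v j. v \<in> J \<Longrightarrow> j \<le> n \<Longrightarrow> ((\<lambda>x. v * b' x j) \<longlongrightarrow> v * b j) F"
    and bd: "\<forall>\<^sub>F x in F. \<forall>j\<le>n. norm (b' x j) \<le> M"
    and v: "v \<in> J"
  shows "((\<lambda>x. v * eval n (b' x) p) \<longlongrightarrow> v * eval n b p) F"
  using v
proof (induction p arbitrary: v)
  case (Var j)
  thus ?case using lim by (auto simp: tendsto_const)
next
  case (Add p q)
  thus ?case by (auto simp: distrib_left intro: tendsto_add)
next
  case (Scale z p)
  thus ?case by (auto simp: scaleC_mult_right intro: tendsto_scaleC)
next
  case (Mul p q)
  have mem: "v * eval n b r \<in> J" if "v \<in> J" for v r
    using that
  proof (induction r arbitrary: v)
    case (Mul r s) thus ?case by (metis eval.simps(3) mult.assoc)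
  qed (use J in \<open>auto simp: distrib_left scaleC_mult_right intro: subalgD\<close>)
  obtain K where K: "\<forall>b :: nat \<Rightarrow> 'a. (\<forall>j\<le>n. norm (b j) \<le> M) \<longrightarrow> norm (eval n b q) \<le> K"
    using eval_bounded by blast
  have 1: "((\<lambda>x. v * eval n (b' x) p - v * eval n b p) \<longlongrightarrow> 0) F"
    using Mul.IH(1)[OF Mul.prems] by (simp add: LIM_zero)
  have "Zfun (\<lambda>x. v * eval n (b' x) p - v * eval n b p) F"
    using 1 by (simp add: tendsto_Zfun_iff)
  moreover have "Bfun (\<lambda>x. eval n (b' x) q) F"
    by (rule BfunI[of _ K]) (use bd K in \<open>auto elim: eventually_mono\<close>)
  ultimately have "Zfun (\<lambda>x. (v * eval n (b' x) p - v * eval n b p) * eval n (b' x) q) F"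
    by (rule bounded_bilinear.Zfun_prod_Bfun[OF bounded_bilinear_mult])
  hence "((\<lambda>x. (v * eval n (b' x) p - v * eval n b p) * eval n (b' x) q) \<longlongrightarrow> 0) F"
    by (simp add: tendsto_Zfun_iff)
  from tendsto_add[OF this Mul.IH(2)[OF mem[OF Mul.prems, of p]]]
  show ?case by (simp add: algebra_simps)
qed

definition compress :: "'a::unital_cstar \<Rightarrow> 'a \<Rightarrow> 'a" where
  "compress u x = (1 - u) * x * (1 - u)"

text \<open>Expand v (1 - u) x (1 - u) = v x - v x u - v u x (1 - u). Both v and v x lie in J, so v
  u and v x u tend to 0, and the remaining factor x (1 - u) is bounded.\<close>

lemma tendsto_compress:
  assumes J: "subalg J" and v: "v \<in> J" "v * x \<in> J"
  shows "((\<lambda>u. v * compress u x) \<longlongrightarrow> v * x) (approx_units J)"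
proof -
  have B: "Bfun (\<lambda>u. x * (1 - u)) (approx_units J)"
  proof (rule BfunI[of _ "norm x * 2"])
    show "\<forall>\<^sub>F u in approx_units J. norm (x * (1 - u)) \<le> norm x * 2"
      using eventually_approx_units[of J]
    proof (eventually_elim)
      case (elim u)
      have "norm (1 - u) \<le> 2" using norm_triangle_ineq4[of 1 u] elim by simp
      thus ?case using norm_mult_ineq[of x "1 - u"] mult_left_mono[of "norm (1 - u)" 2 "norm x"] by simp
    qed
  qed
  have Z: "Zfun (\<lambda>u. v * u) (approx_units J)"
    using approx_units_tendsto(1)[OF v(1)] by (simp add: tendsto_Zfun_iff)
  have "Zfun (\<lambda>u. v * u * (x * (1 - u))) (approx_units J)"
    by (rule bounded_bilinear.Zfun_prod_Bfun[OF bounded_bilinear_mult Z B])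
  hence "((\<lambda>u. v * u * (x * (1 - u))) \<longlongrightarrow> 0) (approx_units J)" by (simp add: tendsto_Zfun_iff)
  from tendsto_diff[OF tendsto_diff[OF tendsto_const[of "v * x"] approx_units_tendsto(1)[OF v(2)]] this]
  show ?thesis by (simp add: compress_def algebra_simps)
qed

lemma norm_compress_le:
  assumes "norm u \<le> 1"
  shows "norm (compress u x) \<le> 4 * norm x"
proof -
  have "norm (1 - u) \<le> 2" using norm_triangle_ineq4[of 1 u] assms by simp
  hence "norm ((1 - u) * x * (1 - u)) \<le> 2 * norm x * 2"
    by (intro order_trans[OF norm_mult_ineq] mult_mono) auto
  thus ?thesis by (simp add: compress_def)
qed

text \<open>The factor 5 consists of 4 for compressing x - a, by \<open>norm_compress_le\<close>,
  and of three terms u a, a u and u a u, each below \<eta>/3 for late u.\<close>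

lemma compress_near:
  assumes a: "a \<in> J" and x: "norm (x - a) < \<eta>"
  shows "\<forall>\<^sub>F u in approx_units J. norm (compress u x - a) < 5 * \<eta>"
proof -
  have \<eta>: "\<eta> > 0" using x norm_ge_zero le_less_trans by blast
  have 1: "\<forall>\<^sub>F u in approx_units J. norm (a * u) < \<eta> / 3" "\<forall>\<^sub>F u in approx_units J. norm (u * a) < \<eta> / 3"
    using tendstoD[OF approx_units_tendsto(1)[OF a], of "\<eta> / 3"]
      tendstoD[OF approx_units_tendsto(2)[OF a], of "\<eta> / 3"] \<eta> by simp_all
  show ?thesis using 1 eventually_approx_units
  proof eventually_elim
    case (elim u)
    have "norm (u * a * u) \<le> norm (u * a) * norm u" by (rule norm_mult_ineq)
    also have "\<dots> \<le> norm (u * a) * 1" using elim by (intro mult_left_mono) auto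
    finally have 2: "norm (u * a * u) < \<eta> / 3" using elim by simp
    have 3: "norm (compress u (x - a)) < 4 * \<eta>" using norm_compress_le[of u "x - a"] elim x by simp
    have "compress u x - a = compress u (x - a) - u * a - a * u + u * a * u"
      by (simp add: compress_def algebra_simps)
    hence "norm (compress u x - a) \<le> norm (compress u (x - a)) + norm (u * a) + norm (a * u) + norm (u * a * u)"
      by (smt (verit) norm_triangle_ineq norm_triangle_ineq4)
    thus ?case using 2 3 elim by simp
  qed
qed

text \<open>The elements 1 - (1 - g)^k are polynomials in g without constant term, hence in
  \<open>S\<close>, and they converge to 1.\<close>

lemma one_in_closed_subalg:
  fixes g :: "'a::unital_cstar"
  assumes S: "closed S" "subalg S" and g: "g \<in> S" "norm (1 - g) < 1"
  shows "1 \<in> S"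
proof -
  have m: "1 - (1 - g) ^ k \<in> S" for k
  proof (induction k)
    case 0 show ?case using S by (simp add: subalgD)
  next
    case (Suc k)
    have "1 - (1 - g) ^ Suc k = g + (1 - (1 - g) ^ k) - g * (1 - (1 - g) ^ k)" by (simp add: algebra_simps)
    moreover have "g + (1 - (1 - g) ^ k) - g * (1 - (1 - g) ^ k) \<in> S"
      by (intro subalgD(8)[OF S(2)] subalgD(2,3)[OF S(2)] g(1) Suc)
    ultimately show ?case by (simp only:)
  qed
  have "(\<lambda>k. (1 - g) ^ k) \<longlonglongrightarrow> 0" using g(2) by (rule LIMSEQ_power_zero)
  from tendsto_diff[OF tendsto_const[of 1] this] have "(\<lambda>k. 1 - (1 - g) ^ k) \<longlonglongrightarrow> 1" by simp
  thus ?thesis using closed_sequentially[OF S(1), of "\<lambda>k. 1 - (1 - g) ^ k" 1] m by simp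
qed

lemma mult_divide_mult_self: "x \<noteq> 0 \<Longrightarrow> x * (y / (z * x)) = y / (z::real)"
  by simp

section \<open>Adjoining 1 to a subalgebra that does not contain it\<close>

definition adjoin_one :: "'a::unital_cstar set \<Rightarrow> 'a set" where
  "adjoin_one J = {v + scaleC z 1 |v z. v \<in> J}"

locale nonunital_subalgebra =
  fixes J :: "'a::unital_cstar set"
  assumes J0: "closed J" "subalg J" "star_closed J" "1 \<notin> J"
begin

lemma adjoin_oneI: "v \<in> J \<Longrightarrow> v + scaleC z 1 \<in> adjoin_one J"
  by (auto simp: adjoin_one_def)

lemma adjoin_oneI_real: "v \<in> J \<Longrightarrow> v + r *\<^sub>R 1 \<in> adjoin_one J"
  using adjoin_oneI[of v "of_real r"] by (simp add: scaleC_of_real)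

lemma subalg_adjoin_one: "subalg (adjoin_one J)"
  unfolding subalg_def
proof (intro conjI ballI allI)
  show "0 \<in> adjoin_one J" using adjoin_oneI[of 0 0] J0 by (simp add: subalgD)
  fix x y assume "x \<in> adjoin_one J" "y \<in> adjoin_one J"
  then obtain v w z z' where v: "v \<in> J" "w \<in> J" and xy: "x = v + scaleC z 1" "y = w + scaleC z' 1"
    by (auto simp: adjoin_one_def)
  show "x + y \<in> adjoin_one J" using adjoin_oneI[of "v + w" "z + z'"] J0 v
    by (simp add: xy scaleC_add_left subalgD algebra_simps)
  have "x * y = (v * w + scaleC z w + scaleC z' v) + scaleC (z * z') 1"
    by (simp add: xy algebra_simps scaleC_mult_left scaleC_mult_right scaleC_scaleC scaleC_add_right)
  moreover have "v * w + scaleC z w + scaleC z' v \<in> J"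
    using v by (intro subalgD(2)[OF J0(2)] subalgD(3,4)[OF J0(2)])
  ultimately show "x * y \<in> adjoin_one J" using adjoin_oneI by simp
next
  fix x c assume "x \<in> adjoin_one J"
  then obtain v z where v: "v \<in> J" "x = v + scaleC z 1" by (auto simp: adjoin_one_def)
  have "scaleC c x = scaleC c v + scaleC (c * z) 1" by (simp add: v(2) scaleC_add_right scaleC_scaleC)
  moreover have "scaleC c v \<in> J" using v(1) by (rule subalgD(4)[OF J0(2)])
  ultimately show "scaleC c x \<in> adjoin_one J" using adjoin_oneI by simp
qed

lemma star_closed_adjoin_one: "star_closed (adjoin_one J)"
  unfolding star_closed_def
proof
  fix x assume "x \<in> adjoin_one J"
  then obtain v z where v: "v \<in> J" "x = v + scaleC z 1" by (auto simp: adjoin_one_def)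
  thus "adj x \<in> adjoin_one J" using adjoin_oneI[of "adj v" "cnj z"] J0
    by (simp add: adj_add adj_scaleC star_closed_def)
qed

text \<open>If the scalar part z were not real, v - \<open>adj v\<close> would be a nonzero multiple
  of 1 inside J.\<close>

lemma self_adj_adjoin_oneE:
  assumes "x \<in> adjoin_one J" "self_adj x"
  obtains v r where "v \<in> J" "self_adj v" "x = v + r *\<^sub>R 1"
proof -
  obtain v z where v: "v \<in> J" "x = v + scaleC z 1" using assms by (auto simp: adjoin_one_def)
  have "adj x = x" using assms by (simp add: self_adjD)
  hence eq: "adj v + scaleC (cnj z) 1 = v + scaleC z 1" by (simp add: v adj_add adj_scaleC)
  hence eq': "v - adj v = scaleC (cnj z - z) 1"
  proof -
    have "scaleC (cnj z - z) 1 = scaleC (cnj z) 1 - scaleC z (1::'a)"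
      using scaleC_add_left[of "cnj z" "- z" "1::'a"] by (simp add: scaleC_minus_left)
    moreover have "v - adj v = (v + scaleC z 1) - adj v - scaleC z 1" by simp
    ultimately show ?thesis by (simp flip: eq)
  qed
  have "cnj z = z"
  proof (rule ccontr)
    assume ne: "cnj z \<noteq> z"
    have "v - adj v \<in> J" using v J0 by (auto intro: subalgD simp: star_closed_def)
    hence "scaleC (inverse (cnj z - z)) (v - adj v) \<in> J" using J0 by (simp add: subalgD)
    also have "scaleC (inverse (cnj z - z)) (v - adj v) = 1" using ne by (simp add: eq' scaleC_scaleC)
    finally show False using J0 by simp
  qed
  hence z: "z = of_real (Re z)" by (metis Reals_cnj_iff complex_is_Real_iff of_real_Re)
  have "x = v + Re z *\<^sub>R 1" using v(2) z scaleC_of_real[of "Re z" "1::'a"] by simp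
  moreover have "self_adj v" using eq \<open>cnj z = z\<close> by (simp add: self_adj_def)
  ultimately show ?thesis using that v(1) by blast
qed

end

section \<open>Dense generation passes to a closed ideal with 1 adjoined\<close>

locale closed_ideal_in = nonunital_subalgebra J for J :: "'a::unital_cstar set" +
  fixes X :: "'a set"
  assumes X: "closed X" "subalg X" "star_closed X" "1 \<in> X"
    and JX: "J \<subseteq> X"
    and ideal: "\<And>x v. x \<in> X \<Longrightarrow> v \<in> J \<Longrightarrow> x * v \<in> J" "\<And>x v. x \<in> X \<Longrightarrow> v \<in> J \<Longrightarrow> v * x \<in> J"
begin

lemmas J = J0(1-3) JX J0(4)

lemma translate_mem:
  assumes "x \<in> X"
  shows "x + r *\<^sub>R 1 \<in> X" "x - r *\<^sub>R 1 \<in> X"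
  using X assms by (auto intro!: subalgD)

lemma compress_mem: "1 - u \<in> J \<Longrightarrow> x \<in> X \<Longrightarrow> compress u x \<in> J"
  unfolding compress_def using ideal J by (meson subsetD)

lemma self_adj_compress: "self_adj u \<Longrightarrow> self_adj x \<Longrightarrow> self_adj (compress u x)"
  unfolding compress_def by (intro self_adj_conj self_adj_diff self_adj_one)

text \<open>Compressing by \<open>1 - u\<close>, where \<open>u\<close> nearly annihilates the given elements of the ideal, moves a
  tuple close to \<open>a + s\<close> into a translate of the ideal.\<close>

lemma compressed_tuple:
  assumes a: "self_adj_tuple J n a" and b: "self_adj_tuple X n b"
    and near: "\<forall>j\<le>n. norm (b j - (a j + s j *\<^sub>R 1)) < \<eta>"
  defines "x \<equiv> \<lambda>u j. compress u (b j - s j *\<^sub>R 1)"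
  shows "\<forall>\<^sub>F u in approx_units J. self_adj_tuple J n (x u) \<and> (\<forall>j\<le>n. norm (x u j - a j) < 5 * \<eta>)"
    and "v \<in> J \<Longrightarrow> ((\<lambda>u. v * eval n (\<lambda>j. x u j + s j *\<^sub>R 1) p) \<longlongrightarrow> v * eval n b p) (approx_units J)"
proof -
  have mem: "b j - s j *\<^sub>R 1 \<in> X" "self_adj (b j - s j *\<^sub>R 1)" if "j \<le> n" for j
    using b that translate_mem by (auto simp: self_adj_tuple_def intro!: self_adj_diff self_adj_scaleR self_adj_one)
  have n: "\<forall>\<^sub>F u in approx_units J. \<forall>j\<in>{..n}. norm (x u j - a j) < 5 * \<eta>"
  proof (intro eventually_ball_finite ballI)
    fix j assume "j \<in> {..n}"
    thus "\<forall>\<^sub>F u in approx_units J. norm (x u j - a j) < 5 * \<eta>"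
      unfolding x_def using near a by (intro compress_near) (auto simp: self_adj_tuple_def algebra_simps)
  qed auto
  show first: "\<forall>\<^sub>F u in approx_units J. self_adj_tuple J n (x u) \<and> (\<forall>j\<le>n. norm (x u j - a j) < 5 * \<eta>)"
    using n eventually_approx_units[of J]
    by eventually_elim (use mem in \<open>auto simp: self_adj_tuple_def x_def intro!: compress_mem self_adj_compress\<close>)
  assume v: "v \<in> J"
  show "((\<lambda>u. v * eval n (\<lambda>j. x u j + s j *\<^sub>R 1) p) \<longlongrightarrow> v * eval n b p) (approx_units J)"
  proof (rule tendsto_left_mult_eval[where J = J and M = "\<Sum>j\<le>n. 4 * norm (b j - s j *\<^sub>R 1) + \<bar>s j\<bar>"])
    show "w * b j \<in> J" if "w \<in> J" "j \<le> n" for w j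
      using that b ideal by (auto simp: self_adj_tuple_def)
    show "((\<lambda>u. w * (x u j + s j *\<^sub>R 1)) \<longlongrightarrow> w * b j) (approx_units J)" if "w \<in> J" "j \<le> n" for w j
    proof -
      have "w * (b j - s j *\<^sub>R 1) \<in> J" using mem that ideal by blast
      from tendsto_add[OF tendsto_compress[OF J(2) that(1) this] tendsto_const[of "w * (s j *\<^sub>R 1)"]]
      show ?thesis by (simp add: x_def algebra_simps)
    qed
    show "\<forall>\<^sub>F u in approx_units J. \<forall>j\<le>n. norm (x u j + s j *\<^sub>R 1) \<le> (\<Sum>j\<le>n. 4 * norm (b j - s j *\<^sub>R 1) + \<bar>s j\<bar>)"
      using eventually_approx_units[of J]
    proof eventually_elim
      case (elim u)
      show ?case
      proof (intro allI impI)
        fix j assume j: "j \<le> n"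
        have "norm (x u j + s j *\<^sub>R 1) \<le> norm (x u j) + norm (s j *\<^sub>R (1::'a))" by (rule norm_triangle_ineq)
        also have "\<dots> \<le> 4 * norm (b j - s j *\<^sub>R 1) + \<bar>s j\<bar>"
          using norm_compress_le[of u "b j - s j *\<^sub>R 1"] elim by (simp add: x_def)
        also have "\<dots> \<le> (\<Sum>j\<le>n. 4 * norm (b j - s j *\<^sub>R 1) + \<bar>s j\<bar>)"
          using j by (intro member_le_sum) auto
        finally show "norm (x u j + s j *\<^sub>R 1) \<le> (\<Sum>j\<le>n. 4 * norm (b j - s j *\<^sub>R 1) + \<bar>s j\<bar>)" .
      qed
    qed
  qed (use J v in auto)
qed

lemma approx_unitsD:
  assumes "\<forall>\<^sub>F u in approx_units J. P u" shows "\<exists>u. P u"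
  using eventually_happens'[OF approx_units_nontrivial[OF J(1-3)] assms] .

lemma translated_tuple:
  assumes "self_adj_tuple J n x"
  shows "self_adj_tuple X n (\<lambda>j. x j + s j *\<^sub>R 1)"
  using assms J X translate_mem
  by (auto simp: self_adj_tuple_def intro!: self_adj_add self_adj_scaleR self_adj_one)

text \<open>Let b' = x + s and w = b' 0 / s 0, so that 1 - w = - x 0 / s 0. If f in the closed
  algebra generated by b' is nearly a right unit for a 0, and hence for x 0, then g = w + f - w f
  satisfies 1 - g = (1 - w)(1 - f), which is small. By \<open>one_in_closed_subalg\<close> that
  algebra then contains 1.\<close>

lemma unit_generating_perturbation:
  assumes X_gen: "dense_gen X n" and a: "self_adj_tuple J n a" and s: "s 0 \<noteq> 0" and e: "\<epsilon> > 0"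
  shows "\<exists>x p. self_adj_tuple J n x \<and> (\<forall>j\<le>n. norm (x j - a j) < \<epsilon>) \<and>
    norm (1 - eval n (\<lambda>j. x j + s j *\<^sub>R 1) p) < 1"
proof -
  \<comment> \<open>Budget for 1 - g in units of |s 0|: x 0 - a 0 costs 1/10 and is multiplied by a
    factor of norm at most 4, and a 0 (1 - f) costs 1/2, together 9/10. The bound 1/2 is twice 1/8 +
    1/8, the first from \<tau> and the second from the compression.\<close>
  define \<eta> where "\<eta> = min (\<epsilon> / 5) (\<bar>s 0\<bar> / 50)"
  define \<tau> where "\<tau> = \<bar>s 0\<bar> / (8 * (norm (a 0) + 1))"
  have pos: "\<eta> > 0" "\<tau> > 0" using e s by (auto simp: \<eta>_def \<tau>_def add_nonneg_pos)
  have \<eta>: "5 * \<eta> \<le> \<epsilon>" "5 * \<eta> \<le> \<bar>s 0\<bar> / 10" by (auto simp: \<eta>_def)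
  obtain b p where b: "self_adj_tuple X n b" "\<forall>j\<le>n. norm (b j - (a j + s j *\<^sub>R 1)) < \<eta>"
    "norm (1 - eval n b p) < \<tau>"
    using dense_genE2[OF X_gen translated_tuple[OF a] pos X(4)] by blast
  have bsa: "\<forall>j\<le>n. self_adj (b j)" using b by (auto simp: self_adj_tuple_def)
  define q where "q = re_expr p"
  have gq: "norm (1 - eval n b q) < \<tau>"
    using norm_diff_re[OF self_adj_one bsa, of p] b(3) by (simp add: q_def)
  have a0: "a 0 \<in> J" using a by (auto simp: self_adj_tuple_def)
  have a0q: "norm (a 0 * (1 - eval n b q)) \<le> \<bar>s 0\<bar> / 8"
  proof -
    have "norm (a 0 * (1 - eval n b q)) \<le> norm (a 0) * norm (1 - eval n b q)" by (rule norm_mult_ineq)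
    also have "\<dots> \<le> (norm (a 0) + 1) * \<tau>" using gq by (intro mult_mono) auto
    also have "\<dots> = \<bar>s 0\<bar> / 8"
      unfolding \<tau>_def by (rule mult_divide_mult_self) (simp add: add_nonneg_eq_0_iff)
    finally show ?thesis .
  qed
  define x where "x = (\<lambda>u j. compress u (b j - s j *\<^sub>R 1))"
  define b' where "b' = (\<lambda>u j. x u j + s j *\<^sub>R 1)"
  have ct: "\<forall>\<^sub>F u in approx_units J. self_adj_tuple J n (x u) \<and> (\<forall>j\<le>n. norm (x u j - a j) < 5 * \<eta>)"
    "\<And>v p. v \<in> J \<Longrightarrow> ((\<lambda>u. v * eval n (b' u) p) \<longlongrightarrow> v * eval n b p) (approx_units J)"
    using compressed_tuple[OF a b(1,2)] unfolding x_def b'_def by blast+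
  have "\<forall>\<^sub>F u in approx_units J. norm (a 0 * eval n (b' u) q - a 0 * eval n b q) < \<bar>s 0\<bar> / 8"
    using tendstoD[OF ct(2)[OF a0, of q], of "\<bar>s 0\<bar> / 8"] s by (simp add: dist_norm)
  from approx_unitsD[OF eventually_conj[OF ct(1) this]] obtain u where
    u: "self_adj_tuple J n (x u)" "\<forall>j\<le>n. norm (x u j - a j) < 5 * \<eta>"
      "norm (a 0 * eval n (b' u) q - a 0 * eval n b q) < \<bar>s 0\<bar> / 8" by blast
  have b'sa: "\<forall>j\<le>n. self_adj (b' u j)"
    using translated_tuple[OF u(1)] by (auto simp: self_adj_tuple_def b'_def)
  define r where "r = eval n (b' u) q"
  have rsa: "self_adj r" unfolding r_def q_def by (rule self_adj_eval_re[OF b'sa])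
  have a0r: "norm (a 0 * (1 - r)) < \<bar>s 0\<bar> / 4"
  proof -
    have "a 0 * (1 - r) = a 0 * (1 - eval n b q) - (a 0 * r - a 0 * eval n b q)" by (simp add: algebra_simps)
    thus ?thesis using a0q u(3) norm_triangle_ineq4[of "a 0 * (1 - eval n b q)" "a 0 * r - a 0 * eval n b q"]
      by (simp add: r_def)
  qed
  define C where "C = closure (gen n (b' u))"
  have C: "closed C" "subalg C" by (auto simp: C_def subalg_closure subalg_gen)
  have sub: "gen n (b' u) \<subseteq> C" by (simp add: C_def closure_subset)
  have rC: "r \<in> C" using eval_in_gen sub by (auto simp: r_def)
  define z where "z = 1 - r"
  have z: "self_adj z" unfolding z_def by (intro self_adj_diff self_adj_one rsa)
  define R where "R = res z"
  have RI: "R \<in> idealizer C"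
    unfolding R_def using C rC idealizer_props[OF C(2)]
    by (intro res_mem_idealizer[OF z C]) (auto simp: z_def intro: subalgD)
  text \<open>Multiplying \<open>r\<close> by the resolvent keeps it close to a unit on \<open>a 0\<close>, with a norm bound
    that does not depend on the polynomial \<open>q\<close>.\<close>
  define f where "f = r * R"
  have fC: "f \<in> C" unfolding f_def using RI rC by (auto simp: idealizer_def)
  have R1: "1 - R = imag * (z * R)" unfolding R_def by (rule one_minus_res(1)[OF z])
  have zR: "z * R = - (imag * (1 - R))" by (simp add: R1 imag_imag_mult)
  have f1: "1 - f = scaleC (1 - \<i>) (1 - R)"
  proof -
    have "1 - f = 1 - R + z * R" by (simp add: f_def z_def algebra_simps)
    also have "\<dots> = scaleC (1 - \<i>) (1 - R)" unfolding zR by (simp add: scaleC_def)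
    finally show ?thesis .
  qed
  have i2: "cmod (1 - \<i>) \<le> 2" using norm_triangle_ineq4[of 1 \<i>] by simp
  have nf: "norm (1 - f) \<le> 4"
    using mult_mono[OF i2 norm_one_minus_res[OF z]] by (simp add: f1 norm_scaleC R_def)
  have a0f: "norm (a 0 * (1 - f)) \<le> \<bar>s 0\<bar> / 2"
  proof -
    \<comment> \<open>Since 1 - R = i z R with z = 1 - r, the small element a 0 (1 - r) is only
      multiplied by the contraction \<open>R\<close> and by scalars.\<close>
    have "a 0 * (1 - f) = scaleC (1 - \<i>) (imag * ((a 0 * (1 - r)) * R))"
      unfolding f1 by (simp add: R1 z_def scaleC_mult_right mult.assoc imag_simps)
    hence "norm (a 0 * (1 - f)) = cmod (1 - \<i>) * norm ((a 0 * (1 - r)) * R)"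
      by (simp add: norm_scaleC)
    also have "norm ((a 0 * (1 - r)) * R) \<le> norm (a 0 * (1 - r)) * norm R" by (rule norm_mult_ineq)
    also have "\<dots> \<le> norm (a 0 * (1 - r)) * 1"
      using res(3)[OF z] unfolding R_def by (intro mult_left_mono) auto
    also have "cmod (1 - \<i>) * (norm (a 0 * (1 - r)) * 1) \<le> 2 * (norm (a 0 * (1 - r)) * 1)"
      using i2 by (rule mult_right_mono) simp
    finally show ?thesis using a0r by simp
  qed
  define w where "w = (1 / s 0) *\<^sub>R b' u 0"
  have wC: "w \<in> C" unfolding w_def using C sub gen_mem[of 0 n "b' u"] by (auto intro!: subalgD)
  define g where "g = w + f - w * f"
  have gC: "g \<in> C" unfolding g_def using C wC fC by (intro subalgD(8)[OF C(2)] subalgD(2,3)[OF C(2)])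
  have "norm (1 - g) < 1"
  proof -
    have "1 - w = - ((1 / s 0) *\<^sub>R x u 0)" using s by (simp add: w_def b'_def scaleR_add_right)
    moreover have "1 - g = (1 - w) * (1 - f)" by (simp add: g_def algebra_simps)
    ultimately have "1 - g = - ((1 / s 0) *\<^sub>R (x u 0 * (1 - f)))" by simp
    also have "x u 0 * (1 - f) = (x u 0 - a 0) * (1 - f) + a 0 * (1 - f)"
      by (simp add: algebra_simps)
    finally have "1 - g = - ((1 / s 0) *\<^sub>R ((x u 0 - a 0) * (1 - f) + a 0 * (1 - f)))" .
    hence "norm (1 - g) = (1 / \<bar>s 0\<bar>) * norm ((x u 0 - a 0) * (1 - f) + a 0 * (1 - f))"
      by simp
    also have "\<dots> \<le> (1 / \<bar>s 0\<bar>) * ((\<bar>s 0\<bar> / 10) * 4 + \<bar>s 0\<bar> / 2)"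
    proof (intro mult_left_mono order_trans[OF norm_triangle_ineq] add_mono a0f)
      have "norm ((x u 0 - a 0) * (1 - f)) \<le> norm (x u 0 - a 0) * norm (1 - f)" by (rule norm_mult_ineq)
      also have "\<dots> \<le> (\<bar>s 0\<bar> / 10) * 4" using nf u(2) \<eta>(2) by (intro mult_mono) (auto intro: less_imp_le less_le_trans)
      finally show "norm ((x u 0 - a 0) * (1 - f)) \<le> (\<bar>s 0\<bar> / 10) * 4" .
    qed auto
    also have "\<dots> < 1" using s by (simp add: field_simps)
    finally show ?thesis .
  qed
  moreover obtain p' where "norm (g - eval n (b' u) p') < 1 - norm (1 - g)"
    using closure_gen_approx[of g n "b' u" "1 - norm (1 - g)"] gC calculation by (auto simp: C_def)
  ultimately have "norm (1 - eval n (b' u) p') < 1"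
    using norm_triangle_ineq[of "1 - g" "g - eval n (b' u) p'"] by simp
  thus ?thesis using u \<eta>(1) unfolding b'_def by (intro exI[of _ "x u"] exI[of _ p']) (auto intro: less_le_trans)
qed

text \<open>A perturbed tuple of X approximates 1 by p(b); its compression, now without translation,
  lies in J and keeps c p(b) close to c. This supplies a polynomial in a tuple of J that acts as a
  right unit on c.\<close>

lemma right_unit_generating_perturbation:
  assumes X_gen: "dense_gen X n" and a: "self_adj_tuple J n a" and c: "c \<in> J" and e: "\<epsilon> > 0" "\<delta> > 0"
  shows "\<exists>x p. self_adj_tuple J n x \<and> (\<forall>j\<le>n. norm (x j - a j) < \<epsilon>) \<and> norm (c * eval n x p - c) < \<delta>"
proof -
  define \<tau> where "\<tau> = \<delta> / (2 * (norm c + 1))"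
  have pos: "\<epsilon> / 5 > 0" "\<tau> > 0" using e by (auto simp: \<tau>_def add_nonneg_pos)
  have aX: "self_adj_tuple X n a" using a J by (auto simp: self_adj_tuple_def)
  obtain b p where b: "self_adj_tuple X n b" "\<forall>j\<le>n. norm (b j - a j) < \<epsilon> / 5"
    "norm (1 - eval n b p) < \<tau>"
    using dense_genE2[OF X_gen aX pos X(4)] by blast
  have cp: "norm (c * (1 - eval n b p)) \<le> \<delta> / 2"
  proof -
    have "norm (c * (1 - eval n b p)) \<le> norm c * norm (1 - eval n b p)" by (rule norm_mult_ineq)
    also have "\<dots> \<le> (norm c + 1) * \<tau>" using b(3) by (intro mult_mono) auto
    also have "\<dots> = \<delta> / 2"
      unfolding \<tau>_def by (rule mult_divide_mult_self) (simp add: add_nonneg_eq_0_iff)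
    finally show ?thesis .
  qed
  define x where "x = (\<lambda>u j. compress u (b j))"
  have ct: "\<forall>\<^sub>F u in approx_units J. self_adj_tuple J n (x u) \<and> (\<forall>j\<le>n. norm (x u j - a j) < 5 * (\<epsilon> / 5))"
    "((\<lambda>u. c * eval n (x u) p) \<longlongrightarrow> c * eval n b p) (approx_units J)"
    using compressed_tuple[OF a b(1), of "\<lambda>_. 0" "\<epsilon> / 5"] b(2) c by (auto simp: x_def)
  have "\<forall>\<^sub>F u in approx_units J. norm (c * eval n (x u) p - c * eval n b p) < \<delta> / 2"
    using tendstoD[OF ct(2), of "\<delta> / 2"] e by (simp add: dist_norm)
  from approx_unitsD[OF eventually_conj[OF ct(1) this]] obtain u where
    u: "self_adj_tuple J n (x u)" "\<forall>j\<le>n. norm (x u j - a j) < \<epsilon>"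
      "norm (c * eval n (x u) p - c * eval n b p) < \<delta> / 2" by auto
  have "c * eval n (x u) p - c = (c * eval n (x u) p - c * eval n b p) - c * (1 - eval n b p)"
    by (simp add: algebra_simps)
  hence "norm (c * eval n (x u) p - c)
      \<le> norm (c * eval n (x u) p - c * eval n b p) + norm (c * (1 - eval n b p))"
    by (metis norm_triangle_ineq4)
  hence "norm (c * eval n (x u) p - c) < \<delta>" using u(3) cp by linarith
  thus ?thesis using u by blast
qed


text \<open>The tuple is moved three times: to make 1 available in the generated algebra, to obtain
  in J an approximate unit y for the target, and to approximate the target itself. The first two
  achievements are open conditions and survive the later moves; the third is carried over to the
  compressed tuple by the truncation t T(t), with y in front.\<close>

theorem dense_gen_adjoin_one:
  assumes X_gen: "dense_gen X n"
  shows "dense_gen (adjoin_one J) n"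
proof (rule dense_gen_self_adj_targets[OF subalg_adjoin_one star_closed_adjoin_one])
  fix A c' and \<epsilon> :: real
  assume c': "c' \<in> adjoin_one J" "self_adj c'" and A: "self_adj_tuple (adjoin_one J) n A" and e: "\<epsilon> > 0"
  obtain c r where c: "c \<in> J" "self_adj c" "c' = c + r *\<^sub>R 1" using self_adj_adjoin_oneE[OF c'] .
  have "\<forall>j. \<exists>v r. j \<le> n \<longrightarrow> v \<in> J \<and> self_adj v \<and> A j = v + r *\<^sub>R 1"
    using A self_adj_adjoin_oneE unfolding self_adj_tuple_def by metis
  then obtain a s' where as: "\<And>j. j \<le> n \<Longrightarrow> a j \<in> J \<and> self_adj (a j) \<and> A j = a j + s' j *\<^sub>R 1"
    by metis
  have a: "self_adj_tuple J n a" using as by (auto simp: self_adj_tuple_def)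
  \<comment> \<open>\<open>unit_generating_perturbation\<close> requires a nonzero scalar part in
    entry 0; if it vanishes it is replaced by \<epsilon>/3.\<close>
  define s where "s = (\<lambda>j. if j = 0 \<and> s' 0 = 0 then \<epsilon> / 3 else s' j)"
  have s0: "s 0 \<noteq> 0" using e by (simp add: s_def)
  have ss: "\<bar>s j - s' j\<bar> \<le> \<epsilon> / 3" for j using e by (simp add: s_def)
  obtain x1 p1 where x1: "self_adj_tuple J n x1" "\<forall>j\<le>n. norm (x1 j - a j) < \<epsilon> / 9"
    and p1: "norm (1 - eval n (\<lambda>j. x1 j + s j *\<^sub>R 1) p1) < 1"
    using unit_generating_perturbation[where s = s, OF X_gen a s0, of "\<epsilon> / 9"] e by auto
  \<comment> \<open>Distance less than 1 is an open condition, so it survives the two later moves,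
    each kept within \<delta>1/2.\<close>
  obtain \<delta>1 where d1: "\<delta>1 > 0"
    "\<And>b'. \<forall>j\<le>n. norm (b' j - (x1 j + s j *\<^sub>R 1)) < \<delta>1 \<Longrightarrow> norm (1 - eval n b' p1) < 1"
    using eval_open_dist[OF p1] by blast
  obtain x2 p2 where x2: "self_adj_tuple J n x2" "\<forall>j\<le>n. norm (x2 j - x1 j) < min (\<epsilon> / 9) (\<delta>1 / 2)"
    and p2: "norm (c * eval n x2 p2 - c) < \<epsilon> / 6"
    using right_unit_generating_perturbation[OF X_gen x1(1) c(1), of "min (\<epsilon> / 9) (\<delta>1 / 2)" "\<epsilon> / 6"] e d1
    by auto
  define y where "y = eval n x2 p2"
  have yJ: "y \<in> J" unfolding y_def using x2 J by (intro eval_in_subalg) (auto simp: self_adj_tuple_def)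
  define N where "N = norm y + 1"
  have N: "N > 0" "norm y \<le> N" by (auto simp: N_def add_nonneg_pos)
  \<comment> \<open>\<open>K\<close> makes the truncation harmless for the target: c - c T(c) has
    norm at most the square of \<open>norm c + 1\<close> divided by K, and the factor y in front, of
    norm at most N, raises this to \<epsilon>/12.\<close>
  define K where "K = 12 * N * (norm c + 1)\<^sup>2 / \<epsilon>"
  have c1: "norm c + 1 > 0" by (simp add: add_nonneg_pos)
  have K: "K > 0" using N e c1 by (simp add: K_def)
  \<comment> \<open>The error of replacing y by its value at the final tuple will be multiplied by
    an element of norm at most 2K, so the tolerance \<epsilon>/(12K) costs \<epsilon>/6. It is fixed
    before the polynomial \<open>p\<close> appears.\<close>
  obtain \<delta>2 where d2: "\<delta>2 > 0"
    "\<And>x. \<forall>j\<le>n. norm (x j - x2 j) < \<delta>2 \<Longrightarrow> norm (eval n x p2 - eval n x2 p2) < \<epsilon> / (12 * K)"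
    using eval_open[of "\<epsilon> / (12 * K)" n x2 p2] e K by auto
  \<comment> \<open>Compression enlarges distances by the factor 5, by
    \<open>compressed_tuple\<close>, so each bound is divided by 5 in advance.\<close>
  define \<eta> where "\<eta> = min (\<epsilon> / 45) (min (\<delta>1 / 10) (\<delta>2 / 5))"
  have \<eta>: "\<eta> > 0" "5 * \<eta> \<le> \<epsilon> / 9" "5 * \<eta> \<le> \<delta>1 / 2" "5 * \<eta> \<le> \<delta>2"
    using e d1 d2 by (auto simp: \<eta>_def)
  have cX: "c \<in> X" using c J by auto
  obtain b p where b: "self_adj_tuple X n b" "\<forall>j\<le>n. norm (b j - (x2 j + s j *\<^sub>R 1)) < \<eta>"
    "norm (c - eval n b p) < \<epsilon> / (6 * N)"
    using dense_genE2[OF X_gen translated_tuple[OF x2(1)] \<eta>(1) _ cX, of "\<epsilon> / (6 * N)"] e N by auto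
  have bsa: "\<forall>j\<le>n. self_adj (b j)" and bX: "\<forall>j\<le>n. b j \<in> X" using b by (auto simp: self_adj_tuple_def)
  define g where "g = eval n b (re_expr p)"
  have gc: "norm (c - g) < \<epsilon> / (6 * N)" unfolding g_def
    using norm_diff_re[OF c(2) bsa, of p] b(3) by simp
  have gsa: "self_adj g" unfolding g_def by (rule self_adj_eval_re[OF bsa])
  have gX: "g \<in> X" unfolding g_def by (rule eval_in_subalg[OF X(2) bX])
  define T where "T = (\<lambda>t::'a. res ((1/K) *\<^sub>R t))"
  have sK: "self_adj ((1/K) *\<^sub>R t)" if "self_adj t" for t :: 'a using that by (rule self_adj_scaleR)
  have T_le: "norm (T t) \<le> 1" if "self_adj t" for t unfolding T_def by (rule res(3)[OF sK[OF that]])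
  have tT_le: "norm (t * T t) \<le> 2 * K" if "self_adj t" for t
  proof -
    have "t * T t = K *\<^sub>R (((1/K) *\<^sub>R t) * T t)" using K by simp
    hence "norm (t * T t) = K * norm (((1/K) *\<^sub>R t) * T t)" using K by (metis abs_of_pos norm_scaleR)
    also have "\<dots> \<le> K * 2" using norm_mult_res[OF sK[OF that]] K unfolding T_def by (intro mult_left_mono) auto
    finally show ?thesis by simp
  qed
  \<comment> \<open>Writing t T(t) as a multiple of 1 - T(t) turns the resolvent identity into this
    formula.\<close>
  have T_diff: "t * T t - t' * T t' = T t' * (t - t') * T t" if "self_adj t" "self_adj t'" for t t'
  proof -
    have e1: "t * T t = K *\<^sub>R (- (imag * (1 - T t)))" if "self_adj t" for t
    proof -
      have "imag * (((1/K) *\<^sub>R t) * T t) = 1 - T t" unfolding T_def by (rule one_minus_res(1)[OF sK[OF that], symmetric])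
      hence "- (imag * (1 - T t)) = ((1/K) *\<^sub>R t) * T t" by (simp add: imag_imag_mult flip: \<open>imag * (((1/K) *\<^sub>R t) * T t) = 1 - T t\<close>)
      thus ?thesis using K by simp
    qed
    have "t * T t - t' * T t' = K *\<^sub>R (- (imag * (T t' - T t)))"
      unfolding e1[OF that(1)] e1[OF that(2)] by (simp add: algebra_simps)
    also have "T t' - T t = imag * (T t' * ((1/K) *\<^sub>R t - (1/K) *\<^sub>R t') * T t)"
      unfolding T_def by (rule res_diff[OF sK[OF that(2)] sK[OF that(1)]])
    also have "K *\<^sub>R (- (imag * \<dots>)) = T t' * (t - t') * T t"
      using K by (simp add: imag_imag_mult flip: scaleR_diff_right)
    finally show ?thesis .
  qed
  \<comment> \<open>The element of the ideal to be fixed before compressing: with q the value at the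
    compressed tuple, (v q - v g) T(q) is, up to sign, the error of passing from g T(g) to q T(q)
    behind \<open>adj y\<close>.\<close>
  define v where "v = adj y * T g"
  have TgX: "T g \<in> X" unfolding T_def using gX X by (intro res_mem[OF sK[OF gsa]]) (auto intro: subalgD)
  have ayJ: "adj y \<in> J" using yJ J by (auto simp: star_closed_def)
  have vJ: "v \<in> J" unfolding v_def using ideal TgX ayJ by blast
  define x where "x = (\<lambda>u j. compress u (b j - s j *\<^sub>R 1))"
  define b' where "b' = (\<lambda>u j. x u j + s j *\<^sub>R 1)"
  have ct: "\<forall>\<^sub>F u in approx_units J. self_adj_tuple J n (x u) \<and> (\<forall>j\<le>n. norm (x u j - x2 j) < 5 * \<eta>)"
    "\<And>v p. v \<in> J \<Longrightarrow> ((\<lambda>u. v * eval n (b' u) p) \<longlongrightarrow> v * eval n b p) (approx_units J)"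
    using compressed_tuple[OF x2(1) b(1,2)] unfolding x_def b'_def by blast+
  have "\<forall>\<^sub>F u in approx_units J. norm (v * eval n (b' u) (re_expr p) - v * g) < \<epsilon> / 6"
    using tendstoD[OF ct(2)[OF vJ, of "re_expr p"], of "\<epsilon> / 6"] e by (simp add: g_def dist_norm)
  from approx_unitsD[OF eventually_conj[OF ct(1) this]] obtain u where
    u: "self_adj_tuple J n (x u)" "\<forall>j\<le>n. norm (x u j - x2 j) < 5 * \<eta>"
      "norm (v * eval n (b' u) (re_expr p) - v * g) < \<epsilon> / 6" by blast
  have b'sa: "\<forall>j\<le>n. self_adj (b' u j)"
    using translated_tuple[OF u(1)] by (auto simp: self_adj_tuple_def b'_def)
  define C where "C = closure (gen n (b' u))"
  have C: "closed C" "subalg C" "star_closed C"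
    by (auto simp: C_def subalg_closure subalg_gen star_closed_closure star_closed_gen b'sa)
  have sub: "gen n (b' u) \<subseteq> C" by (simp add: C_def closure_subset)
  have "norm (1 - eval n (b' u) p1) < 1"
  proof (rule d1(2), intro allI impI)
    fix j assume j: "j \<le> n"
    have "b' u j - (x1 j + s j *\<^sub>R 1) = (x u j - x2 j) + (x2 j - x1 j)" by (simp add: b'_def)
    hence "norm (b' u j - (x1 j + s j *\<^sub>R 1)) \<le> norm (x u j - x2 j) + norm (x2 j - x1 j)"
      by (metis norm_triangle_ineq)
    moreover have "norm (x u j - x2 j) < \<delta>1 / 2" using u(2) j \<eta>(3) by (meson less_le_trans)
    moreover have "norm (x2 j - x1 j) < \<delta>1 / 2" using x2(2) j by simp
    ultimately show "norm (b' u j - (x1 j + s j *\<^sub>R 1)) < \<delta>1" by simp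
  qed
  hence oneC: "1 \<in> C" using one_in_closed_subalg[OF C(1,2)] eval_in_gen sub by blast
  have xC: "\<forall>j\<le>n. x u j \<in> C"
  proof (intro allI impI)
    fix j assume "j \<le> n"
    hence "b' u j \<in> C" using gen_mem sub by blast
    hence "b' u j - s j *\<^sub>R 1 \<in> C" using C oneC by (auto intro!: subalgD)
    thus "x u j \<in> C" by (simp add: b'_def)
  qed
  define y' where "y' = eval n (x u) p2"
  have y'C: "adj y' \<in> C" unfolding y'_def using eval_in_subalg[OF C(2) xC] C(3) by (auto simp: star_closed_def)
  have yy: "norm (adj y' - adj y) < \<epsilon> / (12 * K)"
  proof -
    have "norm (y' - y) < \<epsilon> / (12 * K)" unfolding y'_def y_def
      using u(2) \<eta>(4) by (intro d2(2)) (auto intro: less_le_trans)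
    thus ?thesis by (metis adj_diff norm_adj)
  qed
  define q where "q = eval n (b' u) (re_expr p)"
  have qsa: "self_adj q" unfolding q_def by (rule self_adj_eval_re[OF b'sa])
  have qC: "q \<in> C" using eval_in_gen sub by (auto simp: q_def)
  have TqC: "T q \<in> C" unfolding T_def using qC C oneC by (intro res_mem[OF sK[OF qsa]]) (auto intro: subalgD)
  \<comment> \<open>Compression is controlled under multiplication from the left. As c is
    self-adjoint, the adjoint of a right approximate unit is a left one and can stand in
    front.\<close>
  define m where "m = adj y' * (q * T q)"
  have mC: "m + r *\<^sub>R 1 \<in> C" unfolding m_def
    using C oneC y'C qC TqC by (intro subalgD(2)[OF C(2)] subalgD(3,5)[OF C(2)])
  have t1: "norm ((adj y - adj y') * (q * T q)) \<le> \<epsilon> / 6"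
  proof -
    have "norm ((adj y - adj y') * (q * T q)) \<le> norm (adj y - adj y') * norm (q * T q)" by (rule norm_mult_ineq)
    also have "\<dots> \<le> \<epsilon> / (12 * K) * (2 * K)"
      using yy tT_le[OF qsa] K e by (intro mult_mono) (auto simp: norm_minus_commute)
    finally show ?thesis using K by simp
  qed
  have t2: "norm (adj y * (g * T g - q * T q)) < \<epsilon> / 6"
  proof -
    have "g * T g - q * T q = - (T g * (q - g) * T q)"
      using T_diff[OF qsa gsa] by (metis minus_diff_eq)
    hence "adj y * (g * T g - q * T q) = - ((v * q - v * g) * T q)"
      by (simp only:) (simp add: v_def algebra_simps)
    hence "norm (adj y * (g * T g - q * T q)) \<le> norm (v * q - v * g) * norm (T q)"
      by (simp add: norm_mult_ineq)
    also have "\<dots> \<le> norm (v * q - v * g) * 1" using T_le[OF qsa] by (intro mult_left_mono) auto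
    finally show ?thesis using u(3) by (simp add: q_def)
  qed
  have t3: "norm (adj y * (c * T c - g * T g)) \<le> \<epsilon> / 6"
  proof -
    have "norm (T g * (c - g) * T c) \<le> norm (T g) * norm (c - g) * norm (T c)"
      by (meson norm_mult_ineq order_trans mult_right_mono norm_ge_zero)
    also have "\<dots> \<le> 1 * norm (c - g) * 1" using T_le gsa c(2) by (intro mult_mono) auto
    finally have "norm (c * T c - g * T g) \<le> \<epsilon> / (6 * N)" using gc T_diff[OF c(2) gsa] by simp
    hence "norm (adj y * (c * T c - g * T g)) \<le> N * (\<epsilon> / (6 * N))"
      using N by (intro order_trans[OF norm_mult_ineq] mult_mono) auto
    thus ?thesis using N by simp
  qed
  have t4: "norm (adj y * (c - c * T c)) \<le> \<epsilon> / 6"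
  proof -
    have "c - c * T c = c * (1 - T c)" by (simp add: algebra_simps)
    also have "1 - T c = imag * (((1/K) *\<^sub>R c) * T c)" unfolding T_def by (rule one_minus_res(1)[OF sK[OF c(2)]])
    also have "c * \<dots> = (1/K) *\<^sub>R (imag * (c * c * T c))" by (simp add: mult.assoc imag_simps)
    finally have "norm (c - c * T c) = (1/K) * norm (c * c * T c)" using K by simp
    also have "\<dots> \<le> (1/K) * (norm c * norm c * 1)"
      using K T_le[OF c(2)] by (intro mult_left_mono order_trans[OF norm_mult_ineq] mult_mono norm_mult_ineq) auto
    also have "\<dots> \<le> (1/K) * (norm c + 1)\<^sup>2"
      using K by (intro mult_left_mono) (auto simp: power2_eq_square algebra_simps)
    finally have "norm (adj y * (c - c * T c)) \<le> N * ((1/K) * (norm c + 1)\<^sup>2)"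
      using N by (intro order_trans[OF norm_mult_ineq] mult_mono) auto
    also have "\<dots> = \<epsilon> / 12" using N e c1 by (simp add: K_def)
    finally show ?thesis using e by simp
  qed
  have t5: "norm (c - adj y * c) < \<epsilon> / 6"
  proof -
    have "c - adj y * c = - adj (c * y - c)" using c(2) by (simp add: adj_diff adj_mult self_adjD)
    thus ?thesis using p2 unfolding y_def by simp
  qed
  \<comment> \<open>The intermediate elements are c, then \<open>adj y\<close> times c, c T(c), g
    T(g) and q T(q) in turn, and finally m. Each of the five steps costs at most \<epsilon>/6; the
    last \<epsilon>/6 is left for the polynomial \<open>P\<close>.\<close>
  have "c - m = (c - adj y * c) + adj y * (c - c * T c) + adj y * (c * T c - g * T g)
      + adj y * (g * T g - q * T q) + (adj y - adj y') * (q * T q)"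
    by (simp add: m_def algebra_simps)
  hence "norm (c - m) \<le> norm (c - adj y * c) + norm (adj y * (c - c * T c)) + norm (adj y * (c * T c - g * T g))
      + norm (adj y * (g * T g - q * T q)) + norm ((adj y - adj y') * (q * T q))"
    by (smt (verit) norm_triangle_ineq)
  hence cm: "norm (c - m) < 5 * \<epsilon> / 6" using t1 t2 t3 t4 t5 by simp
  obtain P where P: "norm (m + r *\<^sub>R 1 - eval n (b' u) P) < \<epsilon> / 6"
    using closure_gen_approx[of "m + r *\<^sub>R 1" n "b' u" "\<epsilon> / 6"] mC e by (auto simp: C_def)
  have "c' - eval n (b' u) P = (c - m) + (m + r *\<^sub>R 1 - eval n (b' u) P)" by (simp add: c(3))
  hence "norm (c' - eval n (b' u) P) \<le> norm (c - m) + norm (m + r *\<^sub>R 1 - eval n (b' u) P)"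
    by (metis norm_triangle_ineq)
  hence fin: "norm (c' - eval n (b' u) P) < \<epsilon>" using cm P by linarith
  have tup: "self_adj_tuple (adjoin_one J) n (b' u)"
    using b'sa u(1) by (auto simp: self_adj_tuple_def b'_def intro: adjoin_oneI_real)
  have near: "norm (b' u j - A j) < \<epsilon>" if j: "j \<le> n" for j
  proof -
    have "b' u j - A j = (x u j - x2 j) + (x2 j - x1 j) + (x1 j - a j) + (s j - s' j) *\<^sub>R 1"
      using as[OF j] by (simp add: b'_def algebra_simps)
    hence "norm (b' u j - A j) \<le> norm (x u j - x2 j) + norm (x2 j - x1 j) + norm (x1 j - a j)
        + norm ((s j - s' j) *\<^sub>R (1::'a))" by (smt (verit) norm_triangle_ineq)
    moreover have "norm (x u j - x2 j) < \<epsilon> / 9" using u(2) j \<eta>(2) by (meson less_le_trans)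
    moreover have "norm (x2 j - x1 j) < \<epsilon> / 9" "norm (x1 j - a j) < \<epsilon> / 9" using x2(2) x1(2) j by auto
    ultimately show ?thesis using ss[of j] e by simp
  qed
  show "\<exists>b p. self_adj_tuple (adjoin_one J) n b \<and> (\<forall>j\<le>n. norm (b j - A j) < \<epsilon>) \<and> norm (c' - eval n b p) < \<epsilon>"
    using tup near fin by blast
qed

end

section \<open>Quotients, extensions and units\<close>

locale star_map =
  fixes X :: "'a::unital_cstar set" and q :: "'a \<Rightarrow> 'b::unital_cstar"
  assumes X: "subalg X" "star_closed X"
    and q_add: "\<And>x y. x \<in> X \<Longrightarrow> y \<in> X \<Longrightarrow> q (x + y) = q x + q y"
    and q_mult: "\<And>x y. x \<in> X \<Longrightarrow> y \<in> X \<Longrightarrow> q (x * y) = q x * q y"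
    and q_scaleC: "\<And>x z. x \<in> X \<Longrightarrow> q (scaleC z x) = scaleC z (q x)"
    and q_adj: "\<And>x. x \<in> X \<Longrightarrow> q (adj x) = adj (q x)"
begin

lemma q_zero: "q 0 = 0"
  using q_scaleC[of 0 0] subalgD(1)[OF X(1)] by simp

lemma q_scaleR: "x \<in> X \<Longrightarrow> q (r *\<^sub>R x) = r *\<^sub>R q x"
  using q_scaleC[of x "of_real r"] by (simp add: scaleC_of_real)

lemma q_minus: "x \<in> X \<Longrightarrow> q (- x) = - q x"
  using q_scaleR[of x "- 1"] by simp

lemma q_diff: "x \<in> X \<Longrightarrow> y \<in> X \<Longrightarrow> q (x - y) = q x - q y"
  using q_add[of x "- y"] q_minus[of y] subalgD(7)[OF X(1)] by simp

lemma q_eval: "\<forall>j\<le>n. b j \<in> X \<Longrightarrow> q (eval n b p) = eval n (\<lambda>j. q (b j)) p"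
  by (induction p)
    (auto simp: q_zero q_add q_mult q_scaleC eval_in_subalg[OF X(1)])

lemma q_self_adj: "x \<in> X \<Longrightarrow> self_adj x \<Longrightarrow> self_adj (q x)"
  by (metis q_adj self_adj_def)

lemma q_image: "subalg (q ` X)" "star_closed (q ` X)"
proof -
  show "star_closed (q ` X)"
    using X by (auto simp: star_closed_def simp flip: q_adj)
  show "subalg (q ` X)"
    unfolding subalg_def
  proof (intro conjI ballI allI)
    show "0 \<in> q ` X" using q_zero subalgD(1)[OF X(1)] by (metis imageI)
    fix x y assume "x \<in> q ` X" "y \<in> q ` X"
    then show "x + y \<in> q ` X" "x * y \<in> q ` X"
      using subalgD(2,3)[OF X(1)] by (auto simp flip: q_add q_mult)
  next
    fix x z assume "x \<in> q ` X"
    thus "scaleC z x \<in> q ` X" using subalgD(4)[OF X(1)] by (auto simp flip: q_scaleC)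
  qed
qed

lemma self_adj_lift:
  assumes "y \<in> q ` X" "self_adj y"
  obtains x where "x \<in> X" "self_adj x" "q x = y"
proof -
  obtain x where x: "x \<in> X" "y = q x" using assms by auto
  have ax: "adj x \<in> X" using x X by (auto simp: star_closed_def)
  define x' where "x' = (1/2) *\<^sub>R (x + adj x)"
  have "x' \<in> X" using x ax X by (auto simp: x'_def intro!: subalgD)
  moreover have "self_adj x'" by (simp add: x'_def self_adj_def adj_scaleR adj_add add.commute)
  moreover have "q x' = y"
    using x ax assms(2) subalgD(2)[OF X(1) x(1) ax]
    by (simp add: x'_def q_scaleR q_add q_adj self_adj_def flip: scaleR_2)
  ultimately show ?thesis using that by blast
qed

end

locale bounded_star_map = star_map +
  fixes K :: real
  assumes K: "K > 0" and q_bounded: "\<And>x. x \<in> X \<Longrightarrow> norm (q x) \<le> K * norm x"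
begin

text \<open>Lift target and tuple, the latter to self-adjoint elements, solve the problem upstairs
  within \<epsilon>/K, and map the solution down; polynomials commute with \<open>q\<close>.\<close>

theorem dense_gen_image:
  assumes "dense_gen X n" shows "dense_gen (q ` X) n"
  unfolding dense_gen_def
proof (intro allI ballI impI)
  fix a c and \<epsilon> :: real
  assume c: "c \<in> q ` X" and a: "self_adj_tuple (q ` X) n a" and e: "\<epsilon> > 0"
  obtain c' where c': "c' \<in> X" "c = q c'" using c by auto
  have "\<forall>j. \<exists>x. j \<le> n \<longrightarrow> x \<in> X \<and> self_adj x \<and> q x = a j"
    using a self_adj_lift unfolding self_adj_tuple_def by metis
  then obtain a' where a': "\<And>j. j \<le> n \<Longrightarrow> a' j \<in> X \<and> self_adj (a' j) \<and> q (a' j) = a j" by metis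
  have "self_adj_tuple X n a'" using a' by (auto simp: self_adj_tuple_def)
  from dense_genE[OF assms this _ c'(1), of "\<epsilon> / K"] e K obtain b p where
    b: "self_adj_tuple X n b" "\<And>j. j \<le> n \<Longrightarrow> norm (b j - a' j) < \<epsilon> / K" "norm (c' - eval n b p) < \<epsilon> / K"
    by auto
  have bX: "\<forall>j\<le>n. b j \<in> X" using b by (auto simp: self_adj_tuple_def)
  have less: "norm (q x) < \<epsilon>" if "x \<in> X" "norm x < \<epsilon> / K" for x
    using q_bounded[OF that(1)] that(2) K by (simp add: pos_less_divide_eq mult.commute) 
  have "norm (q (b j) - a j) < \<epsilon>" if j: "j \<le> n" for j
  proof -
    have "q (b j) - a j = q (b j - a' j)" using j a' bX by (simp add: q_diff)
    thus ?thesis using less[of "b j - a' j"] b(2)[OF j] j a' bX X by (simp add: subalgD)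
  qed
  moreover have "norm (c - eval n (\<lambda>j. q (b j)) p) < \<epsilon>"
  proof -
    have "c - eval n (\<lambda>j. q (b j)) p = q (c' - eval n b p)"
      using c' bX by (simp add: q_diff q_eval eval_in_subalg X)
    thus ?thesis using less[of "c' - eval n b p"] b(3) c' bX X by (simp add: subalgD eval_in_subalg)
  qed
  moreover have "self_adj_tuple (q ` X) n (\<lambda>j. q (b j))"
    using b by (auto simp: self_adj_tuple_def q_self_adj)
  ultimately show "\<exists>b p. self_adj_tuple (q ` X) n b \<and> (\<forall>j\<le>n. norm (b j - a j) < \<epsilon>) \<and> norm (c - eval n b p) < \<epsilon>"
    by blast
qed

end

text \<open>Bounds in both directions make the inverse a bounded *-homomorphism as well, so
  \<open>dense_gen_image\<close> applies both ways.\<close>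

lemma dense_gen_star_iso:
  assumes "bounded_star_map X q K" and "\<And>x. x \<in> X \<Longrightarrow> norm x \<le> L * norm (q x)" "L > 0"
  shows "dense_gen (q ` X) n \<longleftrightarrow> dense_gen X n"
proof
  interpret q: bounded_star_map X q K by fact
  have inj: "inj_on q X"
  proof (rule inj_onI)
    fix x y assume xy: "x \<in> X" "y \<in> X" "q x = q y"
    hence "q (x - y) = 0" by (simp add: q.q_diff)
    moreover have "x - y \<in> X" using xy q.X by (simp add: subalgD)
    ultimately have "norm (x - y) \<le> 0" using assms(2)[of "x - y"] by simp
    thus "x = y" by simp
  qed
  define r where "r = inv_into X q"
  have r: "r (q x) = x" if "x \<in> X" for x using inj that by (simp add: r_def)
  interpret r: bounded_star_map "q ` X" r L
  proof
    show "subalg (q ` X)" "star_closed (q ` X)" by (rule q.q_image)+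
    fix x y z assume "x \<in> q ` X" then obtain x' where x': "x' \<in> X" "x = q x'" by auto
    show "r (scaleC z x) = scaleC z (r x)" using x' q.X by (simp add: r subalgD flip: q.q_scaleC)
    show "r (adj x) = adj (r x)" using x' q.X by (simp add: r star_closed_def flip: q.q_adj)
    show "norm (r x) \<le> L * norm x" using assms(2)[OF x'(1)] by (simp add: x' r)
    assume "y \<in> q ` X" then obtain y' where y': "y' \<in> X" "y = q y'" by auto
    show "r (x + y) = r x + r y" using x' y' q.X by (simp add: r subalgD flip: q.q_add)
    show "r (x * y) = r x * r y" using x' y' q.X by (simp add: r subalgD flip: q.q_mult)
  qed fact
  show "dense_gen X n \<Longrightarrow> dense_gen (q ` X) n" by (rule q.dense_gen_image)
  have "r ` q ` X = X" using r by (force simp: image_iff)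
  thus "dense_gen (q ` X) n \<Longrightarrow> dense_gen X n" using r.dense_gen_image by metis
qed

text \<open>Self-adjoint elements of norm less than 1 lie in the real part of a unitary \<open>a + i(1 - y)\<close>
  with \<open>y\<close> in the algebra, and this persists under *-homomorphisms.\<close>

lemma (in star_map) contractive:
  assumes "closed X" and x: "x \<in> X"
  shows "norm (q x) \<le> norm x"
proof -
  have sa: "norm (q a) \<le> 1" if a: "a \<in> X" "self_adj a" "norm a < 1" for a
  proof -
    obtain y where y: "y \<in> X" "self_adj y" "a * y = y * a" "y = (1/2) *\<^sub>R (a * a + y * y)"
      using half_square_fixpoint[OF a(2,3) assms(1) X(1) a(1)] .
    have "q (a * y) = q (y * a)" using y by simp
    hence 1: "q a * q y = q y * q a" by (simp only: q_mult[OF a(1) y(1)] q_mult[OF y(1) a(1)])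
    have "q y = q ((1/2) *\<^sub>R (a * a + y * y))" using y(4) by simp
    also have "\<dots> = (1/2) *\<^sub>R (q a * q a + q y * q y)"
      using a(1) y(1) X(1) by (simp add: q_scaleR q_add q_mult subalgD)
    finally show ?thesis
      using half_square_unitary(1)[OF q_self_adj[OF a(1,2)] q_self_adj[OF y(1,2)] 1] by blast
  qed
  have sa': "norm (q a) \<le> norm a" if a: "a \<in> X" "self_adj a" for a
  proof (rule field_le_epsilon)
    fix e :: real assume e: "e > 0"
    define m where "m = norm a + e"
    have m: "m > 0" using e by (simp add: m_def add_nonneg_pos)
    have "norm (q ((1/m) *\<^sub>R a)) \<le> 1"
      using a m e X by (intro sa) (auto simp: self_adj_scaleR m_def intro: subalgD)
    thus "norm (q a) \<le> norm a + e" using m a by (simp add: q_scaleR m_def divide_simps split: if_splits)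
  qed
  have ax: "adj x \<in> X" using x X by (simp add: star_closed_def)
  have "(norm (q x))\<^sup>2 = norm (q (adj x * x))" using x ax by (simp add: q_mult q_adj norm_adj_mult)
  also have "\<dots> \<le> norm (adj x * x)"
    using x ax X by (intro sa') (auto intro: subalgD self_adj_adj_mult)
  also have "\<dots> = (norm x)\<^sup>2" by (rule norm_adj_mult)
  finally show ?thesis by (rule power2_le_imp_le) simp
qed

text \<open>Up to constants, \<open>q\<close> is the quotient map by \<open>J\<close>: it vanishes
  on J, and an element with small image is close to J.\<close>

locale open_star_map = bounded_star_map X q K
  for X :: "'a::unital_cstar set" and q :: "'a \<Rightarrow> 'b::unital_cstar" and K +
  fixes J :: "'a set" and L :: real
  assumes J: "J \<subseteq> X" "subalg J" "star_closed J" and L: "L > 0"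
    and q_open: "\<And>x \<epsilon>. x \<in> X \<Longrightarrow> norm (q x) < \<epsilon> \<Longrightarrow> \<exists>v\<in>J. norm (x - v) < L * \<epsilon>"
    and unit: "1 \<in> X" and kernel: "\<And>v. v \<in> J \<Longrightarrow> q v = 0"
begin

lemma q_open_self_adj:
  assumes x: "x \<in> X" "self_adj x" "norm (q x) < \<epsilon>"
  obtains v where "v \<in> J" "self_adj v" "norm (x - v) < L * \<epsilon>"
proof -
  obtain v where v: "v \<in> J" "norm (x - v) < L * \<epsilon>" using q_open[OF x(1,3)] by auto
  define w where "w = (1/2) *\<^sub>R (v + adj v)"
  have "w \<in> J" using v J by (auto simp: w_def star_closed_def intro!: subalgD)
  moreover have "self_adj w" by (simp add: w_def self_adj_def adj_scaleR adj_add add.commute)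
  moreover have "norm (x - w) < L * \<epsilon>"
  proof -
    have "x - w = (1/2) *\<^sub>R ((x - v) + adj (x - v))"
      by (simp add: w_def adj_diff self_adjD[OF x(2)] algebra_simps flip: scaleR_add_left)
    hence "norm (x - w) \<le> norm (x - v)"
      using norm_triangle_ineq[of "x - v" "adj (x - v)"] by simp
    thus ?thesis using v by simp
  qed
  ultimately show ?thesis using that by blast
qed

text \<open>The summand 1 comes from counting: n + 1 entries for the quotient and m + 1 for the
  ideal are m + n + 2 entries, that is, index m + n + 1.\<close>

theorem dense_gen_extension:
  assumes DJ: "dense_gen (adjoin_one J) m" and DY: "dense_gen (q ` X) n"
  shows "dense_gen X (m + n + 1)"
  unfolding dense_gen_def
proof (intro allI ballI impI)
  fix a c and \<epsilon> :: real
  assume c: "c \<in> X" and a: "self_adj_tuple X (m + n + 1) a" and e: "\<epsilon> > 0"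
  \<comment> \<open>Every final error consists of a lifting error L \<delta> and a generation error
    \<delta>, and their sum is \<epsilon>/2.\<close>
  define \<delta> where "\<delta> = \<epsilon> / (2 * (L + 1))"
  have "(L + 1) * \<delta> = \<epsilon> / 2" unfolding \<delta>_def by (rule mult_divide_mult_self) (use L in simp)
  hence d: "\<delta> > 0" "L * \<delta> + \<delta> = \<epsilon> / 2"
    using e L by (simp add: \<delta>_def, simp only: distrib_right mult_1)
  have aX: "a j \<in> X" "self_adj (a j)" if "j \<le> m + n + 1" for j
    using a that by (auto simp: self_adj_tuple_def)
  \<comment> \<open>Besides the target, the last m + 1 entries themselves are targets in the
    quotient, so that they too are polynomials in \<open>b\<close> up to errors in J.\<close>
  define C where "C = insert (q c) ((\<lambda>j. q (a (n + 1 + j))) ` {..m})"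
  have C: "finite C" "C \<subseteq> q ` X" using c aX by (auto simp: C_def)
  have qa: "self_adj_tuple (q ` X) n (\<lambda>j. q (a j))"
    using aX by (auto simp: self_adj_tuple_def intro!: q_self_adj)
  obtain B where B: "self_adj_tuple (q ` X) n B" "\<And>j. j \<le> n \<Longrightarrow> norm (B j - q (a j)) < \<delta>"
    "\<forall>c\<in>C. \<exists>p. norm (c - eval n B p) < \<delta>"
    using dense_gen_finite[OF DY C qa d(1) d(1)] by blast
  have "\<exists>b. b \<in> X \<and> self_adj b \<and> q b = B j \<and> norm (b - a j) < L * \<delta>" if j: "j \<le> n" for j
  proof -
    obtain x where x: "x \<in> X" "self_adj x" "q x = B j"
      using self_adj_lift B(1) j unfolding self_adj_tuple_def by metis
    have aj: "a j \<in> X" "self_adj (a j)" using aX j by auto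
    have "x - a j \<in> X" "self_adj (x - a j)" "norm (q (x - a j)) < \<delta>"
      using x aj X B(2)[OF j] by (auto simp: q_diff intro: subalgD self_adj_diff)
    then obtain v where v: "v \<in> J" "self_adj v" "norm ((x - a j) - v) < L * \<delta>" by (rule q_open_self_adj)
    have vX: "v \<in> X" using v J by auto
    show ?thesis
    proof (intro exI[of _ "x - v"] conjI)
      show "x - v \<in> X" using x vX X by (simp add: subalgD)
      show "self_adj (x - v)" using x v by (simp add: self_adj_diff)
      show "q (x - v) = B j" using x vX kernel[OF v(1)] by (simp add: q_diff)
      show "norm ((x - v) - a j) < L * \<delta>" using v(3) by (simp add: algebra_simps)
    qed
  qed
  then obtain b where b: "\<And>j. j \<le> n \<Longrightarrow> b j \<in> X \<and> self_adj (b j) \<and> q (b j) = B j \<and> norm (b j - a j) < L * \<delta>"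
    by metis
  have bX: "\<forall>j\<le>n. b j \<in> X" and bsa: "\<forall>j\<le>n. self_adj (b j)" using b by auto
  have ev: "eval n B p = q (eval n b p)" for p
  proof -
    have "eval n B p = eval n (\<lambda>j. q (b j)) p" by (induction p) (auto simp: b)
    thus ?thesis using bX by (simp add: q_eval)
  qed
  have evX: "eval n b p \<in> X" for p using bX by (intro eval_in_subalg X)
  obtain p where p: "norm (q (c - eval n b p)) < \<delta>"
    using B(3) c evX by (auto simp: C_def ev q_diff)
  obtain y where y: "y \<in> J" "norm (c - eval n b p - y) < L * \<delta>"
    using q_open[OF _ p] c evX X by (auto simp: subalgD)
  have "\<exists>r x. x \<in> J \<and> self_adj x \<and> norm (a (n + 1 + j) - eval n b (re_expr r) - x) < L * \<delta>" if j: "j \<le> m" for j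
  proof -
    have aj: "a (n + 1 + j) \<in> X" "self_adj (a (n + 1 + j))" using aX j by auto
    obtain r where r: "norm (q (a (n + 1 + j)) - eval n B r) < \<delta>" using B(3) j by (auto simp: C_def)
    have "norm (q (a (n + 1 + j)) - eval n B (re_expr r)) < \<delta>"
      using r B(1) norm_diff_re[OF q_self_adj[OF aj], of n B r] by (auto simp: self_adj_tuple_def)
    hence "norm (q (a (n + 1 + j) - eval n b (re_expr r))) < \<delta>" using aj evX by (simp add: ev q_diff)
    moreover have "a (n + 1 + j) - eval n b (re_expr r) \<in> X" "self_adj (a (n + 1 + j) - eval n b (re_expr r))"
      using aj evX X self_adj_eval_re[OF bsa] by (auto intro: subalgD self_adj_diff)
    ultimately obtain x where "x \<in> J" "self_adj x" "norm (a (n + 1 + j) - eval n b (re_expr r) - x) < L * \<delta>"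
      using q_open_self_adj by blast
    thus ?thesis by blast
  qed
  then obtain r x where rx: "\<And>j. j \<le> m \<Longrightarrow> x j \<in> J \<and> self_adj (x j) \<and>
      norm (a (n + 1 + j) - eval n b (re_expr (r j)) - x j) < L * \<delta>" by metis
  define J1 where "J1 = adjoin_one J"
  have JJ1: "v \<in> J1" if "v \<in> J" for v
  proof -
    have "v = v + scaleC 0 1" by simp
    thus ?thesis using that unfolding J1_def adjoin_one_def by blast
  qed
  have J1X: "J1 \<subseteq> X" using J X unit by (auto simp: J1_def adjoin_one_def intro!: subalgD)
  \<comment> \<open>Generation takes place in J + C1, so the perturbed errors may acquire scalar
    parts; they stay in X because 1 is in X.\<close>
  have "self_adj_tuple J1 m x" using rx JJ1 by (auto simp: self_adj_tuple_def)
  from dense_genE[OF DJ[folded J1_def] this d(1) JJ1[OF y(1)]] obtain w s where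
    w: "self_adj_tuple J1 m w" "\<And>j. j \<le> m \<Longrightarrow> norm (w j - x j) < \<delta>" "norm (y - eval m w s) < \<delta>" by blast
  \<comment> \<open>The last entries are polynomials in \<open>b\<close> plus generators
    \<open>w\<close> for the ideal part. The algebra of b' contains b, hence those polynomials,
    hence w by subtraction.\<close>
  define b' where "b' = (\<lambda>j. if j \<le> n then b j else eval n b (re_expr (r (j - (n + 1)))) + w (j - (n + 1)))"
  define N where "N = m + n + 1"
  have bG: "\<forall>j\<le>n. b j \<in> gen N b'"
  proof (intro allI impI)
    fix j assume "j \<le> n"
    thus "b j \<in> gen N b'" using gen_mem[of j N b'] by (simp add: b'_def N_def)
  qed
  hence eG: "eval n b p \<in> gen N b'" for p by (intro eval_in_subalg subalg_gen)
  have wG: "\<forall>j\<le>m. w j \<in> gen N b'"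
  proof (intro allI impI)
    fix j assume "j \<le> m"
    hence "b' (n + 1 + j) \<in> gen N b'" by (intro gen_mem) (simp add: N_def)
    hence "b' (n + 1 + j) - eval n b (re_expr (r j)) \<in> gen N b'" by (intro subalgD(8)[OF subalg_gen] eG)
    thus "w j \<in> gen N b'" by (simp add: b'_def)
  qed
  have "eval n b p + eval m w s \<in> gen N b'"
    by (intro subalgD(2)[OF subalg_gen] eG eval_in_subalg wG subalg_gen)
  then obtain P where P: "eval N b' P = eval n b p + eval m w s" by (auto simp: gen_def)
  have "c - eval N b' P = (c - eval n b p - y) + (y - eval m w s)" by (simp add: P)
  hence "norm (c - eval N b' P) \<le> norm (c - eval n b p - y) + norm (y - eval m w s)"
    by (metis norm_triangle_ineq)
  hence fin: "norm (c - eval N b' P) < \<epsilon>" using y(2) w(3) d(2) e by linarith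
  have near: "b' j \<in> X \<and> self_adj (b' j) \<and> norm (b' j - a j) < \<epsilon>" if j: "j \<le> N" for j
  proof (cases "j \<le> n")
    case True
    have "L * \<delta> < \<epsilon>" using d e by linarith
    thus ?thesis using True b[OF True] by (auto simp: b'_def)
  next
    case False
    define i where "i = j - (n + 1)"
    have i: "i \<le> m" "j = n + 1 + i" using False j by (auto simp: i_def N_def)
    have b'j: "b' j = eval n b (re_expr (r i)) + w i" using False by (simp add: b'_def i_def)
    have wi: "w i \<in> X" "self_adj (w i)" using w(1) i J1X by (auto simp: self_adj_tuple_def)
    have "b' j - a j = (w i - x i) - (a (n + 1 + i) - eval n b (re_expr (r i)) - x i)"
      unfolding b'j by (simp add: i(2))
    hence "norm (b' j - a j) \<le> norm (w i - x i) + norm (a (n + 1 + i) - eval n b (re_expr (r i)) - x i)"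
      by (metis norm_triangle_ineq4)
    hence "norm (b' j - a j) < \<epsilon>" using w(2)[OF i(1)] rx[OF i(1)] d(2) e by linarith
    moreover have "b' j \<in> X" unfolding b'j using evX wi X by (simp add: subalgD)
    moreover have "self_adj (b' j)" unfolding b'j using wi self_adj_eval_re[OF bsa] by (simp add: self_adj_add)
    ultimately show ?thesis by blast
  qed
  show "\<exists>b p. self_adj_tuple X (m + n + 1) b \<and> (\<forall>j\<le>m + n + 1. norm (b j - a j) < \<epsilon>) \<and>
      norm (c - eval (m + n + 1) b p) < \<epsilon>"
    using near fin unfolding N_def self_adj_tuple_def by blast
qed

end

text \<open>If \<open>e\<close> is the unit of \<open>X\<close> then \<open>X + \<complex>1\<close> is the direct sum of \<open>X\<close> and the multiples
  of \<open>1 - e\<close>.\<close>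

theorem dense_gen_unital:
  fixes X :: "'a::unital_cstar set"
  assumes X: "closed X" "subalg X" "star_closed X" "1 \<notin> X"
    and e: "e \<in> X" "\<And>x. x \<in> X \<Longrightarrow> e * x = x" "\<And>x. x \<in> X \<Longrightarrow> x * e = x"
  shows "dense_gen (adjoin_one X) n \<longleftrightarrow> dense_gen X n"
proof -
  interpret I: nonunital_subalgebra X by unfold_locales (fact X)+
  have ae: "adj e \<in> X" using e X by (simp add: star_closed_def)
  have 1: "e * adj e = adj e" using e(2)[OF ae] .
  have "e * adj e = e" using arg_cong[OF 1, of adj] by (simp add: adj_mult)
  with 1 have esa: "adj e = e" by simp
  have scm: "scaleC z 1 * x = scaleC z x" "x * scaleC z 1 = scaleC z x" for z and x :: 'a
    by (simp_all add: scaleC_mult_left scaleC_mult_right)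
  have eX1: "x * e \<in> X" "e * x = x * e" if x: "x \<in> adjoin_one X" for x
  proof -
    obtain v z where v: "v \<in> X" "x = v + scaleC z 1" using x by (auto simp: adjoin_one_def)
    show "x * e \<in> X" "e * x = x * e" using v e X by (auto simp: ring_distribs scm intro: subalgD)
  qed
  have ee: "e * e = e" using e by blast
  show ?thesis
  proof
    assume "dense_gen (adjoin_one X) n"
    \<comment> \<open>The idempotent e commutes with \<open>adjoin_one X\<close>, so multiplication
      by it is a *-homomorphism, and its image is X.\<close>
    interpret q: bounded_star_map "adjoin_one X" "\<lambda>x. x * e" "norm e + 1"
    proof
      fix x y :: 'a and z
      assume x: "x \<in> adjoin_one X"
      show "norm (x * e) \<le> (norm e + 1) * norm x"
        using norm_mult_ineq[of x e] norm_ge_zero[of x] unfolding distrib_right mult_1 by (simp only: mult.commute[of "norm e"])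
      show "scaleC z x * e = scaleC z (x * e)" by (rule scaleC_mult_left)
      show "adj x * e = adj (x * e)"
        using eX1(2)[of "adj x"] I.star_closed_adjoin_one x by (simp add: star_closed_def adj_mult esa)
      assume "y \<in> adjoin_one X"
      show "(x + y) * e = x * e + y * e" by (simp add: distrib_right)
      show "x * y * e = x * e * (y * e)" using eX1(2)[OF \<open>y \<in> adjoin_one X\<close>] ee by (metis mult.assoc)
    qed (auto simp: I.subalg_adjoin_one I.star_closed_adjoin_one add_nonneg_pos)
    have "x \<in> adjoin_one X" if "x \<in> X" for x using I.adjoin_oneI[OF that, of 0] by simp
    hence "(\<lambda>x. x * e) ` adjoin_one X = X" using e(3) eX1(1) by (auto simp: image_iff) metis
    thus "dense_gen X n" using q.dense_gen_image[OF \<open>dense_gen (adjoin_one X) n\<close>] by simp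
  next
    assume gX: "dense_gen X n"
    define f where "f = 1 - e"
    have fX: "f * x = 0" "x * f = 0" if "x \<in> X" for x using e that by (auto simp: f_def algebra_simps)
    have ff: "f * f = f" using ee by (simp add: f_def algebra_simps)
    show "dense_gen (adjoin_one X) n"
      unfolding dense_gen_def
    proof (intro allI ballI impI)
      fix A c and \<epsilon> :: real
      assume c: "c \<in> adjoin_one X" and A: "self_adj_tuple (adjoin_one X) n A" and eps: "\<epsilon> > 0"
      obtain c0 z where c0: "c0 \<in> X" "c = c0 + scaleC z 1" using c by (auto simp: adjoin_one_def)
      have "\<forall>j. \<exists>v r. j \<le> n \<longrightarrow> v \<in> X \<and> self_adj v \<and> A j = v + r *\<^sub>R 1"
        using A I.self_adj_adjoin_oneE unfolding self_adj_tuple_def by metis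
      then obtain v s' where v: "\<And>j. j \<le> n \<Longrightarrow> v j \<in> X \<and> self_adj (v j) \<and> A j = v j + s' j *\<^sub>R 1"
        by metis
      define a where "a = (\<lambda>j. v j + s' j *\<^sub>R e)"
      have sae: "self_adj e" using esa by (simp add: self_adj_def)
      have a: "self_adj_tuple X n a"
        using v X e sae by (auto simp: self_adj_tuple_def a_def subalgD intro!: self_adj_add self_adj_scaleR)
      define \<kappa> where "\<kappa> = \<epsilon> / (3 * (norm f + 1))"
      have nf: "norm f + 1 > 0" by (simp add: add_nonneg_pos)
      have \<kappa>: "\<kappa> > 0" using eps nf by (simp add: \<kappa>_def)
      \<comment> \<open>The scalar part of entry 0 is made nonzero, since f will enter the generated
        algebra only multiplied by s 0.\<close>
      define s where "s = (\<lambda>j. if j = 0 \<and> s' 0 = 0 then \<kappa> else s' j)"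
      have s0: "s 0 \<noteq> 0" using \<kappa> by (simp add: s_def)
      have ss: "norm ((s j - s' j) *\<^sub>R f) \<le> \<epsilon> / 3" for j
      proof -
        have "norm ((s j - s' j) *\<^sub>R f) \<le> (norm f + 1) * \<kappa>" using \<kappa> by (simp add: s_def algebra_simps)
        thus ?thesis using nf unfolding \<kappa>_def by (subst (asm) mult_divide_mult_self) auto
      qed
      have ceX: "c0 + scaleC z e \<in> X" using c0 e X by (simp add: subalgD)
      obtain b1 p1 where b1: "self_adj_tuple X n b1" "\<And>j. j \<le> n \<Longrightarrow> norm (b1 j - a j) < \<epsilon> / 3"
        "norm (c0 + scaleC z e - eval n b1 p1) < \<epsilon> / 2"
        using dense_genE2[OF gX a _ _ ceX, of "\<epsilon> / 3" "\<epsilon> / 2"] eps by auto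
      obtain \<delta> where d: "\<delta> > 0" "\<And>b'. \<forall>j\<le>n. norm (b' j - b1 j) < \<delta> \<Longrightarrow> norm (c0 + scaleC z e - eval n b' p1) < \<epsilon> / 2"
        using eval_open_dist[OF b1(3)] by blast
      have tr: "self_adj_tuple X n (\<lambda>j. b j + r j *\<^sub>R e)" if "self_adj_tuple X n b" for b r
        using that X e sae by (auto simp: self_adj_tuple_def subalgD intro!: self_adj_add self_adj_scaleR)
      \<comment> \<open>The tuple is shifted by - s e before e is approximated, because \<beta> = B
        - s 1 is what the idealizer of the algebra generated by the final tuple \<open>B\<close>
        contains.\<close>
      obtain \<beta> p2 where \<beta>: "self_adj_tuple X n \<beta>" "\<And>j. j \<le> n \<Longrightarrow> norm (\<beta> j - (b1 j + (- s j) *\<^sub>R e)) < min \<delta> (\<epsilon> / 3)"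
        "norm (e - eval n \<beta> p2) < 1"
        using dense_genE2[OF gX tr[OF b1(1), of "\<lambda>j. - s j"] _ _ e(1), of "min \<delta> (\<epsilon> / 3)" 1] d eps by auto
      have \<beta>X: "\<forall>j\<le>n. \<beta> j \<in> X" using \<beta> by (auto simp: self_adj_tuple_def)
      \<comment> \<open>\<open>B\<close> and \<open>b2\<close> differ by the multiples s j f, so the
        good tuple \<open>b2\<close> is recovered from \<open>B\<close> once f is available.\<close>
      define b2 where "b2 = (\<lambda>j. \<beta> j + s j *\<^sub>R e)"
      define B where "B = (\<lambda>j. \<beta> j + s j *\<^sub>R 1)"
      have near2: "norm (b2 j - b1 j) < min \<delta> (\<epsilon> / 3)" if "j \<le> n" for j
        using \<beta>(2)[OF that] by (simp add: b2_def algebra_simps)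
      define C where "C = closure (gen n B)"
      have C: "closed C" "subalg C" by (auto simp: C_def subalg_closure subalg_gen)
      have BC: "\<forall>j\<le>n. B j \<in> C" using gen_mem closure_subset by (fastforce simp: C_def)
      \<comment> \<open>Whether 1 lies in \<open>C\<close> is open at this point; its idealizer
        contains 1, hence the entries of \<beta> and the limit of the powers of 1 - g.\<close>
      define M where "M = idealizer C"
      have M: "closed M" "subalg M" "1 \<in> M" "C \<subseteq> M"
        using C idealizer_props[OF C(2)] closed_idealizer[OF C(1)] by (auto simp: M_def)
      define g where "g = eval n \<beta> p2"
      have gM: "g \<in> M" unfolding g_def
      proof (rule eval_in_subalg[OF M(2)], intro allI impI)
        fix j assume "j \<le> n"
        hence "B j - s j *\<^sub>R 1 \<in> M" using BC M by (auto intro!: subalgD)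
        thus "\<beta> j \<in> M" by (simp add: B_def)
      qed
      have gX': "g \<in> X" unfolding g_def using \<beta>X by (intro eval_in_subalg X)
      \<comment> \<open>\<open>f\<close> annihilates X from both sides, so 1 - g = f + (e - g) is an
        orthogonal sum. As e - g has norm below 1, the powers converge to f.\<close>
      have pw: "(1 - g) ^ Suc k = f + (e - g) ^ Suc k \<and> (e - g) ^ Suc k \<in> X" for k
      proof (induction k)
        case 0 show ?case using e gX' X by (simp add: f_def subalgD)
      next
        case (Suc k)
        have egX: "e - g \<in> X" using e gX' X by (simp add: subalgD)
        have "(1 - g) ^ Suc (Suc k) = (f + (e - g)) * (f + (e - g) ^ Suc k)"
          using Suc by (simp only: power_Suc[of _ "Suc k"]) (simp add: f_def)
        also have "\<dots> = f * f + (e - g) * f + f * (e - g) ^ Suc k + (e - g) ^ Suc (Suc k)"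
          by (simp only: distrib_left distrib_right power_Suc[of _ "Suc k"] add.assoc)
        also have "\<dots> = f + (e - g) ^ Suc (Suc k)"
          using Suc fX egX ff by simp
        finally show ?case using Suc egX subalgD(3)[OF X(2) egX, of "(e - g) ^ Suc k"] by simp
      qed
      have "(\<lambda>k. (e - g) ^ Suc k) \<longlonglongrightarrow> 0"
        using \<beta>(3) by (intro LIMSEQ_Suc LIMSEQ_power_zero) (simp add: g_def)
      from tendsto_add[OF tendsto_const[of f] this] have "(\<lambda>k. (1 - g) ^ Suc k) \<longlonglongrightarrow> f"
        by (simp only: pw) simp
      moreover have "(1 - g) ^ Suc k \<in> M" for k
        using M gM by (intro subalg_power) (auto intro: subalgD)
      ultimately have fM: "f \<in> M" using closed_sequentially[OF M(1), of "\<lambda>k. (1 - g) ^ Suc k" f] by simp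
      \<comment> \<open>Membership in the idealizer brings f into \<open>C\<close> only as a
        multiple: B 0 f = s 0 f, because f kills \<beta> 0.\<close>
      have "B 0 * f \<in> C" using BC fM by (simp add: M_def idealizer_def)
      moreover have "B 0 * f = s 0 *\<^sub>R f" using fX \<beta>X by (simp add: B_def distrib_right)
      ultimately have "(1 / s 0) *\<^sub>R (s 0 *\<^sub>R f) \<in> C" using C by (simp add: subalgD del: scaleR_scaleR)
      hence fC: "f \<in> C" using s0 by simp
      have b2C: "\<forall>j\<le>n. b2 j \<in> C"
      proof (intro allI impI)
        fix j assume "j \<le> n"
        hence "B j - s j *\<^sub>R f \<in> C" using BC fC C by (simp add: subalgD)
        thus "b2 j \<in> C" by (simp add: b2_def B_def f_def algebra_simps)
      qed
      have mC: "eval n b2 p1 + scaleC z f \<in> C" using b2C fC C by (intro subalgD eval_in_subalg) auto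
      obtain P where P: "norm (eval n b2 p1 + scaleC z f - eval n B P) < \<epsilon> / 2"
        using closure_gen_approx[of "eval n b2 p1 + scaleC z f" n B "\<epsilon> / 2"] mC eps by (auto simp: C_def)
      have "c - eval n B P = (c0 + scaleC z e - eval n b2 p1) + (eval n b2 p1 + scaleC z f - eval n B P)"
        by (simp add: c0 f_def scaleC_diff_right)
      hence "norm (c - eval n B P) \<le> norm (c0 + scaleC z e - eval n b2 p1) + norm (eval n b2 p1 + scaleC z f - eval n B P)"
        by (metis norm_triangle_ineq)
      moreover have "norm (c0 + scaleC z e - eval n b2 p1) < \<epsilon> / 2" using near2 by (intro d(2)) auto
      ultimately have fin: "norm (c - eval n B P) < \<epsilon>" using P by linarith
      have "norm (B j - A j) < \<epsilon>" if j: "j \<le> n" for j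
      proof -
        have "B j - A j = (b2 j - b1 j) + (b1 j - a j) + (s j - s' j) *\<^sub>R f"
          using v[OF j] by (simp add: B_def b2_def a_def f_def algebra_simps)
        hence "norm (B j - A j) \<le> norm (b2 j - b1 j) + norm (b1 j - a j) + norm ((s j - s' j) *\<^sub>R f)"
          by (simp only:) (rule order_trans[OF norm_triangle_ineq add_right_mono[OF norm_triangle_ineq]])
        thus ?thesis using near2[OF j] b1(2)[OF j] ss[of j] by linarith
      qed
      moreover have "self_adj_tuple (adjoin_one X) n B"
        using \<beta>(1) by (auto simp: self_adj_tuple_def B_def intro: I.adjoin_oneI_real self_adj_add self_adj_scaleR self_adj_one)
      ultimately show "\<exists>b p. self_adj_tuple (adjoin_one X) n b \<and> (\<forall>j\<le>n. norm (b j - A j) < \<epsilon>) \<and> norm (c - eval n b p) < \<epsilon>"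
        using fin by blast
    qed
  qed
qed

section \<open>Records of C*-algebras\<close>

lemma complex_ring_simps [simp]:
  "carrier complex_ring = UNIV" "a \<oplus>\<^bsub>complex_ring\<^esub> b = a + b" "a \<otimes>\<^bsub>complex_ring\<^esub> b = a * b"
  "\<one>\<^bsub>complex_ring\<^esub> = 1" "\<zero>\<^bsub>complex_ring\<^esub> = 0"
  by (simp_all add: complex_ring_def)

lemma cring_complex_ring: "cring complex_ring"
proof (rule cringI)
  show "abelian_group complex_ring"
    by (rule abelian_groupI) (auto simp: algebra_simps intro: exI[of _ "- x" for x])
  show "comm_monoid complex_ring" by (rule comm_monoidI) (auto simp: algebra_simps)
qed (auto simp: algebra_simps)

text \<open>These axioms determine the metric. Keeping them apart allows
  \<open>cstar_algebraI\<close> to work with the metric before completeness is established.\<close>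

locale normed_cmodule = module complex_ring A for A :: "'a cstar" (structure) +
  assumes n_nonneg: "x \<in> carrier A \<Longrightarrow> 0 \<le> cnorm A x"
    and n_eq_0_iff: "x \<in> carrier A \<Longrightarrow> cnorm A x = 0 \<longleftrightarrow> x = \<zero>"
    and n_triangle: "\<lbrakk>x \<in> carrier A; y \<in> carrier A\<rbrakk> \<Longrightarrow> cnorm A (x \<oplus> y) \<le> cnorm A x + cnorm A y"
    and n_smult: "x \<in> carrier A \<Longrightarrow> cnorm A (c \<odot> x) = cmod c * cnorm A x"
begin

lemma sm_closed [simp]: "x \<in> carrier A \<Longrightarrow> c \<odot> x \<in> carrier A"
  using smult_closed by simp

lemma zero_in [simp]: "\<zero> \<in> carrier A"
  by (rule M.zero_closed)

lemma add_in [simp]: "x \<in> carrier A \<Longrightarrow> y \<in> carrier A \<Longrightarrow> x \<oplus> y \<in> carrier A"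
  by (rule M.a_closed)

lemma sm_l: "x \<in> carrier A \<Longrightarrow> (c + d) \<odot> x = c \<odot> x \<oplus> d \<odot> x"
  using smult_l_distr[of c d x] by simp

lemma sm_r: "x \<in> carrier A \<Longrightarrow> y \<in> carrier A \<Longrightarrow> c \<odot> (x \<oplus> y) = c \<odot> x \<oplus> c \<odot> y"
  using smult_r_distr[of c x y] by simp

lemma sm_assoc: "x \<in> carrier A \<Longrightarrow> c \<odot> (d \<odot> x) = (c * d) \<odot> x"
  using smult_assoc1[of c d x] by simp

lemma sm_one [simp]: "x \<in> carrier A \<Longrightarrow> 1 \<odot> x = x"
  using smult_one[of x] by simp

lemma sm_zero [simp]: "x \<in> carrier A \<Longrightarrow> 0 \<odot> x = \<zero>"
proof -
  assume x: "x \<in> carrier A"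
  have "0 \<odot> x \<oplus> 0 \<odot> x = 0 \<odot> x" using sm_l[OF x, of 0 0] by simp
  thus ?thesis using x M.add.l_cancel_one[of "0 \<odot> x" "0 \<odot> x"] by simp
qed

lemma add_neg [simp]: "x \<in> carrier A \<Longrightarrow> x \<oplus> (- 1) \<odot> x = \<zero>"
  using sm_l[of x 1 "- 1"] by simp

lemma neg_add [simp]: "x \<in> carrier A \<Longrightarrow> (- 1) \<odot> x \<oplus> x = \<zero>"
  using sm_l[of x "- 1" 1] by simp

lemma a_inv_eq: "x \<in> carrier A \<Longrightarrow> \<ominus> x = (- 1) \<odot> x"
  by (rule M.minus_equality) auto

lemma minus_eq: "x \<in> carrier A \<Longrightarrow> y \<in> carrier A \<Longrightarrow> x \<ominus> y = x \<oplus> (- 1) \<odot> y"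
  by (simp add: a_minus_def a_inv_eq)

lemma minus_in: "x \<in> carrier A \<Longrightarrow> y \<in> carrier A \<Longrightarrow> x \<ominus> y \<in> carrier A"
  by (simp add: minus_eq)

lemma eq_iff_minus: "x \<in> carrier A \<Longrightarrow> y \<in> carrier A \<Longrightarrow> x \<oplus> (- 1) \<odot> y = \<zero> \<longleftrightarrow> x = y"
proof
  assume x: "x \<in> carrier A" "y \<in> carrier A" and h: "x \<oplus> (- 1) \<odot> y = \<zero>"
  have "x = x \<oplus> ((- 1) \<odot> y \<oplus> y)" using x by simp
  also have "\<dots> = (x \<oplus> (- 1) \<odot> y) \<oplus> y" using x by (simp add: M.a_assoc)
  also have "\<dots> = y" using h x by simp
  finally show "x = y" .
qed simp

lemma n_zero [simp]: "cnorm A \<zero> = 0"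
  using n_eq_0_iff by simp

lemma n_minus_commute: "x \<in> carrier A \<Longrightarrow> y \<in> carrier A \<Longrightarrow> cnorm A (x \<ominus> y) = cnorm A (y \<ominus> x)"
proof -
  assume x: "x \<in> carrier A" "y \<in> carrier A"
  have "x \<ominus> y = (- 1) \<odot> (y \<ominus> x)" using x by (simp add: minus_eq sm_r sm_assoc M.a_comm)
  thus ?thesis using x by (simp add: n_smult minus_in)
qed

lemma minus_split: "x \<in> carrier A \<Longrightarrow> y \<in> carrier A \<Longrightarrow> z \<in> carrier A \<Longrightarrow> x \<ominus> z = (x \<ominus> y) \<oplus> (y \<ominus> z)"
proof -
  assume x: "x \<in> carrier A" "y \<in> carrier A" "z \<in> carrier A"
  have "(x \<oplus> (- 1) \<odot> y) \<oplus> (y \<oplus> (- 1) \<odot> z) = x \<oplus> (((- 1) \<odot> y \<oplus> y) \<oplus> (- 1) \<odot> z)"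
    using x by (simp only: M.a_assoc sm_closed add_in)
  also have "\<dots> = x \<oplus> (- 1) \<odot> z" using x by simp
  finally show ?thesis using x by (simp add: minus_eq)
qed

lemma n_minus_triangle: "x \<in> carrier A \<Longrightarrow> y \<in> carrier A \<Longrightarrow> z \<in> carrier A \<Longrightarrow>
    cnorm A (x \<ominus> z) \<le> cnorm A (x \<ominus> y) + cnorm A (y \<ominus> z)"
  by (simp add: minus_split[of x y z] n_triangle minus_in)

lemma n_le_minus: "x \<in> carrier A \<Longrightarrow> y \<in> carrier A \<Longrightarrow> cnorm A y \<le> cnorm A x + cnorm A (x \<ominus> y)"
  using n_minus_triangle[of y x \<zero>] n_minus_commute[of y x] by (simp add: minus_eq M.r_zero)

lemma metric: "Metric_space (carrier A) (cdist A)"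
proof
  fix x y z
  show "0 \<le> cdist A x y" by (simp add: cdist_def n_nonneg minus_in)
  show "cdist A x y = cdist A y x" by (simp add: cdist_def n_minus_commute)
  assume x: "x \<in> carrier A" "y \<in> carrier A"
  show "cdist A x y = 0 \<longleftrightarrow> x = y"
    using x by (simp add: cdist_def n_eq_0_iff minus_in minus_eq eq_iff_minus)
  assume "z \<in> carrier A"
  thus "cdist A x z \<le> cdist A x y + cdist A y z" using x by (simp add: cdist_def n_minus_triangle)
qed

definition ccauchy :: "(nat \<Rightarrow> 'a) \<Rightarrow> bool" where
  "ccauchy \<sigma> \<longleftrightarrow> (\<forall>n. \<sigma> n \<in> carrier A) \<and> (\<forall>e>0. \<exists>N. \<forall>m\<ge>N. \<forall>n\<ge>N. cnorm A (\<sigma> m \<ominus> \<sigma> n) < e)"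

lemma limitin_iff:
  assumes "\<And>n. \<sigma> n \<in> carrier A"
  shows "limitin (ctopology A) \<sigma> l sequentially \<longleftrightarrow>
    l \<in> carrier A \<and> (\<lambda>n. cnorm A (\<sigma> n \<ominus> l)) \<longlonglongrightarrow> 0"
  unfolding ctopology_def Metric_space.limit_metric_sequentially[OF metric]
  using assms by (auto simp: cdist_def lim_sequentially dist_real_def abs_of_nonneg n_nonneg minus_in)

lemma complete_iff:
  "Metric_space.mcomplete (carrier A) (cdist A) \<longleftrightarrow>
    (\<forall>\<sigma>. ccauchy \<sigma> \<longrightarrow> (\<exists>l\<in>carrier A. (\<lambda>n. cnorm A (\<sigma> n \<ominus> l)) \<longlonglongrightarrow> 0))"
proof -
  have 1: "Metric_space.MCauchy (carrier A) (cdist A) \<sigma> \<longleftrightarrow> ccauchy \<sigma>" for \<sigma>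
    unfolding Metric_space.MCauchy_def[OF metric] ccauchy_def
    by (auto simp: image_subset_iff cdist_def)
  have 2: "ccauchy \<sigma> \<Longrightarrow> limitin (ctopology A) \<sigma> l sequentially \<longleftrightarrow>
      l \<in> carrier A \<and> (\<lambda>n. cnorm A (\<sigma> n \<ominus> l)) \<longlonglongrightarrow> 0" for \<sigma> l
    by (rule limitin_iff) (simp add: ccauchy_def)
  show ?thesis
    unfolding Metric_space.mcomplete_def[OF metric] 1 ctopology_def[symmetric]
    using 2 by blast
qed

lemma closedin_iff:
  "closedin (ctopology A) S \<longleftrightarrow> S \<subseteq> carrier A \<and>
    (\<forall>\<sigma> l. (\<forall>n. \<sigma> n \<in> S) \<longrightarrow> l \<in> carrier A \<longrightarrow> (\<lambda>n. cnorm A (\<sigma> n \<ominus> l)) \<longlonglongrightarrow> 0 \<longrightarrow> l \<in> S)"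
proof (cases "S \<subseteq> carrier A")
  case True
  have "closedin (ctopology A) S \<longleftrightarrow> S \<subseteq> carrier A \<and>
     (\<forall>\<sigma> l. range \<sigma> \<subseteq> S \<and> limitin (ctopology A) \<sigma> l sequentially \<longrightarrow> l \<in> S)"
    unfolding ctopology_def by (rule Metric_space.metric_closedin_iff_sequentially_closed[OF metric])
  also have "\<dots> \<longleftrightarrow> S \<subseteq> carrier A \<and>
    (\<forall>\<sigma> l. (\<forall>n. \<sigma> n \<in> S) \<longrightarrow> l \<in> carrier A \<longrightarrow> (\<lambda>n. cnorm A (\<sigma> n \<ominus> l)) \<longlonglongrightarrow> 0 \<longrightarrow> l \<in> S)"
  proof -
    have "(range \<sigma> \<subseteq> S \<and> limitin (ctopology A) \<sigma> l sequentially \<longrightarrow> l \<in> S) \<longleftrightarrow>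
      ((\<forall>n. \<sigma> n \<in> S) \<longrightarrow> l \<in> carrier A \<longrightarrow> (\<lambda>n. cnorm A (\<sigma> n \<ominus> l)) \<longlonglongrightarrow> 0 \<longrightarrow> l \<in> S)" for \<sigma> l
    proof (cases "\<forall>n. \<sigma> n \<in> S")
      case mem: True
      hence "\<sigma> n \<in> carrier A" for n using True by blast
      thus ?thesis using mem limitin_iff[of \<sigma> l] by (auto simp only: image_subset_iff)
    next
      case False
      thus ?thesis by blast
    qed
    thus ?thesis by simp
  qed
  finally show ?thesis .
next
  case False
  thus ?thesis using closedin_subset[of "ctopology A" S]
    Metric_space.topspace_mtopology[OF metric] by (auto simp: ctopology_def)
qed

end

sublocale cstar_algebra \<subseteq> normed_cmodule A
  by unfold_locales (fact cnorm_nonneg cnorm_eq_0_iff cnorm_triangle cnorm_smult)+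

text \<open>Additive inverses are obtained as (- 1) \<odot> x. Differences are written in the same
  way, because \<open>a_inv\<close> is a description that depends on the carrier.\<close>

lemma cstar_algebraI:
  fixes A :: "'a cstar" (structure)
  assumes zero: "\<zero> \<in> carrier A"
    and add: "\<And>x y. x \<in> carrier A \<Longrightarrow> y \<in> carrier A \<Longrightarrow> x \<oplus> y \<in> carrier A"
      "\<And>x y z. x \<in> carrier A \<Longrightarrow> y \<in> carrier A \<Longrightarrow> z \<in> carrier A \<Longrightarrow> (x \<oplus> y) \<oplus> z = x \<oplus> (y \<oplus> z)"
      "\<And>x y. x \<in> carrier A \<Longrightarrow> y \<in> carrier A \<Longrightarrow> x \<oplus> y = y \<oplus> x"
      "\<And>x. x \<in> carrier A \<Longrightarrow> \<zero> \<oplus> x = x"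
    and sm: "\<And>x c. x \<in> carrier A \<Longrightarrow> c \<odot> x \<in> carrier A"
      "\<And>x. x \<in> carrier A \<Longrightarrow> 0 \<odot> x = \<zero>"
      "\<And>x c d. x \<in> carrier A \<Longrightarrow> (c + d) \<odot> x = c \<odot> x \<oplus> d \<odot> x"
      "\<And>x y c. x \<in> carrier A \<Longrightarrow> y \<in> carrier A \<Longrightarrow> c \<odot> (x \<oplus> y) = c \<odot> x \<oplus> c \<odot> y"
      "\<And>x c d. x \<in> carrier A \<Longrightarrow> (c * d) \<odot> x = c \<odot> (d \<odot> x)"
      "\<And>x. x \<in> carrier A \<Longrightarrow> 1 \<odot> x = x"
    and mult: "\<And>x y. \<lbrakk>x \<in> carrier A; y \<in> carrier A\<rbrakk> \<Longrightarrow> x \<otimes> y \<in> carrier A"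
      "\<And>x y z. \<lbrakk>x \<in> carrier A; y \<in> carrier A; z \<in> carrier A\<rbrakk> \<Longrightarrow> (x \<otimes> y) \<otimes> z = x \<otimes> (y \<otimes> z)"
      "\<And>x y z. \<lbrakk>x \<in> carrier A; y \<in> carrier A; z \<in> carrier A\<rbrakk> \<Longrightarrow> (x \<oplus> y) \<otimes> z = x \<otimes> z \<oplus> y \<otimes> z"
      "\<And>x y z. \<lbrakk>x \<in> carrier A; y \<in> carrier A; z \<in> carrier A\<rbrakk> \<Longrightarrow> z \<otimes> (x \<oplus> y) = z \<otimes> x \<oplus> z \<otimes> y"
      "\<And>x y c. \<lbrakk>x \<in> carrier A; y \<in> carrier A\<rbrakk> \<Longrightarrow> (c \<odot> x) \<otimes> y = c \<odot> (x \<otimes> y)"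
      "\<And>x y c. \<lbrakk>x \<in> carrier A; y \<in> carrier A\<rbrakk> \<Longrightarrow> x \<otimes> (c \<odot> y) = c \<odot> (x \<otimes> y)"
    and star: "\<And>x. x \<in> carrier A \<Longrightarrow> star A x \<in> carrier A"
      "\<And>x. x \<in> carrier A \<Longrightarrow> star A (star A x) = x"
      "\<And>x y. \<lbrakk>x \<in> carrier A; y \<in> carrier A\<rbrakk> \<Longrightarrow> star A (x \<oplus> y) = star A x \<oplus> star A y"
      "\<And>x c. x \<in> carrier A \<Longrightarrow> star A (c \<odot> x) = cnj c \<odot> star A x"
      "\<And>x y. \<lbrakk>x \<in> carrier A; y \<in> carrier A\<rbrakk> \<Longrightarrow> star A (x \<otimes> y) = star A y \<otimes> star A x"
    and norm: "\<And>x. x \<in> carrier A \<Longrightarrow> 0 \<le> cnorm A x"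
      "\<And>x. x \<in> carrier A \<Longrightarrow> cnorm A x = 0 \<longleftrightarrow> x = \<zero>"
      "\<And>x y. \<lbrakk>x \<in> carrier A; y \<in> carrier A\<rbrakk> \<Longrightarrow> cnorm A (x \<oplus> y) \<le> cnorm A x + cnorm A y"
      "\<And>x c. x \<in> carrier A \<Longrightarrow> cnorm A (c \<odot> x) = cmod c * cnorm A x"
      "\<And>x y. \<lbrakk>x \<in> carrier A; y \<in> carrier A\<rbrakk> \<Longrightarrow> cnorm A (x \<otimes> y) \<le> cnorm A x * cnorm A y"
      "\<And>x. x \<in> carrier A \<Longrightarrow> cnorm A (star A x \<otimes> x) = (cnorm A x)\<^sup>2"
    and complete: "\<And>\<sigma> :: nat \<Rightarrow> 'a. (\<And>n. \<sigma> n \<in> carrier A) \<Longrightarrow>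
      (\<And>e. e > 0 \<Longrightarrow> \<exists>N. \<forall>m\<ge>N. \<forall>n\<ge>N. cnorm A (\<sigma> m \<oplus> (- 1) \<odot> \<sigma> n) < e) \<Longrightarrow>
      \<exists>l\<in>carrier A. (\<lambda>n. cnorm A (\<sigma> n \<oplus> (- 1) \<odot> l)) \<longlonglongrightarrow> 0"
  shows "cstar_algebra A"
proof -
  have ag: "abelian_group A"
  proof (rule abelian_groupI)
    fix x assume x: "x \<in> carrier A"
    have "(- 1) \<odot> x \<oplus> x = \<zero>" using sm(3)[OF x, of "- 1" 1] sm(2,6)[OF x] by simp
    thus "\<exists>y\<in>carrier A. y \<oplus> x = \<zero>" using sm(1)[OF x] by blast
  qed (use zero add in auto)
  have md: "module complex_ring A"
    by (rule moduleI[OF cring_complex_ring ag]) (use sm in auto)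
  interpret normed_cmodule A
    by (intro normed_cmodule.intro md normed_cmodule_axioms.intro) (fact norm)+
  have mc: "Metric_space.mcomplete (carrier A) (cdist A)"
    unfolding complete_iff ccauchy_def
  proof (intro allI impI)
    fix \<sigma> :: "nat \<Rightarrow> 'a" assume *: "(\<forall>n. \<sigma> n \<in> carrier A) \<and> (\<forall>e>0. \<exists>N. \<forall>m\<ge>N. \<forall>n\<ge>N. cnorm A (\<sigma> m \<ominus> \<sigma> n) < e)"
    hence "\<exists>l\<in>carrier A. (\<lambda>n. cnorm A (\<sigma> n \<oplus> (- 1) \<odot> l)) \<longlonglongrightarrow> 0"
      by (intro complete) (auto simp: minus_eq)
    thus "\<exists>l\<in>carrier A. (\<lambda>n. cnorm A (\<sigma> n \<ominus> l)) \<longlonglongrightarrow> 0"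
      using * by (auto simp: minus_eq)
  qed
  show ?thesis
    by (intro cstar_algebra.intro md cstar_algebra_axioms.intro mc) (fact mult star norm)+
qed

context cstar_algebra
begin

lemma completeE:
  assumes "\<And>n. \<sigma> n \<in> carrier A"
    and "\<And>e. e > 0 \<Longrightarrow> \<exists>N. \<forall>m\<ge>N. \<forall>n\<ge>N. cnorm A (\<sigma> m \<oplus> (- 1) \<odot> \<sigma> n) < e"
  obtains l where "l \<in> carrier A" "(\<lambda>n. cnorm A (\<sigma> n \<oplus> (- 1) \<odot> l)) \<longlonglongrightarrow> 0"
proof -
  have "ccauchy \<sigma>" using assms by (simp add: ccauchy_def minus_eq)
  then obtain l where "l \<in> carrier A" "(\<lambda>n. cnorm A (\<sigma> n \<ominus> l)) \<longlonglongrightarrow> 0"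
    using complete complete_iff by blast
  thus ?thesis using that assms(1) by (simp add: minus_eq)
qed

lemma n_star: assumes "x \<in> carrier A" shows "cnorm A (star A x) = cnorm A x"
proof -
  have le: "cnorm A z \<le> cnorm A (star A z)" if z: "z \<in> carrier A" for z
  proof (cases "cnorm A z = 0")
    case False
    have "(cnorm A z)\<^sup>2 \<le> cnorm A (star A z) * cnorm A z"
      using cnorm_mult[of "star A z" z] z by (simp add: cnorm_star_mult star_closed)
    thus ?thesis using False cnorm_nonneg[OF z] by (simp add: power2_eq_square)
  qed (use z in \<open>simp add: cnorm_nonneg star_closed\<close>)
  show ?thesis using le[OF assms] le[of "star A x"] assms by (simp add: star_closed star_star)
qed

lemma mult_zero: assumes "x \<in> carrier A" shows "x \<otimes> \<zero> = \<zero>" "\<zero> \<otimes> x = \<zero>"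
  using smult_mult_r[OF assms zero_in, of 0] smult_mult_l[OF zero_in assms, of 0] assms
  by (simp_all add: mult_closed)

lemma star_zero: "star A \<zero> = \<zero>"
  using star_smult[OF zero_in, of 0] by (simp add: star_closed)

lemma closed_limit:
  assumes "closedin (ctopology A) S" "\<And>n. \<sigma> n \<in> S" "l \<in> carrier A"
    "(\<lambda>n. cnorm A (\<sigma> n \<oplus> (- 1) \<odot> l)) \<longlonglongrightarrow> 0"
  shows "l \<in> S"
proof -
  have "\<sigma> n \<in> carrier A" for n using assms(1,2) closedin_iff by blast
  hence "cnorm A (\<sigma> n \<ominus> l) = cnorm A (\<sigma> n \<oplus> (- 1) \<odot> l)" for n
    using assms(3) by (simp add: minus_eq)
  hence "(\<lambda>n. cnorm A (\<sigma> n \<ominus> l)) \<longlonglongrightarrow> 0" using assms(4) by simp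
  thus ?thesis using assms(1-3) unfolding closedin_iff by blast
qed

end

subsection \<open>Products\<close>

lemma cstar_product_sel:
  "carrier (cstar_product \<Lambda> A) = {x \<in> (\<Pi>\<^sub>E i\<in>\<Lambda>. carrier (A i)). bdd_above ((\<lambda>i. cnorm (A i) (x i)) ` \<Lambda>)}"
  "x \<otimes>\<^bsub>cstar_product \<Lambda> A\<^esub> y = (\<lambda>i\<in>\<Lambda>. x i \<otimes>\<^bsub>A i\<^esub> y i)"
  "\<zero>\<^bsub>cstar_product \<Lambda> A\<^esub> = (\<lambda>i\<in>\<Lambda>. \<zero>\<^bsub>A i\<^esub>)"
  "x \<oplus>\<^bsub>cstar_product \<Lambda> A\<^esub> y = (\<lambda>i\<in>\<Lambda>. x i \<oplus>\<^bsub>A i\<^esub> y i)"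
  "c \<odot>\<^bsub>cstar_product \<Lambda> A\<^esub> x = (\<lambda>i\<in>\<Lambda>. c \<odot>\<^bsub>A i\<^esub> x i)"
  "star (cstar_product \<Lambda> A) x = (\<lambda>i\<in>\<Lambda>. star (A i) (x i))"
  "cnorm (cstar_product \<Lambda> A) x = (SUP i\<in>\<Lambda>. cnorm (A i) (x i))"
  by (simp_all add: cstar_product_def)

lemma cstar_product_cstar_algebra:
  assumes A: "\<And>i. i \<in> \<Lambda> \<Longrightarrow> cstar_algebra (A i)" and ne: "\<Lambda> \<noteq> {}"
  shows "cstar_algebra (cstar_product \<Lambda> A)"
proof -
  let ?P = "cstar_product \<Lambda> A"
  have nc: "normed_cmodule (A i)" if "i \<in> \<Lambda>" for i
  proof -
    interpret cstar_algebra "A i" using A that .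
    show ?thesis by unfold_locales
  qed
  note N = nc[THEN normed_cmodule.sm_closed] nc[THEN normed_cmodule.zero_in] nc[THEN normed_cmodule.add_in]
    A[THEN cstar_algebra.mult_closed] A[THEN cstar_algebra.star_closed]
  have ab: "abelian_group (A i)" if "i \<in> \<Lambda>" for i
    using cstar_algebra.axioms(1)[OF A[OF that]] by (simp add: module_def)
  have memI: "x \<in> carrier ?P" if "x \<in> (\<Pi>\<^sub>E i\<in>\<Lambda>. carrier (A i))" "\<And>i. i \<in> \<Lambda> \<Longrightarrow> cnorm (A i) (x i) \<le> M" for x M
    using that by (auto simp: cstar_product_sel intro!: bdd_aboveI[of _ M])
  have memD: "x i \<in> carrier (A i)" "cnorm (A i) (x i) \<le> cnorm ?P x" if "x \<in> carrier ?P" "i \<in> \<Lambda>" for x i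
    using that by (auto simp: cstar_product_sel intro: cSUP_upper)
  have ext: "x \<in> extensional \<Lambda>" if "x \<in> carrier ?P" for x
    using that by (auto simp: cstar_product_sel PiE_def)
  have le: "cnorm ?P x \<le> M" if "\<And>i. i \<in> \<Lambda> \<Longrightarrow> cnorm (A i) (x i) \<le> M" for x M
    unfolding cstar_product_sel using ne that by (intro cSUP_least)
  have eqI: "x = y" if "x \<in> extensional \<Lambda>" "y \<in> extensional \<Lambda>" "\<And>i. i \<in> \<Lambda> \<Longrightarrow> x i = y i" for x y
    using that by (rule extensionalityI)
  have nn: "0 \<le> cnorm ?P x" if "x \<in> carrier ?P" for x
  proof -
    obtain i where i: "i \<in> \<Lambda>" using ne by auto
    have "0 \<le> cnorm (A i) (x i)" using memD(1)[OF that i] A[OF i] by (simp add: cstar_algebra.cnorm_nonneg)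
    thus ?thesis using memD(2)[OF that i] by simp
  qed
  have closed_sm: "c \<odot>\<^bsub>?P\<^esub> x \<in> carrier ?P" if x: "x \<in> carrier ?P" for x c
    by (rule memI[of _ "cmod c * cnorm ?P x"])
      (auto simp: cstar_product_sel(5) N memD[OF x] A[THEN cstar_algebra.cnorm_smult] intro!: mult_left_mono)
  have closed_add: "x \<oplus>\<^bsub>?P\<^esub> y \<in> carrier ?P" if x: "x \<in> carrier ?P" and y: "y \<in> carrier ?P" for x y
    by (rule memI[of _ "cnorm ?P x + cnorm ?P y"])
      (auto simp: cstar_product_sel(4) N memD[OF x] memD[OF y] intro!: order_trans[OF A[THEN cstar_algebra.cnorm_triangle]] add_mono)
  note closed = closed_add closed_sm
  show ?thesis
  proof (rule cstar_algebraI)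
    show "\<zero>\<^bsub>?P\<^esub> \<in> carrier ?P"
      by (rule memI[of _ 0]) (auto simp: cstar_product_sel N normed_cmodule.n_zero[OF nc])
    fix x y z c d
    assume x: "x \<in> carrier ?P"
    note xD = memD[OF x]
    show "c \<odot>\<^bsub>?P\<^esub> x \<in> carrier ?P" by (rule closed_sm[OF x])
    show "star ?P x \<in> carrier ?P"
      by (rule memI[of _ "cnorm ?P x"]) (auto simp: cstar_product_sel(6) N xD A[THEN cstar_algebra.n_star])
    show "\<zero>\<^bsub>?P\<^esub> \<oplus>\<^bsub>?P\<^esub> x = x" "0 \<odot>\<^bsub>?P\<^esub> x = \<zero>\<^bsub>?P\<^esub>" "1 \<odot>\<^bsub>?P\<^esub> x = x"
      "(c + d) \<odot>\<^bsub>?P\<^esub> x = c \<odot>\<^bsub>?P\<^esub> x \<oplus>\<^bsub>?P\<^esub> d \<odot>\<^bsub>?P\<^esub> x" "(c * d) \<odot>\<^bsub>?P\<^esub> x = c \<odot>\<^bsub>?P\<^esub> (d \<odot>\<^bsub>?P\<^esub> x)"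
      "star ?P (star ?P x) = x" "star ?P (c \<odot>\<^bsub>?P\<^esub> x) = cnj c \<odot>\<^bsub>?P\<^esub> star ?P x"
      by (rule eqI; use ext[OF x] in \<open>auto simp: cstar_product_sel xD N nc[THEN normed_cmodule.sm_zero]
        nc[THEN normed_cmodule.sm_one] nc[THEN normed_cmodule.sm_l] nc[THEN normed_cmodule.sm_assoc]
        A[THEN cstar_algebra.star_star] A[THEN cstar_algebra.star_smult]
        abelian_monoid.l_zero[OF abelian_group.axioms(1)[OF ab]]\<close>)+
    show "0 \<le> cnorm ?P x" by (rule nn[OF x])
    show "cnorm ?P x = 0 \<longleftrightarrow> x = \<zero>\<^bsub>?P\<^esub>"
    proof
      assume 0: "cnorm ?P x = 0"
      show "x = \<zero>\<^bsub>?P\<^esub>"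
      proof (rule eqI[OF ext[OF x]])
        fix i assume i: "i \<in> \<Lambda>"
        have "cnorm (A i) (x i) = 0"
          using xD[OF i] 0 A[OF i] by (simp add: cstar_algebra.cnorm_nonneg order_antisym)
        thus "x i = \<zero>\<^bsub>?P\<^esub> i" using xD[OF i] A[OF i] i by (simp add: cstar_algebra.cnorm_eq_0_iff cstar_product_sel)
      qed (simp add: cstar_product_sel)
    next
      assume "x = \<zero>\<^bsub>?P\<^esub>"
      hence "cnorm ?P x \<le> 0" by (intro le) (simp add: cstar_product_sel nc[THEN normed_cmodule.n_zero])
      thus "cnorm ?P x = 0" using nn[OF x] by simp
    qed
    show "cnorm ?P (c \<odot>\<^bsub>?P\<^esub> x) = cmod c * cnorm ?P x"
    proof (rule antisym)
      show "cnorm ?P (c \<odot>\<^bsub>?P\<^esub> x) \<le> cmod c * cnorm ?P x"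
        by (rule le) (auto simp: cstar_product_sel(5) xD A[THEN cstar_algebra.cnorm_smult] intro!: mult_left_mono)
      show "cmod c * cnorm ?P x \<le> cnorm ?P (c \<odot>\<^bsub>?P\<^esub> x)"
      proof (cases "c = 0")
        case False
        have "cnorm ?P x \<le> cnorm ?P (c \<odot>\<^bsub>?P\<^esub> x) / cmod c"
        proof (rule le)
          fix i assume i: "i \<in> \<Lambda>"
          have "cmod c * cnorm (A i) (x i) \<le> cnorm ?P (c \<odot>\<^bsub>?P\<^esub> x)"
            using memD(2)[OF \<open>c \<odot>\<^bsub>?P\<^esub> x \<in> carrier ?P\<close> i] xD[OF i] A[OF i] i
            by (simp add: cstar_product_sel(5) cstar_algebra.cnorm_smult)
          thus "cnorm (A i) (x i) \<le> cnorm ?P (c \<odot>\<^bsub>?P\<^esub> x) / cmod c" using False by (simp add: field_simps)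
        qed
        thus ?thesis using False by (simp add: field_simps)
      qed (use nn[OF \<open>c \<odot>\<^bsub>?P\<^esub> x \<in> carrier ?P\<close>] in simp)
    qed
    show "cnorm ?P (star ?P x \<otimes>\<^bsub>?P\<^esub> x) = (cnorm ?P x)\<^sup>2"
    proof (rule antisym)
      have *: "cnorm (A i) ((star ?P x \<otimes>\<^bsub>?P\<^esub> x) i) = (cnorm (A i) (x i))\<^sup>2" if "i \<in> \<Lambda>" for i
        using that by (simp add: cstar_product_sel A[THEN cstar_algebra.cnorm_star_mult] xD)
      show "cnorm ?P (star ?P x \<otimes>\<^bsub>?P\<^esub> x) \<le> (cnorm ?P x)\<^sup>2"
        by (rule le) (simp add: * power_mono xD A[THEN cstar_algebra.cnorm_nonneg])
      have mem: "star ?P x \<otimes>\<^bsub>?P\<^esub> x \<in> carrier ?P"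
        by (rule memI[of _ "(cnorm ?P x)\<^sup>2"])
          (simp_all add: * power_mono xD A[THEN cstar_algebra.cnorm_nonneg], simp add: cstar_product_sel N xD)
      have "cnorm ?P x \<le> sqrt (cnorm ?P (star ?P x \<otimes>\<^bsub>?P\<^esub> x))"
        by (rule le, rule real_le_rsqrt) (use memD(2)[OF mem] * in simp)
      hence "(cnorm ?P x)\<^sup>2 \<le> (sqrt (cnorm ?P (star ?P x \<otimes>\<^bsub>?P\<^esub> x)))\<^sup>2" using nn[OF x] by (rule power_mono)
      thus "(cnorm ?P x)\<^sup>2 \<le> cnorm ?P (star ?P x \<otimes>\<^bsub>?P\<^esub> x)" using nn[OF mem] by simp
    qed
    assume y: "y \<in> carrier ?P"
    note yD = memD[OF y]
    show "x \<oplus>\<^bsub>?P\<^esub> y \<in> carrier ?P" by (rule closed_add[OF x y])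
    show "x \<otimes>\<^bsub>?P\<^esub> y \<in> carrier ?P"
      by (rule memI[of _ "cnorm ?P x * cnorm ?P y"])
        (auto simp: cstar_product_sel(2) N xD yD nn[OF x] A[THEN cstar_algebra.cnorm_nonneg]
          intro!: order_trans[OF A[THEN cstar_algebra.cnorm_mult]] mult_mono)
    show "cnorm ?P (x \<oplus>\<^bsub>?P\<^esub> y) \<le> cnorm ?P x + cnorm ?P y"
      by (rule le)
        (auto simp: cstar_product_sel(4) N xD yD intro!: order_trans[OF A[THEN cstar_algebra.cnorm_triangle]] add_mono)
    show "cnorm ?P (x \<otimes>\<^bsub>?P\<^esub> y) \<le> cnorm ?P x * cnorm ?P y"
      by (rule le)
        (auto simp: cstar_product_sel(2) N xD yD nn[OF x] A[THEN cstar_algebra.cnorm_nonneg]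
          intro!: order_trans[OF A[THEN cstar_algebra.cnorm_mult]] mult_mono)
    show "x \<oplus>\<^bsub>?P\<^esub> y = y \<oplus>\<^bsub>?P\<^esub> x" "c \<odot>\<^bsub>?P\<^esub> (x \<oplus>\<^bsub>?P\<^esub> y) = c \<odot>\<^bsub>?P\<^esub> x \<oplus>\<^bsub>?P\<^esub> c \<odot>\<^bsub>?P\<^esub> y"
      "(c \<odot>\<^bsub>?P\<^esub> x) \<otimes>\<^bsub>?P\<^esub> y = c \<odot>\<^bsub>?P\<^esub> (x \<otimes>\<^bsub>?P\<^esub> y)" "x \<otimes>\<^bsub>?P\<^esub> (c \<odot>\<^bsub>?P\<^esub> y) = c \<odot>\<^bsub>?P\<^esub> (x \<otimes>\<^bsub>?P\<^esub> y)"
      "star ?P (x \<oplus>\<^bsub>?P\<^esub> y) = star ?P x \<oplus>\<^bsub>?P\<^esub> star ?P y" "star ?P (x \<otimes>\<^bsub>?P\<^esub> y) = star ?P y \<otimes>\<^bsub>?P\<^esub> star ?P x"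
      by (rule eqI; auto simp: cstar_product_sel xD yD N nc[THEN normed_cmodule.sm_r]
        A[THEN cstar_algebra.smult_mult_l] A[THEN cstar_algebra.smult_mult_r] A[THEN cstar_algebra.star_add]
        A[THEN cstar_algebra.star_mult] abelian_monoid.a_comm[OF abelian_group.axioms(1)[OF ab]])+
    assume z: "z \<in> carrier ?P"
    note zD = memD[OF z]
    show "(x \<oplus>\<^bsub>?P\<^esub> y) \<oplus>\<^bsub>?P\<^esub> z = x \<oplus>\<^bsub>?P\<^esub> (y \<oplus>\<^bsub>?P\<^esub> z)" "(x \<otimes>\<^bsub>?P\<^esub> y) \<otimes>\<^bsub>?P\<^esub> z = x \<otimes>\<^bsub>?P\<^esub> (y \<otimes>\<^bsub>?P\<^esub> z)"
      "(x \<oplus>\<^bsub>?P\<^esub> y) \<otimes>\<^bsub>?P\<^esub> z = x \<otimes>\<^bsub>?P\<^esub> z \<oplus>\<^bsub>?P\<^esub> y \<otimes>\<^bsub>?P\<^esub> z"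
      "z \<otimes>\<^bsub>?P\<^esub> (x \<oplus>\<^bsub>?P\<^esub> y) = z \<otimes>\<^bsub>?P\<^esub> x \<oplus>\<^bsub>?P\<^esub> z \<otimes>\<^bsub>?P\<^esub> y"
      by (rule eqI; auto simp: cstar_product_sel xD yD zD N A[THEN cstar_algebra.mult_assoc]
        A[THEN cstar_algebra.mult_l_distr] A[THEN cstar_algebra.mult_r_distr]
        abelian_monoid.a_assoc[OF abelian_group.axioms(1)[OF ab]])+
  next
    fix \<sigma> :: "nat \<Rightarrow> 'a \<Rightarrow> 'b"
    assume \<sigma>: "\<And>n. \<sigma> n \<in> carrier ?P"
      and cau: "\<And>e. e > 0 \<Longrightarrow> \<exists>N. \<forall>m\<ge>N. \<forall>n\<ge>N. cnorm ?P (\<sigma> m \<oplus>\<^bsub>?P\<^esub> (- 1) \<odot>\<^bsub>?P\<^esub> \<sigma> n) < e"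
    show "\<exists>l\<in>carrier ?P. (\<lambda>n. cnorm ?P (\<sigma> n \<oplus>\<^bsub>?P\<^esub> (- 1) \<odot>\<^bsub>?P\<^esub> l)) \<longlonglongrightarrow> 0"
    proof -
      have co: "cnorm (A i) (\<sigma> m i \<ominus>\<^bsub>A i\<^esub> \<sigma> n i) \<le> cnorm ?P (\<sigma> m \<oplus>\<^bsub>?P\<^esub> (- 1) \<odot>\<^bsub>?P\<^esub> \<sigma> n)"
        if "i \<in> \<Lambda>" for i m n
        using memD(2)[OF closed(1)[OF \<sigma> closed(2)[OF \<sigma>]] that, of m "- 1" n] memD(1)[OF \<sigma> that] that
        by (simp add: cstar_product_sel(4,5) normed_cmodule.minus_eq[OF nc])
      have "\<exists>l\<in>carrier (A i). (\<lambda>n. cnorm (A i) (\<sigma> n i \<ominus>\<^bsub>A i\<^esub> l)) \<longlonglongrightarrow> 0" if i: "i \<in> \<Lambda>" for i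
      proof -
        interpret cstar_algebra "A i" by (rule A[OF i])
        have "\<exists>N. \<forall>m\<ge>N. \<forall>n\<ge>N. cnorm (A i) (\<sigma> m i \<ominus>\<^bsub>A i\<^esub> \<sigma> n i) < e" if "e > 0" for e
          using cau[OF that] co[OF i] le_less_trans by meson
        hence "ccauchy (\<lambda>n. \<sigma> n i)" using memD(1)[OF \<sigma> i] by (simp add: ccauchy_def)
        thus ?thesis using complete complete_iff by blast
      qed
      then obtain l where l: "\<And>i. i \<in> \<Lambda> \<Longrightarrow> l i \<in> carrier (A i)"
        "\<And>i. i \<in> \<Lambda> \<Longrightarrow> (\<lambda>n. cnorm (A i) (\<sigma> n i \<ominus>\<^bsub>A i\<^esub> l i)) \<longlonglongrightarrow> 0" by metis
      \<comment> \<open>The index N is the same for all coordinates: the comparison index m is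
        chosen for each coordinate separately and disappears from the estimate.\<close>
      have key: "\<exists>N. \<forall>n\<ge>N. \<forall>i\<in>\<Lambda>. cnorm (A i) (\<sigma> n i \<ominus>\<^bsub>A i\<^esub> l i) \<le> e" if e: "e > 0" for e
      proof -
        obtain N where N: "\<forall>m\<ge>N. \<forall>n\<ge>N. cnorm ?P (\<sigma> m \<oplus>\<^bsub>?P\<^esub> (- 1) \<odot>\<^bsub>?P\<^esub> \<sigma> n) < e / 2"
          using cau[of "e / 2"] e by auto
        have "cnorm (A i) (\<sigma> n i \<ominus>\<^bsub>A i\<^esub> l i) \<le> e" if i: "i \<in> \<Lambda>" and n: "n \<ge> N" for i n
        proof -
          have "eventually (\<lambda>m. cnorm (A i) (\<sigma> m i \<ominus>\<^bsub>A i\<^esub> l i) < e / 2) sequentially"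
            using order_tendstoD(2)[OF l(2)[OF i], of "e / 2"] e by simp
          then obtain M where M: "\<forall>m\<ge>M. cnorm (A i) (\<sigma> m i \<ominus>\<^bsub>A i\<^esub> l i) < e / 2"
            by (auto simp: eventually_sequentially)
          define m where "m = max M N"
          have "cnorm (A i) (\<sigma> n i \<ominus>\<^bsub>A i\<^esub> l i) \<le> cnorm (A i) (\<sigma> n i \<ominus>\<^bsub>A i\<^esub> \<sigma> m i) + cnorm (A i) (\<sigma> m i \<ominus>\<^bsub>A i\<^esub> l i)"
            using normed_cmodule.n_minus_triangle[OF nc[OF i] memD(1)[OF \<sigma> i] memD(1)[OF \<sigma> i] l(1)[OF i]] .
          moreover have "cnorm (A i) (\<sigma> m i \<ominus>\<^bsub>A i\<^esub> l i) < e / 2" using M by (simp add: m_def)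
          moreover have "cnorm (A i) (\<sigma> n i \<ominus>\<^bsub>A i\<^esub> \<sigma> m i) < e / 2"
          proof (rule le_less_trans[OF co[OF i]])
            have "N \<le> m" by (simp add: m_def)
            thus "cnorm ?P (\<sigma> n \<oplus>\<^bsub>?P\<^esub> (- 1) \<odot>\<^bsub>?P\<^esub> \<sigma> m) < e / 2" using N n by blast
          qed
          ultimately show ?thesis by simp
        qed
        thus ?thesis by blast
      qed
      define L where "L = restrict l \<Lambda>"
      have LP: "L \<in> carrier ?P"
      proof -
        obtain N where N: "\<forall>n\<ge>N. \<forall>i\<in>\<Lambda>. cnorm (A i) (\<sigma> n i \<ominus>\<^bsub>A i\<^esub> l i) \<le> 1" using key[of 1] by auto
        show ?thesis
        proof (rule memI[of _ "cnorm ?P (\<sigma> N) + 1"])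
          show "L \<in> (\<Pi>\<^sub>E i\<in>\<Lambda>. carrier (A i))" using l(1) by (auto simp: L_def)
          fix i assume i: "i \<in> \<Lambda>"
          have "cnorm (A i) (l i) \<le> cnorm (A i) (\<sigma> N i) + cnorm (A i) (\<sigma> N i \<ominus>\<^bsub>A i\<^esub> l i)"
            by (rule normed_cmodule.n_le_minus[OF nc[OF i] memD(1)[OF \<sigma> i] l(1)[OF i]])
          thus "cnorm (A i) (L i) \<le> cnorm ?P (\<sigma> N) + 1"
            using memD(2)[OF \<sigma> i, of N] N i by (force simp: L_def)
        qed
      qed
      have nnL: "0 \<le> cnorm ?P (\<sigma> n \<oplus>\<^bsub>?P\<^esub> (- 1) \<odot>\<^bsub>?P\<^esub> L)" for n by (rule nn[OF closed(1)[OF \<sigma> closed(2)[OF LP]]])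
      have "(\<lambda>n. cnorm ?P (\<sigma> n \<oplus>\<^bsub>?P\<^esub> (- 1) \<odot>\<^bsub>?P\<^esub> L)) \<longlonglongrightarrow> 0"
      proof (rule LIMSEQ_I)
        fix e :: real assume e: "e > 0"
        obtain N where N: "\<forall>n\<ge>N. \<forall>i\<in>\<Lambda>. cnorm (A i) (\<sigma> n i \<ominus>\<^bsub>A i\<^esub> l i) \<le> e / 2" using key[of "e / 2"] e by auto
        have "cnorm ?P (\<sigma> n \<oplus>\<^bsub>?P\<^esub> (- 1) \<odot>\<^bsub>?P\<^esub> L) \<le> e / 2" if n: "n \<ge> N" for n
        proof (rule le)
          fix i assume i: "i \<in> \<Lambda>"
          have "cnorm (A i) (\<sigma> n i \<ominus>\<^bsub>A i\<^esub> l i) \<le> e / 2" using N n i by blast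
          thus "cnorm (A i) ((\<sigma> n \<oplus>\<^bsub>?P\<^esub> (- 1) \<odot>\<^bsub>?P\<^esub> L) i) \<le> e / 2"
            unfolding normed_cmodule.minus_eq[OF nc[OF i] memD(1)[OF \<sigma> i] l(1)[OF i]]
            using i by (simp add: cstar_product_sel(4,5) L_def)
        qed
        thus "\<exists>no. \<forall>n\<ge>no. norm (cnorm ?P (\<sigma> n \<oplus>\<^bsub>?P\<^esub> (- 1) \<odot>\<^bsub>?P\<^esub> L) - 0) < e"
          using e nnL by (intro exI[of _ N]) (force simp: abs_of_nonneg)
      qed
      thus ?thesis using LP by blast
    qed
  qed
qed

subsection \<open>Unitization\<close>

text \<open>Taking the maximum with the modulus of the scalar part yields a C*-norm even if \<open>A\<close> is unital.\<close>

definition unitization :: "'a cstar \<Rightarrow> ('a \<times> complex) cstar" where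
  "unitization A = (adjoin_unit A)\<lparr>cnorm := \<lambda>x. max (cnorm (adjoin_unit A) x) (cmod (snd x))\<rparr>"

lemma unitization_sel:
  "carrier (unitization A) = carrier A \<times> UNIV"
  "x \<otimes>\<^bsub>unitization A\<^esub> y = (fst x \<otimes>\<^bsub>A\<^esub> fst y \<oplus>\<^bsub>A\<^esub> snd x \<odot>\<^bsub>A\<^esub> fst y \<oplus>\<^bsub>A\<^esub> snd y \<odot>\<^bsub>A\<^esub> fst x, snd x * snd y)"
  "\<one>\<^bsub>unitization A\<^esub> = (\<zero>\<^bsub>A\<^esub>, 1)"
  "\<zero>\<^bsub>unitization A\<^esub> = (\<zero>\<^bsub>A\<^esub>, 0)"
  "x \<oplus>\<^bsub>unitization A\<^esub> y = (fst x \<oplus>\<^bsub>A\<^esub> fst y, snd x + snd y)"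
  "c \<odot>\<^bsub>unitization A\<^esub> x = (c \<odot>\<^bsub>A\<^esub> fst x, c * snd x)"
  "star (unitization A) x = (star A (fst x), cnj (snd x))"
  by (simp_all add: unitization_def adjoin_unit_def split_beta)

context cstar_algebra
begin

definition act :: "'a \<times> complex \<Rightarrow> 'a \<Rightarrow> 'a" where
  "act x b = fst x \<otimes> b \<oplus> snd x \<odot> b"

definition opnorm :: "'a \<times> complex \<Rightarrow> real" where
  "opnorm x = (SUP b\<in>{b \<in> carrier A. cnorm A b \<le> 1}. cnorm A (act x b))"

lemma cnorm_adjoin_unit: "cnorm (adjoin_unit A) x = opnorm x"
  by (simp add: adjoin_unit_def opnorm_def act_def split_beta)

lemma cnorm_unitization: "cnorm (unitization A) x = max (opnorm x) (cmod (snd x))"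
  by (simp add: unitization_def cnorm_adjoin_unit)

lemmas alg_simps = mult_closed star_closed M.a_ac mult_l_distr mult_r_distr smult_mult_l smult_mult_r
  sm_r sm_assoc mult_assoc sm_l

lemma act_closed [simp]: "fst x \<in> carrier A \<Longrightarrow> b \<in> carrier A \<Longrightarrow> act x b \<in> carrier A"
  by (simp add: act_def mult_closed)

lemma act_add: "fst x \<in> carrier A \<Longrightarrow> fst y \<in> carrier A \<Longrightarrow> b \<in> carrier A \<Longrightarrow>
    act (x \<oplus>\<^bsub>unitization A\<^esub> y) b = act x b \<oplus> act y b"
  by (simp add: act_def unitization_sel alg_simps)

lemma act_smult: "fst x \<in> carrier A \<Longrightarrow> b \<in> carrier A \<Longrightarrow> act (c \<odot>\<^bsub>unitization A\<^esub> x) b = c \<odot> act x b"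
  by (simp add: act_def unitization_sel alg_simps)

lemma act_smult_right: "fst x \<in> carrier A \<Longrightarrow> b \<in> carrier A \<Longrightarrow> act x (c \<odot> b) = c \<odot> act x b"
  by (simp add: act_def alg_simps mult.commute)

lemma act_add_right: "fst x \<in> carrier A \<Longrightarrow> b \<in> carrier A \<Longrightarrow> d \<in> carrier A \<Longrightarrow> act x (b \<oplus> d) = act x b \<oplus> act x d"
  by (simp add: act_def alg_simps)

lemma act_mult: "fst x \<in> carrier A \<Longrightarrow> fst y \<in> carrier A \<Longrightarrow> b \<in> carrier A \<Longrightarrow>
    act (x \<otimes>\<^bsub>unitization A\<^esub> y) b = act x (act y b)"
  by (simp add: act_def unitization_sel alg_simps)

lemma act_mult_right: "fst x \<in> carrier A \<Longrightarrow> b \<in> carrier A \<Longrightarrow> d \<in> carrier A \<Longrightarrow> act x (b \<otimes> d) = act x b \<otimes> d"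
  by (simp add: act_def alg_simps)

text \<open>Moving x to the other factor replaces it by its adjoint, as for operators on a Hilbert
  space; the C*-identity of the operator norm rests on this.\<close>

lemma star_act_mult: "fst x \<in> carrier A \<Longrightarrow> b \<in> carrier A \<Longrightarrow> d \<in> carrier A \<Longrightarrow>
    star A (act x b) \<otimes> d = star A b \<otimes> act (star (unitization A) x) d"
  by (simp add: act_def unitization_sel alg_simps star_add star_mult star_smult)

lemma cnorm_act_le:
  assumes "fst x \<in> carrier A" "b \<in> carrier A"
  shows "cnorm A (act x b) \<le> (cnorm A (fst x) + cmod (snd x)) * cnorm A b"
  using cnorm_triangle[of "fst x \<otimes> b" "snd x \<odot> b"] cnorm_mult[of "fst x" b] assms
  by (simp add: act_def mult_closed cnorm_smult distrib_right)

lemma opnorm_upper: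
  assumes "fst x \<in> carrier A" "b \<in> carrier A" "cnorm A b \<le> 1"
  shows "cnorm A (act x b) \<le> opnorm x"
  unfolding opnorm_def
proof (rule cSUP_upper)
  show "bdd_above ((\<lambda>b. cnorm A (act x b)) ` {b \<in> carrier A. cnorm A b \<le> 1})"
  proof (rule bdd_aboveI2[where M = "cnorm A (fst x) + cmod (snd x)"])
    fix b assume b: "b \<in> {b \<in> carrier A. cnorm A b \<le> 1}"
    have "(cnorm A (fst x) + cmod (snd x)) * cnorm A b \<le> (cnorm A (fst x) + cmod (snd x)) * 1"
      using b assms by (intro mult_left_mono) (auto intro: add_nonneg_nonneg cnorm_nonneg)
    thus "cnorm A (act x b) \<le> cnorm A (fst x) + cmod (snd x)"
      using cnorm_act_le[of x b] assms b by simp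
  qed
qed (use assms in simp)

lemma opnorm_least:
  assumes "\<And>b. b \<in> carrier A \<Longrightarrow> cnorm A b \<le> 1 \<Longrightarrow> cnorm A (act x b) \<le> m"
  shows "opnorm x \<le> m"
  unfolding opnorm_def using assms by (intro cSUP_least) (auto intro!: exI[of _ \<zero>])

lemma act_zero_right: "fst x \<in> carrier A \<Longrightarrow> act x \<zero> = \<zero>"
  by (simp add: act_def mult_zero)

lemma opnorm_nonneg: "fst x \<in> carrier A \<Longrightarrow> 0 \<le> opnorm x"
  using opnorm_upper[of x \<zero>] by (simp add: act_zero_right)

lemma cnorm_act_opnorm:
  assumes x: "fst x \<in> carrier A" and b: "b \<in> carrier A"
  shows "cnorm A (act x b) \<le> opnorm x * cnorm A b"
proof (cases "cnorm A b = 0")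
  case True
  hence "b = \<zero>" using b cnorm_eq_0_iff by simp
  thus ?thesis using x by (simp add: act_zero_right)
next
  case False
  define m where "m = cnorm A b"
  have m: "m > 0" using False cnorm_nonneg[OF b] by (simp add: m_def)
  have "cnorm A (complex_of_real (1 / m) \<odot> b) = 1" using b m by (simp add: cnorm_smult m_def norm_divide)
  hence "cnorm A (act x (complex_of_real (1 / m) \<odot> b)) \<le> opnorm x" using x b by (intro opnorm_upper) auto
  hence "(1 / m) * cnorm A (act x b) \<le> opnorm x" using x b m by (simp add: act_smult_right cnorm_smult norm_divide)
  thus ?thesis using m by (simp add: m_def[symmetric] field_simps)
qed

lemma opnorm_le: "fst x \<in> carrier A \<Longrightarrow> opnorm x \<le> cnorm A (fst x) + cmod (snd x)"
proof (rule opnorm_least)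
  fix b assume x: "fst x \<in> carrier A" and b: "b \<in> carrier A" "cnorm A b \<le> 1"
  have "(cnorm A (fst x) + cmod (snd x)) * cnorm A b \<le> (cnorm A (fst x) + cmod (snd x)) * 1"
    using b x by (intro mult_left_mono) (auto intro: add_nonneg_nonneg cnorm_nonneg)
  thus "cnorm A (act x b) \<le> cnorm A (fst x) + cmod (snd x)" using cnorm_act_le[OF x b(1)] by simp
qed

lemma opnorm_triangle:
  assumes "fst x \<in> carrier A" "fst y \<in> carrier A"
  shows "opnorm (x \<oplus>\<^bsub>unitization A\<^esub> y) \<le> opnorm x + opnorm y"
proof (rule opnorm_least)
  fix b assume b: "b \<in> carrier A" "cnorm A b \<le> 1"
  have "cnorm A (act x b \<oplus> act y b) \<le> cnorm A (act x b) + cnorm A (act y b)"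
    using assms b by (intro cnorm_triangle) auto
  also have "\<dots> \<le> opnorm x + opnorm y" using assms b by (intro add_mono opnorm_upper)
  finally show "cnorm A (act (x \<oplus>\<^bsub>unitization A\<^esub> y) b) \<le> opnorm x + opnorm y" using assms b by (simp add: act_add)
qed

lemma opnorm_smult:
  assumes x: "fst x \<in> carrier A"
  shows "opnorm (c \<odot>\<^bsub>unitization A\<^esub> x) = cmod c * opnorm x"
proof -
  have le: "opnorm (c \<odot>\<^bsub>unitization A\<^esub> x) \<le> cmod c * opnorm x" if x: "fst x \<in> carrier A" for c x
    using x by (intro opnorm_least) (auto simp: act_smult cnorm_smult intro!: mult_left_mono opnorm_upper)
  show ?thesis
  proof (cases "c = 0")
    case True
    have "fst (c \<odot>\<^bsub>unitization A\<^esub> x) \<in> carrier A" using x by (simp add: unitization_sel)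
    thus ?thesis using True le[OF x, of c] opnorm_nonneg by fastforce
  next
    case False
    have "opnorm x = opnorm (inverse c \<odot>\<^bsub>unitization A\<^esub> (c \<odot>\<^bsub>unitization A\<^esub> x))"
      using x False by (cases x) (simp add: unitization_sel sm_assoc mult.assoc[symmetric])
    also have "\<dots> \<le> cmod (inverse c) * opnorm (c \<odot>\<^bsub>unitization A\<^esub> x)"
      using x by (intro le) (simp add: unitization_sel)
    finally have "cmod c * opnorm x \<le> opnorm (c \<odot>\<^bsub>unitization A\<^esub> x)"
      using False by (simp add: norm_inverse norm_divide field_simps)
    thus ?thesis using le[OF x, of c] by simp
  qed
qed

lemma opnorm_mult:
  assumes "fst x \<in> carrier A" "fst y \<in> carrier A"
  shows "opnorm (x \<otimes>\<^bsub>unitization A\<^esub> y) \<le> opnorm x * opnorm y"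
proof (rule opnorm_least)
  fix b assume b: "b \<in> carrier A" "cnorm A b \<le> 1"
  have "cnorm A (act x (act y b)) \<le> opnorm x * cnorm A (act y b)"
    using assms b by (intro cnorm_act_opnorm) auto
  also have "\<dots> \<le> opnorm x * opnorm y"
    using assms b by (intro mult_left_mono opnorm_upper opnorm_nonneg)
  finally show "cnorm A (act (x \<otimes>\<^bsub>unitization A\<^esub> y) b) \<le> opnorm x * opnorm y"
    using assms b by (simp add: act_mult)
qed

text \<open>For b in the unit ball the squared norm of x b is the norm of b* (x* x b), at most that
  of x* x. So the norm of x is at most that of x*, by symmetry they agree, and submultiplicativity
  gives the other inequality.\<close>

lemma opnorm_star_mult:
  assumes x: "fst x \<in> carrier A"
  shows "opnorm (star (unitization A) x \<otimes>\<^bsub>unitization A\<^esub> x) = (opnorm x)\<^sup>2"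
proof -
  let ?s = "star (unitization A)"
  have sx: "fst (?s x) \<in> carrier A" if "fst x \<in> carrier A" for x using that by (simp add: unitization_sel star_closed)
  have m: "fst (?s x \<otimes>\<^bsub>unitization A\<^esub> x) \<in> carrier A" if "fst x \<in> carrier A" for x
    using that by (simp add: unitization_sel star_closed mult_closed)
  have sq: "(opnorm x)\<^sup>2 \<le> opnorm (?s x \<otimes>\<^bsub>unitization A\<^esub> x)" if x: "fst x \<in> carrier A" for x
  proof -
    have "opnorm x \<le> sqrt (opnorm (?s x \<otimes>\<^bsub>unitization A\<^esub> x))"
    proof (rule opnorm_least, rule real_le_rsqrt)
      fix b assume b: "b \<in> carrier A" "cnorm A b \<le> 1"
      have "(cnorm A (act x b))\<^sup>2 = cnorm A (star A (act x b) \<otimes> act x b)"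
        using x b by (simp add: cnorm_star_mult)
      also have "\<dots> = cnorm A (star A b \<otimes> act (?s x \<otimes>\<^bsub>unitization A\<^esub> x) b)"
        using x b sx by (simp add: star_act_mult act_mult)
      also have "\<dots> \<le> cnorm A (star A b) * cnorm A (act (?s x \<otimes>\<^bsub>unitization A\<^esub> x) b)"
        using x b m by (intro cnorm_mult) (auto simp: star_closed)
      also have "\<dots> \<le> 1 * opnorm (?s x \<otimes>\<^bsub>unitization A\<^esub> x)"
        using x b m by (intro mult_mono opnorm_upper) (auto simp: n_star cnorm_nonneg)
      finally show "(cnorm A (act x b))\<^sup>2 \<le> opnorm (?s x \<otimes>\<^bsub>unitization A\<^esub> x)" by simp
    qed
    hence "(opnorm x)\<^sup>2 \<le> (sqrt (opnorm (?s x \<otimes>\<^bsub>unitization A\<^esub> x)))\<^sup>2"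
      using x by (intro power_mono opnorm_nonneg)
    thus ?thesis using opnorm_nonneg[OF m[OF x]] by simp
  qed
  have le: "opnorm x \<le> opnorm (?s x)" if x: "fst x \<in> carrier A" for x
  proof (cases "opnorm x = 0")
    case False
    have "opnorm x * opnorm x \<le> opnorm (?s x) * opnorm x"
      using sq[OF x] opnorm_mult[OF sx[OF x] x] by (simp add: power2_eq_square)
    thus ?thesis using False opnorm_nonneg[OF x] by simp
  qed (use opnorm_nonneg[OF sx[OF x]] in simp)
  have "opnorm (?s x) \<le> opnorm (?s (?s x))" by (rule le[OF sx[OF x]])
  hence "opnorm (?s x) \<le> opnorm x" using x by (simp add: unitization_sel star_star)
  hence "opnorm (?s x \<otimes>\<^bsub>unitization A\<^esub> x) \<le> opnorm x * opnorm x"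
    using opnorm_mult[OF sx[OF x] x] mult_right_mono[OF _ opnorm_nonneg[OF x], of "opnorm (?s x)" "opnorm x"] by linarith
  thus ?thesis using sq[OF x] by (simp add: power2_eq_square)
qed

text \<open>The lower bound is tested on \<open>star A a\<close>, since a a* has norm the square of
  that of a.\<close>

lemma opnorm_zero_scalar:
  assumes a: "a \<in> carrier A" shows "opnorm (a, 0) = cnorm A a"
proof (rule antisym)
  show "opnorm (a, 0) \<le> cnorm A a" using opnorm_le[of "(a, 0)"] a by simp
  have "(cnorm A a)\<^sup>2 = cnorm A (a \<otimes> star A a)"
    using cnorm_star_mult[of "star A a"] a by (simp add: star_closed star_star n_star)
  also have "\<dots> = cnorm A (act (a, 0) (star A a))" using a by (simp add: act_def star_closed mult_closed M.r_zero)
  also have "\<dots> \<le> opnorm (a, 0) * cnorm A a"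
    using cnorm_act_opnorm[of "(a, 0)" "star A a"] a by (simp add: star_closed n_star)
  finally have *: "cnorm A a * cnorm A a \<le> opnorm (a, 0) * cnorm A a" by (simp add: power2_eq_square)
  show "cnorm A a \<le> opnorm (a, 0)"
  proof (cases "cnorm A a = 0")
    case False thus ?thesis using * cnorm_nonneg[OF a] by simp
  qed (use opnorm_nonneg[of "(a, 0)"] a in simp)
qed

text \<open>The norm is equivalent to the sum of the norms of both components; definiteness and
  completeness of the unitization are read off from this. The first bound splits off the scalar part
  as (0, - s).\<close>

lemma unitization_norm_bounds:
  assumes "a \<in> carrier A"
  shows "cnorm A a \<le> 2 * cnorm (unitization A) (a, s)" "cmod s \<le> cnorm (unitization A) (a, s)"
    "cnorm (unitization A) (a, s) \<le> cnorm A a + cmod s"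
proof -
  show "cmod s \<le> cnorm (unitization A) (a, s)" by (simp add: cnorm_unitization)
  show "cnorm (unitization A) (a, s) \<le> cnorm A a + cmod s"
    using opnorm_le[of "(a, s)"] assms cnorm_nonneg[OF assms] by (simp add: cnorm_unitization)
  have "(a, 0) = (a, s) \<oplus>\<^bsub>unitization A\<^esub> (\<zero>, - s)" using assms by (simp add: unitization_sel M.r_zero)
  hence "opnorm (a, 0) \<le> opnorm (a, s) + opnorm (\<zero>, - s)"
    using opnorm_triangle[of "(a, s)" "(\<zero>, - s)"] assms by (simp only: fst_conv zero_in)
  hence "cnorm A a \<le> opnorm (a, s) + opnorm (\<zero>, - s)" using assms by (simp add: opnorm_zero_scalar)
  moreover have "opnorm (\<zero>, - s) \<le> cmod s" using opnorm_le[of "(\<zero>, - s)"] by simp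
  ultimately show "cnorm A a \<le> 2 * cnorm (unitization A) (a, s)" by (simp add: cnorm_unitization)
qed

theorem unitization_cstar_algebra: "cstar_algebra (unitization A)"
proof (rule cstar_algebraI)
  let ?V = "unitization A"
  fix x y z :: "'a \<times> complex" and c d
  show "\<zero>\<^bsub>?V\<^esub> \<in> carrier ?V" by (simp add: unitization_sel)
  assume x: "x \<in> carrier ?V"
  hence fx: "fst x \<in> carrier A" by (auto simp: unitization_sel)
  show "\<zero>\<^bsub>?V\<^esub> \<oplus>\<^bsub>?V\<^esub> x = x" "c \<odot>\<^bsub>?V\<^esub> x \<in> carrier ?V" "0 \<odot>\<^bsub>?V\<^esub> x = \<zero>\<^bsub>?V\<^esub>" "1 \<odot>\<^bsub>?V\<^esub> x = x"
    "(c + d) \<odot>\<^bsub>?V\<^esub> x = c \<odot>\<^bsub>?V\<^esub> x \<oplus>\<^bsub>?V\<^esub> d \<odot>\<^bsub>?V\<^esub> x" "(c * d) \<odot>\<^bsub>?V\<^esub> x = c \<odot>\<^bsub>?V\<^esub> (d \<odot>\<^bsub>?V\<^esub> x)"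
    "star ?V x \<in> carrier ?V" "star ?V (star ?V x) = x" "star ?V (c \<odot>\<^bsub>?V\<^esub> x) = cnj c \<odot>\<^bsub>?V\<^esub> star ?V x"
    using fx by (simp_all add: unitization_sel star_closed star_star star_smult sm_l sm_assoc M.l_zero distrib_right)
  show "0 \<le> cnorm ?V x" by (simp add: cnorm_unitization le_max_iff_disj)
  show "cnorm ?V x = 0 \<longleftrightarrow> x = \<zero>\<^bsub>?V\<^esub>"
  proof
    assume 0: "cnorm ?V x = 0"
    obtain a s where xs: "x = (a, s)" by (cases x)
    have a: "a \<in> carrier A" using fx xs by simp
    have "cmod s \<le> 0" "cnorm A a \<le> 0"
      using unitization_norm_bounds(1,2)[OF a, of s] 0 unfolding xs by simp_all
    thus "x = \<zero>\<^bsub>?V\<^esub>" using cnorm_nonneg[OF a] cnorm_eq_0_iff[OF a] by (simp add: xs unitization_sel)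
  next
    assume "x = \<zero>\<^bsub>?V\<^esub>" thus "cnorm ?V x = 0" by (simp add: cnorm_unitization unitization_sel opnorm_zero_scalar)
  qed
  show "cnorm ?V (c \<odot>\<^bsub>?V\<^esub> x) = cmod c * cnorm ?V x"
    using opnorm_smult[OF fx, of c]
    by (simp add: cnorm_unitization max_mult_distrib_left) (simp add: unitization_sel norm_mult)
  have pm: "(max p q)\<^sup>2 = max (p\<^sup>2) (q\<^sup>2)" if "0 \<le> p" "0 \<le> q" for p q :: real
    using that power_mono[of p q 2] power_mono[of q p 2] by (cases "p \<le> q") (simp_all add: max_def)
  show "cnorm ?V (star ?V x \<otimes>\<^bsub>?V\<^esub> x) = (cnorm ?V x)\<^sup>2"
    using opnorm_star_mult[OF fx] pm[OF opnorm_nonneg[OF fx] norm_ge_zero[of "snd x"]]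
    by (simp add: cnorm_unitization) (simp add: unitization_sel norm_mult power2_eq_square)
  assume y: "y \<in> carrier ?V"
  hence fy: "fst y \<in> carrier A" by (auto simp: unitization_sel)
  show "x \<oplus>\<^bsub>?V\<^esub> y \<in> carrier ?V" "x \<oplus>\<^bsub>?V\<^esub> y = y \<oplus>\<^bsub>?V\<^esub> x" "c \<odot>\<^bsub>?V\<^esub> (x \<oplus>\<^bsub>?V\<^esub> y) = c \<odot>\<^bsub>?V\<^esub> x \<oplus>\<^bsub>?V\<^esub> c \<odot>\<^bsub>?V\<^esub> y"
    "x \<otimes>\<^bsub>?V\<^esub> y \<in> carrier ?V" "(c \<odot>\<^bsub>?V\<^esub> x) \<otimes>\<^bsub>?V\<^esub> y = c \<odot>\<^bsub>?V\<^esub> (x \<otimes>\<^bsub>?V\<^esub> y)"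
    "x \<otimes>\<^bsub>?V\<^esub> (c \<odot>\<^bsub>?V\<^esub> y) = c \<odot>\<^bsub>?V\<^esub> (x \<otimes>\<^bsub>?V\<^esub> y)"
    "star ?V (x \<oplus>\<^bsub>?V\<^esub> y) = star ?V x \<oplus>\<^bsub>?V\<^esub> star ?V y" "star ?V (x \<otimes>\<^bsub>?V\<^esub> y) = star ?V y \<otimes>\<^bsub>?V\<^esub> star ?V x"
    using fx fy by (simp_all add: unitization_sel alg_simps star_add star_mult star_smult algebra_simps)
  show "cnorm ?V (x \<oplus>\<^bsub>?V\<^esub> y) \<le> cnorm ?V x + cnorm ?V y"
    using opnorm_triangle[OF fx fy] norm_triangle_ineq[of "snd x" "snd y"]
    by (simp add: cnorm_unitization) (auto simp: unitization_sel max_def)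
  show "cnorm ?V (x \<otimes>\<^bsub>?V\<^esub> y) \<le> cnorm ?V x * cnorm ?V y"
  proof -
    have "opnorm x * opnorm y \<le> cnorm ?V x * cnorm ?V y"
      using opnorm_nonneg[OF fx] opnorm_nonneg[OF fy] by (intro mult_mono) (auto simp: cnorm_unitization)
    moreover have "cmod (snd x) * cmod (snd y) \<le> cnorm ?V x * cnorm ?V y"
      by (intro mult_mono) (auto simp: cnorm_unitization le_max_iff_disj)
    ultimately show ?thesis using opnorm_mult[OF fx fy]
      by (simp only: cnorm_unitization[of "x \<otimes>\<^bsub>?V\<^esub> y"]) (simp add: unitization_sel(2) norm_mult)
  qed
  assume z: "z \<in> carrier ?V"
  hence fz: "fst z \<in> carrier A" by (auto simp: unitization_sel)
  show "(x \<oplus>\<^bsub>?V\<^esub> y) \<oplus>\<^bsub>?V\<^esub> z = x \<oplus>\<^bsub>?V\<^esub> (y \<oplus>\<^bsub>?V\<^esub> z)" "(x \<otimes>\<^bsub>?V\<^esub> y) \<otimes>\<^bsub>?V\<^esub> z = x \<otimes>\<^bsub>?V\<^esub> (y \<otimes>\<^bsub>?V\<^esub> z)"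
    "(x \<oplus>\<^bsub>?V\<^esub> y) \<otimes>\<^bsub>?V\<^esub> z = x \<otimes>\<^bsub>?V\<^esub> z \<oplus>\<^bsub>?V\<^esub> y \<otimes>\<^bsub>?V\<^esub> z"
    "z \<otimes>\<^bsub>?V\<^esub> (x \<oplus>\<^bsub>?V\<^esub> y) = z \<otimes>\<^bsub>?V\<^esub> x \<oplus>\<^bsub>?V\<^esub> z \<otimes>\<^bsub>?V\<^esub> y"
    using fx fy fz by (simp_all add: unitization_sel alg_simps algebra_simps)
next
  let ?V = "unitization A"
  fix \<sigma> :: "nat \<Rightarrow> 'a \<times> complex"
  assume \<sigma>: "\<And>n. \<sigma> n \<in> carrier ?V"
    and cau: "\<And>e. e > 0 \<Longrightarrow> \<exists>N. \<forall>m\<ge>N. \<forall>n\<ge>N. cnorm ?V (\<sigma> m \<oplus>\<^bsub>?V\<^esub> (- 1) \<odot>\<^bsub>?V\<^esub> \<sigma> n) < e"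
  define a where "a = (\<lambda>n. fst (\<sigma> n))"
  define s where "s = (\<lambda>n. snd (\<sigma> n))"
  have aA: "a n \<in> carrier A" for n using \<sigma>[of n] by (auto simp: a_def unitization_sel)
  have diff: "\<sigma> m \<oplus>\<^bsub>?V\<^esub> (- 1) \<odot>\<^bsub>?V\<^esub> (l, t) = (a m \<oplus> (- 1) \<odot> l, s m - t)" for m l t
    by (simp add: unitization_sel a_def s_def)
  have diff': "\<sigma> m \<oplus>\<^bsub>?V\<^esub> (- 1) \<odot>\<^bsub>?V\<^esub> \<sigma> n = (a m \<oplus> (- 1) \<odot> a n, s m - s n)" for m n
    using diff[of m "a n" "s n"] by (simp add: a_def s_def)
  have b: "cnorm A (a m \<oplus> (- 1) \<odot> a n) \<le> 2 * cnorm ?V (\<sigma> m \<oplus>\<^bsub>?V\<^esub> (- 1) \<odot>\<^bsub>?V\<^esub> \<sigma> n)"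
    "cmod (s m - s n) \<le> cnorm ?V (\<sigma> m \<oplus>\<^bsub>?V\<^esub> (- 1) \<odot>\<^bsub>?V\<^esub> \<sigma> n)" for m n
    unfolding diff' by (rule unitization_norm_bounds; simp add: aA)+
  have "\<exists>N. \<forall>m\<ge>N. \<forall>n\<ge>N. cnorm A (a m \<oplus> (- 1) \<odot> a n) < e" if e: "e > 0" for e
  proof -
    obtain N where N: "\<forall>m\<ge>N. \<forall>n\<ge>N. cnorm ?V (\<sigma> m \<oplus>\<^bsub>?V\<^esub> (- 1) \<odot>\<^bsub>?V\<^esub> \<sigma> n) < e / 2"
      using cau[of "e / 2"] e by auto
    have "cnorm A (a m \<oplus> (- 1) \<odot> a n) < e" if "m \<ge> N" "n \<ge> N" for m n
    proof -
      have "cnorm ?V (\<sigma> m \<oplus>\<^bsub>?V\<^esub> (- 1) \<odot>\<^bsub>?V\<^esub> \<sigma> n) < e / 2" using N that by blast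
      thus ?thesis using b(1)[of m n] by linarith
    qed
    thus ?thesis by blast
  qed
  then obtain l where l: "l \<in> carrier A" "(\<lambda>n. cnorm A (a n \<oplus> (- 1) \<odot> l)) \<longlonglongrightarrow> 0"
    using completeE[of a] aA by blast
  have "Cauchy s"
    unfolding Cauchy_def dist_norm using cau b(2) by (meson le_less_trans)
  then obtain t where t: "s \<longlonglongrightarrow> t" using Cauchy_convergent convergentD by blast
  have "(\<lambda>n. cnorm ?V (\<sigma> n \<oplus>\<^bsub>?V\<^esub> (- 1) \<odot>\<^bsub>?V\<^esub> (l, t))) \<longlonglongrightarrow> 0"
  proof (rule tendsto_sandwich[OF _ _ tendsto_const])
    have "(\<lambda>n. cmod (s n - t)) \<longlonglongrightarrow> 0" using t by (simp add: LIM_zero tendsto_norm_zero)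
    from tendsto_add[OF l(2) this] show "(\<lambda>n. cnorm A (a n \<oplus> (- 1) \<odot> l) + cmod (s n - t)) \<longlonglongrightarrow> 0" by simp
    show "\<forall>\<^sub>F n in sequentially. 0 \<le> cnorm ?V (\<sigma> n \<oplus>\<^bsub>?V\<^esub> (- 1) \<odot>\<^bsub>?V\<^esub> (l, t))"
      by (simp add: cnorm_unitization le_max_iff_disj)
    show "\<forall>\<^sub>F n in sequentially. cnorm ?V (\<sigma> n \<oplus>\<^bsub>?V\<^esub> (- 1) \<odot>\<^bsub>?V\<^esub> (l, t))
        \<le> cnorm A (a n \<oplus> (- 1) \<odot> l) + cmod (s n - t)"
      unfolding diff by (intro always_eventually allI unitization_norm_bounds(3)) (simp add: aA l)
  qed
  thus "\<exists>l\<in>carrier ?V. (\<lambda>n. cnorm ?V (\<sigma> n \<oplus>\<^bsub>?V\<^esub> (- 1) \<odot>\<^bsub>?V\<^esub> l)) \<longlonglongrightarrow> 0"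
    using l(1) by (auto simp: unitization_sel intro!: bexI[of _ "(l, t)"])
qed

text \<open>If the operator norm of \<open>a + s 1\<close> were smaller than the modulus of \<open>s\<close>, then \<open>a\<close> would be
  invertible modulo scalars and the fixed point below would be a left unit.\<close>

lemma nonunital_opnorm_ge:
  assumes nu: "\<not> unital A" and a: "a \<in> carrier A"
  shows "cmod s \<le> opnorm (a, s)"
proof (rule ccontr)
  assume less: "\<not> cmod s \<le> opnorm (a, s)"
  have on: "0 \<le> opnorm (a, s)" using a by (intro opnorm_nonneg) simp
  have s: "s \<noteq> 0" using less on by auto
  define y where "y = inverse s \<odot>\<^bsub>unitization A\<^esub> (a, s)"
  have y: "fst y \<in> carrier A" "snd y = 1" using a s by (simp_all add: y_def unitization_sel)
  have "opnorm y = opnorm (a, s) / cmod s"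
    using opnorm_smult[of "(a, s)" "inverse s"] a unfolding y_def norm_inverse by (simp add: divide_inverse mult.commute)
  hence k: "opnorm y < 1" using less s by simp
  \<comment> \<open>With y = a' + 1, where a' = s^-1 a, the map is b -> y b - a', so f e = e means
    a' e = a'. It is a contraction because y has operator norm below 1.\<close>
  define f where "f = (\<lambda>b. act y b \<oplus> (- 1) \<odot> fst y)"
  have fc: "f b \<in> carrier A" if "b \<in> carrier A" for b using that y by (simp add: f_def)
  have fd: "f b \<ominus> f d = act y (b \<ominus> d)" if b: "b \<in> carrier A" "d \<in> carrier A" for b d
  proof -
    have 1: "f b \<ominus> f d = (act y b \<oplus> (- 1) \<odot> act y d) \<oplus> ((- 1) \<odot> fst y \<oplus> fst y)"
      using b y fc by (simp add: minus_eq f_def sm_r sm_assoc M.a_ac del: neg_add add_neg)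
    show ?thesis unfolding 1 using b y by (simp add: minus_eq act_add_right act_smult_right M.r_zero)
  qed
  obtain e where e: "e \<in> carrier A" "f e = e"
  proof (rule Metric_space.Banach_fixedpoint_thm[OF metric complete, of f "opnorm y"])
    show "carrier A \<noteq> {}" using zero_in by blast
    show "f \<in> carrier A \<rightarrow> carrier A" using fc by blast
    show "cdist A (f b) (f d) \<le> opnorm y * cdist A b d" if "b \<in> carrier A" "d \<in> carrier A" for b d
      using that fc fd[OF that] cnorm_act_opnorm[OF y(1), of "b \<ominus> d"] by (simp add: cdist_def minus_in)
  qed (use k in auto)
  have left: "e \<otimes> b = b" if b: "b \<in> carrier A" for b
  proof -
    have yb: "act y b = fst y \<otimes> b \<oplus> b" using b y by (simp add: act_def)
    have "e \<otimes> b = f e \<otimes> b" using e by simp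
    also have "\<dots> = act y (e \<otimes> b) \<oplus> (- 1) \<odot> (fst y \<otimes> b)"
      using e(1) b y by (simp add: f_def act_mult_right mult_l_distr smult_mult_l)
    finally have eb: "e \<otimes> b = act y (e \<otimes> b) \<oplus> (- 1) \<odot> (fst y \<otimes> b)" .
    \<comment> \<open>From a' e = a' follows a' (b - e b) = 0, that is y d = d; as y has operator
      norm below 1, d vanishes.\<close>
    define d where "d = b \<ominus> e \<otimes> b"
    have d: "d \<in> carrier A" using b e by (simp add: d_def minus_in mult_closed)
    have ebc: "e \<otimes> b \<in> carrier A" "fst y \<otimes> b \<in> carrier A" using b e y by (simp_all add: mult_closed)
    have "d = b \<oplus> (- 1) \<odot> (act y (e \<otimes> b) \<oplus> (- 1) \<odot> (fst y \<otimes> b))"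
      using eb b ebc by (simp add: d_def minus_eq)
    also have "\<dots> = (fst y \<otimes> b \<oplus> b) \<oplus> (- 1) \<odot> act y (e \<otimes> b)"
      using b ebc y by (simp add: sm_r sm_assoc M.a_ac)
    also have "\<dots> = act y d"
      using b ebc y by (simp add: d_def minus_eq act_add_right act_smult_right yb)
    finally have "cnorm A d \<le> opnorm y * cnorm A d" using cnorm_act_opnorm[OF y(1) d] by simp
    hence "cnorm A d = 0"
      using mult_strict_right_mono[OF k, of "cnorm A d"] cnorm_nonneg[OF d] by (cases "cnorm A d = 0") auto
    hence "b \<ominus> e \<otimes> b = \<zero>" using d cnorm_eq_0_iff by (simp add: d_def)
    thus ?thesis using b ebc by (simp add: minus_eq eq_iff_minus)
  qed
  \<comment> \<open>Taking adjoints turns the left unit e into the right unit e*, and a left and a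
    right unit coincide.\<close>
  have right: "b \<otimes> star A e = b" if b: "b \<in> carrier A" for b
    using arg_cong[OF left[OF star_closed[OF b]], of "star A"] b e by (simp add: star_mult star_star star_closed)
  have "star A e = e" using left[OF star_closed[OF e(1)]] right[OF e(1)] by simp
  hence "unital A" using left right e unfolding unital_def by metis
  thus False using nu by simp
qed

end

lemma (in cstar_algebra) carrier_sub_cstar_algebra: "sub_cstar_algebra (carrier A) A"
  unfolding sub_cstar_algebra_def
proof (intro conjI)
  show "additive_subgroup (carrier A) A"
    by (rule additive_subgroup.intro) (use group.subgroup_self[OF M.a_group] in simp)
  show "closedin (ctopology A) (carrier A)" unfolding closedin_iff by blast
qed (auto simp: mult_closed star_closed)

lemma (in cstar_algebra) cstar_generated_subset: "S \<subseteq> carrier A \<Longrightarrow> cstar_generated A S \<subseteq> carrier A"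
  using carrier_sub_cstar_algebra by (auto simp: cstar_generated_def)

text \<open>All norms in the definition are taken of elements of the carrier, and
  \<open>cdist\<close> is 0 elsewhere by convention. Hence records whose norms agree only on the
  carrier can be exchanged.\<close>

lemma dense_generation_cong_norm:
  assumes X: "cstar_algebra X" and N: "\<And>x. x \<in> carrier X \<Longrightarrow> N x = cnorm X x"
  shows "dense_generation (X\<lparr>cnorm := N\<rparr>) n = dense_generation X n"
proof -
  interpret cstar_algebra X by fact
  let ?Y = "X\<lparr>cnorm := N\<rparr>"
  have minus: "x \<ominus>\<^bsub>?Y\<^esub> y = x \<ominus>\<^bsub>X\<^esub> y" for x y by (simp add: a_minus_def a_inv_def)
  have "cdist ?Y = cdist X" by (rule ext, rule ext) (simp add: cdist_def minus N minus_in)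
  hence "ctopology ?Y = ctopology X" by (simp add: ctopology_def)
  hence "sub_cstar_algebra B ?Y = sub_cstar_algebra B X" for B
    by (simp add: sub_cstar_algebra_def additive_subgroup_def)
  hence g: "cstar_generated ?Y S = cstar_generated X S" for S by (simp add: cstar_generated_def)
  have s: "selfadjoint ?Y = selfadjoint X" by (simp add: selfadjoint_def)
  have eq1: "N (b j \<ominus>\<^bsub>X\<^esub> a j) = cnorm X (b j \<ominus>\<^bsub>X\<^esub> a j)"
    if "a \<in> {..n} \<rightarrow> selfadjoint X" "b \<in> {..n} \<rightarrow> selfadjoint X" "j \<le> n" for a b j
    using that by (intro N minus_in) (auto simp: selfadjoint_def)
  have eq2: "N (c \<ominus>\<^bsub>X\<^esub> g) = cnorm X (c \<ominus>\<^bsub>X\<^esub> g)"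
    if "b \<in> {..n} \<rightarrow> selfadjoint X" "c \<in> carrier X" "g \<in> cstar_generated X (b ` {..n})" for b c g
  proof -
    have "b ` {..n} \<subseteq> carrier X" using that(1) by (auto simp: selfadjoint_def)
    hence "g \<in> carrier X" using cstar_generated_subset that(3) by blast
    thus ?thesis using that(2) by (intro N minus_in)
  qed
  show ?thesis
    unfolding dense_generation_def g s minus
    by (simp add: eq1 eq2 cong: ball_cong bex_cong)
qed

text \<open>For non-unital A the operator norm dominates the modulus of the scalar part, so the
  maximum in \<open>unitization\<close> changes no value on the carrier.\<close>

lemma (in cstar_algebra) dense_generation_adjoin_unit:
  assumes "\<not> unital A"
  shows "dense_generation (adjoin_unit A) n = dense_generation (unitization A) n"
proof -
  have "adjoin_unit A = (unitization A)\<lparr>cnorm := opnorm\<rparr>"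
    by (simp add: adjoin_unit_def unitization_def opnorm_def act_def split_beta fun_eq_iff)
  moreover have "opnorm x = cnorm (unitization A) x" if "x \<in> carrier (unitization A)" for x
    using nonunital_opnorm_ge[OF assms, of "fst x" "snd x"] that
    by (auto simp: cnorm_unitization unitization_sel)
  ultimately show ?thesis using dense_generation_cong_norm[OF unitization_cstar_algebra] by simp
qed

section \<open>A universal C*-algebra over a type\<close>

text \<open>The unitization of the product of all C*-algebras with elements in \<open>'a\<close> is a type of class
  \<open>unital_cstar\<close> that contains each of these algebras as a direct summand of the product.\<close>

lemma cstar_algebra_exists: "\<exists>A :: 'a cstar. cstar_algebra A"
proof -
  let ?A = "\<lparr>carrier = {undefined}, mult = \<lambda>_ _. undefined, one = undefined, zero = undefined,
    add = \<lambda>_ _. undefined, smult = \<lambda>_ _. undefined, star = \<lambda>_. undefined, cnorm = \<lambda>_. 0\<rparr> :: 'a cstar"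
  have "cstar_algebra ?A" by (rule cstar_algebraI) auto
  thus ?thesis by blast
qed

definition all_cstar :: "'a cstar set" where
  "all_cstar = Collect cstar_algebra"

definition universal_product :: "('a cstar \<Rightarrow> 'a) cstar" where
  "universal_product = cstar_product all_cstar (\<lambda>A. A)"

definition universal :: "(('a cstar \<Rightarrow> 'a) \<times> complex) cstar" where
  "universal = unitization universal_product"

lemma universal_product_cstar_algebra: "cstar_algebra (universal_product :: ('a cstar \<Rightarrow> 'a) cstar)"
  unfolding universal_product_def
  by (rule cstar_product_cstar_algebra) (use cstar_algebra_exists in \<open>auto simp: all_cstar_def\<close>)

interpretation UP: cstar_algebra universal_product
  by (rule universal_product_cstar_algebra)

interpretation U: cstar_algebra universal
  unfolding universal_def by (rule UP.unitization_cstar_algebra)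

lemma universal_one:
  "\<one>\<^bsub>universal\<^esub> \<in> carrier universal"
  "x \<in> carrier universal \<Longrightarrow> \<one>\<^bsub>universal\<^esub> \<otimes>\<^bsub>universal\<^esub> x = x"
  "x \<in> carrier universal \<Longrightarrow> x \<otimes>\<^bsub>universal\<^esub> \<one>\<^bsub>universal\<^esub> = x"
  "star universal \<one>\<^bsub>universal\<^esub> = \<one>\<^bsub>universal\<^esub>" "\<one>\<^bsub>universal\<^esub> \<noteq> \<zero>\<^bsub>universal\<^esub>"
  by (auto simp: universal_def unitization_sel UP.mult_zero UP.M.l_zero UP.M.r_zero UP.star_zero)

text \<open>The modulus of the scalar part in the norm of \<open>unitization\<close> forces the
  lower bound, as the class \<open>real_normed_algebra_1\<close> demands.\<close>

lemma universal_norm_one: "cnorm universal \<one>\<^bsub>universal :: (('a cstar \<Rightarrow> 'a) \<times> complex) cstar\<^esub> = 1"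
proof -
  let ?P = "universal_product :: ('a cstar \<Rightarrow> 'a) cstar"
  have "1 \<le> cnorm (unitization ?P) (\<zero>\<^bsub>?P\<^esub>, 1)" "cnorm (unitization ?P) (\<zero>\<^bsub>?P\<^esub>, 1) \<le> 1"
    using UP.unitization_norm_bounds(2,3)[OF UP.zero_in, of 1] by simp_all
  thus ?thesis by (simp add: universal_def unitization_sel)
qed

typedef 'a universal = "carrier (universal :: (('a cstar \<Rightarrow> 'a) \<times> complex) cstar)"
  using universal_one(1) by blast

lemma Rep_in [simp]: "Rep_universal x \<in> carrier universal"
  by (rule Rep_universal)

instantiation universal :: (type) real_normed_algebra_1
begin

definition "0 = Abs_universal \<zero>\<^bsub>universal\<^esub>"
definition "1 = Abs_universal \<one>\<^bsub>universal\<^esub>"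
definition "x + y = Abs_universal (Rep_universal x \<oplus>\<^bsub>universal\<^esub> Rep_universal y)"
definition "- x = Abs_universal ((- 1) \<odot>\<^bsub>universal\<^esub> Rep_universal x)"
definition "x - y = Abs_universal (Rep_universal x \<oplus>\<^bsub>universal\<^esub> (- 1) \<odot>\<^bsub>universal\<^esub> Rep_universal y)"
definition "x * y = Abs_universal (Rep_universal x \<otimes>\<^bsub>universal\<^esub> Rep_universal y)"
definition "r *\<^sub>R x = Abs_universal (complex_of_real r \<odot>\<^bsub>universal\<^esub> Rep_universal x)"
definition "norm x = cnorm universal (Rep_universal x)"
definition "dist x y = norm (x - y :: 'a universal)"
definition "sgn x = inverse (norm x) *\<^sub>R (x :: 'a universal)"
definition [code del]:
  "(uniformity :: ('a universal \<times> 'a universal) filter) = (INF e\<in>{0<..}. principal {(x, y). dist x y < e})"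
definition [code del]:
  "open (S :: 'a universal set) = (\<forall>x\<in>S. \<forall>\<^sub>F (x', y) in uniformity. x' = x \<longrightarrow> y \<in> S)"

lemma Rep_simps:
  "Rep_universal 0 = \<zero>\<^bsub>universal\<^esub>"
  "Rep_universal 1 = \<one>\<^bsub>universal\<^esub>"
  "Rep_universal (x + y) = Rep_universal x \<oplus>\<^bsub>universal\<^esub> Rep_universal y"
  "Rep_universal (- x) = (- 1) \<odot>\<^bsub>universal\<^esub> Rep_universal x"
  "Rep_universal (x - y) = Rep_universal x \<oplus>\<^bsub>universal\<^esub> (- 1) \<odot>\<^bsub>universal\<^esub> Rep_universal y"
  "Rep_universal (x * y) = Rep_universal x \<otimes>\<^bsub>universal\<^esub> Rep_universal y"
  "Rep_universal (r *\<^sub>R x) = complex_of_real r \<odot>\<^bsub>universal\<^esub> Rep_universal x"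
  by (simp_all add: zero_universal_def one_universal_def plus_universal_def uminus_universal_def
      minus_universal_def times_universal_def scaleR_universal_def Abs_universal_inverse universal_one U.mult_closed)

instance
proof
  fix x y z :: "'a universal" and r s :: real
  note R = Rep_universal_inject[symmetric] Rep_simps
  show "x + y + z = x + (y + z)" "x + y = y + x" "0 + x = x" "- x + x = 0" "x - y = x + - y"
    "r *\<^sub>R (x + y) = r *\<^sub>R x + r *\<^sub>R y" "(r + s) *\<^sub>R x = r *\<^sub>R x + s *\<^sub>R x"
    "r *\<^sub>R s *\<^sub>R x = (r * s) *\<^sub>R x" "1 *\<^sub>R x = x"
    by (simp_all add: R U.M.a_ac U.M.l_zero U.sm_l U.sm_r U.sm_assoc)
  show "x * y * z = x * (y * z)" "(x + y) * z = x * z + y * z" "x * (y + z) = x * y + x * z"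
    "r *\<^sub>R x * y = r *\<^sub>R (x * y)" "x * r *\<^sub>R y = r *\<^sub>R (x * y)" "1 * x = x" "x * 1 = x"
    "(0::'a universal) \<noteq> 1"
    using universal_one(5)[symmetric]
    by (simp_all add: R U.mult_assoc U.mult_l_distr U.mult_r_distr U.smult_mult_l U.smult_mult_r universal_one)
  show "dist x y = norm (x - y)" "sgn x = inverse (norm x) *\<^sub>R x"
    "uniformity = (INF e\<in>{0<..}. principal {(x, y). dist (x::'a universal) y < e})"
    "open (S :: 'a universal set) = (\<forall>x\<in>S. \<forall>\<^sub>F (x', y) in uniformity. x' = x \<longrightarrow> y \<in> S)" for S
    by (simp_all add: dist_universal_def sgn_universal_def uniformity_universal_def open_universal_def)
  show "(norm x = 0) = (x = 0)" "norm (x + y) \<le> norm x + norm y" "norm (r *\<^sub>R x) = \<bar>r\<bar> * norm x"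
    "norm (x * y) \<le> norm x * norm y" "norm (1::'a universal) = 1"
    by (simp_all add: R norm_universal_def U.cnorm_eq_0_iff U.cnorm_triangle U.cnorm_smult U.cnorm_mult universal_norm_one)
qed

end

instance universal :: (type) complete_space
proof
  fix X :: "nat \<Rightarrow> 'a universal" assume X: "Cauchy X"
  have n: "norm (x - y) = cnorm universal (Rep_universal x \<oplus>\<^bsub>universal\<^esub> (- 1) \<odot>\<^bsub>universal\<^esub> Rep_universal y)"
    for x y :: "'a universal" by (simp add: norm_universal_def Rep_simps)
  have "\<exists>N. \<forall>m\<ge>N. \<forall>k\<ge>N. cnorm universal (Rep_universal (X m) \<oplus>\<^bsub>universal\<^esub> (- 1) \<odot>\<^bsub>universal\<^esub> Rep_universal (X k)) < e"
    if "e > 0" for e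
    using metric_CauchyD[OF X that] by (simp add: dist_norm n)
  then obtain l where l: "l \<in> carrier universal"
    "(\<lambda>k. cnorm universal (Rep_universal (X k) \<oplus>\<^bsub>universal\<^esub> (- 1) \<odot>\<^bsub>universal\<^esub> l)) \<longlonglongrightarrow> 0"
    using U.completeE[of "\<lambda>k. Rep_universal (X k)"] Rep_in by blast
  have "(\<lambda>k. norm (X k - Abs_universal l)) \<longlonglongrightarrow> 0"
    using l by (simp add: n Abs_universal_inverse)
  hence "X \<longlonglongrightarrow> Abs_universal l" by (simp add: tendsto_norm_zero_iff LIM_zero_iff)
  thus "convergent X" by (rule convergentI)
qed

instantiation universal :: (type) unital_cstar
begin

definition "adj x = Abs_universal (star universal (Rep_universal x))"
definition "imag = Abs_universal (\<i> \<odot>\<^bsub>universal\<^esub> \<one>\<^bsub>universal\<^esub>)"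

lemma Rep_simps_star:
  "Rep_universal (adj x) = star universal (Rep_universal x)"
  "Rep_universal imag = \<i> \<odot>\<^bsub>universal\<^esub> \<one>\<^bsub>universal\<^esub>"
  by (simp_all add: adj_universal_def imag_universal_def Abs_universal_inverse universal_one U.star_closed)

instance
proof
  fix x y :: "'a universal" and r :: real
  show "imag * imag = - (1::'a universal)" "x * imag = imag * x" "adj (adj x) = x" "adj (x + y) = adj x + adj y"
    "adj (x * y) = adj y * adj x" "adj (r *\<^sub>R x) = r *\<^sub>R adj x" "adj imag = - (imag::'a universal)"
    "norm (adj x * x) = (norm x)\<^sup>2"
    by (simp_all add: Rep_universal_inject[symmetric] Rep_simps Rep_simps_star norm_universal_def U.smult_mult_l U.smult_mult_r
        U.sm_assoc U.star_closed U.star_star U.star_add U.star_mult U.star_smult U.cnorm_star_mult universal_one)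
qed

end

lemma Rep_scaleC: "Rep_universal (scaleC z x) = z \<odot>\<^bsub>universal\<^esub> Rep_universal x"
proof -
  have "Rep_universal (scaleC z x) =
      complex_of_real (Re z) \<odot>\<^bsub>universal\<^esub> Rep_universal x \<oplus>\<^bsub>universal\<^esub> (complex_of_real (Im z) * \<i>) \<odot>\<^bsub>universal\<^esub> Rep_universal x"
    by (simp add: scaleC_def Rep_simps Rep_simps_star U.smult_mult_l universal_one U.sm_assoc)
  also have "\<dots> = z \<odot>\<^bsub>universal\<^esub> Rep_universal x"
    using U.sm_l[of "Rep_universal x" "complex_of_real (Re z)" "complex_of_real (Im z) * \<i>"]
    by (simp add: complex_eq[of z, symmetric] mult.commute)
  finally show ?thesis .
qed

section \<open>Each algebra as a summand of the universal one\<close>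

definition embed :: "'a cstar \<Rightarrow> 'a \<times> complex \<Rightarrow> 'a universal" where
  "embed A x = Abs_universal (\<lambda>B\<in>all_cstar. if B = A then fst x else \<zero>\<^bsub>B\<^esub>, snd x)"

lemma universal_product_sel:
  "x \<otimes>\<^bsub>universal_product\<^esub> y = (\<lambda>B\<in>all_cstar. x B \<otimes>\<^bsub>B\<^esub> y B)"
  "x \<oplus>\<^bsub>universal_product\<^esub> y = (\<lambda>B\<in>all_cstar. x B \<oplus>\<^bsub>B\<^esub> y B)"
  "c \<odot>\<^bsub>universal_product\<^esub> x = (\<lambda>B\<in>all_cstar. c \<odot>\<^bsub>B\<^esub> x B)"
  "\<zero>\<^bsub>universal_product\<^esub> = (\<lambda>B\<in>all_cstar. \<zero>\<^bsub>B\<^esub>)"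
  "star universal_product x = (\<lambda>B\<in>all_cstar. star B (x B))"
  "cnorm universal_product x = (SUP B\<in>all_cstar. cnorm B (x B))"
  "carrier universal_product = {x \<in> (\<Pi>\<^sub>E B\<in>all_cstar. carrier B). bdd_above ((\<lambda>B. cnorm B (x B)) ` all_cstar)}"
  by (simp_all add: universal_product_def cstar_product_sel)

context cstar_algebra
begin

lemma all_cstar_mem: "A \<in> all_cstar"
  by (simp add: all_cstar_def cstar_algebra_axioms)

lemma all_cstarD: "B \<in> all_cstar \<Longrightarrow> cstar_algebra B"
  by (simp add: all_cstar_def)

definition summand :: "'a \<Rightarrow> 'a cstar \<Rightarrow> 'a" where
  "summand a = (\<lambda>B\<in>all_cstar. if B = A then a else \<zero>\<^bsub>B\<^esub>)"

lemma cstar_zero_simps: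
  assumes "cstar_algebra B"
  shows "\<zero>\<^bsub>B\<^esub> \<in> carrier B" "\<zero>\<^bsub>B\<^esub> \<oplus>\<^bsub>B\<^esub> \<zero>\<^bsub>B\<^esub> = \<zero>\<^bsub>B\<^esub>" "\<zero>\<^bsub>B\<^esub> \<otimes>\<^bsub>B\<^esub> \<zero>\<^bsub>B\<^esub> = \<zero>\<^bsub>B\<^esub>" "c \<odot>\<^bsub>B\<^esub> \<zero>\<^bsub>B\<^esub> = \<zero>\<^bsub>B\<^esub>"
    "star B \<zero>\<^bsub>B\<^esub> = \<zero>\<^bsub>B\<^esub>" "cnorm B \<zero>\<^bsub>B\<^esub> = 0"
proof -
  interpret B: cstar_algebra B by fact
  show "\<zero>\<^bsub>B\<^esub> \<in> carrier B" "\<zero>\<^bsub>B\<^esub> \<oplus>\<^bsub>B\<^esub> \<zero>\<^bsub>B\<^esub> = \<zero>\<^bsub>B\<^esub>" "\<zero>\<^bsub>B\<^esub> \<otimes>\<^bsub>B\<^esub> \<zero>\<^bsub>B\<^esub> = \<zero>\<^bsub>B\<^esub>" "c \<odot>\<^bsub>B\<^esub> \<zero>\<^bsub>B\<^esub> = \<zero>\<^bsub>B\<^esub>"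
    "star B \<zero>\<^bsub>B\<^esub> = \<zero>\<^bsub>B\<^esub>" "cnorm B \<zero>\<^bsub>B\<^esub> = 0"
    by (simp_all add: B.M.l_zero B.mult_zero B.star_zero)
qed

lemma summand_mem:
  assumes a: "a \<in> carrier A"
  shows "summand a \<in> carrier universal_product" "cnorm universal_product (summand a) = cnorm A a"
proof -
  have *: "cnorm B (summand a B) = (if B = A then cnorm A a else 0)" if "B \<in> all_cstar" for B
    using that cstar_zero_simps(6)[OF all_cstarD[OF that]] by (simp add: summand_def)
  have le: "cnorm B (summand a B) \<le> cnorm A a" if "B \<in> all_cstar" for B
    using *[OF that] cnorm_nonneg[OF a] by simp
  have bd: "bdd_above ((\<lambda>B. cnorm B (summand a B)) ` all_cstar)"
    using le by (intro bdd_aboveI2)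
  have "summand a \<in> (\<Pi>\<^sub>E B\<in>all_cstar. carrier B)"
    using a cstar_zero_simps(1)[OF all_cstarD] by (auto simp: summand_def)
  thus "summand a \<in> carrier universal_product" using bd by (simp add: universal_product_sel)
  show "cnorm universal_product (summand a) = cnorm A a"
    unfolding universal_product_sel
  proof (rule antisym)
    show "(SUP B\<in>all_cstar. cnorm B (summand a B)) \<le> cnorm A a"
      using le all_cstar_mem by (intro cSUP_least) auto
    show "cnorm A a \<le> (SUP B\<in>all_cstar. cnorm B (summand a B))"
      using cSUP_upper[OF all_cstar_mem bd] *[OF all_cstar_mem] by simp
  qed
qed

lemma summand_ops:
  assumes "a \<in> carrier A" "b \<in> carrier A"
  shows "summand a \<oplus>\<^bsub>universal_product\<^esub> summand b = summand (a \<oplus> b)"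
    "summand a \<otimes>\<^bsub>universal_product\<^esub> summand b = summand (a \<otimes> b)"
    "c \<odot>\<^bsub>universal_product\<^esub> summand a = summand (c \<odot> a)"
    "star universal_product (summand a) = summand (star A a)"
    "\<zero>\<^bsub>universal_product\<^esub> = summand \<zero>"
  by (auto simp: universal_product_sel summand_def fun_eq_iff restrict_def cstar_zero_simps all_cstarD)

lemma Rep_embed:
  assumes "x \<in> carrier (unitization A)"
  shows "Rep_universal (embed A x) = (summand (fst x), snd x)"
proof -
  have "(summand (fst x), snd x) \<in> carrier universal"
    using assms summand_mem(1) by (auto simp: universal_def unitization_sel)
  thus ?thesis by (simp add: embed_def summand_def[symmetric] Abs_universal_inverse)
qed

lemma unitization_closed:
  assumes "x \<in> carrier (unitization A)" "y \<in> carrier (unitization A)"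
  shows "x \<oplus>\<^bsub>unitization A\<^esub> y \<in> carrier (unitization A)" "x \<otimes>\<^bsub>unitization A\<^esub> y \<in> carrier (unitization A)"
    "c \<odot>\<^bsub>unitization A\<^esub> x \<in> carrier (unitization A)" "star (unitization A) x \<in> carrier (unitization A)"
  using assms by (auto simp: unitization_sel mult_closed star_closed)

lemma embed_ops:
  assumes x: "x \<in> carrier (unitization A)" and y: "y \<in> carrier (unitization A)"
  shows "embed A (x \<oplus>\<^bsub>unitization A\<^esub> y) = embed A x + embed A y"
    "embed A (x \<otimes>\<^bsub>unitization A\<^esub> y) = embed A x * embed A y"
    "embed A (c \<odot>\<^bsub>unitization A\<^esub> x) = scaleC c (embed A x)"
    "embed A (star (unitization A) x) = adj (embed A x)"
  using x y unitization_closed[OF x y]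
  by (simp_all add: Rep_universal_inject[symmetric] Rep_embed Rep_simps Rep_simps_star Rep_scaleC)
    (auto simp: universal_def unitization_sel summand_ops mult_closed)

lemma embed_unit: "embed A (\<zero>, z) = scaleC z 1"
  by (simp add: Rep_universal_inject[symmetric] Rep_embed Rep_scaleC Rep_simps unitization_sel)
    (simp add: universal_def unitization_sel summand_ops flip: summand_ops(5)[OF zero_in zero_in])

lemma embed_norm_bounds:
  assumes "a \<in> carrier A"
  shows "cnorm A a \<le> 2 * norm (embed A (a, s))" "cmod s \<le> norm (embed A (a, s))"
    "norm (embed A (a, s)) \<le> cnorm A a + cmod s"
  using UP.unitization_norm_bounds[OF summand_mem(1)[OF assms], of s] assms summand_mem(2)[OF assms]
  by (simp_all add: norm_universal_def Rep_embed unitization_sel universal_def[symmetric])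

lemma norm_embed_zero:
  assumes a: "a \<in> carrier A" shows "norm (embed A (a, 0)) = cnorm A a"
  using UP.opnorm_zero_scalar[OF summand_mem(1)[OF a]] summand_mem(2)[OF a] a cnorm_nonneg[OF a]
  by (simp add: norm_universal_def Rep_embed unitization_sel universal_def UP.cnorm_unitization)

definition emb :: "'a \<Rightarrow> 'a universal" where
  "emb a = embed A (a, 0)"

lemma emb_ops:
  assumes "a \<in> carrier A" "b \<in> carrier A"
  shows "emb (a \<oplus> b) = emb a + emb b" "emb (a \<otimes> b) = emb a * emb b" "emb (c \<odot> a) = scaleC c (emb a)"
    "emb (star A a) = adj (emb a)" "norm (emb a) = cnorm A a" "emb \<zero> = 0"
  using embed_ops[of "(a, 0)" "(b, 0)"] assms norm_embed_zero[OF assms(1)] embed_unit[of 0]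
  by (simp_all add: emb_def unitization_sel M.r_zero mult_closed)

lemma embed_eq: "a \<in> carrier A \<Longrightarrow> embed A (a, z) = emb a + scaleC z 1"
  using embed_ops(1)[of "(a, 0)" "(\<zero>, z)"] embed_unit[of z] by (simp add: emb_def unitization_sel M.r_zero)

lemma emb_minus: "a \<in> carrier A \<Longrightarrow> b \<in> carrier A \<Longrightarrow> emb (a \<ominus> b) = emb a - emb b"
  by (simp add: minus_eq emb_ops scaleC_minus_left)

lemma norm_emb_diff: "a \<in> carrier A \<Longrightarrow> b \<in> carrier A \<Longrightarrow> norm (emb a - emb b) = cnorm A (a \<ominus> b)"
  using emb_ops(5)[of "a \<ominus> b" \<zero>] by (simp add: emb_minus minus_in)

lemma emb_inj: "inj_on emb (carrier A)"
proof (rule inj_onI)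
  fix a b assume ab: "a \<in> carrier A" "b \<in> carrier A" "emb a = emb b"
  have "cnorm A (a \<ominus> b) = 0" using ab emb_ops(5)[of "a \<ominus> b" \<zero>] by (simp add: minus_in emb_minus)
  thus "a = b" using ab by (simp add: cnorm_eq_0_iff minus_in minus_eq eq_iff_minus)
qed

text \<open>The image is closed because \<open>emb\<close> is isometric and A complete. It misses 1
  because its scalar coordinates vanish, even if A is unital; so the hull always contains a new
  unit.\<close>

lemma emb_image:
  "subalg (emb ` carrier A)" "star_closed (emb ` carrier A)" "closed (emb ` carrier A)" "1 \<notin> emb ` carrier A"
proof -
  show "subalg (emb ` carrier A)"
    unfolding subalg_def
  proof (intro conjI ballI allI)
    show "0 \<in> emb ` carrier A" using emb_ops(6)[OF zero_in zero_in] zero_in by (metis imageI)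
    fix x y assume "x \<in> emb ` carrier A" "y \<in> emb ` carrier A"
    thus "x + y \<in> emb ` carrier A" "x * y \<in> emb ` carrier A"
      by (auto simp flip: emb_ops intro!: imageI mult_closed)
  next
    fix x z assume "x \<in> emb ` carrier A"
    thus "scaleC z x \<in> emb ` carrier A" by (auto simp flip: emb_ops intro!: imageI)
  qed
  show "star_closed (emb ` carrier A)"
    unfolding star_closed_def by (auto simp flip: emb_ops intro!: imageI star_closed)
  show "closed (emb ` carrier A)"
    unfolding closed_sequential_limits
  proof (intro allI impI, elim conjE)
    fix X l assume X: "\<forall>n. X n \<in> emb ` carrier A" "X \<longlonglongrightarrow> l"
    obtain a where a: "\<And>n. a n \<in> carrier A" "\<And>n. X n = emb (a n)" using X(1) unfolding image_iff by metis
    have "\<exists>N. \<forall>m\<ge>N. \<forall>n\<ge>N. cnorm A (a m \<oplus> (- 1) \<odot> a n) < e" if "e > 0" for e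
      using metric_CauchyD[OF LIMSEQ_imp_Cauchy[OF X(2)] that] a
      by (simp add: dist_norm norm_emb_diff flip: minus_eq)
    then obtain b where b: "b \<in> carrier A" "(\<lambda>n. cnorm A (a n \<oplus> (- 1) \<odot> b)) \<longlonglongrightarrow> 0"
      using completeE[of a] a(1) by blast
    have "(\<lambda>n. norm (X n - emb b)) \<longlonglongrightarrow> 0"
      using b a by (simp add: norm_emb_diff minus_eq)
    hence "X \<longlonglongrightarrow> emb b" by (simp add: tendsto_norm_zero_iff LIM_zero_iff)
    hence "l = emb b" using X(2) LIMSEQ_unique by blast
    thus "l \<in> emb ` carrier A" using b by simp
  qed
  show "1 \<notin> emb ` carrier A"
  proof
    assume "1 \<in> emb ` carrier A"
    then obtain a where a: "a \<in> carrier A" "1 = emb a" by auto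
    have "Rep_universal (1 :: 'a universal) = Rep_universal (emb a)" using a by simp
    thus False using a by (simp add: emb_def Rep_embed unitization_sel Rep_simps) (simp add: universal_def unitization_sel)
  qed
qed

lemma embed_image: "embed A ` carrier (unitization A) = adjoin_one (emb ` carrier A)"
proof
  show "embed A ` carrier (unitization A) \<subseteq> adjoin_one (emb ` carrier A)"
  proof
    fix y assume "y \<in> embed A ` carrier (unitization A)"
    then obtain a z where a: "a \<in> carrier A" "y = embed A (a, z)" by (auto simp: unitization_sel)
    hence "y = emb a + scaleC z 1" by (simp add: embed_eq)
    thus "y \<in> adjoin_one (emb ` carrier A)" using a(1) unfolding adjoin_one_def by blast
  qed
  show "adjoin_one (emb ` carrier A) \<subseteq> embed A ` carrier (unitization A)"
  proof
    fix x assume "x \<in> adjoin_one (emb ` carrier A)"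
    then obtain a z where a: "a \<in> carrier A" "x = emb a + scaleC z 1" by (auto simp: adjoin_one_def)
    have "x = embed A (a, z)" using a by (simp add: embed_eq)
    moreover have "(a, z) \<in> carrier (unitization A)" using a by (simp add: unitization_sel)
    ultimately show "x \<in> embed A ` carrier (unitization A)" by (rule image_eqI)
  qed
qed

end

section \<open>Dense generation of records\<close>

text \<open>Bounds in both directions suffice in place of isometry, since dense generation depends
  only on the equivalence class of the norm. This admits \<open>embed\<close> with the constant
  3.\<close>

locale bounded_embedding = cstar_algebra A for A :: "'a cstar" (structure) +
  fixes \<iota> :: "'a \<Rightarrow> 't::unital_cstar" and K :: real
  assumes add: "\<And>x y. x \<in> carrier A \<Longrightarrow> y \<in> carrier A \<Longrightarrow> \<iota> (x \<oplus> y) = \<iota> x + \<iota> y"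
    and mult: "\<And>x y. x \<in> carrier A \<Longrightarrow> y \<in> carrier A \<Longrightarrow> \<iota> (x \<otimes> y) = \<iota> x * \<iota> y"
    and scale: "\<And>x c. x \<in> carrier A \<Longrightarrow> \<iota> (c \<odot> x) = scaleC c (\<iota> x)"
    and star: "\<And>x. x \<in> carrier A \<Longrightarrow> \<iota> (star A x) = adj (\<iota> x)"
    and K: "K > 0"
    and bounds: "\<And>x. x \<in> carrier A \<Longrightarrow> norm (\<iota> x) \<le> K * cnorm A x" "\<And>x. x \<in> carrier A \<Longrightarrow> cnorm A x \<le> K * norm (\<iota> x)"
begin

lemma \<iota>_zero: "\<iota> \<zero> = 0"
  using scale[OF zero_in, of 0] by simp

lemma \<iota>_minus: "x \<in> carrier A \<Longrightarrow> y \<in> carrier A \<Longrightarrow> \<iota> (x \<ominus> y) = \<iota> x - \<iota> y"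
  by (simp add: minus_eq add scale scaleC_minus_left)

lemma \<iota>_inj: "x \<in> carrier A \<Longrightarrow> y \<in> carrier A \<Longrightarrow> \<iota> x = \<iota> y \<Longrightarrow> x = y"
proof -
  assume x: "x \<in> carrier A" "y \<in> carrier A" "\<iota> x = \<iota> y"
  have "cnorm A (x \<ominus> y) \<le> 0" using bounds(2)[of "x \<ominus> y"] x by (simp add: \<iota>_minus minus_in)
  hence "x \<ominus> y = \<zero>" using cnorm_nonneg[of "x \<ominus> y"] cnorm_eq_0_iff[of "x \<ominus> y"] x by (simp add: minus_in)
  thus "x = y" using x by (simp add: minus_eq eq_iff_minus)
qed

lemma self_adj_iff: "x \<in> carrier A \<Longrightarrow> self_adj (\<iota> x) \<longleftrightarrow> star A x = x"
  using \<iota>_inj[of "star A x" x] by (auto simp: self_adj_def star_closed star[symmetric])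

lemma subalg_preimage:
  assumes C: "closed C" "subalg C" "star_closed C"
  shows "sub_cstar_algebra {x \<in> carrier A. \<iota> x \<in> C} A"
  unfolding sub_cstar_algebra_def
proof (intro conjI ballI allI)
  show "additive_subgroup {x \<in> carrier A. \<iota> x \<in> C} A"
  proof (rule additive_subgroup.intro, rule group.subgroupI[OF M.a_group])
    show "{x \<in> carrier A. \<iota> x \<in> C} \<subseteq> carrier (add_monoid A)" by auto
    show "{x \<in> carrier A. \<iota> x \<in> C} \<noteq> {}" using C \<iota>_zero by (auto intro!: exI[of _ \<zero>] simp: subalgD)
    fix a b assume a: "a \<in> {x \<in> carrier A. \<iota> x \<in> C}"
    have "inv\<^bsub>add_monoid A\<^esub> a = (- 1) \<odot> a" using a_inv_eq[of a] a by (simp add: a_inv_def)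
    thus "inv\<^bsub>add_monoid A\<^esub> a \<in> {x \<in> carrier A. \<iota> x \<in> C}" using a C by (simp add: scale subalgD)
    assume "b \<in> {x \<in> carrier A. \<iota> x \<in> C}"
    thus "a \<otimes>\<^bsub>add_monoid A\<^esub> b \<in> {x \<in> carrier A. \<iota> x \<in> C}" using a C by (simp add: add subalgD)
  qed
  show "closedin (ctopology A) {x \<in> carrier A. \<iota> x \<in> C}"
    unfolding closedin_iff
  proof (intro conjI allI impI)
    fix \<sigma> l assume \<sigma>: "\<forall>n::nat. \<sigma> n \<in> {x \<in> carrier A. \<iota> x \<in> C}" and l: "l \<in> carrier A"
      "(\<lambda>n. cnorm A (\<sigma> n \<ominus> l)) \<longlonglongrightarrow> 0"
    have "(\<lambda>n. \<iota> (\<sigma> n) - \<iota> l) \<longlonglongrightarrow> 0"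
    proof (rule Lim_null_comparison)
      show "(\<lambda>n. K * cnorm A (\<sigma> n \<ominus> l)) \<longlonglongrightarrow> 0" using tendsto_mult_left[OF l(2), of K] by simp
      show "\<forall>\<^sub>F n in sequentially. norm (\<iota> (\<sigma> n) - \<iota> l) \<le> K * cnorm A (\<sigma> n \<ominus> l)"
      proof (intro always_eventually allI)
        fix n
        show "norm (\<iota> (\<sigma> n) - \<iota> l) \<le> K * cnorm A (\<sigma> n \<ominus> l)"
          using bounds(1)[of "\<sigma> n \<ominus> l"] \<sigma> l(1) by (simp add: \<iota>_minus minus_in)
      qed
    qed
    hence "(\<lambda>n. \<iota> (\<sigma> n)) \<longlonglongrightarrow> \<iota> l" by (simp add: LIM_zero_iff)
    hence "\<iota> l \<in> C" using closed_sequentially[OF C(1), of "\<lambda>n. \<iota> (\<sigma> n)"] \<sigma> by simp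
    thus "l \<in> {x \<in> carrier A. \<iota> x \<in> C}" using l by simp
  qed auto
qed (use C in \<open>auto simp: mult_closed star_closed mult scale star subalgD star_closed_def\<close>)

lemma sub_cstar_algebra_closed:
  assumes "sub_cstar_algebra B A"
  shows "x \<in> B \<Longrightarrow> y \<in> B \<Longrightarrow> x \<oplus> y \<in> B" "x \<in> B \<Longrightarrow> y \<in> B \<Longrightarrow> x \<otimes> y \<in> B" "x \<in> B \<Longrightarrow> c \<odot> x \<in> B" "\<zero> \<in> B"
  using assms additive_subgroup.a_closed additive_subgroup.zero_closed by (auto simp: sub_cstar_algebra_def)

text \<open>The preimage of the closure of the polynomials is a C*-subalgebra containing the entries
  of b, hence it contains the intersection of all such subalgebras.\<close>

lemma generated_sound:
  assumes b: "b \<in> {..n} \<rightarrow> carrier A" and g: "g \<in> cstar_generated A (b ` {..n})"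
    and sa: "\<forall>j\<le>n. self_adj (\<iota> (b j))"
  shows "\<iota> g \<in> closure (gen n (\<lambda>j. \<iota> (b j)))"
proof -
  let ?C = "closure (gen n (\<lambda>j. \<iota> (b j)))"
  have "sub_cstar_algebra {x \<in> carrier A. \<iota> x \<in> ?C} A"
    by (rule subalg_preimage) (auto simp: subalg_closure subalg_gen star_closed_closure star_closed_gen sa)
  moreover have "b ` {..n} \<subseteq> {x \<in> carrier A. \<iota> x \<in> ?C}"
    using b gen_mem[of _ n "\<lambda>j. \<iota> (b j)"] closure_subset by fastforce
  ultimately have "g \<in> {x \<in> carrier A. \<iota> x \<in> ?C}" using g unfolding cstar_generated_def by blast
  thus ?thesis by simp
qed

text \<open>Every C*-subalgebra containing the entries is closed under the operations from which
  expressions are built.\<close>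

lemma generated_complete:
  assumes b: "b \<in> {..n} \<rightarrow> carrier A"
  shows "\<exists>g \<in> cstar_generated A (b ` {..n}). g \<in> carrier A \<and> \<iota> g = eval n (\<lambda>j. \<iota> (b j)) p"
proof -
  let ?G = "cstar_generated A (b ` {..n})"
  have Gi: "x \<in> ?G \<longleftrightarrow> (\<forall>B. sub_cstar_algebra B A \<longrightarrow> b ` {..n} \<subseteq> B \<longrightarrow> x \<in> B)" for x
    by (auto simp: cstar_generated_def)
  have G: "x \<oplus> y \<in> ?G" "x \<otimes> y \<in> ?G" "c \<odot> x \<in> ?G" if "x \<in> ?G" "y \<in> ?G" for x y c
    using that unfolding Gi by (simp_all add: sub_cstar_algebra_closed)
  have z: "\<zero> \<in> ?G" unfolding Gi by (simp add: sub_cstar_algebra_closed)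
  have bG: "b j \<in> ?G" if "j \<le> n" for j using that unfolding cstar_generated_def by blast
  show ?thesis
  proof (induction p)
    case (Var j)
    show ?case
    proof (cases "j \<le> n")
      case True
      thus ?thesis using b bG[OF True] by (intro bexI[of _ "b j"]) auto
    next
      case False
      thus ?thesis using z \<iota>_zero by (intro bexI[of _ \<zero>]) auto
    qed
  next
    case (Add p q)
    then obtain x y where "x \<in> ?G" "x \<in> carrier A" "\<iota> x = eval n (\<lambda>j. \<iota> (b j)) p"
      "y \<in> ?G" "y \<in> carrier A" "\<iota> y = eval n (\<lambda>j. \<iota> (b j)) q" by blast
    thus ?case using G(1) by (intro bexI[of _ "x \<oplus> y"]) (auto simp: add)
  next
    case (Mul p q)
    then obtain x y where "x \<in> ?G" "x \<in> carrier A" "\<iota> x = eval n (\<lambda>j. \<iota> (b j)) p"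
      "y \<in> ?G" "y \<in> carrier A" "\<iota> y = eval n (\<lambda>j. \<iota> (b j)) q" by blast
    thus ?case using G(2) by (intro bexI[of _ "x \<otimes> y"]) (auto simp: mult mult_closed)
  next
    case (Scale z p)
    then obtain x where "x \<in> ?G" "x \<in> carrier A" "\<iota> x = eval n (\<lambda>j. \<iota> (b j)) p" by blast
    thus ?case using G(3) by (intro bexI[of _ "z \<odot> x"]) (auto simp: scale)
  qed
qed

theorem dense_generation_iff: "dense_generation A n \<longleftrightarrow> dense_gen (\<iota> ` carrier A) n"
proof
  assume D: "dense_generation A n"
  show "dense_gen (\<iota> ` carrier A) n"
    unfolding dense_gen_def
  proof (intro allI ballI impI)
    fix a c and \<epsilon> :: real
    assume c: "c \<in> \<iota> ` carrier A" and a: "self_adj_tuple (\<iota> ` carrier A) n a" and e: "\<epsilon> > 0"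
    obtain c' where c': "c' \<in> carrier A" "c = \<iota> c'" using c by auto
    have "\<forall>j. \<exists>x. j \<le> n \<longrightarrow> x \<in> selfadjoint A \<and> \<iota> x = a j"
      using a self_adj_iff unfolding self_adj_tuple_def selfadjoint_def by fastforce
    then obtain a' where a': "\<And>j. j \<le> n \<Longrightarrow> a' j \<in> selfadjoint A \<and> \<iota> (a' j) = a j" by metis
    \<comment> \<open>Half of \<epsilon> pays for the generated element, the other half for
      replacing that element by a polynomial.\<close>
    define \<delta> where "\<delta> = \<epsilon> / (2 * K)"
    have d: "\<delta> > 0" using e K by (simp add: \<delta>_def)
    have "a' \<in> {..n} \<rightarrow> selfadjoint A" using a' by auto
    then obtain b g where b: "b \<in> {..n} \<rightarrow> selfadjoint A" "\<forall>j\<le>n. cnorm A (b j \<ominus> a' j) < \<delta>"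
      and g: "g \<in> cstar_generated A (b ` {..n})" "cnorm A (c' \<ominus> g) < \<delta>"
      using D d c' unfolding dense_generation_def by blast
    have bA: "b \<in> {..n} \<rightarrow> carrier A" using b by (auto simp: selfadjoint_def)
    have sa: "\<forall>j\<le>n. self_adj (\<iota> (b j))" using b(1) self_adj_iff by (auto simp: selfadjoint_def Pi_iff)
    have gA: "g \<in> carrier A" using g(1) cstar_generated_subset[of "b ` {..n}"] bA by auto
    have less: "norm (\<iota> x) < \<epsilon> / 2" if "x \<in> carrier A" "cnorm A x < \<delta>" for x
    proof -
      have "norm (\<iota> x) \<le> K * cnorm A x" by (rule bounds(1)[OF that(1)])
      also have "\<dots> < K * \<delta>" using that(2) K by simp
      finally show ?thesis using K by (simp add: \<delta>_def)
    qed
    obtain p where p: "norm (\<iota> g - eval n (\<lambda>j. \<iota> (b j)) p) < \<epsilon> / 2"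
      using closure_gen_approx[OF generated_sound[OF bA g(1) sa], of "\<epsilon> / 2"] e by auto
    have "norm (\<iota> (c' \<ominus> g)) < \<epsilon> / 2" using c' gA g(2) by (intro less) (auto simp: minus_in)
    hence "norm (c - eval n (\<lambda>j. \<iota> (b j)) p) < \<epsilon>"
      using p norm_triangle_ineq[of "c - \<iota> g" "\<iota> g - eval n (\<lambda>j. \<iota> (b j)) p"] c' gA by (simp add: \<iota>_minus)
    moreover have "norm (\<iota> (b j) - a j) < \<epsilon>" if j: "j \<le> n" for j
    proof -
      have m: "b j \<in> carrier A" "a' j \<in> carrier A" using bA a'[OF j] j by (auto simp: selfadjoint_def)
      have "norm (\<iota> (b j \<ominus> a' j)) < \<epsilon> / 2" using m b(2) j by (intro less) (auto simp: minus_in)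
      thus ?thesis using e m a'[OF j] by (simp add: \<iota>_minus)
    qed
    moreover have "self_adj_tuple (\<iota> ` carrier A) n (\<lambda>j. \<iota> (b j))"
      using bA sa by (auto simp: self_adj_tuple_def)
    ultimately show "\<exists>b p. self_adj_tuple (\<iota> ` carrier A) n b \<and> (\<forall>j\<le>n. norm (b j - a j) < \<epsilon>) \<and> norm (c - eval n b p) < \<epsilon>"
      by blast
  qed
next
  assume D: "dense_gen (\<iota> ` carrier A) n"
  show "dense_generation A n"
    unfolding dense_generation_def
  proof (intro allI ballI impI)
    fix a c and \<epsilon> :: real
    assume a: "a \<in> {..n} \<rightarrow> selfadjoint A" and e: "\<epsilon> > 0" and c: "c \<in> carrier A"
    have aA: "a j \<in> carrier A" if "j \<le> n" for j using a that by (auto simp: selfadjoint_def)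
    have "self_adj_tuple (\<iota> ` carrier A) n (\<lambda>j. \<iota> (a j))"
      using a aA self_adj_iff by (auto simp: self_adj_tuple_def selfadjoint_def Pi_iff)
    moreover have "\<epsilon> / K > 0" using e K by simp
    ultimately obtain B p where B: "self_adj_tuple (\<iota> ` carrier A) n B" "\<And>j. j \<le> n \<Longrightarrow> norm (B j - \<iota> (a j)) < \<epsilon> / K"
      "norm (\<iota> c - eval n B p) < \<epsilon> / K"
      using dense_genE[OF D, of "\<lambda>j. \<iota> (a j)" "\<epsilon> / K" "\<iota> c"] c by blast
    have "\<forall>j. \<exists>x. j \<le> n \<longrightarrow> x \<in> selfadjoint A \<and> \<iota> x = B j"
      using B(1) self_adj_iff unfolding self_adj_tuple_def selfadjoint_def by fastforce
    then obtain b where b: "\<And>j. j \<le> n \<Longrightarrow> b j \<in> selfadjoint A \<and> \<iota> (b j) = B j" by metis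
    have bA: "b j \<in> carrier A" if "j \<le> n" for j using b[OF that] by (simp add: selfadjoint_def)
    have ev: "eval n (\<lambda>j. \<iota> (b j)) p = eval n B p" by (induction p) (auto simp: b)
    obtain g where g: "g \<in> cstar_generated A (b ` {..n})" "g \<in> carrier A" "\<iota> g = eval n B p"
      using generated_complete[of b n p] bA ev by auto
    have less: "cnorm A x < \<epsilon>" if "x \<in> carrier A" "norm (\<iota> x) < \<epsilon> / K" for x
      using bounds(2)[OF that(1)] that(2) K by (simp add: pos_less_divide_eq mult.commute)
    have "cnorm A (c \<ominus> g) < \<epsilon>" using c g B(3) by (intro less) (auto simp: minus_in \<iota>_minus)
    moreover have "cnorm A (b j \<ominus> a j) < \<epsilon>" if "j \<le> n" for j
      using bA[OF that] aA[OF that] B(2)[OF that] b[OF that] by (intro less) (auto simp: minus_in \<iota>_minus)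
    moreover have "b \<in> {..n} \<rightarrow> selfadjoint A" using b by auto
    ultimately show "\<exists>b\<in>{..n} \<rightarrow> selfadjoint A. (\<forall>j\<le>n. cnorm A (b j \<ominus> a j) < \<epsilon>) \<and>
        (\<exists>g\<in>cstar_generated A (b ` {..n}). cnorm A (c \<ominus> g) < \<epsilon>)"
      using g(1) by blast
  qed
qed

end

context cstar_algebra
begin

abbreviation unital_hull :: "'a universal set" where
  "unital_hull \<equiv> adjoin_one (emb ` carrier A)"

lemma nonunital_subalgebra_emb: "nonunital_subalgebra (emb ` carrier A)"
  using emb_image by unfold_locales

text \<open>If A is unital, \<open>gr\<close> refers to A itself and \<open>dense_gen_unital\<close>
  passes to the hull with its new unit. Otherwise the hull is the image of the unitization, whose
  norm agrees with that of \<open>adjoin_unit\<close>.\<close>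

lemma gr_eq:
  "gr A = (if \<exists>n. dense_gen unital_hull n then enat (LEAST n. dense_gen unital_hull n) else \<infinity>)"
proof (cases "unital A")
  case True
  interpret E: bounded_embedding A emb 1
    by unfold_locales (auto simp: emb_ops)
  obtain u where u: "u \<in> carrier A" "\<And>x. x \<in> carrier A \<Longrightarrow> u \<otimes> x = x \<and> x \<otimes> u = x"
    using True by (auto simp: unital_def)
  have "dense_gen unital_hull n \<longleftrightarrow> dense_gen (emb ` carrier A) n" for n
    by (rule dense_gen_unital[OF emb_image(3,1,2,4), of "emb u"]) (use u in \<open>auto simp flip: emb_ops(2)\<close>)
  hence "dense_generation A = dense_gen unital_hull" by (simp add: fun_eq_iff E.dense_generation_iff)
  thus ?thesis using True by (simp add: gr_def gr0_def)
next
  case False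
  interpret V: cstar_algebra "unitization A" by (rule unitization_cstar_algebra)
  interpret E: bounded_embedding "unitization A" "embed A" 3
  proof unfold_locales
    fix x assume x: "x \<in> carrier (unitization A)"
    obtain a z where az: "x = (a, z)" "a \<in> carrier A" using x by (auto simp: unitization_sel)
    show "norm (embed A x) \<le> 3 * cnorm (unitization A) x"
      using embed_norm_bounds(3)[OF az(2), of z] unitization_norm_bounds(1,2)[OF az(2), of z] by (simp add: az)
    show "cnorm (unitization A) x \<le> 3 * norm (embed A x)"
      using embed_norm_bounds(1,2)[OF az(2), of z] unitization_norm_bounds(3)[OF az(2), of z] by (simp add: az)
  qed (auto simp: embed_ops)
  have "dense_generation (adjoin_unit A) = dense_gen unital_hull"
    by (simp add: fun_eq_iff dense_generation_adjoin_unit[OF False] E.dense_generation_iff embed_image)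
  thus ?thesis using False by (simp add: gr_def gr0_def)
qed

lemma gr_le: "dense_gen unital_hull n \<Longrightarrow> gr A \<le> enat n"
  by (auto simp: gr_eq intro: Least_le)

lemma gr_dense_gen: "gr A = enat n \<Longrightarrow> dense_gen unital_hull n"
  by (auto simp: gr_eq split: if_splits intro: LeastI)

end

section \<open>Subalgebras, ideals and quotients of records\<close>

context cstar_algebra
begin

lemma sub_cstar_algebraD:
  assumes "sub_cstar_algebra B A"
  shows "B \<subseteq> carrier A" "\<zero> \<in> B" "x \<in> B \<Longrightarrow> y \<in> B \<Longrightarrow> x \<oplus> y \<in> B" "x \<in> B \<Longrightarrow> y \<in> B \<Longrightarrow> x \<otimes> y \<in> B"
    "x \<in> B \<Longrightarrow> c \<odot> x \<in> B" "x \<in> B \<Longrightarrow> star A x \<in> B" "closedin (ctopology A) B"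
  using assms additive_subgroup.a_closed[of B A] additive_subgroup.zero_closed[of B A] additive_subgroup.a_subset[of B A]
  by (auto simp: sub_cstar_algebra_def)

lemma cstar_algebra_restrict:
  assumes B: "sub_cstar_algebra B A"
  shows "cstar_algebra (A\<lparr>carrier := B\<rparr>)"
proof -
  note BD = sub_cstar_algebraD[OF B]
  have c: "x \<in> carrier A" if "x \<in> B" for x using that BD(1) by auto
  show ?thesis
  proof (rule cstar_algebraI)
    fix \<sigma> :: "nat \<Rightarrow> 'a"
    assume \<sigma>: "\<And>n. \<sigma> n \<in> carrier (A\<lparr>carrier := B\<rparr>)"
      and "\<And>e. e > 0 \<Longrightarrow> \<exists>N. \<forall>m\<ge>N. \<forall>n\<ge>N. cnorm (A\<lparr>carrier := B\<rparr>)
        (\<sigma> m \<oplus>\<^bsub>A\<lparr>carrier := B\<rparr>\<^esub> (- 1) \<odot>\<^bsub>A\<lparr>carrier := B\<rparr>\<^esub> \<sigma> n) < e"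
    hence "\<And>n. \<sigma> n \<in> carrier A" "\<And>e. e > 0 \<Longrightarrow> \<exists>N. \<forall>m\<ge>N. \<forall>n\<ge>N. cnorm A (\<sigma> m \<oplus> (- 1) \<odot> \<sigma> n) < e"
      using c by simp_all
    then obtain l where l: "l \<in> carrier A" "(\<lambda>n. cnorm A (\<sigma> n \<oplus> (- 1) \<odot> l)) \<longlonglongrightarrow> 0"
      by (rule completeE)
    have "l \<in> B" using closed_limit[OF BD(7) _ l] \<sigma> by simp
    thus "\<exists>l\<in>carrier (A\<lparr>carrier := B\<rparr>). (\<lambda>n. cnorm (A\<lparr>carrier := B\<rparr>)
        (\<sigma> n \<oplus>\<^bsub>A\<lparr>carrier := B\<rparr>\<^esub> (- 1) \<odot>\<^bsub>A\<lparr>carrier := B\<rparr>\<^esub> l)) \<longlonglongrightarrow> 0"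
      using l by auto
  qed (use BD(2-6) c in \<open>simp_all add: M.a_ac M.l_zero sm_l sm_r sm_assoc mult_assoc mult_l_distr mult_r_distr
    smult_mult_l smult_mult_r star_star star_add star_smult star_mult cnorm_nonneg cnorm_eq_0_iff cnorm_triangle
    cnorm_smult cnorm_mult cnorm_star_mult\<close>)
qed

end

lemmas (in cstar_algebra) emb_unary = emb_ops(3-5)[OF _ zero_in] emb_ops(6)[OF zero_in zero_in]

text \<open>With w a large multiple of \<open>adj x * x\<close>, the adjoint h of 1 -
  \<open>res w\<close> lies in J, and \<open>adj x\<close> - h \<open>adj x\<close> is the adjoint
  of x \<open>res w\<close>, which is small. An appeal to \<open>right_annihilator\<close> would be
  circular, as it presupposes closure under adjoints.\<close>

lemma star_closed_of_ideal:
  fixes J :: "'a::unital_cstar set"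
  assumes J: "closed J" "subalg J" and X: "star_closed X"
    and ideal: "\<And>x v. x \<in> X \<Longrightarrow> v \<in> J \<Longrightarrow> x * v \<in> J" "\<And>x v. x \<in> X \<Longrightarrow> v \<in> J \<Longrightarrow> v * x \<in> J" "J \<subseteq> X"
  shows "star_closed J"
  unfolding star_closed_def
proof
  fix x assume x: "x \<in> J"
  have ax: "adj x \<in> X" using x X ideal by (auto simp: star_closed_def)
  have z: "adj x * x \<in> J" using ideal ax x by blast
  have "adj x \<in> closure J"
    unfolding closure_approachable
  proof (intro allI impI)
    fix \<epsilon> :: real assume e: "\<epsilon> > 0"
    define \<tau> where "\<tau> = 4 / \<epsilon>\<^sup>2"
    have \<tau>: "\<tau> > 0" using e by (simp add: \<tau>_def)
    define w where "w = \<tau> *\<^sub>R (adj x * x)"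
    have w: "self_adj w" by (simp add: w_def self_adj_scaleR self_adj_adj_mult)
    have wJ: "w \<in> J" using J z by (simp add: w_def subalgD)
    have I: "closed (idealizer J)" "subalg (idealizer J)" "1 \<in> idealizer J" "w \<in> idealizer J"
      using closed_idealizer[OF J(1)] idealizer_props[OF J(2)] wJ by auto
    have "adj (1 - res w) = - (imag * (adj (res w) * w))"
      by (simp only: one_minus_res(1)[OF w]) (simp add: adj_mult adj_imag self_adjD[OF w] imag_simps)
    moreover have "adj (res w) * w \<in> J" using res_mem(2)[OF w I] wJ by (simp add: idealizer_def)
    ultimately have h: "adj (1 - res w) \<in> J" using J by (simp add: subalgD)
    have "adj (x * res w) * (x * res w) = (1/\<tau>) *\<^sub>R (adj (res w) * (w * res w))"
      using \<tau> by (simp add: adj_mult w_def mult.assoc)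
    hence "(norm (x * res w))\<^sup>2 = (1/\<tau>) * norm (adj (res w) * (w * res w))"
      using \<tau> by (metis norm_adj_mult norm_scaleR abs_of_pos zero_less_divide_1_iff)
    also have "\<dots> \<le> (1/\<tau>) * (norm (adj (res w)) * norm (w * res w))"
      using \<tau> by (intro mult_left_mono norm_mult_ineq) auto
    also have "\<dots> \<le> (1/\<tau>) * (1 * 2)"
      using \<tau> res(3)[OF w] norm_mult_res[OF w] by (intro mult_left_mono mult_mono) auto
    also have "\<dots> < \<epsilon>\<^sup>2" using e by (simp add: \<tau>_def)
    finally have small: "norm (x * res w) < \<epsilon>" using e by (simp add: power2_less_imp_less)
    have "adj x - adj (1 - res w) * adj x = adj (x * res w)"
      by (simp add: adj_mult adj_diff algebra_simps)
    hence "norm (adj x - adj (1 - res w) * adj x) < \<epsilon>" using small by simp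
    moreover have "adj (1 - res w) * adj x \<in> J" using h ax ideal by blast
    ultimately show "\<exists>y\<in>J. dist y (adj x) < \<epsilon>" by (metis dist_commute dist_norm)
  qed
  thus "adj x \<in> J" using J by simp
qed

section \<open>Closed ideals and their quotients\<close>

locale cstar_ideal = cstar_algebra A for A :: "'a cstar" (structure) +
  fixes I :: "'a set"
  assumes closed_ideal: "closed_ideal I A"
begin

lemma I_subset: "I \<subseteq> carrier A"
  using closed_ideal additive_subgroup.a_subset[of I A] by (auto simp: closed_ideal_def)

lemma I_mem [simp]: "v \<in> I \<Longrightarrow> v \<in> carrier A"
  using I_subset by auto

lemma I_closed:
  "\<zero> \<in> I" "v \<in> I \<Longrightarrow> w \<in> I \<Longrightarrow> v \<oplus> w \<in> I" "v \<in> I \<Longrightarrow> c \<odot> v \<in> I"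
  "a \<in> carrier A \<Longrightarrow> v \<in> I \<Longrightarrow> a \<otimes> v \<in> I" "a \<in> carrier A \<Longrightarrow> v \<in> I \<Longrightarrow> v \<otimes> a \<in> I"
  "closedin (ctopology A) I"
  using closed_ideal additive_subgroup.a_closed[of I A] additive_subgroup.zero_closed[of I A]
  by (auto simp: closed_ideal_def)

lemma emb_I:
  "closed (emb ` I)" "subalg (emb ` I)" "emb ` I \<subseteq> emb ` carrier A"
  "x \<in> unital_hull \<Longrightarrow> v \<in> emb ` I \<Longrightarrow> x * v \<in> emb ` I"
  "x \<in> unital_hull \<Longrightarrow> v \<in> emb ` I \<Longrightarrow> v * x \<in> emb ` I"
proof -
  show sub: "emb ` I \<subseteq> emb ` carrier A" using I_subset by auto
  show s: "subalg (emb ` I)"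
    unfolding subalg_def
  proof (intro conjI ballI allI)
    show "0 \<in> emb ` I" using emb_ops(6)[OF zero_in zero_in] I_closed(1) by (metis imageI)
    fix x y assume "x \<in> emb ` I" "y \<in> emb ` I"
    thus "x + y \<in> emb ` I" "x * y \<in> emb ` I"
      using I_closed by (auto simp flip: emb_ops intro!: imageI)
  next
    fix x z assume "x \<in> emb ` I"
    thus "scaleC z x \<in> emb ` I" using I_closed by (auto simp flip: emb_unary(1) intro!: imageI)
  qed
  show "closed (emb ` I)"
    unfolding closed_sequential_limits
  proof (intro allI impI, elim conjE)
    fix X l assume X: "\<forall>n. X n \<in> emb ` I" "X \<longlonglongrightarrow> l"
    obtain a where a: "\<And>n. a n \<in> I" "\<And>n. X n = emb (a n)" using X(1) unfolding image_iff by metis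
    have "l \<in> emb ` carrier A" using closed_sequentially[OF emb_image(3), of X l] X sub by blast
    then obtain b where b: "b \<in> carrier A" "l = emb b" by auto
    have "(\<lambda>n. norm (X n - l)) \<longlonglongrightarrow> 0" using X(2) by (simp add: LIM_zero tendsto_norm_zero)
    hence "(\<lambda>n. cnorm A (a n \<oplus> (- 1) \<odot> b)) \<longlonglongrightarrow> 0" using a b by (simp add: norm_emb_diff minus_eq)
    hence "b \<in> I" by (rule closed_limit[where \<sigma> = a, OF I_closed(6) a(1) b(1)])
    thus "l \<in> emb ` I" using b by simp
  qed
  assume x: "x \<in> unital_hull" and v: "v \<in> emb ` I"
  obtain a z where a: "a \<in> carrier A" "x = emb a + scaleC z 1" using x by (auto simp: adjoin_one_def)
  obtain w where w: "w \<in> I" "v = emb w" using v by auto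
  have "x * v = emb (a \<otimes> w \<oplus> z \<odot> w)" "v * x = emb (w \<otimes> a \<oplus> z \<odot> w)"
    using a w by (simp_all add: emb_ops mult_closed ring_distribs scaleC_mult_left scaleC_mult_right)
  thus "x * v \<in> emb ` I" "v * x \<in> emb ` I" using I_closed a w by auto
qed

lemma star_closed_emb_I: "star_closed (emb ` I)"
proof (rule star_closed_of_ideal[OF emb_I(1,2) emb_image(2)])
  have h: "x \<in> unital_hull" if "x \<in> emb ` carrier A" for x
    using nonunital_subalgebra.adjoin_oneI[OF nonunital_subalgebra_emb that, of 0] by simp
  show "x * v \<in> emb ` I" "v * x \<in> emb ` I" if "x \<in> emb ` carrier A" "v \<in> emb ` I" for x v
    using emb_I(4,5)[OF h[OF that(1)] that(2)] .
qed (rule emb_I(3))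

lemma star_I: assumes v: "v \<in> I" shows "star A v \<in> I"
proof -
  have "emb (star A v) \<in> emb ` I" using star_closed_emb_I v by (auto simp: star_closed_def emb_unary(2))
  then obtain w where w: "w \<in> I" "emb (star A v) = emb w" by auto
  have "star A v = w" using inj_onD[OF emb_inj w(2)] v w(1) by (simp add: star_closed)
  thus ?thesis using w by simp
qed

lemma sub_cstar_algebra_I: "sub_cstar_algebra I A"
  using closed_ideal star_I by (auto simp: closed_ideal_def sub_cstar_algebra_def)

abbreviation q :: "'a \<Rightarrow> 'a set" where "q x \<equiv> I +> x"

abbreviation Q :: "'a set cstar" where "Q \<equiv> cstar_quotient A I"

lemma mem_q: "y \<in> q x \<longleftrightarrow> (\<exists>v\<in>I. y = v \<oplus> x)"
  by (auto simp: a_r_coset_def')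

lemma mem_q_carrier: "y \<in> q x \<Longrightarrow> x \<in> carrier A \<Longrightarrow> y \<in> carrier A"
  by (auto simp: mem_q)

lemma self_mem_q: "x \<in> carrier A \<Longrightarrow> x \<in> q x"
  unfolding mem_q using I_closed(1) by (intro bexI[of _ \<zero>]) (auto simp: M.l_zero)

sublocale abelian_subgroup I A
  using closed_ideal M.abelian_group_axioms by (intro abelian_subgroupI3) (auto simp: closed_ideal_def)

lemma q_absorb: "v \<in> I \<Longrightarrow> x \<in> carrier A \<Longrightarrow> q (v \<oplus> x) = q x"
  using M.a_repr_independence[of "v \<oplus> x" I x] a_subgroup by (auto simp: mem_q)

lemma q_eqI: "y \<in> q x \<Longrightarrow> x \<in> carrier A \<Longrightarrow> q y = q x"
  by (auto simp: mem_q q_absorb)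

lemma q_eq_iff: "x \<in> carrier A \<Longrightarrow> y \<in> carrier A \<Longrightarrow> q x = q y \<longleftrightarrow> x \<oplus> (- 1) \<odot> y \<in> I"
proof
  assume x: "x \<in> carrier A" "y \<in> carrier A"
  { assume "q x = q y"
    hence "x \<in> q y" using self_mem_q[OF x(1)] by simp
    then obtain v where v: "v \<in> I" "x = v \<oplus> y" by (auto simp: mem_q)
    have "x \<oplus> (- 1) \<odot> y = v" using v x by (simp add: M.a_assoc M.r_zero)
    thus "x \<oplus> (- 1) \<odot> y \<in> I" using v by simp }
  { assume "x \<oplus> (- 1) \<odot> y \<in> I"
    from q_absorb[OF this x(2)] show "q x = q y" using x by (simp add: M.a_assoc M.r_zero) }
qed

lemma q_zero: "q \<zero> = I" "v \<in> I \<Longrightarrow> q v = I"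
  using M.a_coset_join2 a_subgroup I_closed(1) by auto

text \<open>Scalar multiplication and adjoint of the quotient are unions over representatives; if
  all of them yield the same coset, the union is that coset.\<close>

lemma UN_coset:
  assumes x: "x \<in> carrier A" and f: "\<And>a. a \<in> q x \<Longrightarrow> q (f a) = q (f x)"
  shows "(\<Union>a\<in>q x. q (f a)) = q (f x)"
proof -
  have "(\<Union>a\<in>q x. q (f a)) = (\<Union>a\<in>q x. q (f x))" by (intro SUP_cong refl f)
  thus ?thesis using self_mem_q[OF x] by blast
qed

lemma Q_ops:
  assumes x: "x \<in> carrier A" and y: "y \<in> carrier A"
  shows "q x \<oplus>\<^bsub>Q\<^esub> q y = q (x \<oplus> y)" "q x \<otimes>\<^bsub>Q\<^esub> q y = q (x \<otimes> y)" "c \<odot>\<^bsub>Q\<^esub> q x = q (c \<odot> x)"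
    "star Q (q x) = q (star A x)" "\<zero>\<^bsub>Q\<^esub> = q \<zero>" "carrier Q = q ` carrier A"
    "cnorm Q (q x) = (INF a\<in>q x. cnorm A a)"
proof -
  show "q x \<oplus>\<^bsub>Q\<^esub> q y = q (x \<oplus> y)" using a_rcos_sum[OF x y] by (simp add: cstar_quotient_def)
  have m: "q (a \<otimes> b) = q (x \<otimes> y)" if ab: "a \<in> q x" "b \<in> q y" for a b
  proof -
    obtain v w where v: "v \<in> I" "a = v \<oplus> x" and w: "w \<in> I" "b = w \<oplus> y" using ab by (auto simp: mem_q)
    have "a \<otimes> b = (v \<otimes> w \<oplus> v \<otimes> y \<oplus> x \<otimes> w) \<oplus> x \<otimes> y"
      using v w x y by (simp add: mult_l_distr mult_r_distr mult_closed M.a_ac)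
    moreover have "v \<otimes> w \<oplus> v \<otimes> y \<oplus> x \<otimes> w \<in> I" using v w x y by (intro I_closed) auto
    ultimately show ?thesis using q_absorb x y by (simp add: mult_closed)
  qed
  have "q x \<otimes>\<^bsub>Q\<^esub> q y = (\<Union>a\<in>q x. \<Union>b\<in>q y. q (a \<otimes> b))" by (simp add: cstar_quotient_def rcoset_mult_def)
  also have "\<dots> = (\<Union>a\<in>q x. \<Union>b\<in>q y. q (x \<otimes> y))" by (intro SUP_cong refl m)
  also have "\<dots> = q (x \<otimes> y)" using self_mem_q[OF x] self_mem_q[OF y] by blast
  finally show "q x \<otimes>\<^bsub>Q\<^esub> q y = q (x \<otimes> y)" .
  have "q (c \<odot> a) = q (c \<odot> x)" if a: "a \<in> q x" for a
  proof -
    obtain v where v: "v \<in> I" "a = v \<oplus> x" using a by (auto simp: mem_q)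
    hence "c \<odot> a = c \<odot> v \<oplus> c \<odot> x" using x by (simp add: sm_r)
    thus ?thesis using q_absorb[OF I_closed(3)[OF v(1)]] x by simp
  qed
  from UN_coset[where f = "\<lambda>a. c \<odot> a", OF x this] show "c \<odot>\<^bsub>Q\<^esub> q x = q (c \<odot> x)" by (simp add: cstar_quotient_def)
  have "q (star A a) = q (star A x)" if a: "a \<in> q x" for a
  proof -
    obtain v where v: "v \<in> I" "a = v \<oplus> x" using a by (auto simp: mem_q)
    hence "star A a = star A v \<oplus> star A x" using x by (simp add: star_add)
    thus ?thesis using q_absorb[OF star_I[OF v(1)]] x by (simp add: star_closed)
  qed
  from UN_coset[where f = "star A", OF x this] show "star Q (q x) = q (star A x)" by (simp add: cstar_quotient_def)
  show "\<zero>\<^bsub>Q\<^esub> = q \<zero>" by (simp add: cstar_quotient_def q_zero)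
  show "carrier Q = q ` carrier A" by (auto simp: cstar_quotient_def A_RCOSETS_def')
  show "cnorm Q (q x) = (INF a\<in>q x. cnorm A a)" by (simp add: cstar_quotient_def)
qed

lemma Q_norm_le: "a \<in> q x \<Longrightarrow> x \<in> carrier A \<Longrightarrow> cnorm Q (q x) \<le> cnorm A a"
  unfolding Q_ops(7)[OF _ zero_in]
  by (rule cINF_lower) (auto intro!: bdd_belowI2[where m = 0] simp: cnorm_nonneg mem_q_carrier)

lemma Q_norm_approx:
  assumes "x \<in> carrier A" "cnorm Q (q x) < r"
  obtains a where "a \<in> q x" "a \<in> carrier A" "cnorm A a < r"
proof -
  have "q x \<noteq> {}" using self_mem_q[OF assms(1)] by auto
  moreover have "bdd_below (cnorm A ` q x)"
    using assms(1) by (intro bdd_belowI2[where m = 0]) (auto simp: cnorm_nonneg mem_q_carrier)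
  ultimately obtain a where "a \<in> q x" "cnorm A a < r"
    using assms(2) cINF_less_iff[of "q x" "cnorm A" r] unfolding Q_ops(7)[OF assms(1) zero_in] by blast
  thus ?thesis using that mem_q_carrier assms(1) by blast
qed

lemma Q_norm_self: "x \<in> carrier A \<Longrightarrow> cnorm Q (q x) \<le> cnorm A x"
  by (rule Q_norm_le[OF self_mem_q])

lemma Q_norm_nonneg: "x \<in> carrier A \<Longrightarrow> 0 \<le> cnorm Q (q x)"
  unfolding Q_ops(7)[OF _ zero_in] using self_mem_q
  by (intro cINF_greatest) (auto simp: cnorm_nonneg mem_q_carrier)

lemma Q_norm_triangle:
  assumes "x \<in> carrier A" "y \<in> carrier A"
  shows "cnorm Q (q (x \<oplus> y)) \<le> cnorm Q (q x) + cnorm Q (q y)"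
proof (rule field_le_epsilon)
  fix e :: real assume e: "e > 0"
  obtain a where a: "a \<in> q x" "a \<in> carrier A" "cnorm A a < cnorm Q (q x) + e / 2"
    using Q_norm_approx[OF assms(1), of "cnorm Q (q x) + e / 2"] e by auto
  obtain b where b: "b \<in> q y" "b \<in> carrier A" "cnorm A b < cnorm Q (q y) + e / 2"
    using Q_norm_approx[OF assms(2), of "cnorm Q (q y) + e / 2"] e by auto
  have "q (x \<oplus> y) = q (a \<oplus> b)"
    using Q_ops(1)[OF assms] Q_ops(1)[OF a(2) b(2)] q_eqI[OF a(1) assms(1)] q_eqI[OF b(1) assms(2)] by simp
  hence "cnorm Q (q (x \<oplus> y)) \<le> cnorm A (a \<oplus> b)" using Q_norm_self[of "a \<oplus> b"] a b by simp
  also have "\<dots> \<le> cnorm A a + cnorm A b" using a b by (intro cnorm_triangle)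
  finally show "cnorm Q (q (x \<oplus> y)) \<le> cnorm Q (q x) + cnorm Q (q y) + e" using a b by simp
qed

lemma Q_norm_mult:
  assumes "x \<in> carrier A" "y \<in> carrier A"
  shows "cnorm Q (q (x \<otimes> y)) \<le> cnorm Q (q x) * cnorm Q (q y)"
proof -
  have "cnorm Q (q (x \<otimes> y)) \<le> r * s" if r: "cnorm Q (q x) < r" "cnorm Q (q y) < s" for r s
  proof -
    obtain a where a: "a \<in> q x" "a \<in> carrier A" "cnorm A a < r" using Q_norm_approx[OF assms(1) r(1)] .
    obtain b where b: "b \<in> q y" "b \<in> carrier A" "cnorm A b < s" using Q_norm_approx[OF assms(2) r(2)] .
    have "q (x \<otimes> y) = q (a \<otimes> b)"
      using Q_ops(2)[OF assms] Q_ops(2)[OF a(2) b(2)] q_eqI[OF a(1) assms(1)] q_eqI[OF b(1) assms(2)] by simp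
    hence "cnorm Q (q (x \<otimes> y)) \<le> cnorm A (a \<otimes> b)" using Q_norm_self[of "a \<otimes> b"] a b by (simp add: mult_closed)
    also have "\<dots> \<le> cnorm A a * cnorm A b" using a b by (intro cnorm_mult)
    also have "\<dots> \<le> r * s" using a b cnorm_nonneg[OF a(2)] cnorm_nonneg[OF b(2)] by (intro mult_mono) auto
    finally show ?thesis .
  qed
  hence le: "cnorm Q (q (x \<otimes> y)) \<le> (cnorm Q (q x) + inverse (real (Suc k))) * (cnorm Q (q y) + inverse (real (Suc k)))" for k
    by simp
  have "(\<lambda>k. (cnorm Q (q x) + inverse (real (Suc k))) * (cnorm Q (q y) + inverse (real (Suc k))))
      \<longlonglongrightarrow> (cnorm Q (q x) + 0) * (cnorm Q (q y) + 0)"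
    by (intro tendsto_intros LIMSEQ_inverse_real_of_nat)
  thus ?thesis using le by (intro LIMSEQ_le_const) auto
qed

lemma Q_norm_star:
  assumes x: "x \<in> carrier A" shows "cnorm Q (q (star A x)) = cnorm Q (q x)"
proof -
  have le: "cnorm Q (q (star A x)) \<le> cnorm Q (q x)" if x: "x \<in> carrier A" for x
  proof (rule field_le_epsilon)
    fix e :: real assume e: "e > 0"
    obtain a where a: "a \<in> q x" "a \<in> carrier A" "cnorm A a < cnorm Q (q x) + e"
      using Q_norm_approx[OF x, of "cnorm Q (q x) + e"] e by auto
    have "q (star A x) = q (star A a)"
      using Q_ops(4)[OF x zero_in] Q_ops(4)[OF a(2) zero_in] q_eqI[OF a(1) x] by simp
    thus "cnorm Q (q (star A x)) \<le> cnorm Q (q x) + e"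
      using Q_norm_self[of "star A a"] a by (simp add: star_closed n_star)
  qed
  show ?thesis using le[OF x] le[OF star_closed[OF x]] x by (simp add: star_star)
qed

text \<open>The representative \<open>xu\<close> of the class of \<open>x\<close>, where \<open>u\<close> nearly annihilates
  a given element of \<open>I\<close>, shows that the quotient norm is a C*-norm.\<close>

lemma Q_norm_star_mult:
  assumes x: "x \<in> carrier A" shows "cnorm Q (q (star A x \<otimes> x)) = (cnorm Q (q x))\<^sup>2"
proof (rule antisym)
  show "cnorm Q (q (star A x \<otimes> x)) \<le> (cnorm Q (q x))\<^sup>2"
    using Q_norm_mult[OF star_closed[OF x] x] Q_norm_star[OF x] by (simp add: power2_eq_square)
  let ?z = "star A x \<otimes> x"
  have z: "?z \<in> carrier A" using x by (simp add: mult_closed star_closed)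
  show "(cnorm Q (q x))\<^sup>2 \<le> cnorm Q (q ?z)"
  proof (rule field_le_epsilon)
    fix e :: real assume e: "e > 0"
    obtain y where y: "y \<in> q ?z" "y \<in> carrier A" "cnorm A y < cnorm Q (q ?z) + e / 2"
      using Q_norm_approx[OF z, of "cnorm Q (q ?z) + e / 2"] e by auto
    obtain w where w: "w \<in> I" "y = w \<oplus> ?z" using y(1) by (auto simp: mem_q)
    obtain u where u: "norm u \<le> 1" "1 - u \<in> emb ` I" "norm (emb w * u) < e / 2"
      using right_annihilator[OF emb_I(1,2) star_closed_emb_I, of "{emb w}" "e / 2"] w e by auto
    obtain h where h: "h \<in> I" "1 - u = emb h" using u(2) by auto
    have uh: "u = 1 - emb h" using h by (simp add: algebra_simps)
    \<comment> \<open>This is x u. Although u is not in A, x u = x - x h is, and it represents the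
      class of x because h is in \<open>I\<close>.\<close>
    define a where "a = (- 1) \<odot> (x \<otimes> h) \<oplus> x"
    have aA: "a \<in> carrier A" using x h by (simp add: a_def mult_closed)
    have "emb a = emb x * u"
      using x h by (simp add: a_def uh emb_ops mult_closed scaleC_minus_left algebra_simps)
    hence "(cnorm A a)\<^sup>2 = (norm (emb x * u))\<^sup>2" using emb_ops(5)[OF aA zero_in] by simp
    also have "\<dots> = norm (adj u * ((adj (emb x) * emb x) * u))"
      by (simp add: adj_mult mult.assoc flip: norm_adj_mult)
    also have "adj (emb x) * emb x = emb y - emb w"
      using w x z by (simp add: emb_ops star_closed mult_closed)
    also have "norm (adj u * ((emb y - emb w) * u)) \<le> norm (adj u) * norm ((emb y - emb w) * u)"
      by (rule norm_mult_ineq)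
    also have "\<dots> \<le> 1 * norm ((emb y - emb w) * u)" using u(1) by (intro mult_right_mono) auto
    also have "1 * norm ((emb y - emb w) * u) \<le> norm (emb y * u) + norm (emb w * u)"
      using norm_triangle_ineq4[of "emb y * u" "emb w * u"] by (simp add: algebra_simps)
    also have "norm (emb y * u) \<le> norm (emb y) * 1"
      using u(1) by (intro order_trans[OF norm_mult_ineq] mult_left_mono) auto
    also have "norm (emb y) * 1 + norm (emb w * u) \<le> cnorm Q (q ?z) + e"
      using y u(3) emb_ops(5)[OF y(2) zero_in] by simp
    finally have "(cnorm A a)\<^sup>2 \<le> cnorm Q (q ?z) + e" by simp
    moreover have "a \<in> q x" using I_closed(3)[OF I_closed(4)[OF x h(1)], of "- 1"] by (auto simp: a_def mem_q)
    hence "(cnorm Q (q x))\<^sup>2 \<le> (cnorm A a)\<^sup>2" using x by (intro power_mono Q_norm_le Q_norm_nonneg)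
    ultimately show "(cnorm Q (q x))\<^sup>2 \<le> cnorm Q (q ?z) + e" by simp
  qed
qed

text \<open>Quotient norm 0 yields v k in I with v k + x tending to 0, so x is the limit of the
  elements - v k of the closed ideal.\<close>

lemma Q_norm_zero_iff:
  assumes x: "x \<in> carrier A" shows "cnorm Q (q x) = 0 \<longleftrightarrow> x \<in> I"
proof
  assume 0: "cnorm Q (q x) = 0"
  have "\<exists>v\<in>I. cnorm A (v \<oplus> x) < inverse (real (Suc k))" for k
  proof -
    have "cnorm Q (q x) < inverse (real (Suc k))" using 0 by simp
    from Q_norm_approx[OF x this] show ?thesis by (auto simp: mem_q)
  qed
  then obtain v where v: "\<And>k. v k \<in> I" "\<And>k. cnorm A (v k \<oplus> x) < inverse (real (Suc k))" by metis
  have "(\<lambda>k. cnorm A ((- 1) \<odot> v k \<oplus> (- 1) \<odot> x)) \<longlonglongrightarrow> 0"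
  proof (rule Lim_null_comparison[OF _ LIMSEQ_inverse_real_of_nat], intro always_eventually allI)
    fix k
    have "cnorm A ((- 1) \<odot> (v k \<oplus> x)) = cnorm A (v k \<oplus> x)" using v(1) x by (simp add: cnorm_smult)
    thus "norm (cnorm A ((- 1) \<odot> v k \<oplus> (- 1) \<odot> x)) \<le> inverse (real (Suc k))"
      using v[of k] x by (simp add: sm_r cnorm_nonneg)
  qed
  from closed_limit[OF I_closed(6) _ x this] show "x \<in> I" using v(1) I_closed by blast
next
  assume "x \<in> I"
  hence "\<zero> \<in> q x" unfolding mem_q using I_closed(3)[of x "- 1"] by (intro bexI[of _ "(- 1) \<odot> x"]) auto
  hence "cnorm Q (q x) \<le> 0" using Q_norm_le[of \<zero> x] x by simp
  thus "cnorm Q (q x) = 0" using Q_norm_nonneg[OF x] by simp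
qed

lemma Q_norm_smult:
  assumes x: "x \<in> carrier A" shows "cnorm Q (q (c \<odot> x)) = cmod c * cnorm Q (q x)"
proof -
  have le: "cnorm Q (q (c \<odot> x)) \<le> cmod c * cnorm Q (q x)" if x: "x \<in> carrier A" for c x
  proof (rule field_le_epsilon)
    fix e :: real assume e: "e > 0"
    have c1: "cmod c + 1 > 0" by (simp add: add_nonneg_pos)
    define d where "d = e / (cmod c + 1)"
    have d: "d > 0" "cmod c * d \<le> e"
      using e c1 by (simp_all add: d_def pos_divide_le_eq mult_left_mono algebra_simps)
    obtain a where a: "a \<in> q x" "a \<in> carrier A" "cnorm A a < cnorm Q (q x) + d"
      using Q_norm_approx[OF x, of "cnorm Q (q x) + d"] d by auto
    have "q (c \<odot> x) = q (c \<odot> a)"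
      using Q_ops(3)[OF x zero_in] Q_ops(3)[OF a(2) zero_in] q_eqI[OF a(1) x] by simp
    hence "cnorm Q (q (c \<odot> x)) \<le> cmod c * cnorm A a" using Q_norm_self[of "c \<odot> a"] a by (simp add: cnorm_smult)
    also have "\<dots> \<le> cmod c * (cnorm Q (q x) + d)" using a by (intro mult_left_mono) auto
    finally show "cnorm Q (q (c \<odot> x)) \<le> cmod c * cnorm Q (q x) + e" using d by (simp add: distrib_left)
  qed
  show ?thesis
  proof (cases "c = 0")
    case True
    have "cnorm Q (q (0 \<odot> x)) = 0" using Q_norm_zero_iff[OF zero_in] I_closed(1) x by simp
    thus ?thesis using True by simp
  next
    case False
    have "cnorm Q (q x) = cnorm Q (q (inverse c \<odot> (c \<odot> x)))" using x False by (simp add: sm_assoc)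
    also have "\<dots> \<le> inverse (cmod c) * cnorm Q (q (c \<odot> x))"
      using le[OF sm_closed[OF x, of c], of "inverse c"] by (simp only: norm_inverse)
    finally have "cmod c * cnorm Q (q x) \<le> cmod c * (inverse (cmod c) * cnorm Q (q (c \<odot> x)))"
      by (rule mult_left_mono) simp
    also have "\<dots> = cnorm Q (q (c \<odot> x))" using False by simp
    finally show ?thesis using le[OF x, of c] by simp
  qed
qed

text \<open>A subsequence with geometrically small gaps is lifted one term at a time to
  representatives with the same gaps. Their differences are summable in \<open>universal\<close>,
  and the limit stays in the closed image of A.\<close>

lemma Q_complete:
  assumes \<sigma>: "\<And>n. \<sigma> n \<in> carrier A"
    and cau: "\<And>e. e > 0 \<Longrightarrow> \<exists>N. \<forall>m\<ge>N. \<forall>n\<ge>N. cnorm Q (q (\<sigma> m \<oplus> (- 1) \<odot> \<sigma> n)) < e"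
  shows "\<exists>l\<in>carrier A. (\<lambda>n. cnorm Q (q (\<sigma> n \<oplus> (- 1) \<odot> l))) \<longlonglongrightarrow> 0"
proof -
  have "\<exists>N. \<forall>m\<ge>N. \<forall>n\<ge>N. cnorm Q (q (\<sigma> m \<oplus> (- 1) \<odot> \<sigma> n)) < (1/2) ^ k" for k by (rule cau) simp
  then obtain N where N: "\<And>k m n. m \<ge> N k \<Longrightarrow> n \<ge> N k \<Longrightarrow> cnorm Q (q (\<sigma> m \<oplus> (- 1) \<odot> \<sigma> n)) < (1/2) ^ k"
    by metis
  \<comment> \<open>Partial sums give an index sequence that is both increasing and above N.\<close>
  define M where "M = (\<lambda>k. \<Sum>i\<le>k. N i)"
  have M: "N k \<le> M k" "M k \<le> M (Suc k)" for k by (auto simp: M_def intro: member_le_sum)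
  have "\<exists>x. \<forall>k. x k \<in> q (\<sigma> (M k)) \<and> cnorm A (x (Suc k) \<oplus> (- 1) \<odot> x k) < (1/2) ^ k"
  proof (rule dependent_nat_choice)
    show "\<exists>x. x \<in> q (\<sigma> (M 0))" using self_mem_q[OF \<sigma>] by blast
    fix x k assume x: "x \<in> q (\<sigma> (M k))"
    have xA: "x \<in> carrier A" using mem_q_carrier[OF x \<sigma>] .
    let ?s = "\<sigma> (M (Suc k))"
    have "q (?s \<oplus> (- 1) \<odot> x) = q (?s \<oplus> (- 1) \<odot> \<sigma> (M k))"
      using Q_ops(1)[OF \<sigma> sm_closed[OF xA], of "M (Suc k)" "- 1"] Q_ops(1)[OF \<sigma> sm_closed[OF \<sigma>], of "M (Suc k)" "- 1" "M k"]
        Q_ops(3)[OF xA zero_in, of "- 1"] Q_ops(3)[OF \<sigma> zero_in, of "- 1"] q_eqI[OF x \<sigma>] by simp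
    moreover have "cnorm Q (q (?s \<oplus> (- 1) \<odot> \<sigma> (M k))) < (1/2) ^ k"
      using M[of k] by (intro N) auto
    ultimately have "cnorm Q (q (?s \<oplus> (- 1) \<odot> x)) < (1/2) ^ k" by simp
    from Q_norm_approx[OF _ this] obtain a where a: "a \<in> q (?s \<oplus> (- 1) \<odot> x)" "cnorm A a < (1/2) ^ k"
      using \<sigma> xA by auto
    obtain v where v: "v \<in> I" "a = v \<oplus> (?s \<oplus> (- 1) \<odot> x)" using a(1) by (auto simp: mem_q)
    have "a = (v \<oplus> ?s) \<oplus> (- 1) \<odot> x" using v \<sigma> xA by (simp add: M.a_assoc)
    thus "\<exists>y. y \<in> q (\<sigma> (M (Suc k))) \<and> cnorm A (y \<oplus> (- 1) \<odot> x) < (1/2) ^ k"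
      using a(2) v(1) by (intro exI[of _ "v \<oplus> ?s"]) (auto simp: mem_q)
  qed
  then obtain x where x: "\<And>k. x k \<in> q (\<sigma> (M k))" "\<And>k. cnorm A (x (Suc k) \<oplus> (- 1) \<odot> x k) < (1/2) ^ k" by blast
  have xA: "x k \<in> carrier A" for k using mem_q_carrier[OF x(1) \<sigma>] .
  have "summable (\<lambda>k. emb (x (Suc k)) - emb (x k))"
  proof (rule summable_comparison_test')
    show "summable (\<lambda>k. (1/2 :: real) ^ k)" by (simp add: summable_geometric)
    show "norm (emb (x (Suc k)) - emb (x k)) \<le> (1/2) ^ k" if "k \<ge> 0" for k
      using x(2)[of k] xA by (simp add: norm_emb_diff minus_eq)
  qed
  hence "convergent (\<lambda>n. \<Sum>k<n. emb (x (Suc k)) - emb (x k))" by (simp add: summable_iff_convergent)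
  hence "convergent (\<lambda>n. emb (x n) - emb (x 0))" by (simp only: sum_lessThan_telescope[where f = "\<lambda>k. emb (x k)"])
  then obtain L where "(\<lambda>n. emb (x n) - emb (x 0)) \<longlonglongrightarrow> L" by (auto simp: convergent_def)
  from tendsto_add[OF this tendsto_const[of "emb (x 0)"]] have L: "(\<lambda>n. emb (x n)) \<longlonglongrightarrow> L + emb (x 0)" by simp
  have "L + emb (x 0) \<in> emb ` carrier A"
    using closed_sequentially[OF emb_image(3) _ L] xA by blast
  then obtain l where l: "l \<in> carrier A" "L + emb (x 0) = emb l" by auto
  have xl: "(\<lambda>n. cnorm A (x n \<oplus> (- 1) \<odot> l)) \<longlonglongrightarrow> 0"
  proof -
    have "(\<lambda>n. norm (emb (x n) - emb l)) \<longlonglongrightarrow> 0" using L l by (simp add: LIM_zero tendsto_norm_zero)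
    thus ?thesis using xA l by (simp add: norm_emb_diff minus_eq)
  qed
  have sub: "cnorm Q (q (\<sigma> n \<oplus> (- 1) \<odot> l)) \<le> cnorm Q (q (\<sigma> n \<oplus> (- 1) \<odot> \<sigma> (M k))) + cnorm A (x k \<oplus> (- 1) \<odot> l)" for n k
  proof -
    have "\<sigma> n \<oplus> (- 1) \<odot> l = (\<sigma> n \<oplus> (- 1) \<odot> \<sigma> (M k)) \<oplus> (\<sigma> (M k) \<oplus> (- 1) \<odot> l)"
      using minus_split[OF \<sigma> \<sigma> l(1), of n "M k"] \<sigma> l by (simp add: minus_eq)
    hence "cnorm Q (q (\<sigma> n \<oplus> (- 1) \<odot> l)) \<le> cnorm Q (q (\<sigma> n \<oplus> (- 1) \<odot> \<sigma> (M k))) + cnorm Q (q (\<sigma> (M k) \<oplus> (- 1) \<odot> l))"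
      using Q_norm_triangle[of "\<sigma> n \<oplus> (- 1) \<odot> \<sigma> (M k)" "\<sigma> (M k) \<oplus> (- 1) \<odot> l"] \<sigma> l by simp
    moreover have "q (\<sigma> (M k) \<oplus> (- 1) \<odot> l) = q (x k \<oplus> (- 1) \<odot> l)"
      using Q_ops(1)[OF \<sigma> sm_closed[OF l(1)], of "M k" "- 1"] Q_ops(1)[OF xA sm_closed[OF l(1)], of k "- 1"] q_eqI[OF x(1) \<sigma>]
      by simp
    moreover have "cnorm Q (q (x k \<oplus> (- 1) \<odot> l)) \<le> cnorm A (x k \<oplus> (- 1) \<odot> l)"
      using xA l by (intro Q_norm_self) auto
    ultimately show ?thesis by simp
  qed
  have "(\<lambda>n. cnorm Q (q (\<sigma> n \<oplus> (- 1) \<odot> l))) \<longlonglongrightarrow> 0"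
  proof (rule LIMSEQ_I)
    fix e :: real assume e: "e > 0"
    have "eventually (\<lambda>k. (1/2 :: real) ^ k < e / 2) sequentially"
      by (rule order_tendstoD(2)[OF LIMSEQ_power_zero]) (use e in auto)
    moreover have "eventually (\<lambda>k. cnorm A (x k \<oplus> (- 1) \<odot> l) < e / 2) sequentially"
      by (rule order_tendstoD(2)[OF xl]) (use e in auto)
    ultimately have "eventually (\<lambda>k. (1/2 :: real) ^ k < e / 2 \<and> cnorm A (x k \<oplus> (- 1) \<odot> l) < e / 2) sequentially"
      by eventually_elim simp
    then obtain k where k: "(1/2 :: real) ^ k < e / 2" "cnorm A (x k \<oplus> (- 1) \<odot> l) < e / 2"
      by (auto simp: eventually_sequentially)
    have "cnorm Q (q (\<sigma> n \<oplus> (- 1) \<odot> l)) < e" if n: "n \<ge> N k" for n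
      using sub[of n k] N[OF n M(1)[of k]] k by linarith
    moreover have "0 \<le> cnorm Q (q (\<sigma> n \<oplus> (- 1) \<odot> l))" for n using \<sigma> l by (intro Q_norm_nonneg) auto
    ultimately show "\<exists>no. \<forall>n\<ge>no. norm (cnorm Q (q (\<sigma> n \<oplus> (- 1) \<odot> l)) - 0) < e" by auto
  qed
  thus ?thesis using l(1) by blast
qed

theorem cstar_algebra_quotient: "cstar_algebra Q"
proof (rule cstar_algebraI)
  have ca: "carrier Q = q ` carrier A" by (rule Q_ops(6)[OF zero_in zero_in])
  have z: "\<zero>\<^bsub>Q\<^esub> = q \<zero>" by (rule Q_ops(5)[OF zero_in zero_in])
  show "\<zero>\<^bsub>Q\<^esub> \<in> carrier Q" unfolding ca z by simp
  fix X Y Z c d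
  assume X: "X \<in> carrier Q"
  then obtain x where x: "x \<in> carrier A" "X = q x" unfolding ca by auto
  note ops = Q_ops(1,2) Q_ops(3,4)[OF _ zero_in]
  show "\<zero>\<^bsub>Q\<^esub> \<oplus>\<^bsub>Q\<^esub> X = X" "0 \<odot>\<^bsub>Q\<^esub> X = \<zero>\<^bsub>Q\<^esub>" "1 \<odot>\<^bsub>Q\<^esub> X = X" "(c + d) \<odot>\<^bsub>Q\<^esub> X = c \<odot>\<^bsub>Q\<^esub> X \<oplus>\<^bsub>Q\<^esub> d \<odot>\<^bsub>Q\<^esub> X"
    "(c * d) \<odot>\<^bsub>Q\<^esub> X = c \<odot>\<^bsub>Q\<^esub> (d \<odot>\<^bsub>Q\<^esub> X)" "star Q (star Q X) = X" "star Q (c \<odot>\<^bsub>Q\<^esub> X) = cnj c \<odot>\<^bsub>Q\<^esub> star Q X"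
    using x by (simp_all add: z ops M.l_zero sm_l sm_assoc star_closed star_star star_smult)
  show "c \<odot>\<^bsub>Q\<^esub> X \<in> carrier Q" "star Q X \<in> carrier Q"
    using x by (simp_all add: ca ops star_closed)
  show "0 \<le> cnorm Q X" using x Q_norm_nonneg by simp
  show "cnorm Q X = 0 \<longleftrightarrow> X = \<zero>\<^bsub>Q\<^esub>"
    using Q_norm_zero_iff[OF x(1)] q_eq_iff[OF x(1) zero_in] x by (simp add: z M.r_zero)
  show "cnorm Q (c \<odot>\<^bsub>Q\<^esub> X) = cmod c * cnorm Q X" "cnorm Q (star Q X \<otimes>\<^bsub>Q\<^esub> X) = (cnorm Q X)\<^sup>2"
    using x Q_norm_smult Q_norm_star_mult by (simp_all add: ops star_closed)
  assume Y: "Y \<in> carrier Q"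
  then obtain y where y: "y \<in> carrier A" "Y = q y" unfolding ca by auto
  show "X \<oplus>\<^bsub>Q\<^esub> Y \<in> carrier Q" "X \<otimes>\<^bsub>Q\<^esub> Y \<in> carrier Q"
    using x y by (simp_all add: ca ops mult_closed)
  show "X \<oplus>\<^bsub>Q\<^esub> Y = Y \<oplus>\<^bsub>Q\<^esub> X" using x y by (simp add: ops M.a_comm[of x y])
  show "c \<odot>\<^bsub>Q\<^esub> (X \<oplus>\<^bsub>Q\<^esub> Y) = c \<odot>\<^bsub>Q\<^esub> X \<oplus>\<^bsub>Q\<^esub> c \<odot>\<^bsub>Q\<^esub> Y"
    "(c \<odot>\<^bsub>Q\<^esub> X) \<otimes>\<^bsub>Q\<^esub> Y = c \<odot>\<^bsub>Q\<^esub> (X \<otimes>\<^bsub>Q\<^esub> Y)" "X \<otimes>\<^bsub>Q\<^esub> (c \<odot>\<^bsub>Q\<^esub> Y) = c \<odot>\<^bsub>Q\<^esub> (X \<otimes>\<^bsub>Q\<^esub> Y)"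
    "star Q (X \<oplus>\<^bsub>Q\<^esub> Y) = star Q X \<oplus>\<^bsub>Q\<^esub> star Q Y" "star Q (X \<otimes>\<^bsub>Q\<^esub> Y) = star Q Y \<otimes>\<^bsub>Q\<^esub> star Q X"
    using x y by (simp_all add: ops sm_r mult_closed smult_mult_l smult_mult_r star_closed star_add star_mult)
  show "cnorm Q (X \<oplus>\<^bsub>Q\<^esub> Y) \<le> cnorm Q X + cnorm Q Y" "cnorm Q (X \<otimes>\<^bsub>Q\<^esub> Y) \<le> cnorm Q X * cnorm Q Y"
    using x y Q_norm_triangle Q_norm_mult by (simp_all add: ops)
  assume Z: "Z \<in> carrier Q"
  then obtain w where w: "w \<in> carrier A" "Z = q w" unfolding ca by auto
  show "(X \<oplus>\<^bsub>Q\<^esub> Y) \<oplus>\<^bsub>Q\<^esub> Z = X \<oplus>\<^bsub>Q\<^esub> (Y \<oplus>\<^bsub>Q\<^esub> Z)" "(X \<otimes>\<^bsub>Q\<^esub> Y) \<otimes>\<^bsub>Q\<^esub> Z = X \<otimes>\<^bsub>Q\<^esub> (Y \<otimes>\<^bsub>Q\<^esub> Z)"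
    "(X \<oplus>\<^bsub>Q\<^esub> Y) \<otimes>\<^bsub>Q\<^esub> Z = X \<otimes>\<^bsub>Q\<^esub> Z \<oplus>\<^bsub>Q\<^esub> Y \<otimes>\<^bsub>Q\<^esub> Z"
    "Z \<otimes>\<^bsub>Q\<^esub> (X \<oplus>\<^bsub>Q\<^esub> Y) = Z \<otimes>\<^bsub>Q\<^esub> X \<oplus>\<^bsub>Q\<^esub> Z \<otimes>\<^bsub>Q\<^esub> Y"
    using x y w by (simp_all add: ops M.a_assoc mult_closed mult_assoc mult_l_distr mult_r_distr)
next
  have ca: "carrier Q = q ` carrier A" by (rule Q_ops(6)[OF zero_in zero_in])
  fix S :: "nat \<Rightarrow> 'a set"
  assume S: "\<And>n. S n \<in> carrier Q"
    and cau: "\<And>e. e > 0 \<Longrightarrow> \<exists>N. \<forall>m\<ge>N. \<forall>n\<ge>N. cnorm Q (S m \<oplus>\<^bsub>Q\<^esub> (- 1) \<odot>\<^bsub>Q\<^esub> S n) < e"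
  obtain \<sigma> where \<sigma>: "\<And>n. \<sigma> n \<in> carrier A" "\<And>n. S n = q (\<sigma> n)" using S unfolding ca image_iff by metis
  have diff: "q x \<oplus>\<^bsub>Q\<^esub> (- 1) \<odot>\<^bsub>Q\<^esub> q y = q (x \<oplus> (- 1) \<odot> y)" if "x \<in> carrier A" "y \<in> carrier A" for x y
    using that by (simp add: Q_ops(1) Q_ops(3)[OF _ zero_in])
  have "\<exists>l\<in>carrier A. (\<lambda>n. cnorm Q (q (\<sigma> n \<oplus> (- 1) \<odot> l))) \<longlonglongrightarrow> 0"
    using cau \<sigma> by (intro Q_complete) (simp_all add: diff)
  then obtain l where l: "l \<in> carrier A" "(\<lambda>n. cnorm Q (q (\<sigma> n \<oplus> (- 1) \<odot> l))) \<longlonglongrightarrow> 0" by blast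
  show "\<exists>l\<in>carrier Q. (\<lambda>n. cnorm Q (S n \<oplus>\<^bsub>Q\<^esub> (- 1) \<odot>\<^bsub>Q\<^esub> l)) \<longlonglongrightarrow> 0"
    using l \<sigma> by (intro bexI[of _ "q l"]) (simp_all add: diff ca)
qed

end

section \<open>Homomorphisms and unital hulls\<close>

definition coord :: "'a cstar \<Rightarrow> 'a universal \<Rightarrow> 'a \<times> complex" where
  "coord A t = (fst (Rep_universal t) A, snd (Rep_universal t))"

text \<open>The unital extension a + z 1 -> f a + z 1, whether or not f preserves units;
  \<open>coord\<close> recovers the pair (a, z) from the embedded element.\<close>

definition hull_map :: "'a cstar \<Rightarrow> 'b cstar \<Rightarrow> ('a \<Rightarrow> 'b) \<Rightarrow> 'a universal \<Rightarrow> 'b universal" where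
  "hull_map A B f t = embed B (f (fst (coord A t)), snd (coord A t))"

context cstar_algebra
begin

lemma coord_embed: "x \<in> carrier (unitization A) \<Longrightarrow> coord A (embed A x) = x"
  by (simp add: coord_def Rep_embed summand_def all_cstar_mem)

lemma embed_in_hull: "x \<in> carrier (unitization A) \<Longrightarrow> embed A x \<in> unital_hull"
  using embed_image by blast

lemma hullE:
  assumes "t \<in> unital_hull"
  obtains x where "x \<in> carrier (unitization A)" "t = embed A x"
  using assms embed_image by blast

lemma emb_in_hull: "a \<in> carrier A \<Longrightarrow> emb a \<in> unital_hull"
  unfolding emb_def[of a] by (rule embed_in_hull) (simp add: unitization_sel)

lemma subalg_hull: "subalg unital_hull" "star_closed unital_hull" "1 \<in> unital_hull"
proof -
  interpret N: nonunital_subalgebra "emb ` carrier A" by (rule nonunital_subalgebra_emb)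
  show "subalg unital_hull" "star_closed unital_hull" by (rule N.subalg_adjoin_one N.star_closed_adjoin_one)+
  show "1 \<in> unital_hull" using embed_in_hull[of "(\<zero>, 1)"] embed_unit[of 1] by (simp add: unitization_sel)
qed

text \<open>The norm bounds the scalar part, so the scalar parts of a convergent sequence converge.
  Subtracting them leaves a convergent sequence in the closed image of A.\<close>

lemma closed_hull: "closed unital_hull"
  unfolding closed_sequential_limits
proof (intro allI impI, elim conjE)
  fix X l assume X: "\<forall>n. X n \<in> unital_hull" "X \<longlonglongrightarrow> l"
  have "\<exists>a z. a \<in> carrier A \<and> X n = emb a + scaleC z 1" for n
  proof -
    have "X n \<in> unital_hull" using X(1) by blast
    then obtain v z where "v \<in> emb ` carrier A" "X n = v + scaleC z 1" unfolding adjoin_one_def by blast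
    thus ?thesis by blast
  qed
  then obtain a z where az: "\<And>n. a n \<in> carrier A" "\<And>n. X n = emb (a n) + scaleC (z n) 1" by metis
  have le: "cmod (z m - z n) \<le> norm (X m - X n)" for m n
  proof -
    have "X m - X n = embed A (a m \<ominus> a n, z m - z n)"
      using az by (simp add: embed_eq minus_in emb_minus scaleC_def algebra_simps)
    thus ?thesis using embed_norm_bounds(2)[of "a m \<ominus> a n" "z m - z n"] az by (simp add: minus_in)
  qed
  have "Cauchy X" using X(2) by (rule LIMSEQ_imp_Cauchy)
  hence "Cauchy z" unfolding Cauchy_def dist_norm using le by (meson le_less_trans)
  then obtain w where w: "z \<longlonglongrightarrow> w" using Cauchy_convergent convergentD by blast
  have "(\<lambda>n. scaleC (z n) (1::'a universal)) \<longlonglongrightarrow> scaleC w 1"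
    unfolding scaleC_def using w by (intro tendsto_intros)
  from tendsto_diff[OF X(2) this] have "(\<lambda>n. emb (a n)) \<longlonglongrightarrow> l - scaleC w 1" using az(2) by simp
  hence "l - scaleC w 1 \<in> emb ` carrier A" 
    by (rule closed_sequentially[OF emb_image(3), rotated]) (use az(1) in simp)
  then obtain b where "b \<in> carrier A" "l = emb b + scaleC w 1" by (auto simp: algebra_simps)
  thus "l \<in> unital_hull" unfolding adjoin_one_def by blast
qed

end

locale cstar_hom = A: cstar_algebra A + B: cstar_algebra B for A :: "'a cstar" and B :: "'b cstar" +
  fixes f :: "'a \<Rightarrow> 'b"
  assumes hom: "f \<in> star_hom A B"
begin

lemma homD:
  "x \<in> carrier A \<Longrightarrow> f x \<in> carrier B"
  "x \<in> carrier A \<Longrightarrow> y \<in> carrier A \<Longrightarrow> f (x \<oplus>\<^bsub>A\<^esub> y) = f x \<oplus>\<^bsub>B\<^esub> f y"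
  "x \<in> carrier A \<Longrightarrow> y \<in> carrier A \<Longrightarrow> f (x \<otimes>\<^bsub>A\<^esub> y) = f x \<otimes>\<^bsub>B\<^esub> f y"
  "x \<in> carrier A \<Longrightarrow> f (c \<odot>\<^bsub>A\<^esub> x) = c \<odot>\<^bsub>B\<^esub> f x"
  "x \<in> carrier A \<Longrightarrow> f (star A x) = star B (f x)"
  using hom by (auto simp: star_hom_def)

lemma hom_minus: "x \<in> carrier A \<Longrightarrow> y \<in> carrier A \<Longrightarrow> f (x \<ominus>\<^bsub>A\<^esub> y) = f x \<ominus>\<^bsub>B\<^esub> f y"
  by (simp add: A.minus_eq B.minus_eq homD)

lemma hull_map_embed:
  "x \<in> carrier (unitization A) \<Longrightarrow> hull_map A B f (embed A x) = embed B (f (fst x), snd x)"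
  by (simp add: hull_map_def A.coord_embed)

lemma hull_map_emb: "a \<in> carrier A \<Longrightarrow> hull_map A B f (A.emb a) = B.emb (f a)"
  by (simp add: A.emb_def B.emb_def hull_map_embed unitization_sel)

lemma star_map_hull_map: "star_map A.unital_hull (hull_map A B f)"
proof
  show "subalg A.unital_hull" "star_closed A.unital_hull" by (rule A.subalg_hull)+
  fix s t z assume s: "s \<in> A.unital_hull"
  then obtain x where x: "x \<in> carrier (unitization A)" "s = embed A x" by (rule A.hullE)
  have fx: "(f (fst x), snd x) \<in> carrier (unitization B)" using x(1) by (auto simp: unitization_sel homD)
  note xc = A.unitization_closed[OF x(1)]
  show "hull_map A B f (scaleC z s) = scaleC z (hull_map A B f s)"
    unfolding x(2) using x(1) fx xc(3)[OF x(1)]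
    by (simp add: hull_map_embed flip: A.embed_ops(3)[OF x(1) x(1)] B.embed_ops(3)[OF fx fx])
      (auto simp: unitization_sel homD)
  show "hull_map A B f (adj s) = adj (hull_map A B f s)"
    unfolding x(2) using x(1) fx xc(4)[OF x(1)]
    by (simp add: hull_map_embed flip: A.embed_ops(4)[OF x(1) x(1)] B.embed_ops(4)[OF fx fx])
      (auto simp: unitization_sel homD)
  assume t: "t \<in> A.unital_hull"
  then obtain y where y: "y \<in> carrier (unitization A)" "t = embed A y" by (rule A.hullE)
  have fy: "(f (fst y), snd y) \<in> carrier (unitization B)" using y(1) by (auto simp: unitization_sel homD)
  show "hull_map A B f (s + t) = hull_map A B f s + hull_map A B f t"
    unfolding x(2) y(2) using x(1) y(1) fx fy xc(1)[OF y(1)]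
    by (simp add: hull_map_embed flip: A.embed_ops(1)[OF x(1) y(1)] B.embed_ops(1)[OF fx fy])
      (auto simp: unitization_sel homD)
  show "hull_map A B f (s * t) = hull_map A B f s * hull_map A B f t"
    unfolding x(2) y(2) using x(1) y(1) fx fy xc(2)[OF y(1)]
    by (simp add: hull_map_embed flip: A.embed_ops(2)[OF x(1) y(1)] B.embed_ops(2)[OF fx fy])
      (auto simp: unitization_sel homD A.mult_closed)
qed

theorem hom_contractive:
  assumes a: "a \<in> carrier A" shows "cnorm B (f a) \<le> cnorm A a"
proof -
  interpret H: star_map A.unital_hull "hull_map A B f" by (rule star_map_hull_map)
  have "norm (hull_map A B f (A.emb a)) \<le> norm (A.emb a)"
    by (rule H.contractive[OF A.closed_hull A.emb_in_hull[OF a]])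
  thus ?thesis using a homD(1)[OF a] by (simp add: hull_map_emb A.emb_unary B.emb_unary)
qed

lemma bounded_star_map_hull_map: "bounded_star_map A.unital_hull (hull_map A B f) 1"
proof -
  interpret H: star_map A.unital_hull "hull_map A B f" by (rule star_map_hull_map)
  show ?thesis by unfold_locales (use H.contractive[OF A.closed_hull] in auto)
qed

lemma hull_map_image: "hull_map A B f ` A.unital_hull = adjoin_one (B.emb ` f ` carrier A)"
proof -
  have "hull_map A B f ` A.unital_hull = (\<lambda>x. embed B (f (fst x), snd x)) ` carrier (unitization A)"
    unfolding A.embed_image[symmetric] image_image by (intro image_cong refl hull_map_embed)
  also have "\<dots> = adjoin_one (B.emb ` f ` carrier A)"
  proof
    show "(\<lambda>x. embed B (f (fst x), snd x)) ` carrier (unitization A) \<subseteq> adjoin_one (B.emb ` f ` carrier A)"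
    proof
      fix t assume "t \<in> (\<lambda>x. embed B (f (fst x), snd x)) ` carrier (unitization A)"
      then obtain a z where a: "a \<in> carrier A" "t = embed B (f a, z)" by (auto simp: unitization_sel)
      hence "t = B.emb (f a) + scaleC z 1" by (simp add: B.embed_eq homD)
      thus "t \<in> adjoin_one (B.emb ` f ` carrier A)" using a(1) unfolding adjoin_one_def by blast
    qed
    show "adjoin_one (B.emb ` f ` carrier A) \<subseteq> (\<lambda>x. embed B (f (fst x), snd x)) ` carrier (unitization A)"
    proof
      fix t assume "t \<in> adjoin_one (B.emb ` f ` carrier A)"
      then obtain a z where a: "a \<in> carrier A" "t = B.emb (f a) + scaleC z 1" by (auto simp: adjoin_one_def)
      hence "t = embed B (f a, z)" by (simp add: B.embed_eq homD)
      thus "t \<in> (\<lambda>x. embed B (f (fst x), snd x)) ` carrier (unitization A)"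
        using a(1) by (intro image_eqI[of _ _ "(a, z)"]) (auto simp: unitization_sel)
    qed
  qed
  finally show ?thesis .
qed

end

section \<open>Rank of ideals, quotients and extensions\<close>

context cstar_ideal
begin

abbreviation R :: "'a cstar" where "R \<equiv> A\<lparr>carrier := I\<rparr>"

lemma cstar_algebra_R: "cstar_algebra R"
  by (rule cstar_algebra_restrict[OF sub_cstar_algebra_I])

lemma closed_ideal_in_hull: "closed_ideal_in (emb ` I) unital_hull"
proof (intro closed_ideal_in.intro nonunital_subalgebra.intro closed_ideal_in_axioms.intro)
  show "closed (emb ` I)" "subalg (emb ` I)" "star_closed (emb ` I)" by (rule emb_I star_closed_emb_I)+
  show "1 \<notin> emb ` I" using emb_image(4) emb_I(3) by blast
  show "closed unital_hull" by (rule closed_hull)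
  show "subalg unital_hull" "star_closed unital_hull" "1 \<in> unital_hull" by (rule subalg_hull)+
  show "emb ` I \<subseteq> unital_hull" using emb_in_hull by auto
qed (rule emb_I; assumption)+

text \<open>As an algebra of its own, I has its own record and thus occupies a different coordinate
  of the universal product than as a subset of A. The hull map of the inclusion identifies the two
  copies up to equivalent norms.\<close>

lemma dense_gen_R: "dense_gen (cstar_algebra.unital_hull R) n \<longleftrightarrow> dense_gen (adjoin_one (emb ` I)) n"
proof -
  interpret R: cstar_algebra R by (rule cstar_algebra_R)
  interpret inc: cstar_hom R A "\<lambda>x. x"
    by unfold_locales (auto simp: star_hom_def)
  have "dense_gen (hull_map R A (\<lambda>x. x) ` R.unital_hull) n \<longleftrightarrow> dense_gen R.unital_hull n"
  proof (rule dense_gen_star_iso[OF inc.bounded_star_map_hull_map])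
    fix t assume "t \<in> R.unital_hull"
    then obtain x where x: "x \<in> carrier (unitization R)" "t = embed R x" by (rule R.hullE)
    obtain a z where a: "x = (a, z)" "a \<in> I" using x(1) by (auto simp: unitization_sel)
    have "hull_map R A (\<lambda>x. x) t = embed A (a, z)" using x a by (simp add: inc.hull_map_embed)
    thus "norm t \<le> 3 * norm (hull_map R A (\<lambda>x. x) t)"
      using R.embed_norm_bounds(3)[of a z] embed_norm_bounds(1,2)[of a z] x(2) a by simp
  qed simp
  thus ?thesis unfolding inc.hull_map_image by simp
qed

lemma q_hom: "cstar_hom A Q q"
proof -
  interpret Q: cstar_algebra Q by (rule cstar_algebra_quotient)
  show ?thesis
    by unfold_locales (auto simp: star_hom_def Q_ops(1,2) Q_ops(3,4,6)[OF _ zero_in] Q_ops(6)[OF zero_in zero_in])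
qed

lemma q_hull_image: "hull_map A Q q ` unital_hull = cstar_algebra.unital_hull Q"
proof -
  interpret q: cstar_hom A Q q by (rule q_hom)
  show ?thesis unfolding q.hull_map_image Q_ops(6)[OF zero_in zero_in] ..
qed

theorem gr_ideal_le: "gr R \<le> gr A"
proof (cases "gr A")
  case (enat n)
  interpret R: cstar_algebra R by (rule cstar_algebra_R)
  interpret J: closed_ideal_in "emb ` I" unital_hull by (rule closed_ideal_in_hull)
  have "dense_gen (adjoin_one (emb ` I)) n" by (rule J.dense_gen_adjoin_one[OF gr_dense_gen[OF enat]])
  hence "gr R \<le> enat n" by (intro R.gr_le) (simp only: dense_gen_R)
  thus ?thesis using enat by simp
qed simp

theorem gr_quotient_le: "gr Q \<le> gr A"
proof (cases "gr A")
  case (enat n)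
  interpret q: cstar_hom A Q q by (rule q_hom)
  interpret H: bounded_star_map unital_hull "hull_map A Q q" 1 by (rule q.bounded_star_map_hull_map)
  have "dense_gen q.B.unital_hull n"
    using H.dense_gen_image[OF gr_dense_gen[OF enat]] by (simp only: q_hull_image)
  thus ?thesis using q.B.gr_le enat by simp
qed simp

theorem gr_extension_le: "gr A \<le> gr R + gr Q + 1"
proof (cases "gr R = \<infinity> \<or> gr Q = \<infinity>")
  case False
  then obtain m n where mn: "gr R = enat m" "gr Q = enat n" by auto
  interpret R: cstar_algebra R by (rule cstar_algebra_R)
  interpret q: cstar_hom A Q q by (rule q_hom)
  interpret H: bounded_star_map unital_hull "hull_map A Q q" 1 by (rule q.bounded_star_map_hull_map)
  interpret J: closed_ideal_in "emb ` I" unital_hull by (rule closed_ideal_in_hull)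
  \<comment> \<open>The constant 3 adds the factor 2 by which the norm of the image bounds the coset
    part and the factor 1 for the scalar part.\<close>
  interpret O: open_star_map unital_hull "hull_map A Q q" 1 "emb ` I" 3
  proof
    show "emb ` I \<subseteq> unital_hull" "subalg (emb ` I)" "star_closed (emb ` I)" "1 \<in> unital_hull"
      using J.JX J.J0 J.X by blast+
    fix v assume "v \<in> emb ` I"
    then obtain w where w: "w \<in> I" "v = emb w" by auto
    have "hull_map A Q q v = q.B.emb \<zero>\<^bsub>Q\<^esub>"
      using w q_zero by (simp add: q.hull_map_emb Q_ops(5)[OF zero_in zero_in])
    thus "hull_map A Q q v = 0" by (simp add: q.B.emb_unary)
  next
    fix t \<epsilon> assume t: "t \<in> unital_hull" and e: "norm (hull_map A Q q t) < \<epsilon>"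
    obtain x where x: "x \<in> carrier (unitization A)" "t = embed A x" using t by (rule hullE)
    obtain a z where a: "x = (a, z)" "a \<in> carrier A" using x(1) by (auto simp: unitization_sel)
    have "hull_map A Q q t = embed Q (q a, z)" using x a by (simp add: q.hull_map_embed)
    hence b: "cnorm Q (q a) < 2 * \<epsilon>" "cmod z < \<epsilon>"
      using q.B.embed_norm_bounds(1,2)[of "q a" z] q.homD(1)[OF a(2)] e by simp_all
    obtain d where d: "d \<in> q a" "d \<in> carrier A" "cnorm A d < 2 * \<epsilon>" using Q_norm_approx[OF a(2) b(1)] .
    obtain v where v: "v \<in> I" "d = v \<oplus> a" using d(1) by (auto simp: mem_q)
    have "t - emb ((- 1) \<odot> v) = embed A (d, z)"
      using v d a x by (simp add: embed_eq emb_ops emb_unary scaleC_minus_left)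
    hence "norm (t - emb ((- 1) \<odot> v)) < 3 * \<epsilon>"
      using embed_norm_bounds(3)[OF d(2), of z] d(3) b(2) by simp
    thus "\<exists>v\<in>emb ` I. norm (t - v) < 3 * \<epsilon>" using I_closed(3)[OF v(1)] by blast
  qed simp
  have "dense_gen (adjoin_one (emb ` I)) m" using R.gr_dense_gen[OF mn(1)] by (simp only: dense_gen_R)
  moreover have "dense_gen (hull_map A Q q ` unital_hull) n"
    unfolding q_hull_image by (rule q.B.gr_dense_gen[OF mn(2)])
  ultimately have "gr A \<le> enat (m + n + 1)" by (intro gr_le O.dense_gen_extension)
  thus ?thesis using mn by (simp add: one_enat_def)
qed auto

end

section \<open>Inductive limits\<close>

lemma (in normed_cmodule) closure_of_iff:
  "x \<in> ctopology A closure_of S \<longleftrightarrow>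
    x \<in> carrier A \<and> (\<forall>e>0. \<exists>y\<in>S. y \<in> carrier A \<and> cnorm A (x \<ominus> y) < e)"
  unfolding ctopology_def Metric_space.metric_closure_of[OF metric]
  by (auto simp: Metric_space.in_mball[OF metric] cdist_def)

lemma (in cstar_algebra) sub_cstar_algebra_closure_of:
  assumes D: "D \<subseteq> carrier A" "subalg (emb ` D)" "star_closed (emb ` D)"
  shows "sub_cstar_algebra (ctopology A closure_of D) A"
proof -
  interpret E: bounded_embedding A emb 1 by unfold_locales (auto simp: emb_ops emb_unary)
  have "x \<in> ctopology A closure_of D \<longleftrightarrow> x \<in> carrier A \<and> emb x \<in> closure (emb ` D)" for x
  proof (cases "x \<in> carrier A")
    case True
    have "dist (emb y) (emb x) = cnorm A (x \<ominus> y)" if "y \<in> D" for y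
      using D(1) that True by (simp add: dist_norm norm_minus_commute norm_emb_diff subset_iff)
    thus ?thesis using True D(1) by (auto simp: closure_of_iff closure_approachable subset_iff)
  next
    case False
    thus ?thesis by (simp add: closure_of_iff)
  qed
  hence "ctopology A closure_of D = {x \<in> carrier A. emb x \<in> closure (emb ` D)}" by auto
  thus ?thesis using E.subalg_preimage[of "closure (emb ` D)"] D
    by (simp add: subalg_closure star_closed_closure)
qed

section \<open>The limit inside bounded families modulo null families\<close>

locale inductive_system_locale =
  fixes \<Lambda> :: "'i set" and r :: "'i rel" and B :: "'i \<Rightarrow> 'b cstar" and \<phi> :: "'i \<Rightarrow> 'i \<Rightarrow> 'b \<Rightarrow> 'b"
  assumes system: "inductive_system \<Lambda> r B \<phi>"
begin

lemma nonempty: "\<Lambda> \<noteq> {}"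
  and refl: "i \<in> \<Lambda> \<Longrightarrow> (i, i) \<in> r"
  and trans: "(i, j) \<in> r \<Longrightarrow> (j, k) \<in> r \<Longrightarrow> (i, k) \<in> r"
  and upper: "i \<in> \<Lambda> \<Longrightarrow> j \<in> \<Lambda> \<Longrightarrow> \<exists>k\<in>\<Lambda>. (i, k) \<in> r \<and> (j, k) \<in> r"
  and B: "i \<in> \<Lambda> \<Longrightarrow> cstar_algebra (B i)"
  and \<phi>: "(i, j) \<in> r \<Longrightarrow> \<phi> i j \<in> star_hom (B i) (B j)"
  and \<phi>_comp: "(i, j) \<in> r \<Longrightarrow> (j, k) \<in> r \<Longrightarrow> x \<in> carrier (B i) \<Longrightarrow> \<phi> j k (\<phi> i j x) = \<phi> i k x"
  using system unfolding inductive_system_def directed_on_def preorder_on_def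
  by (auto simp: refl_on_def dest: transD)

lemma \<phi>_hom: "i \<in> \<Lambda> \<Longrightarrow> j \<in> \<Lambda> \<Longrightarrow> (i, j) \<in> r \<Longrightarrow> cstar_hom (B i) (B j) (\<phi> i j)"
  by (intro cstar_hom.intro cstar_hom_axioms.intro B \<phi>)

lemma eventually_tails: "eventually P (tails \<Lambda> r) \<longleftrightarrow> (\<exists>i\<in>\<Lambda>. \<forall>j\<in>\<Lambda>. (i, j) \<in> r \<longrightarrow> P j)"
proof -
  have "eventually P (tails \<Lambda> r) \<longleftrightarrow> (\<exists>i\<in>\<Lambda>. eventually P (principal {j \<in> \<Lambda>. (i, j) \<in> r}))"
    unfolding tails_def
  proof (rule eventually_INF_base[OF nonempty])
    fix i j assume ij: "i \<in> \<Lambda>" "j \<in> \<Lambda>"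
    obtain k where k: "k \<in> \<Lambda>" "(i, k) \<in> r" "(j, k) \<in> r" using upper[OF ij] by blast
    have "{l \<in> \<Lambda>. (k, l) \<in> r} \<subseteq> {l \<in> \<Lambda>. (i, l) \<in> r} \<inter> {l \<in> \<Lambda>. (j, l) \<in> r}"
      using trans k by blast
    thus "\<exists>k\<in>\<Lambda>. principal {l \<in> \<Lambda>. (k, l) \<in> r} \<le> inf (principal {l \<in> \<Lambda>. (i, l) \<in> r}) (principal {l \<in> \<Lambda>. (j, l) \<in> r})"
      using k(1) by (intro bexI[of _ k]) auto
  qed
  thus ?thesis unfolding eventually_principal by blast
qed

abbreviation P where "P \<equiv> cstar_product \<Lambda> B"

lemma P: "cstar_algebra P"
  by (rule cstar_product_cstar_algebra[OF B nonempty])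

lemma P_mem: "x \<in> carrier P \<Longrightarrow> i \<in> \<Lambda> \<Longrightarrow> x i \<in> carrier (B i)"
  "x \<in> carrier P \<Longrightarrow> i \<in> \<Lambda> \<Longrightarrow> cnorm (B i) (x i) \<le> cnorm P x"
  by (auto simp: cstar_product_sel intro: cSUP_upper)

lemma in_tails: "\<forall>\<^sub>F i in tails \<Lambda> r. i \<in> \<Lambda>"
  unfolding eventually_tails using nonempty by blast

lemma null_familiesI:
  assumes x: "x \<in> carrier P" and lim: "(h \<longlongrightarrow> 0) (tails \<Lambda> r)"
    and le: "\<And>i. i \<in> \<Lambda> \<Longrightarrow> cnorm (B i) (x i) \<le> h i"
  shows "x \<in> null_families \<Lambda> r B"
proof -
  have "((\<lambda>i. cnorm (B i) (x i)) \<longlongrightarrow> 0) (tails \<Lambda> r)"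
  proof (rule Lim_null_comparison[OF _ lim])
    show "\<forall>\<^sub>F i in tails \<Lambda> r. norm (cnorm (B i) (x i)) \<le> h i"
      using in_tails
    proof eventually_elim
      case (elim i)
      thus ?case using le[OF elim] cstar_algebra.cnorm_nonneg[OF B[OF elim] P_mem(1)[OF x elim]] by simp
    qed
  qed
  thus ?thesis using x by (simp add: null_families_def)
qed

lemma null_familiesD:
  "x \<in> null_families \<Lambda> r B \<Longrightarrow> x \<in> carrier P"
  "x \<in> null_families \<Lambda> r B \<Longrightarrow> ((\<lambda>i. cnorm (B i) (x i)) \<longlongrightarrow> 0) (tails \<Lambda> r)"
  by (auto simp: null_families_def)

lemma closed_ideal_null_families: "closed_ideal (null_families \<Lambda> r B) P"
proof -
  interpret P: cstar_algebra P by (rule P)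
  let ?N = "null_families \<Lambda> r B"
  have zero: "\<zero>\<^bsub>P\<^esub> \<in> ?N"
  proof (rule null_familiesI)
    fix i assume i: "i \<in> \<Lambda>"
    interpret Bi: cstar_algebra "B i" by (rule B[OF i])
    show "cnorm (B i) (\<zero>\<^bsub>P\<^esub> i) \<le> 0" using i by (simp add: cstar_product_sel(3))
  qed (rule P.zero_in tendsto_const)+
  have add: "x \<oplus>\<^bsub>P\<^esub> y \<in> ?N" if x: "x \<in> ?N" and y: "y \<in> ?N" for x y
  proof (rule null_familiesI)
    show "x \<oplus>\<^bsub>P\<^esub> y \<in> carrier P" using null_familiesD(1)[OF x] null_familiesD(1)[OF y] by simp
    show "((\<lambda>i. cnorm (B i) (x i) + cnorm (B i) (y i)) \<longlongrightarrow> 0) (tails \<Lambda> r)"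
      using tendsto_add[OF null_familiesD(2)[OF x] null_familiesD(2)[OF y]] by simp
    fix i assume i: "i \<in> \<Lambda>"
    show "cnorm (B i) ((x \<oplus>\<^bsub>P\<^esub> y) i) \<le> cnorm (B i) (x i) + cnorm (B i) (y i)"
      using cstar_algebra.cnorm_triangle[OF B[OF i] P_mem(1)[OF null_familiesD(1)[OF x] i] P_mem(1)[OF null_familiesD(1)[OF y] i]] i
      by (simp add: cstar_product_sel(4))
  qed
  have smult: "c \<odot>\<^bsub>P\<^esub> x \<in> ?N" if x: "x \<in> ?N" for x c
  proof (rule null_familiesI)
    show "c \<odot>\<^bsub>P\<^esub> x \<in> carrier P" using null_familiesD(1)[OF x] by simp
    show "((\<lambda>i. cmod c * cnorm (B i) (x i)) \<longlongrightarrow> 0) (tails \<Lambda> r)"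
      using tendsto_mult_left[OF null_familiesD(2)[OF x], of "cmod c"] by simp
    fix i assume i: "i \<in> \<Lambda>"
    show "cnorm (B i) ((c \<odot>\<^bsub>P\<^esub> x) i) \<le> cmod c * cnorm (B i) (x i)"
      using cstar_algebra.cnorm_smult[OF B[OF i] P_mem(1)[OF null_familiesD(1)[OF x] i], of c] i
      by (simp add: cstar_product_sel(5))
  qed
  have mult: "a \<otimes>\<^bsub>P\<^esub> x \<in> ?N \<and> x \<otimes>\<^bsub>P\<^esub> a \<in> ?N" if a: "a \<in> carrier P" and x: "x \<in> ?N" for a x
  proof -
    have xP: "x \<in> carrier P" by (rule null_familiesD(1)[OF x])
    have lim: "((\<lambda>i. cnorm P a * cnorm (B i) (x i)) \<longlongrightarrow> 0) (tails \<Lambda> r)"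
      using tendsto_mult_left[OF null_familiesD(2)[OF x], of "cnorm P a"] by simp
    have le: "cnorm (B i) (a i \<otimes>\<^bsub>B i\<^esub> x i) \<le> cnorm P a * cnorm (B i) (x i)"
      "cnorm (B i) (x i \<otimes>\<^bsub>B i\<^esub> a i) \<le> cnorm P a * cnorm (B i) (x i)" if i: "i \<in> \<Lambda>" for i
    proof -
      interpret Bi: cstar_algebra "B i" by (rule B[OF i])
      have m: "a i \<in> carrier (B i)" "x i \<in> carrier (B i)" using P_mem(1) a xP i by auto
      have "cnorm (B i) (a i) * cnorm (B i) (x i) \<le> cnorm P a * cnorm (B i) (x i)"
        using P_mem(2)[OF a i] Bi.cnorm_nonneg[OF m(2)] by (rule mult_right_mono)
      thus "cnorm (B i) (a i \<otimes>\<^bsub>B i\<^esub> x i) \<le> cnorm P a * cnorm (B i) (x i)"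
        "cnorm (B i) (x i \<otimes>\<^bsub>B i\<^esub> a i) \<le> cnorm P a * cnorm (B i) (x i)"
        using Bi.cnorm_mult[OF m] Bi.cnorm_mult[OF m(2,1)] by (simp_all add: mult.commute)
    qed
    show ?thesis
      using P.mult_closed[OF a xP] P.mult_closed[OF xP a] le
      by (auto intro!: null_familiesI[OF _ lim] simp: cstar_product_sel(2))
  qed
  have closed: "closedin (ctopology P) ?N"
    unfolding P.closedin_iff
  proof (intro conjI allI impI)
    show "?N \<subseteq> carrier P" using null_familiesD(1) by blast
    fix \<sigma> l assume \<sigma>: "\<forall>n::nat. \<sigma> n \<in> ?N" and l: "l \<in> carrier P" "(\<lambda>n. cnorm P (\<sigma> n \<ominus>\<^bsub>P\<^esub> l)) \<longlonglongrightarrow> 0"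
    have \<sigma>P: "\<sigma> n \<in> carrier P" for n using \<sigma> null_familiesD(1) by blast
    have "((\<lambda>i. cnorm (B i) (l i)) \<longlongrightarrow> 0) (tails \<Lambda> r)"
      unfolding tendsto_iff
    proof (intro allI impI)
      fix e :: real assume e: "e > 0"
      have "eventually (\<lambda>n. cnorm P (\<sigma> n \<ominus>\<^bsub>P\<^esub> l) < e / 2) sequentially"
        by (rule order_tendstoD(2)[OF l(2)]) (use e in simp)
      then obtain n where n: "cnorm P (\<sigma> n \<ominus>\<^bsub>P\<^esub> l) < e / 2" by (auto simp: eventually_sequentially)
      have "\<forall>\<^sub>F i in tails \<Lambda> r. cnorm (B i) (\<sigma> n i) < e / 2"
        using order_tendstoD(2)[OF null_familiesD(2)[of "\<sigma> n"], of "e / 2"] \<sigma> e by simp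
      thus "\<forall>\<^sub>F i in tails \<Lambda> r. dist (cnorm (B i) (l i)) 0 < e"
        using in_tails
      proof eventually_elim
        case (elim i)
        interpret Bi: cstar_algebra "B i" by (rule B[OF elim(2)])
        have m: "\<sigma> n i \<in> carrier (B i)" "l i \<in> carrier (B i)" using P_mem(1) \<sigma>P l(1) elim(2) by auto
        have "\<sigma> n \<ominus>\<^bsub>P\<^esub> l \<in> carrier P" using \<sigma>P l(1) by (rule P.minus_in)
        from P_mem(2)[OF this elim(2)] have "cnorm (B i) (\<sigma> n i \<ominus>\<^bsub>B i\<^esub> l i) \<le> cnorm P (\<sigma> n \<ominus>\<^bsub>P\<^esub> l)"
          using elim(2) m by (simp add: P.minus_eq[OF \<sigma>P l(1)] Bi.minus_eq) (simp add: cstar_product_sel(4,5))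
        thus ?case using Bi.n_le_minus[OF m] n elim(1) Bi.cnorm_nonneg[OF m(2)] by simp
      qed
    qed
    thus "l \<in> ?N" using l(1) by (simp add: null_families_def)
  qed
  have "additive_subgroup ?N P"
  proof (rule additive_subgroup.intro, rule group.subgroupI[OF P.M.a_group])
    show "?N \<subseteq> carrier (add_monoid P)" using null_familiesD(1) by auto
    show "?N \<noteq> {}" using zero by blast
    fix a b assume a: "a \<in> ?N"
    have "inv\<^bsub>add_monoid P\<^esub> a = (- 1) \<odot>\<^bsub>P\<^esub> a" using P.a_inv_eq[OF null_familiesD(1)[OF a]] by (simp add: a_inv_def)
    thus "inv\<^bsub>add_monoid P\<^esub> a \<in> ?N" using smult[OF a] by simp
    assume "b \<in> ?N"
    thus "a \<otimes>\<^bsub>add_monoid P\<^esub> b \<in> ?N" using add[OF a] by simp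
  qed
  thus ?thesis using smult mult closed by (auto simp: closed_ideal_def)
qed

sublocale N: cstar_ideal P "null_families \<Lambda> r B"
  by (intro cstar_ideal.intro cstar_ideal_axioms.intro P closed_ideal_null_families)

abbreviation lm where "lm \<equiv> limit_map \<Lambda> r B \<phi>"

definition fam where "fam i a = (\<lambda>j\<in>\<Lambda>. if (i, j) \<in> r then \<phi> i j a else \<zero>\<^bsub>B j\<^esub>)"

lemma lm_eq: "lm i a = N.q (fam i a)"
  by (simp add: limit_map_def fam_def)

lemma asymptotic_eq: "asymptotic_algebra \<Lambda> r B = N.Q"
  by (simp add: asymptotic_algebra_def)

text \<open>*-Homomorphisms are contractive, so the family is bounded by the norm of a.\<close>

lemma fam_mem:
  assumes i: "i \<in> \<Lambda>" and a: "a \<in> carrier (B i)" shows "fam i a \<in> carrier P"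
proof -
  have *: "fam i a j \<in> carrier (B j) \<and> cnorm (B j) (fam i a j) \<le> cnorm (B i) a" if j: "j \<in> \<Lambda>" for j
  proof (cases "(i, j) \<in> r")
    case True
    interpret h: cstar_hom "B i" "B j" "\<phi> i j" by (rule \<phi>_hom[OF i j True])
    show ?thesis using True j a h.homD(1) h.hom_contractive by (simp add: fam_def)
  next
    case False
    interpret Bi: cstar_algebra "B i" by (rule B[OF i])
    interpret Bj: cstar_algebra "B j" by (rule B[OF j])
    show ?thesis using False j a Bi.cnorm_nonneg by (simp add: fam_def)
  qed
  show ?thesis unfolding cstar_product_sel
  proof (intro CollectI conjI)
    show "fam i a \<in> (\<Pi>\<^sub>E i\<in>\<Lambda>. carrier (B i))" using * by (auto simp: fam_def)
    show "bdd_above ((\<lambda>j. cnorm (B j) (fam i a j)) ` \<Lambda>)" using * by (intro bdd_aboveI2) blast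
  qed
qed

lemma fam_ops:
  assumes i: "i \<in> \<Lambda>" and a: "a \<in> carrier (B i)" and b: "b \<in> carrier (B i)"
  shows "fam i (a \<oplus>\<^bsub>B i\<^esub> b) = fam i a \<oplus>\<^bsub>P\<^esub> fam i b" "fam i (a \<otimes>\<^bsub>B i\<^esub> b) = fam i a \<otimes>\<^bsub>P\<^esub> fam i b"
    "fam i (c \<odot>\<^bsub>B i\<^esub> a) = c \<odot>\<^bsub>P\<^esub> fam i a" "fam i (star (B i) a) = star P (fam i a)"
proof -
  have *: "fam i (a \<oplus>\<^bsub>B i\<^esub> b) j = fam i a j \<oplus>\<^bsub>B j\<^esub> fam i b j \<and>
     fam i (a \<otimes>\<^bsub>B i\<^esub> b) j = fam i a j \<otimes>\<^bsub>B j\<^esub> fam i b j \<and>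
     fam i (c \<odot>\<^bsub>B i\<^esub> a) j = c \<odot>\<^bsub>B j\<^esub> fam i a j \<and> fam i (star (B i) a) j = star (B j) (fam i a j)"
    if j: "j \<in> \<Lambda>" for j
  proof (cases "(i, j) \<in> r")
    case True
    interpret h: cstar_hom "B i" "B j" "\<phi> i j" by (rule \<phi>_hom[OF i j True])
    show ?thesis using True j a b h.homD by (simp add: fam_def)
  next
    case False
    interpret Bj: cstar_algebra "B j" by (rule B[OF j])
    show ?thesis using False j by (simp add: fam_def Bj.cstar_zero_simps[OF Bj.cstar_algebra_axioms])
  qed
  show "fam i (a \<oplus>\<^bsub>B i\<^esub> b) = fam i a \<oplus>\<^bsub>P\<^esub> fam i b" "fam i (a \<otimes>\<^bsub>B i\<^esub> b) = fam i a \<otimes>\<^bsub>P\<^esub> fam i b"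
    "fam i (c \<odot>\<^bsub>B i\<^esub> a) = c \<odot>\<^bsub>P\<^esub> fam i a" "fam i (star (B i) a) = star P (fam i a)"
    by (rule ext, use * in \<open>auto simp: cstar_product_sel fam_def\<close>)+
qed

lemma lm_hom: assumes i: "i \<in> \<Lambda>" shows "lm i \<in> star_hom (B i) N.Q"
  unfolding star_hom_def lm_eq
  using fam_mem[OF i] fam_ops[OF i]
  by (auto simp: N.Q_ops(1,2) N.Q_ops(3,4)[OF _ N.zero_in] N.Q_ops(6)[OF N.zero_in N.zero_in])

text \<open>The families of a and of its image at j agree at all indices above j, so their
  difference is a null family.\<close>

lemma lm_comp:
  assumes ij: "i \<in> \<Lambda>" "j \<in> \<Lambda>" "(i, j) \<in> r" and a: "a \<in> carrier (B i)"
  shows "lm j (\<phi> i j a) = lm i a"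
proof -
  interpret h: cstar_hom "B i" "B j" "\<phi> i j" by (rule \<phi>_hom[OF ij])
  have m: "fam j (\<phi> i j a) \<in> carrier P" "fam i a \<in> carrier P" using fam_mem ij a h.homD(1) by auto
  let ?d = "fam j (\<phi> i j a) \<oplus>\<^bsub>P\<^esub> (- 1) \<odot>\<^bsub>P\<^esub> fam i a"
  have "\<forall>\<^sub>F k in tails \<Lambda> r. cnorm (B k) (?d k) = 0"
    unfolding eventually_tails
  proof (intro bexI[OF _ ij(2)] ballI impI)
    fix k assume k: "k \<in> \<Lambda>" "(j, k) \<in> r"
    interpret Bk: cstar_algebra "B k" by (rule B[OF k(1)])
    have "fam j (\<phi> i j a) k = fam i a k"
      using k trans[OF ij(3) k(2)] \<phi>_comp[OF ij(3) k(2) a] by (simp add: fam_def)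
    thus "cnorm (B k) (?d k) = 0" using k P_mem(1)[OF m(2) k(1)] by (simp add: cstar_product_sel)
  qed
  hence "((\<lambda>k. cnorm (B k) (?d k)) \<longlongrightarrow> 0) (tails \<Lambda> r)"
    by (rule tendsto_eventually)
  hence "?d \<in> null_families \<Lambda> r B"
    unfolding null_families_def by (intro CollectI conjI N.add_in N.sm_closed m)
  thus ?thesis unfolding lm_eq using N.q_eq_iff[OF m] by simp
qed

definition D where "D = (\<Union>i\<in>\<Lambda>. lm i ` carrier (B i))"

text \<open>By directedness any two elements of \<open>D\<close> come from one algebra of the
  system, so sums and products stay in D; the closure is then a C*-subalgebra.\<close>

lemma D_sub: "sub_cstar_algebra (ctopology N.Q closure_of D) N.Q"
proof -
  interpret Q: cstar_algebra N.Q by (rule N.cstar_algebra_quotient)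
  have hom: "cstar_hom (B i) N.Q (lm i)" if "i \<in> \<Lambda>" for i
    by (intro cstar_hom.intro cstar_hom_axioms.intro B lm_hom that N.cstar_algebra_quotient)
  have sub: "D \<subseteq> carrier N.Q" using cstar_hom.homD(1)[OF hom] by (auto simp: D_def)
  have pair: "\<exists>k\<in>\<Lambda>. \<exists>a\<in>carrier (B k). \<exists>b\<in>carrier (B k). x = lm k a \<and> y = lm k b" if xy: "x \<in> D" "y \<in> D" for x y
  proof -
    obtain i a where i: "i \<in> \<Lambda>" "a \<in> carrier (B i)" "x = lm i a" using xy(1) by (auto simp: D_def)
    obtain j b where j: "j \<in> \<Lambda>" "b \<in> carrier (B j)" "y = lm j b" using xy(2) by (auto simp: D_def)
    obtain k where k: "k \<in> \<Lambda>" "(i, k) \<in> r" "(j, k) \<in> r" using upper[OF i(1) j(1)] by blast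
    have "\<phi> i k a \<in> carrier (B k)" "\<phi> j k b \<in> carrier (B k)"
      using cstar_hom.homD(1)[OF \<phi>_hom] i j k by blast+
    moreover have "x = lm k (\<phi> i k a)" "y = lm k (\<phi> j k b)" using lm_comp i j k by auto
    ultimately show ?thesis using k(1) by blast
  qed
  have add: "x \<oplus>\<^bsub>N.Q\<^esub> y \<in> D" and mult: "x \<otimes>\<^bsub>N.Q\<^esub> y \<in> D" if xy: "x \<in> D" "y \<in> D" for x y
  proof -
    obtain k a b where k: "k \<in> \<Lambda>" "a \<in> carrier (B k)" "b \<in> carrier (B k)" "x = lm k a" "y = lm k b"
      using pair[OF xy] by blast
    interpret h: cstar_hom "B k" N.Q "lm k" by (rule hom[OF k(1)])
    have "x \<oplus>\<^bsub>N.Q\<^esub> y = lm k (a \<oplus>\<^bsub>B k\<^esub> b)" "x \<otimes>\<^bsub>N.Q\<^esub> y = lm k (a \<otimes>\<^bsub>B k\<^esub> b)" using k h.homD by simp_all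
    thus "x \<oplus>\<^bsub>N.Q\<^esub> y \<in> D" "x \<otimes>\<^bsub>N.Q\<^esub> y \<in> D"
      unfolding D_def using k(1) h.A.add_in[OF k(2,3)] h.A.mult_closed[OF k(2,3)] by blast+
  qed
  have smult: "c \<odot>\<^bsub>N.Q\<^esub> x \<in> D" and star: "star N.Q x \<in> D" if x: "x \<in> D" for x c
  proof -
    obtain k a where k: "k \<in> \<Lambda>" "a \<in> carrier (B k)" "x = lm k a" using x by (auto simp: D_def)
    interpret h: cstar_hom "B k" N.Q "lm k" by (rule hom[OF k(1)])
    have "c \<odot>\<^bsub>N.Q\<^esub> x = lm k (c \<odot>\<^bsub>B k\<^esub> a)" "star N.Q x = lm k (star (B k) a)" using k h.homD by simp_all
    thus "c \<odot>\<^bsub>N.Q\<^esub> x \<in> D" "star N.Q x \<in> D"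
      unfolding D_def using k(1) h.A.sm_closed[OF k(2), of c] h.A.star_closed[OF k(2)] by blast+
  qed
  have c: "x \<in> carrier N.Q" if "x \<in> D" for x using sub that by blast
  obtain d where d: "d \<in> D"
  proof -
    obtain i where i: "i \<in> \<Lambda>" using nonempty by blast
    interpret Bi: cstar_algebra "B i" by (rule B[OF i])
    have "lm i \<zero>\<^bsub>B i\<^esub> \<in> D" using i Bi.zero_in by (auto simp: D_def)
    thus ?thesis by (rule that)
  qed
  have "subalg (Q.emb ` D)"
    unfolding subalg_def
  proof (intro conjI ballI allI)
    show "0 \<in> Q.emb ` D" using smult[OF d, of 0] c[OF d] Q.emb_unary(4) by (metis Q.sm_zero imageI)
    fix x y assume "x \<in> Q.emb ` D" "y \<in> Q.emb ` D"
    then obtain u v where uv: "u \<in> D" "v \<in> D" "x = Q.emb u" "y = Q.emb v" by auto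
    show "x + y \<in> Q.emb ` D" "x * y \<in> Q.emb ` D"
      using add[OF uv(1,2)] mult[OF uv(1,2)] Q.emb_ops(1,2)[OF c[OF uv(1)] c[OF uv(2)]] uv(3,4) by (metis imageI)+
  next
    fix x z assume "x \<in> Q.emb ` D"
    then obtain u where u: "u \<in> D" "x = Q.emb u" by auto
    show "scaleC z x \<in> Q.emb ` D" using smult[OF u(1), of z] Q.emb_unary(1)[OF c[OF u(1)], of z] u(2) by (metis imageI)
  qed
  moreover have "star_closed (Q.emb ` D)"
    unfolding star_closed_def
  proof
    fix x assume "x \<in> Q.emb ` D"
    then obtain u where u: "u \<in> D" "x = Q.emb u" by auto
    show "adj x \<in> Q.emb ` D" using star[OF u(1)] Q.emb_unary(2)[OF c[OF u(1)]] u(2) by (metis imageI)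
  qed
  ultimately show ?thesis by (rule Q.sub_cstar_algebra_closure_of[OF sub])
qed

abbreviation L where "L \<equiv> inductive_limit \<Lambda> r B \<phi>"

lemma L_eq: "L = N.Q\<lparr>carrier := ctopology N.Q closure_of D\<rparr>"
  by (simp add: inductive_limit_def asymptotic_eq D_def)

lemma L: "cstar_algebra L"
  unfolding L_eq by (rule cstar_algebra.cstar_algebra_restrict[OF N.cstar_algebra_quotient D_sub])

lemma lm_in_L: assumes "i \<in> \<Lambda>" "a \<in> carrier (B i)" shows "lm i a \<in> carrier L"
proof -
  interpret Q: cstar_algebra N.Q by (rule N.cstar_algebra_quotient)
  have "lm i a \<in> carrier N.Q" using lm_hom[OF assms(1)] assms(2) by (auto simp: star_hom_def)
  moreover have "lm i a \<in> D" using assms by (auto simp: D_def)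
  ultimately show ?thesis
    by (auto simp: L_eq Q.closure_of_iff Q.minus_eq intro!: bexI[of _ "lm i a"])
qed

end

text \<open>Target and entries are replaced by nearby elements of one subset \<open>Z\<close>, the
  entries by self-adjoint parts, which come no further away. The problem is then solved in Z with
  the remaining \<epsilon>/2.\<close>

lemma dense_gen_local:
  fixes X :: "'a::unital_cstar set"
  assumes local: "\<And>F \<delta>. finite F \<Longrightarrow> F \<subseteq> X \<Longrightarrow> \<delta> > 0 \<Longrightarrow>
    \<exists>Z\<subseteq>X. subalg Z \<and> star_closed Z \<and> dense_gen Z n \<and> (\<forall>x\<in>F. \<exists>z\<in>Z. norm (x - z) < \<delta>)"
  shows "dense_gen X n"
  unfolding dense_gen_def
proof (intro allI ballI impI)
  fix a c and \<epsilon> :: real assume c: "c \<in> X" and a: "self_adj_tuple X n a" and e: "\<epsilon> > 0"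
  have F: "finite (insert c (a ` {..n}))" "insert c (a ` {..n}) \<subseteq> X"
    using c a by (auto simp: self_adj_tuple_def)
  obtain Z where Z: "Z \<subseteq> X" "subalg Z" "star_closed Z" "dense_gen Z n"
    and near: "\<forall>x\<in>insert c (a ` {..n}). \<exists>z\<in>Z. norm (x - z) < \<epsilon> / 2"
    using local[OF F half_gt_zero[OF e]] by blast
  have "\<exists>z. z \<in> Z \<and> self_adj z \<and> norm (a j - z) < \<epsilon> / 2" if j: "j \<le> n" for j
  proof -
    obtain z where z: "z \<in> Z" "norm (a j - z) < \<epsilon> / 2" using near j by auto
    let ?s = "(1/2) *\<^sub>R (z + adj z)"
    have "adj (a j) = a j" using a j by (simp add: self_adj_tuple_def self_adj_def)
    hence "a j - ?s = (1/2) *\<^sub>R ((a j - z) + adj (a j - z))"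
      by (simp add: adj_diff scaleR_add_right scaleR_diff_right flip: scaleR_add_left)
    hence "norm (a j - ?s) \<le> norm (a j - z)"
      using norm_triangle_ineq[of "a j - z" "adj (a j - z)"] by (simp del: adj_diff)
    moreover have "?s \<in> Z" using z(1) Z(2,3) by (auto simp: star_closed_def intro!: subalgD)
    moreover have "self_adj ?s" by (simp add: self_adj_def adj_scaleR adj_add add.commute)
    ultimately show ?thesis using z(2) by (intro exI[of _ ?s]) auto
  qed
  then obtain z where z: "\<And>j. j \<le> n \<Longrightarrow> z j \<in> Z \<and> self_adj (z j) \<and> norm (a j - z j) < \<epsilon> / 2" by metis
  obtain w where w: "w \<in> Z" "norm (c - w) < \<epsilon> / 2" using near by blast
  have "self_adj_tuple Z n z" using z by (simp add: self_adj_tuple_def)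
  then obtain b p where b: "self_adj_tuple Z n b" "\<And>j. j \<le> n \<Longrightarrow> norm (b j - z j) < \<epsilon> / 2"
    "norm (w - eval n b p) < \<epsilon> / 2"
    using dense_genE[OF Z(4) _ half_gt_zero[OF e] w(1)] by blast
  have "norm (b j - a j) < \<epsilon>" if "j \<le> n" for j
    using norm_triangle_ineq[of "b j - z j" "z j - a j"] b(2)[OF that] z[OF that] by (simp add: norm_minus_commute)
  moreover have "norm (c - eval n b p) < \<epsilon>"
    using norm_triangle_ineq[of "c - w" "w - eval n b p"] w(2) b(3) by simp
  moreover have "self_adj_tuple X n b" using b(1) Z(1) by (auto simp: self_adj_tuple_def)
  ultimately show "\<exists>b p. self_adj_tuple X n b \<and> (\<forall>j\<le>n. norm (b j - a j) < \<epsilon>) \<and> norm (c - eval n b p) < \<epsilon>"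
    by blast
qed

section \<open>Rank of an inductive limit\<close>

context inductive_system_locale
begin

text \<open>The canonical maps are followed by the inverse of the isomorphism, so that only maps
  into A remain. That inverse is contractive as a *-homomorphism, which carries the density of the
  images over to A.\<close>

lemma limit_cone:
  assumes A: "cstar_algebra A" "star_isomorphic A L"
  obtains \<psi> where "\<And>i. i \<in> \<Lambda> \<Longrightarrow> cstar_hom (B i) A (\<psi> i)"
    "\<And>i j a. i \<in> \<Lambda> \<Longrightarrow> j \<in> \<Lambda> \<Longrightarrow> (i, j) \<in> r \<Longrightarrow> a \<in> carrier (B i) \<Longrightarrow> \<psi> j (\<phi> i j a) = \<psi> i a"
    "\<And>x \<epsilon>. x \<in> carrier A \<Longrightarrow> \<epsilon> > 0 \<Longrightarrow> \<exists>i\<in>\<Lambda>. \<exists>a\<in>carrier (B i). cnorm A (x \<ominus>\<^bsub>A\<^esub> \<psi> i a) < \<epsilon>"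
proof -
  obtain f where f: "f \<in> star_hom A L" "bij_betw f (carrier A) (carrier L)"
    using A(2) by (auto simp: star_isomorphic_def)
  interpret Q: cstar_algebra N.Q by (rule N.cstar_algebra_quotient)
  interpret f: cstar_hom A L f by (intro cstar_hom.intro cstar_hom_axioms.intro A(1) L f(1))
  define g where "g = inv_into (carrier A) f"
  have gf: "g (f x) = x" if "x \<in> carrier A" for x
    using f(2) that unfolding g_def by (intro inv_into_f_f) (simp_all add: bij_betw_def)
  have g_ex: "\<exists>x\<in>carrier A. y = f x \<and> g y = x" if "y \<in> carrier L" for y
  proof -
    have "y \<in> f ` carrier A" using that bij_betw_imp_surj_on[OF f(2)] by (simp only:)
    then obtain x where x: "x \<in> carrier A" "y = f x" by (rule imageE) blast
    show ?thesis by (intro bexI[OF _ x(1)]) (simp add: x(2) gf[OF x(1)])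
  qed
  have ghom: "g \<in> star_hom L A"
    unfolding star_hom_def
  proof (intro CollectI conjI ballI allI Pi_I)
    fix y c assume "y \<in> carrier L"
    then obtain x where x: "x \<in> carrier A" "y = f x" using g_ex by blast
    show "g y \<in> carrier A" using x gf by simp
    show "g (c \<odot>\<^bsub>L\<^esub> y) = c \<odot>\<^bsub>A\<^esub> g y"
      using x gf f.A.sm_closed[OF x(1)] by (simp only: f.homD(4)[OF x(1), symmetric])
    show "g (star L y) = star A (g y)"
      using x gf f.A.star_closed[OF x(1)] by (simp only: f.homD(5)[OF x(1), symmetric])
    fix y' assume "y' \<in> carrier L"
    then obtain x' where x': "x' \<in> carrier A" "y' = f x'" using g_ex by blast
    show "g (y \<oplus>\<^bsub>L\<^esub> y') = g y \<oplus>\<^bsub>A\<^esub> g y'"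
      using x x' gf f.A.add_in[OF x(1) x'(1)] by (simp only: f.homD(2)[OF x(1) x'(1), symmetric])
    show "g (y \<otimes>\<^bsub>L\<^esub> y') = g y \<otimes>\<^bsub>A\<^esub> g y'"
      using x x' gf f.A.mult_closed[OF x(1) x'(1)] by (simp only: f.homD(3)[OF x(1) x'(1), symmetric])
  qed
  interpret g: cstar_hom L A g by (intro cstar_hom.intro cstar_hom_axioms.intro A(1) L ghom)
  have ops: "x \<oplus>\<^bsub>L\<^esub> y = x \<oplus>\<^bsub>N.Q\<^esub> y" "x \<otimes>\<^bsub>L\<^esub> y = x \<otimes>\<^bsub>N.Q\<^esub> y" "c \<odot>\<^bsub>L\<^esub> x = c \<odot>\<^bsub>N.Q\<^esub> x"
    "star L x = star N.Q x" "cnorm L x = cnorm N.Q x" for x y c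
    unfolding L_eq by simp_all
  have lm: "lm i \<in> star_hom (B i) L" if "i \<in> \<Lambda>" for i
    using lm_hom[OF that] lm_in_L[OF that] unfolding star_hom_def ops by blast
  show ?thesis
  proof (rule that[of "\<lambda>i a. g (lm i a)"])
    fix i assume i: "i \<in> \<Lambda>"
    interpret l: cstar_hom "B i" L "lm i" by (intro cstar_hom.intro cstar_hom_axioms.intro B[OF i] L lm[OF i])
    have "(\<lambda>a. g (lm i a)) \<in> star_hom (B i) A"
      unfolding star_hom_def by (intro CollectI conjI ballI allI Pi_I) (simp_all only: l.homD g.homD)
    thus "cstar_hom (B i) A (\<lambda>a. g (lm i a))" by (intro cstar_hom.intro cstar_hom_axioms.intro B[OF i] A(1))
  next
    fix i j a assume "i \<in> \<Lambda>" "j \<in> \<Lambda>" "(i, j) \<in> r" "a \<in> carrier (B i)"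
    thus "g (lm j (\<phi> i j a)) = g (lm i a)" by (simp only: lm_comp)
  next
    fix x and \<epsilon> :: real assume x: "x \<in> carrier A" and e: "\<epsilon> > 0"
    have fx: "f x \<in> carrier L" by (rule f.homD(1)[OF x])
    hence fQ: "f x \<in> carrier N.Q" and cl: "\<forall>e>0. \<exists>y\<in>D. y \<in> carrier N.Q \<and> cnorm N.Q (f x \<ominus>\<^bsub>N.Q\<^esub> y) < e"
      unfolding L_eq by (auto simp: Q.closure_of_iff)
    obtain y where y: "y \<in> D" "y \<in> carrier N.Q" "cnorm N.Q (f x \<ominus>\<^bsub>N.Q\<^esub> y) < \<epsilon>" using cl e by blast
    obtain i a where i: "i \<in> \<Lambda>" "a \<in> carrier (B i)" "y = lm i a" using y(1) by (auto simp: D_def)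
    have yL: "y \<in> carrier L" using lm_in_L i by simp
    have "f x \<ominus>\<^bsub>L\<^esub> y = f x \<ominus>\<^bsub>N.Q\<^esub> y"
      using f.B.minus_eq[OF fx yL] Q.minus_eq[OF fQ y(2)] by (simp only: ops)
    moreover have "x \<ominus>\<^bsub>A\<^esub> g y = g (f x \<ominus>\<^bsub>L\<^esub> y)" using g.hom_minus[OF fx yL] gf[OF x] by simp
    moreover have "cnorm A (g (f x \<ominus>\<^bsub>L\<^esub> y)) \<le> cnorm L (f x \<ominus>\<^bsub>L\<^esub> y)"
      by (rule g.hom_contractive[OF f.B.minus_in[OF fx yL]])
    ultimately have "cnorm A (x \<ominus>\<^bsub>A\<^esub> g (lm i a)) < \<epsilon>" using y(3) i(3) ops(5) by simp
    thus "\<exists>i\<in>\<Lambda>. \<exists>a\<in>carrier (B i). cnorm A (x \<ominus>\<^bsub>A\<^esub> g (lm i a)) < \<epsilon>" using i by blast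
  qed
qed

text \<open>The images Z i of the unital hulls increase with i and have dense union, so a finite set
  close to some Z i is close to all later ones; rank at most n for cofinally many indices is enough.
  Passing to images also covers connecting maps that are not injective.\<close>

lemma gr_limit_le:
  assumes A: "cstar_algebra A" "star_isomorphic A L"
    and cofinal: "\<And>i. i \<in> \<Lambda> \<Longrightarrow> \<exists>j\<in>\<Lambda>. (i, j) \<in> r \<and> gr (B j) \<le> enat n"
  shows "gr A \<le> enat n"
proof -
  interpret A: cstar_algebra A by fact
  obtain \<psi> where hom: "\<And>i. i \<in> \<Lambda> \<Longrightarrow> cstar_hom (B i) A (\<psi> i)"
    and comp: "\<And>i j a. i \<in> \<Lambda> \<Longrightarrow> j \<in> \<Lambda> \<Longrightarrow> (i, j) \<in> r \<Longrightarrow> a \<in> carrier (B i) \<Longrightarrow> \<psi> j (\<phi> i j a) = \<psi> i a"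
    and approx: "\<And>x \<epsilon>. x \<in> carrier A \<Longrightarrow> \<epsilon> > 0 \<Longrightarrow> \<exists>i\<in>\<Lambda>. \<exists>a\<in>carrier (B i). cnorm A (x \<ominus>\<^bsub>A\<^esub> \<psi> i a) < \<epsilon>"
    using limit_cone[OF A] by blast
  define Z where "Z i = adjoin_one (A.emb ` \<psi> i ` carrier (B i))" for i
  have Z_mono: "Z i \<subseteq> Z j" if ij: "i \<in> \<Lambda>" "j \<in> \<Lambda>" "(i, j) \<in> r" for i j
  proof -
    have "\<psi> i a \<in> \<psi> j ` carrier (B j)" if a: "a \<in> carrier (B i)" for a
      using comp[OF ij a] cstar_hom.homD(1)[OF \<phi>_hom[OF ij] a] by (metis imageI)
    thus ?thesis unfolding Z_def adjoin_one_def by blast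
  qed
  have Z_approx: "\<exists>i\<in>\<Lambda>. \<exists>z\<in>Z i. norm (x - z) < \<delta>" if x: "x \<in> A.unital_hull" and d: "\<delta> > 0" for x \<delta>
  proof -
    obtain a w where a: "a \<in> carrier A" "x = A.emb a + scaleC w 1" using x unfolding adjoin_one_def by blast
    obtain i b where b: "i \<in> \<Lambda>" "b \<in> carrier (B i)" "cnorm A (a \<ominus>\<^bsub>A\<^esub> \<psi> i b) < \<delta>" using approx[OF a(1) d] by blast
    have "norm (x - (A.emb (\<psi> i b) + scaleC w 1)) < \<delta>"
      using A.norm_emb_diff[OF a(1) cstar_hom.homD(1)[OF hom[OF b(1)] b(2)]] b(3) a(2) by simp
    moreover have "A.emb (\<psi> i b) + scaleC w 1 \<in> Z i" using b(2) unfolding Z_def adjoin_one_def by blast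
    ultimately show ?thesis using b(1) by blast
  qed
  have Z_finite: "\<exists>i\<in>\<Lambda>. \<forall>x\<in>F. \<exists>z\<in>Z i. norm (x - z) < \<delta>"
    if "finite F" "F \<subseteq> A.unital_hull" and d: "\<delta> > 0" for F \<delta>
    using that(1,2)
  proof (induction F)
    case empty
    thus ?case using nonempty by blast
  next
    case (insert x F)
    obtain i where i: "i \<in> \<Lambda>" "\<forall>x\<in>F. \<exists>z\<in>Z i. norm (x - z) < \<delta>" using insert by blast
    obtain j where j: "j \<in> \<Lambda>" "\<exists>z\<in>Z j. norm (x - z) < \<delta>" using Z_approx[OF _ d] insert.prems by blast
    obtain k where k: "k \<in> \<Lambda>" "(i, k) \<in> r" "(j, k) \<in> r" using upper[OF i(1) j(1)] by blast
    have "Z i \<subseteq> Z k" "Z j \<subseteq> Z k" using Z_mono i(1) j(1) k by blast+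
    thus ?case using i(2) j(2) by (intro bexI[OF _ k(1)]) blast
  qed
  have "dense_gen A.unital_hull n"
  proof (rule dense_gen_local)
    fix F \<delta> assume F: "finite F" "F \<subseteq> A.unital_hull" "(\<delta>::real) > 0"
    obtain i where i: "i \<in> \<Lambda>" "\<forall>x\<in>F. \<exists>z\<in>Z i. norm (x - z) < \<delta>" using Z_finite[OF F] by blast
    obtain j where j: "j \<in> \<Lambda>" "(i, j) \<in> r" "gr (B j) \<le> enat n" using cofinal[OF i(1)] by blast
    interpret \<psi>: cstar_hom "B j" A "\<psi> j" by (rule hom[OF j(1)])
    interpret H: bounded_star_map "\<psi>.A.unital_hull" "hull_map (B j) A (\<psi> j)" 1
      by (rule \<psi>.bounded_star_map_hull_map)
    obtain m where m: "gr (B j) = enat m" "m \<le> n" using j(3) by (cases "gr (B j)") auto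
    have Z_eq: "Z j = hull_map (B j) A (\<psi> j) ` \<psi>.A.unital_hull" by (simp only: Z_def \<psi>.hull_map_image)
    have "dense_gen (Z j) n"
      unfolding Z_eq by (rule H.dense_gen_image[OF dense_gen_mono[OF \<psi>.A.gr_dense_gen[OF m(1)] m(2)]])
    moreover have "subalg (Z j)" "star_closed (Z j)" unfolding Z_eq by (rule H.q_image)+
    moreover have "Z j \<subseteq> A.unital_hull"
      using \<psi>.homD(1) unfolding Z_def adjoin_one_def by blast
    moreover have "\<forall>x\<in>F. \<exists>z\<in>Z j. norm (x - z) < \<delta>" using i(2) Z_mono[OF i(1) j(1,2)] by blast
    ultimately show "\<exists>Z\<subseteq>A.unital_hull. subalg Z \<and> star_closed Z \<and> dense_gen Z n \<and> (\<forall>x\<in>F. \<exists>z\<in>Z. norm (x - z) < \<delta>)"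
      by blast
  qed
  thus ?thesis by (rule A.gr_le)
qed

theorem gr_limit_le_Liminf:
  assumes A: "cstar_algebra A" "star_isomorphic A L"
  shows "gr A \<le> Liminf (tails \<Lambda> r) (\<lambda>i. gr (B i))"
  unfolding le_Liminf_iff
proof (intro allI impI, rule ccontr)
  fix y assume y: "y < gr A" and "\<not> (\<forall>\<^sub>F i in tails \<Lambda> r. y < gr (B i))"
  \<comment> \<open>Not being eventually above y means being at most y cofinally often; y itself is
    finite because it lies below \<open>gr A\<close>.\<close>
  hence cof: "\<exists>j\<in>\<Lambda>. (i, j) \<in> r \<and> gr (B j) \<le> y" if "i \<in> \<Lambda>" for i
    using that unfolding eventually_tails by (meson not_le)
  obtain n where "y = enat n" using y by (cases y) auto
  thus False using gr_limit_le[OF A, of n] cof y by (simp add: leD)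
qed

end

text \<open>An inductive limit is determined only up to isomorphism, so A enters as any algebra
  isomorphic to the model \<open>inductive_limit\<close>, whose elements are classes of
  families.\<close>

theorem theorem3:
  fixes A :: "'a cstar"
  assumes "cstar_algebra A"
  shows "(\<forall>I. closed_ideal I A \<longrightarrow>
            max (gr (A\<lparr>carrier := I\<rparr>)) (gr (cstar_quotient A I)) \<le> gr A \<and>
            gr A \<le> gr (A\<lparr>carrier := I\<rparr>) + gr (cstar_quotient A I) + 1) \<and>
         (\<forall>(\<Lambda> :: 'i set) r (B :: 'i \<Rightarrow> 'b cstar) \<phi>.
            inductive_system \<Lambda> r B \<phi> \<and> star_isomorphic A (inductive_limit \<Lambda> r B \<phi>) \<longrightarrow>
            gr A \<le> Liminf (tails \<Lambda> r) (\<lambda>i. gr (B i)))"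
proof (intro conjI allI impI; (elim conjE)?)
  fix I assume "closed_ideal I A"
  then interpret cstar_ideal A I using assms by (intro cstar_ideal.intro cstar_ideal_axioms.intro)
  show "max (gr (A\<lparr>carrier := I\<rparr>)) (gr (cstar_quotient A I)) \<le> gr A"
    using gr_ideal_le gr_quotient_le by simp
  show "gr A \<le> gr (A\<lparr>carrier := I\<rparr>) + gr (cstar_quotient A I) + 1" by (rule gr_extension_le)
next
  fix \<Lambda> :: "'i set" and r and B :: "'i \<Rightarrow> 'b cstar" and \<phi>
  assume sys: "inductive_system \<Lambda> r B \<phi>" and iso: "star_isomorphic A (inductive_limit \<Lambda> r B \<phi>)"
  interpret inductive_system_locale \<Lambda> r B \<phi> by unfold_locales (rule sys)
  show "gr A \<le> Liminf (tails \<Lambda> r) (\<lambda>i. gr (B i))" by (rule gr_limit_le_Liminf[OF assms iso])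
qed

end
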